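(* Let $G\in\{A_{n-1},B_n\}$ and let $\psi_1,\ldots,\psi_n$ be fundamental invariants of $G$. \begin{enumerate} \item The isotypic decomposition of $H_{n,d}$ is $$\bigoplus_{\Lambda\vdash n}q_d^\Lambda\cdot S^\Lambda,$$ where $\Lambda$ ranges over all partitions of $n$ if $G=A_{n-1}$ and over all bipartitions of $n$ if $G=B_n$. \item There exists a symmetry adapted basis of the coinvariant algebra $\mathbb{R}[\underline{X}]_G$ consisting of higher Specht polynomials $(s_1^\Lambda,\ldots,s_{\vartheta_\Lambda}^\Lambda)_{\Lambda\vdash n}$, where $\vartheta_\Lambda$ denotes the dimension of $S^\Lambda$. Defining symmetric matrix polynomials $H^\Lambda\in\mathbb{R}[\underline{X}]^{\vartheta_\Lambda\times\vartheta_\Lambda}$ by $H^\Lambda_{v,u}:=\mathcal{R}_G(s_v^\Lambda\cdot s_u^\Lambda)$, one has $$\Sigma\,\mathbb{R}[\underline{X}]^2\cap\mathbb{R}[\underline{X}]^G=\left\{g\in\mathbb{R}[\psi_1,\ldots,\psi_n]\;:\;g=\sum_{\Lambda\vdash n}\operatorname{Tr}(H^\Lambda\cdot A_\Lambda)\right\},$$ where $A_\Lambda\in\mathbb{R}[\psi_1,\ldots,\psi_n]^{\vartheta_\Lambda\times\vartheta_\Lambda}$ ranges over sum of squares matrix polynomials. \item There exists a symmetry adapted basis of $H_{n,d}=\bigoplus_{\Lambda\vdash n}q_d^\Lambda\cdot S^\Lambda$ in which the elements $(s_1^\Lambda,\ldots,s_{q_d^\Lambda}^\Lambda)$ belonging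 to the isotypic component $q_d^\Lambda\cdot S^\Lambda$ are each a product of one higher Specht polynomial and a monomial in $\psi_1,\ldots,\psi_n$. Defining matrix polynomials $B^\Lambda\in(\mathbb{R}[\underline{X}]^G)^{q_d^\Lambda\times q_d^\Lambda}$ by $B^\Lambda_{v,u}:=\mathcal{R}_G(s_v^\Lambda\cdot s_u^\Lambda)$, a form $f\in H_{n,2d}^G$ is a sum of squares if and only if $$f=\sum_\Lambda\operatorname{Tr}(B^\Lambda\cdot A_\Lambda)$$ for some positive semidefinite matrices $A_\Lambda\in\mathbb{R}^{q_d^\Lambda\times q_d^\Lambda}$. \end{enumerate}
   Context: $\mathbb{R}[\underline{X}]=\mathbb{R}[X_1,\ldots,X_n]$; $H_{n,d}$ is the space of real forms of degree $d$ in $n$ variables, $H_{n,d}^G$ its $G$-invariant subspace, and $\Sigma\,\mathbb{R}[\underline{X}]^2$ the set of finite sums of squares of polynomials. Type $A_{n-1}$ means the symmetric group $\mathfrak{S}_n$ permuting the coordinates of $\mathbb{R}^n$; $B_n$ is the hyperoctahedral group of all coordinate permutations and sign changes. Fundamental invariants are $n$ algebraically independent forms $\psi_1,\ldots,\psi_n$ generating $\mathbb{R}[\underline{X}]^G$. $\mathcal{R}_G(f)=\frac1{|G|}\sum_{\sigma\in G}\sigma(f)$. The coinvariant algebra is $\mathbb{R}[\underline{X}]_G=\mathbb{R}[\underline{X}]/(\psi_1,\ldots,\psi_n)$. A partition $\lambda\vdash n$ is a non-increasing sequence of positive integers with sum $n$; a bipartition $\Lambda=(\lambda^1,\lambda^2)\vdash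 n$ is a pair of (possibly empty) partitions with $|\lambda^1|+|\lambda^2|=n$. A (bi-)tableau of shape $\Lambda$ is a filling of the Young diagram (respectively of the pair of Young diagrams) with the numbers $1,\ldots,n$, each used once; it is standard if entries increase along the rows and columns of each diagram. $\mathrm{SYT}(\Lambda)$ is the set of standard (bi-)tableaux. For a tableau $T$, let $\mathcal{C}_T$, $\mathcal{R}_T$ be its column and row stabilizers and $\epsilon_T=\frac{f^\lambda}{n!}\sum_{\sigma\in\mathcal{C}_T,\tau\in\mathcal{R}_T}\mathrm{sgn}(\sigma)\,\sigma\tau\in\mathbb{R}[\mathfrak{S}_n]$, with $f^\lambda$ the number of standard tableaux of shape $\lambda\vdash n$; for a bitableau $T=(T^1,T^2)$, $\epsilon_{T^1},\epsilon_{T^2}$ are defined analogously on the respective sets of entries and $\epsilon_T=\epsilon_{T^1}\epsilon_{T^2}$. The word $w(T)$ is obtained by reading each column from bottom to top, columns from left to right, first in $T^1$ and then in $T^2$. The index $i(T)$ is the sequence assigning to the letters of $w(T)$: the letter $1$ has index $0$; if $k$ has index $p$, then $k+1$ has index $p$ if it lies to the right of $k$ in the word and $p+1$ if it lies to the left. For (bi-)tableaux $T,S$ of the same shape set $\underline{X}_T^S=X_{w(T)_1}^{i(S)_1}\cdots X_{w(T)_n}^{i(S)_n}$, $F_T^S=\epsilon_T\cdot\underline{X}_T^S$, and $\widehat{F}_T^S=F_T^S(X_1^2,\ldots,X_n^2)\prod_{j\in T^2}X_j$ (product over entries of $T^2$). The higher Specht polynomials are the $F_T^S$ (for $A_{n-1}$),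 respectively $\widehat{F}_T^S$ (for $B_n$), with $T,S\in\mathrm{SYT}(\Lambda)$. For fixed $S$, the polynomials with $T\in\mathrm{SYT}(\Lambda)$ span an irreducible $G$-module whose isomorphism class, depending only on $\Lambda$, is denoted $S^\Lambda$. $q_d^\Lambda$ denotes the multiplicity of $S^\Lambda$ in $H_{n,d}$. For a polynomial $f$, $\langle f\rangle_G$ is the span of $\{\sigma f:\sigma\in G\}$. A symmetry adapted basis of a $G$-module $V\subseteq\mathbb{R}[\underline{X}]$ is a family of elements $f_{ji}$ such that each $\langle f_{ji}\rangle_G$ is irreducible, $V=\bigoplus_{j,i}\langle f_{ji}\rangle_G$, modules with the same $j$ are isomorphic via a $G$-isomorphism mapping $f_{j1}$ to $f_{ji}$, and modules with different $j$ are non-isomorphic. A symmetry adapted basis of $\mathbb{R}[\underline{X}]_G$ consisting of polynomials is a symmetry adapted basis of a graded $G$-submodule of $\mathbb{R}[\underline{X}]$ that maps isomorphically onto $\mathbb{R}[\underline{X}]_G$. A sum of squares matrix polynomial is a matrix of the form $L^tL$ with $L$ a (rectangular) matrix over $\mathbb{R}[\psi_1,\ldots,\psi_n]$. *)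

theory Defs
  imports
    "HOL-Library.Poly_Mapping"
    "HOL-Combinatorics.Permutations"
    "Jordan_Normal_Form.Matrix"
begin

section \<open>Real polynomials in the variables \<open>X\<^sub>1, \<dots>, X\<^sub>n\<close>\<close>

type_synonym rpoly = "(nat \<Rightarrow>\<^sub>0 nat) \<Rightarrow>\<^sub>0 real"

instantiation poly_mapping :: (type, real_vector) real_vector
begin

lift_definition scaleR_poly_mapping :: "real \<Rightarrow> ('a \<Rightarrow>\<^sub>0 'b) \<Rightarrow> 'a \<Rightarrow>\<^sub>0 'b"
  is "\<lambda>c f k. c *\<^sub>R f k"
  by (rule finite_subset) auto

instance
  by standard (transfer; simp add: fun_eq_iff scaleR_add_right scaleR_add_left)+

end

definition indet :: "nat \<Rightarrow> rpoly" where
  "indet i = Poly_Mapping.single (Poly_Mapping.single i 1) 1"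

definition const :: "real \<Rightarrow> rpoly" where
  "const a = Poly_Mapping.single 0 a"

definition poly_ring :: "nat \<Rightarrow> rpoly set" where
  "poly_ring n = {p. \<forall>m \<in> Poly_Mapping.keys p. Poly_Mapping.keys m \<subseteq> {1..n}}"

definition mdeg :: "(nat \<Rightarrow>\<^sub>0 nat) \<Rightarrow> nat" where
  "mdeg m = (\<Sum>i \<in> Poly_Mapping.keys m. Poly_Mapping.lookup m i)"

text \<open>The space \<open>H\<^sub>n\<^sub>,\<^sub>d\<close>; being a vector space, it contains \<open>0\<close>.\<close>

definition forms :: "nat \<Rightarrow> nat \<Rightarrow> rpoly set" where
  "forms n d = {p \<in> poly_ring n. \<forall>m \<in> Poly_Mapping.keys p. mdeg m = d}"

text \<open>\<open>psubst h p = p(h 1, \<dots>, h n)\<close>\<close>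

definition psubst :: "(nat \<Rightarrow> rpoly) \<Rightarrow> rpoly \<Rightarrow> rpoly" where
  "psubst h p = (\<Sum>m \<in> Poly_Mapping.keys p.
     Poly_Mapping.lookup p m *\<^sub>R (\<Prod>i \<in> Poly_Mapping.keys m. h i ^ Poly_Mapping.lookup m i))"

definition sums_of_squares :: "nat \<Rightarrow> rpoly set" where
  "sums_of_squares n = {sum_list (map (\<lambda>h. h ^ 2) hs) | hs. set hs \<subseteq> poly_ring n}"


section \<open>The groups of type \<open>A\<^bsub>n-1\<^esub>\<close> and \<open>B\<^sub>n\<close> and their invariants\<close>

text \<open>
  A signed permutation is a pair \<open>(\<pi>, N)\<close> of a permutation \<open>\<pi>\<close> of \<open>{1..n}\<close> and the set
  \<open>N \<subseteq> {1..n}\<close> of those \<open>i\<close> whose variable changes sign: \<open>X\<^sub>i \<mapsto> \<plusminus>X\<^bsub>\<pi> i\<^esub>\<close>, with minus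
  exactly for \<open>i \<in> N\<close>. Groups are represented by their sets of elements.
\<close>

datatype cox_type = TypeA | TypeB

type_synonym signed_perm = "(nat \<Rightarrow> nat) \<times> nat set"

fun refl_group :: "cox_type \<Rightarrow> nat \<Rightarrow> signed_perm set" where
  "refl_group TypeA n = {\<pi>. \<pi> permutes {1..n}} \<times> {{}}"
| "refl_group TypeB n = {\<pi>. \<pi> permutes {1..n}} \<times> Pow {1..n}"

definition act :: "signed_perm \<Rightarrow> rpoly \<Rightarrow> rpoly" where
  "act \<sigma> = psubst (\<lambda>i. (if i \<in> snd \<sigma> then - 1 else 1) * indet (fst \<sigma> i))"

definition invariants :: "nat \<Rightarrow> signed_perm set \<Rightarrow> rpoly set" where
  "invariants n G = {p \<in> poly_ring n. \<forall>\<sigma> \<in> G. act \<sigma> p = p}"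

definition reynolds :: "signed_perm set \<Rightarrow> rpoly \<Rightarrow> rpoly" where
  "reynolds G p = (1 / real (card G)) *\<^sub>R (\<Sum>\<sigma> \<in> G. act \<sigma> p)"

text \<open>The subring \<open>\<real>[\<psi>\<^sub>1, \<dots>, \<psi>\<^sub>n]\<close>\<close>

definition generated_ring :: "nat \<Rightarrow> (nat \<Rightarrow> rpoly) \<Rightarrow> rpoly set" where
  "generated_ring n \<psi> = psubst \<psi> ` poly_ring n"

definition fundamental_invariants :: "nat \<Rightarrow> signed_perm set \<Rightarrow> (nat \<Rightarrow> rpoly) \<Rightarrow> bool" where
  "fundamental_invariants n G \<psi> \<longleftrightarrow>
     (\<forall>i \<in> {1..n}. \<exists>d. \<psi> i \<in> forms n d) \<and>
     (\<forall>p \<in> poly_ring n. psubst \<psi> p = 0 \<longrightarrow> p = 0) \<and>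
     generated_ring n \<psi> = invariants n G"


section \<open>\<open>G\<close>-modules inside the polynomial ring\<close>

definition gmodule :: "signed_perm set \<Rightarrow> rpoly set \<Rightarrow> bool" where
  "gmodule G V \<longleftrightarrow> subspace V \<and> (\<forall>\<sigma> \<in> G. \<forall>v \<in> V. act \<sigma> v \<in> V)"

definition irreducible_gmodule :: "signed_perm set \<Rightarrow> rpoly set \<Rightarrow> bool" where
  "irreducible_gmodule G V \<longleftrightarrow> gmodule G V \<and> V \<noteq> {0} \<and>
     (\<forall>U. gmodule G U \<and> U \<subseteq> V \<longrightarrow> U = {0} \<or> U = V)"

definition gmodule_iso ::
    "signed_perm set \<Rightarrow> rpoly set \<Rightarrow> rpoly set \<Rightarrow> (rpoly \<Rightarrow> rpoly) \<Rightarrow> bool" where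
  "gmodule_iso G V W \<phi> \<longleftrightarrow> bij_betw \<phi> V W \<and>
     (\<forall>u \<in> V. \<forall>v \<in> V. \<phi> (u + v) = \<phi> u + \<phi> v) \<and>
     (\<forall>a. \<forall>v \<in> V. \<phi> (a *\<^sub>R v) = a *\<^sub>R \<phi> v) \<and>
     (\<forall>\<sigma> \<in> G. \<forall>v \<in> V. \<phi> (act \<sigma> v) = act \<sigma> (\<phi> v))"

definition isomorphic_gmodules :: "signed_perm set \<Rightarrow> rpoly set \<Rightarrow> rpoly set \<Rightarrow> bool" where
  "isomorphic_gmodules G V W \<longleftrightarrow> gmodule G V \<and> gmodule G W \<and> (\<exists>\<phi>. gmodule_iso G V W \<phi>)"

text \<open>\<open>V\<close> is the internal direct sum of the finite family of subspaces \<open>U i\<close>, \<open>i \<in> I\<close>.\<close>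

definition direct_sum :: "rpoly set \<Rightarrow> 'i set \<Rightarrow> ('i \<Rightarrow> rpoly set) \<Rightarrow> bool" where
  "direct_sum V I U \<longleftrightarrow> finite I \<and> (\<forall>i \<in> I. subspace (U i)) \<and>
     V = {\<Sum>i\<in>I. u i | u. \<forall>i \<in> I. u i \<in> U i} \<and>
     (\<forall>u. (\<forall>i \<in> I. u i \<in> U i) \<and> (\<Sum>i\<in>I. u i) = 0 \<longrightarrow> (\<forall>i \<in> I. u i = 0))"

text \<open>
  The multiplicity of the irreducible module \<open>M\<close> in \<open>V\<close>: the number of summands isomorphic
  to \<open>M\<close> in a decomposition of \<open>V\<close> into irreducibles.
\<close>

definition module_multiplicity :: "signed_perm set \<Rightarrow> rpoly set \<Rightarrow> rpoly set \<Rightarrow> nat" where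
  "module_multiplicity G V M = (THE q. \<exists>(I :: nat set) U.
     direct_sum V I U \<and> (\<forall>i \<in> I. irreducible_gmodule G (U i)) \<and>
     q = card {i \<in> I. isomorphic_gmodules G (U i) M})"

definition isotypic_component :: "signed_perm set \<Rightarrow> rpoly set \<Rightarrow> rpoly set \<Rightarrow> rpoly set" where
  "isotypic_component G V M = span (\<Union>{U. U \<subseteq> V \<and> isomorphic_gmodules G U M})"

text \<open>The isotypic decomposition of \<open>V\<close> is \<open>\<Oplus>\<^bsub>j \<in> J\<^esub> q j \<cdot> M j\<close>.\<close>

definition isotypic_decomposition ::
    "signed_perm set \<Rightarrow> rpoly set \<Rightarrow> 'j set \<Rightarrow> ('j \<Rightarrow> nat) \<Rightarrow> ('j \<Rightarrow> rpoly set) \<Rightarrow> bool" where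
  "isotypic_decomposition G V J q M \<longleftrightarrow>
     (\<forall>j \<in> J. irreducible_gmodule G (M j)) \<and>
     (\<forall>j \<in> J. \<forall>k \<in> J. j \<noteq> k \<longrightarrow> \<not> isomorphic_gmodules G (M j) (M k)) \<and>
     direct_sum V J (\<lambda>j. isotypic_component G V (M j)) \<and>
     (\<forall>j \<in> J. \<exists>U. direct_sum (isotypic_component G V (M j)) {..<q j} U \<and>
        (\<forall>i < q j. isomorphic_gmodules G (U i) (M j)))"

definition orbit_span :: "signed_perm set \<Rightarrow> rpoly \<Rightarrow> rpoly set" where
  "orbit_span G f = span ((\<lambda>\<sigma>. act \<sigma> f) ` G)"

text \<open>The members of the family are \<open>s j i\<close> with \<open>j \<in> J\<close> and \<open>i < q j\<close>, counted from \<open>0\<close>.\<close>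

definition symmetry_adapted_basis ::
    "signed_perm set \<Rightarrow> rpoly set \<Rightarrow> 'j set \<Rightarrow> ('j \<Rightarrow> nat) \<Rightarrow> ('j \<Rightarrow> nat \<Rightarrow> rpoly) \<Rightarrow> bool" where
  "symmetry_adapted_basis G V J q s \<longleftrightarrow> gmodule G V \<and>
     (\<forall>j \<in> J. \<forall>i < q j. irreducible_gmodule G (orbit_span G (s j i))) \<and>
     direct_sum V (SIGMA j:J. {..<q j}) (\<lambda>(j, i). orbit_span G (s j i)) \<and>
     (\<forall>j \<in> J. \<forall>i < q j. \<exists>\<phi>.
        gmodule_iso G (orbit_span G (s j 0)) (orbit_span G (s j i)) \<phi> \<and> \<phi> (s j 0) = s j i) \<and>
     (\<forall>j \<in> J. \<forall>k \<in> J. j \<noteq> k \<longrightarrow> (\<forall>i < q j. \<forall>l < q k.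
        \<not> isomorphic_gmodules G (orbit_span G (s j i)) (orbit_span G (s k l))))"


section \<open>The coinvariant algebra\<close>

definition coinvariant_ideal :: "nat \<Rightarrow> (nat \<Rightarrow> rpoly) \<Rightarrow> rpoly set" where
  "coinvariant_ideal n \<psi> = {\<Sum>i = 1..n. a i * \<psi> i | a. \<forall>i \<in> {1..n}. a i \<in> poly_ring n}"

definition residue_class :: "nat \<Rightarrow> (nat \<Rightarrow> rpoly) \<Rightarrow> rpoly \<Rightarrow> rpoly set" where
  "residue_class n \<psi> p = {p + h | h. h \<in> coinvariant_ideal n \<psi>}"

definition coinvariant_algebra :: "nat \<Rightarrow> (nat \<Rightarrow> rpoly) \<Rightarrow> rpoly set set" where
  "coinvariant_algebra n \<psi> = residue_class n \<psi> ` poly_ring n"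

definition graded_gmodule :: "nat \<Rightarrow> signed_perm set \<Rightarrow> rpoly set \<Rightarrow> bool" where
  "graded_gmodule n G W \<longleftrightarrow> gmodule G W \<and> W \<subseteq> poly_ring n \<and> W = span (\<Union>d. W \<inter> forms n d)"

definition coinvariant_adapted_basis :: "nat \<Rightarrow> signed_perm set \<Rightarrow> (nat \<Rightarrow> rpoly) \<Rightarrow>
    'j set \<Rightarrow> ('j \<Rightarrow> nat) \<Rightarrow> ('j \<Rightarrow> nat \<Rightarrow> rpoly) \<Rightarrow> bool" where
  "coinvariant_adapted_basis n G \<psi> J q s \<longleftrightarrow>
     (\<exists>W. graded_gmodule n G W \<and> bij_betw (residue_class n \<psi>) W (coinvariant_algebra n \<psi>) \<and>
          symmetry_adapted_basis G W J q s)"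


section \<open>Tableaux and higher Specht polynomials\<close>

text \<open>
  A tableau is the list of its rows. A partition \<open>\<kappa>\<close>, the shape in type \<open>A\<close>, is encoded as
  the bipartition \<open>(\<kappa>, [])\<close>, and a tableau in type \<open>A\<close> as the bitableau with empty second
  component; on these, the notions for bitableaux specialise to those for tableaux.
\<close>

type_synonym shape = "nat list \<times> nat list"
type_synonym tableau = "nat list list"
type_synonym bitableau = "tableau \<times> tableau"

definition is_partition :: "nat list \<Rightarrow> bool" where
  "is_partition \<kappa> \<longleftrightarrow> sorted_wrt (\<ge>) \<kappa> \<and> (\<forall>k \<in> set \<kappa>. 0 < k)"

fun shapes :: "cox_type \<Rightarrow> nat \<Rightarrow> shape set" where
  "shapes TypeA n = {(\<kappa>, []) | \<kappa>. is_partition \<kappa> \<and> sum_list \<kappa> = n}"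
| "shapes TypeB n = {(\<kappa>, \<mu>). is_partition \<kappa> \<and> is_partition \<mu> \<and> sum_list \<kappa> + sum_list \<mu> = n}"

definition filling :: "shape \<Rightarrow> bitableau \<Rightarrow> bool" where
  "filling \<Lambda> T \<longleftrightarrow> map length (fst T) = fst \<Lambda> \<and> map length (snd T) = snd \<Lambda> \<and>
     distinct (concat (fst T) @ concat (snd T)) \<and>
     set (concat (fst T) @ concat (snd T)) = {1..sum_list (fst \<Lambda>) + sum_list (snd \<Lambda>)}"

text \<open>For rows of non-increasing lengths, \<^const>\<open>List.transpose\<close> yields the list of columns.\<close>

definition increasing_tableau :: "tableau \<Rightarrow> bool" where
  "increasing_tableau T \<longleftrightarrow>
     (\<forall>r \<in> set T. sorted_wrt (<) r) \<and> (\<forall>c \<in> set (List.transpose T). sorted_wrt (<) c)"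

definition SYT :: "shape \<Rightarrow> bitableau set" where
  "SYT \<Lambda> = {T. filling \<Lambda> T \<and> increasing_tableau (fst T) \<and> increasing_tableau (snd T)}"

definition stabilizer :: "tableau \<Rightarrow> nat list list \<Rightarrow> (nat \<Rightarrow> nat) set" where
  "stabilizer T blocks = {\<sigma>. \<sigma> permutes set (concat T) \<and> (\<forall>b \<in> set blocks. \<sigma> ` set b = set b)}"

abbreviation row_stabilizer :: "tableau \<Rightarrow> (nat \<Rightarrow> nat) set" where
  "row_stabilizer T \<equiv> stabilizer T T"

abbreviation column_stabilizer :: "tableau \<Rightarrow> (nat \<Rightarrow> nat) set" where
  "column_stabilizer T \<equiv> stabilizer T (List.transpose T)"

text \<open>
  The action of \<open>\<epsilon>\<^sub>T\<close> on polynomials, for a single tableau \<open>T\<close> of shape \<open>map length T\<close> with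
  an arbitrary set of entries.
\<close>

definition young_symmetrizer :: "tableau \<Rightarrow> rpoly \<Rightarrow> rpoly" where
  "young_symmetrizer T p =
     (real (card (SYT (map length T, []))) / fact (length (concat T))) *\<^sub>R
     (\<Sum>\<sigma> \<in> column_stabilizer T. \<Sum>\<tau> \<in> row_stabilizer T.
        of_int (sign \<sigma>) *\<^sub>R act (\<sigma>, {}) (act (\<tau>, {}) p))"

definition word :: "bitableau \<Rightarrow> nat list" where
  "word T = concat (map rev (List.transpose (fst T))) @ concat (map rev (List.transpose (snd T)))"

definition left_of :: "nat list \<Rightarrow> nat \<Rightarrow> nat \<Rightarrow> bool" where
  "left_of w a b \<longleftrightarrow> (\<exists>i j. i < j \<and> j < length w \<and> w ! i = a \<and> w ! j = b)"

text \<open>Letters start at \<open>1\<close>; the value at \<open>0\<close> is irrelevant.\<close>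

fun letter_index :: "nat list \<Rightarrow> nat \<Rightarrow> nat" where
  "letter_index w 0 = 0"
| "letter_index w (Suc 0) = 0"
| "letter_index w (Suc (Suc k)) =
     (if left_of w (Suc k) (Suc (Suc k)) then letter_index w (Suc k)
      else letter_index w (Suc k) + 1)"

definition tableau_index :: "bitableau \<Rightarrow> nat list" where
  "tableau_index T = map (letter_index (word T)) (word T)"

definition tableau_monomial :: "bitableau \<Rightarrow> bitableau \<Rightarrow> rpoly" where
  "tableau_monomial T S = (\<Prod>k < length (word T). indet (word T ! k) ^ (tableau_index S ! k))"

text \<open>The polynomial \<open>F\<^sub>T\<^sup>S\<close>\<close>

definition specht_F :: "bitableau \<Rightarrow> bitableau \<Rightarrow> rpoly" where
  "specht_F T S =
     young_symmetrizer (fst T) (young_symmetrizer (snd T) (tableau_monomial T S))"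

fun higher_specht :: "cox_type \<Rightarrow> bitableau \<Rightarrow> bitableau \<Rightarrow> rpoly" where
  "higher_specht TypeA T S = specht_F T S"
| "higher_specht TypeB T S =
     psubst (\<lambda>i. indet i ^ 2) (specht_F T S) * (\<Prod>j \<in> set (concat (snd T)). indet j)"

definition higher_specht_polys :: "cox_type \<Rightarrow> shape \<Rightarrow> rpoly set" where
  "higher_specht_polys c \<Lambda> = {higher_specht c T S | T S. T \<in> SYT \<Lambda> \<and> S \<in> SYT \<Lambda>}"

text \<open>
  A representative of the isomorphism class \<open>S\<^sup>\<Lambda>\<close>; the class does not depend on the
  chosen \<open>S\<close>.
\<close>

definition specht_module :: "cox_type \<Rightarrow> shape \<Rightarrow> rpoly set" where
  "specht_module c \<Lambda> = (let S = (SOME S. S \<in> SYT \<Lambda>) in span {higher_specht c T S | T. T \<in> SYT \<Lambda>})"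

definition specht_dim :: "cox_type \<Rightarrow> shape \<Rightarrow> nat" where
  "specht_dim c \<Lambda> = dim (specht_module c \<Lambda>)"

definition specht_mult :: "cox_type \<Rightarrow> nat \<Rightarrow> nat \<Rightarrow> shape \<Rightarrow> nat" where
  "specht_mult c n d \<Lambda> = module_multiplicity (refl_group c n) (forms n d) (specht_module c \<Lambda>)"


section \<open>Matrix polynomials\<close>

definition mat_trace :: "'a :: comm_monoid_add mat \<Rightarrow> 'a" where
  "mat_trace A = sum_list (diag_mat A)"

definition reynolds_matrix :: "signed_perm set \<Rightarrow> nat \<Rightarrow> (nat \<Rightarrow> rpoly) \<Rightarrow> rpoly mat" where
  "reynolds_matrix G q s = mat q q (\<lambda>(v, u). reynolds G (s v * s u))"

definition sos_matrix :: "nat \<Rightarrow> (nat \<Rightarrow> rpoly) \<Rightarrow> nat \<Rightarrow> rpoly mat \<Rightarrow> bool" where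
  "sos_matrix n \<psi> q A \<longleftrightarrow> (\<exists>k. \<exists>L \<in> carrier_mat k q.
     elements_mat L \<subseteq> generated_ring n \<psi> \<and> A = transpose_mat L * L)"

definition psd_matrix :: "nat \<Rightarrow> real mat \<Rightarrow> bool" where
  "psd_matrix q A \<longleftrightarrow> A \<in> carrier_mat q q \<and> transpose_mat A = A \<and>
     (\<forall>x \<in> carrier_vec q. 0 \<le> x \<bullet> (A *\<^sub>v x))"

end

theory Submission
 imports Defs
begin

text \<open>The core is that R[X] is a free module over the invariants whose basis consists of
  higher Specht polynomials. They appear as \<open>tp (j, S, T)\<close>, that is
  \<open>tw j T (sp j S)\<close>: for a shape \<open>j\<close>, a row symmetrizer and then a column
  antisymmetrizer (\<open>CR\<close>) are applied to the monomial with exponents given by the index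
  of \<open>S\<close>, and a permutation then relabels the tableau by \<open>T\<close>.

  Representation theory enters through operators from the real group algebra, each carried together
  with its adjoint for the inner product in which monomials are orthonormal (\<open>gop\<close>). A
  self-adjoint variant of the Young symmetrizer yields for each shape an idempotent E_j such that
  E_j A E_j is a real multiple of E_j and E_j A E_k = 0 for j different from k
  (\<open>primitive_system_of_diagrams\<close>). A nonzero vector fixed by E_j generates an
  irreducible module whose type depends on j alone, and linearly independent fixed vectors generate
  modules with a direct sum (\<open>orbit_spans_direct\<close>).

  Freeness is independence plus a count. For a fixed shape the \<open>sp j S\<close> are independent
  over the invariants, because a relation has an extremal exponent to which only one
  \<open>S\<close> contributes (\<open>leading_independence\<close>). The translates by the various
  \<open>T\<close> are independent over R (\<open>tw_sp_independent\<close>), and E_j combines both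
  facts (\<open>sp_free\<close>). Monomials of degree d are as numerous as pairs of a standard and a
  semistandard filling of one shape (\<open>sum_fnum_Knum\<close>), and a semistandard filling is
  the index of a standard filling plus a monotone vector (\<open>standardization\<close>). So there
  are enough products of symmetric functions and Specht polynomials to span H_{n,d}
  (\<open>forms_spanned\<close>).

  Writing invariants in terms of the psi_i, the products of a monomial in the psi_i and a higher
  Specht polynomial form the symmetry adapted basis of H_{n,d}, and multiplicities count them.
  Modulo the psi_i only the higher Specht polynomials themselves remain, which gives the basis of
  the coinvariant algebra.

  An invariant sum of squares equals the sum of the averages of its squares h_r^2. If h_r is
  expanded in translates of the basis vectors, Schur's lemma (\<open>reynolds_pair\<close>) removes
  products of different types and turns the average of (A s_v)(B s_u) into a real scalar times the
  average of s_v s_u; the scalar is the inner product of A y and B y for a normalized reference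
  vector y. So each average is a trace against a Gram matrix (\<open>reynolds_square\<close>,
  \<open>sum_of_squares_gram\<close>). Its entries are invariants in general; for forms of degree 2d
  it suffices to use the degree d parts of the h_r (\<open>homogeneous_sos\<close>), and the entries
  are real. Conversely, a trace against a Gram matrix is a sum of averaged squares
  (\<open>trace_gram_sos\<close>).\<close>

unbundle no m_inv_syntax

section \<open>Polynomial algebra: monomial expansion, substitution, homogeneous components\<close>

section \<open>Polynomials\<close>

abbreviation "keys == Poly_Mapping.keys"

abbreviation coef :: "('a \<Rightarrow>\<^sub>0 'b::zero) => 'a => 'b" where
 "coef == Poly_Mapping.lookup"

abbreviation mon :: "(nat \<Rightarrow>\<^sub>0 nat) => rpoly" where
 "mon m == Poly_Mapping.single m 1"

lemma coef_scaleR [simp]: "coef (a *\<^sub>R p) m = a *\<^sub>R coef p m" by transfer simp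

lemma const_mult: "const a * p = a *\<^sub>R (p :: rpoly)"
proof -
 have "const a * p = Poly_Mapping.map ((*) a) p" by (simp add: const_def mult_map_scale_conv_mult)
 also have "... = a *\<^sub>R p" by (rule poly_mapping_eqI) (simp add: Poly_Mapping.map.rep_eq when_def)
 finally show ?thesis .
qed

lemma rpoly_scaleR_mult_left [simp]: "(a *\<^sub>R p) * q = a *\<^sub>R (p * q :: rpoly)"
 by (simp flip: const_mult add: mult.assoc)

lemma rpoly_scaleR_mult_right [simp]: "p * (a *\<^sub>R q) = a *\<^sub>R (p * q :: rpoly)"
 by (simp flip: const_mult add: mult.left_commute)

lemma poly_expand: assumes "finite A" "keys p <= A"
 shows "(p :: rpoly) = (SUM m:A. coef p m *\<^sub>R mon m)"
proof (rule poly_mapping_eqI)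
 fix k
 have "coef (SUM m:A. coef p m *\<^sub>R mon m) k = (SUM m:A. if m = k then coef p k else 0)"
  by (auto simp: lookup_sum lookup_single when_def intro!: sum.cong)
 also have "... = coef p k" using assms by (auto simp: sum.delta in_keys_iff)
 finally show "coef p k = coef (SUM m:A. coef p m *\<^sub>R mon m) k" by simp
qed

text \<open>Monomials span, so identities between substitutions, actions and coefficient functionals
  need checking on monomials alone.\<close>

lemma linear_eq_on_mon: assumes "linear f" "linear g" "!!m. f (mon m) = g (mon m)"
 shows "f p = g (p :: rpoly)" by (subst (1 2) poly_expand[OF finite_keys order.refl])
   (simp add: linear_sum[OF assms(1)] linear_sum[OF assms(2)]
    linear_scale[OF assms(1)] linear_scale[OF assms(2)] assms(3))

definition mpow :: "(nat => rpoly) => (nat \<Rightarrow>\<^sub>0 nat) => rpoly" where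
 "mpow h m = (PROD i:keys m. h i ^ coef m i)"

lemma mpow_superset: assumes "finite A" "keys m <= A"
 shows "mpow h m = (PROD i:A. h i ^ coef m i)" unfolding mpow_def using assms
 by (intro prod.mono_neutral_left) (auto simp: in_keys_iff)

lemma mpow_0 [simp]: "mpow h 0 = 1" by (simp add: mpow_def)

lemma mpow_add: "mpow h (m + m') = mpow h m * mpow h m'"
proof -
 let ?A = "keys m Un keys m'"
 have "keys (m + m') <= ?A" by (rule keys_add)
 thus ?thesis by (simp add: mpow_superset[of ?A] lookup_add power_add prod.distrib)
qed

lemma psubst_superset: assumes "finite A" "keys p <= A"
 shows "psubst h p = (SUM m:A. coef p m *\<^sub>R mpow h m)" unfolding psubst_def mpow_def using assms
 by (intro sum.mono_neutral_left) (auto simp: in_keys_iff)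

lemma linear_psubst: "linear (psubst h)"
proof (rule linearI)
 fix p q :: rpoly
 let ?A = "keys p Un keys q"
 have "keys (p + q) <= ?A" by (rule keys_add)
 thus "psubst h (p + q) = psubst h p + psubst h q"
  by (simp add: psubst_superset[of ?A] lookup_add scaleR_add_left sum.distrib)
next
 fix r and p :: rpoly
 have "keys (r *\<^sub>R p) <= keys p" by (auto simp: in_keys_iff)
 thus "psubst h (r *\<^sub>R p) = r *\<^sub>R psubst h p"
  by (simp add: psubst_superset[of "keys p"] scaleR_sum_right)
qed

lemma psubst_mon [simp]: "psubst h (mon m) = mpow h m" by (simp add: psubst_superset[of "{m}"])

lemma psubst_add: "psubst h (p + q) = psubst h p + psubst h q" by (rule linear_add[OF linear_psubst])

lemma psubst_scaleR: "psubst h (a *\<^sub>R p) = a *\<^sub>R psubst h p"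
 by (rule linear_scale[OF linear_psubst])

lemma psubst_sum: "psubst h (sum f A) = (SUM x:A. psubst h (f x))" by (rule linear_sum[OF linear_psubst])

lemma psubst_0 [simp]: "psubst h 0 = 0" by (rule linear_0[OF linear_psubst])

lemma psubst_1 [simp]: "psubst h 1 = 1" using psubst_mon[of h 0] by simp

lemma linear_mult_left_rpoly: "linear (%p. q * p :: rpoly)" by (rule linearI) (simp_all add: algebra_simps)

lemma linear_mult_right_rpoly: "linear (%p. p * q :: rpoly)" by (rule linearI) (simp_all add: algebra_simps)

lemma mon_mult: "mon m * mon m' = mon (m + m')" by (simp add: mult_single)

lemma psubst_mult: "psubst h (p * q) = psubst h p * psubst h q"
proof -
 have 1: "psubst h (mon m * q) = psubst h (mon m) * psubst h q" for m
 proof (rule linear_eq_on_mon[where p = q])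
  show "linear (%q. psubst h (mon m * q))"
   using linear_compose[OF linear_mult_left_rpoly linear_psubst] by (simp add: o_def)
  show "linear (%q. psubst h (mon m) * psubst h q)"
   using linear_compose[OF linear_psubst linear_mult_left_rpoly] by (simp add: o_def)
 qed (simp add: mon_mult mpow_add)
 show ?thesis
 proof (rule linear_eq_on_mon[where p = p])
  show "linear (%p. psubst h (p * q))"
   using linear_compose[OF linear_mult_right_rpoly linear_psubst] by (simp add: o_def)
  show "linear (%p. psubst h p * psubst h q)"
   using linear_compose[OF linear_psubst linear_mult_right_rpoly] by (simp add: o_def)
 qed (rule 1)
qed

lemma mon_sum: "finite A ==> mon (sum f A) = (PROD i:A. mon (f i))"
 by (induction A rule: finite_induct) (simp_all flip: mon_mult)

lemma indet_power: "indet i ^ k = mon (Poly_Mapping.single i k)"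
 by (induction k) (simp_all add: indet_def mon_mult single_add[symmetric])

lemma prod_indet_power: assumes "finite A"
 shows "(PROD i:A. indet (f i) ^ k i) = mon (SUM i:A. Poly_Mapping.single (f i) (k i))"
 using assms by (simp add: mon_sum indet_power)

lemma coef_sum_single: assumes "finite A"
 shows "coef (SUM i:A. Poly_Mapping.single i (k i)) j = (if j:A then k j else 0)"
proof -
 have "coef (SUM i:A. Poly_Mapping.single i (k i)) j = (SUM i:A. if i = j then k j else 0)"
  by (auto simp: lookup_sum lookup_single when_def intro!: sum.cong)
 thus ?thesis using assms by (simp add: sum.delta)
qed

subsection \<open>Homogeneous components\<close>

lemma mdeg_superset: assumes "finite A" "keys m <= A"
 shows "mdeg m = (SUM i:A. coef m i)"
 unfolding mdeg_def using assms by (intro sum.mono_neutral_left) (auto simp: in_keys_iff)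

lemma mdeg_add: "mdeg (m + m') = mdeg m + mdeg m'"
proof -
 let ?A = "keys m Un keys m'"
 have "keys (m + m') <= ?A" by (rule keys_add)
 thus ?thesis by (simp add: mdeg_superset[of ?A] lookup_add sum.distrib)
qed

lemma mdeg_0 [simp]: "mdeg 0 = 0" by (simp add: mdeg_def)

lemma poly_ring_iff:
 "p:poly_ring n \<longleftrightarrow> (ALL m. coef p m ~= 0 --> keys m <= {1..n})"
 by (auto simp: poly_ring_def in_keys_iff)

lemma forms_iff:
 "p:forms n d \<longleftrightarrow> p:poly_ring n & (ALL m. coef p m ~= 0 --> mdeg m = d)"
 by (auto simp: forms_def in_keys_iff)

lemma subspace_poly_ring: "subspace (poly_ring n)" unfolding subspace_def
proof (intro conjI ballI allI)
 fix x y assume "x:poly_ring n" "y:poly_ring n"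
 thus "x + y:poly_ring n" unfolding poly_ring_iff lookup_add by (metis add.right_neutral add.left_neutral)
qed (auto simp: poly_ring_iff)

lemma subspace_forms: "subspace (forms n d)" unfolding subspace_def
proof (intro conjI ballI allI)
 fix x y assume "x:forms n d" "y:forms n d"
 thus "x + y:forms n d" unfolding forms_iff using subspace_add[OF subspace_poly_ring]
  by (auto simp: lookup_add) (metis add.right_neutral add.left_neutral)
qed (auto simp: forms_iff poly_ring_iff)

lemma coef_mult_nonzero: assumes "coef (p * q :: rpoly) m ~= 0"
 obtains a b where "m = a + b" "coef p a ~= 0" "coef q b ~= 0"
proof -
 have "m:keys (p * q)" using assms by (simp add: in_keys_iff)
 hence "m:{a + b | a b. a:keys p & b:keys q}" using keys_mult by blast
 thus ?thesis using that by (auto simp: in_keys_iff)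
qed

lemma poly_ring_mult: "p:poly_ring n ==> q:poly_ring n ==> p * q:poly_ring n" unfolding poly_ring_iff
 by (auto elim!: coef_mult_nonzero dest!: set_mp[OF keys_add])

lemma forms_mult: "p:forms n d ==> q:forms n e ==> p * q:forms n (d + e)" unfolding forms_iff
 by (auto elim!: coef_mult_nonzero simp: mdeg_add poly_ring_mult)

lemma poly_ring_1 [simp]: "1:poly_ring n" by (auto simp: poly_ring_def)

lemma forms_1 [simp]: "1:forms n 0" by (auto simp: forms_def)

lemma forms_power: "p:forms n d ==> p ^ k:forms n (k * d)" by (induction k) (auto intro: forms_mult)

lemma forms_prod: assumes "finite A" "!!x. x:A ==> f x:forms n (e x)" shows "prod f A:forms n (sum e A)"
 using assms by (induction A rule: finite_induct) (auto intro: forms_mult)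

lemma forms_subset_poly_ring: "forms n d <= poly_ring n" by (auto simp: forms_def)

lemma mon_in_poly_ring: "mon m:poly_ring n \<longleftrightarrow> keys m <= {1..n}"
 by (auto simp: poly_ring_def)

lemma mon_in_forms: "mon m:forms n d \<longleftrightarrow> keys m <= {1..n} & mdeg m = d"
 by (auto simp: forms_def poly_ring_def)

definition hcomp :: "nat => rpoly => rpoly" where
 "hcomp d p = (SUM m:{m:keys p. mdeg m = d}. coef p m *\<^sub>R mon m)"

lemma coef_hcomp: "coef (hcomp d p) m = (if mdeg m = d then coef p m else 0)"
proof -
 have "coef (hcomp d p) m
  = (SUM k:{m:keys p. mdeg m = d}. if k = m then coef p m else 0)"
  unfolding hcomp_def lookup_sum by (intro sum.cong refl) (simp add: lookup_single when_def)
 thus ?thesis by (auto simp: sum.delta in_keys_iff)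
qed

lemma linear_hcomp: "linear (hcomp d)"
 by (rule linearI; rule poly_mapping_eqI) (auto simp: coef_hcomp lookup_add)

lemma hcomp_in_forms: "p:poly_ring n ==> hcomp d p:forms n d"
 by (auto simp: forms_iff poly_ring_iff coef_hcomp)

lemma hcomp_forms: "p:forms n e ==> hcomp d p = (if d = e then p else 0)"
 by (intro poly_mapping_eqI) (auto simp: coef_hcomp forms_iff)

lemma sum_hcomp: assumes "finite D" "mdeg ` keys p <= D"
 shows "p = (SUM d:D. hcomp d p)"
proof (rule poly_mapping_eqI)
 fix m
 have "coef (SUM d:D. hcomp d p) m = (SUM d:D. if d = mdeg m then coef p m else 0)"
  by (auto simp: lookup_sum coef_hcomp intro!: sum.cong)
 also have "... = coef p m" using assms by (auto simp: sum.delta in_keys_iff image_subset_iff)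
 finally show "coef p m = coef (SUM d:D. hcomp d p) m" by simp
qed

section \<open>Signed permutations acting on polynomials by isometries\<close>

section \<open>The group action\<close>

text \<open>The sign acquired by the monomial with exponent \<open>m\<close> when the variables in
  \<open>N\<close> change sign.\<close>

definition sg :: "nat set => (nat \<Rightarrow>\<^sub>0 nat) => real" where
 "sg N m = (-1) ^ (SUM i:N. coef m i)"

abbreviation pm :: "(nat => nat) => (nat \<Rightarrow>\<^sub>0 nat) => (nat \<Rightarrow>\<^sub>0 nat)" where
 "pm == Poly_Mapping.map_key"

lemma coef_pm: "inj f ==> coef (pm f m) i = coef m (f i)" by (simp add: map_key.rep_eq)

lemma pm_pm: "inj f ==> inj g ==> pm f (pm g m) = pm (g o f) m"
 by (rule poly_mapping_eqI) (simp add: coef_pm inj_compose)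

lemma pm_id [simp]: "pm id m = m" by (rule poly_mapping_eqI) (simp add: coef_pm)

lemma pm_eq_iff: assumes "bij f" shows "pm (inv f) k = m \<longleftrightarrow> k = pm f m"
proof -
 have "inj f" "inj (inv f)" using assms by (auto simp: bij_is_inj bij_imp_bij_inv)
 moreover have "f o inv f = id" "inv f o f = id" using assms by (auto simp: bij_def surj_iff)
 ultimately show ?thesis by (auto simp: pm_pm)
qed

lemma sg_mult_self [simp]: "sg N m * sg N m = 1" by (simp add: sg_def flip: power_mult_distrib)

lemma sg_empty [simp]: "sg {} m = 1" by (simp add: sg_def)

lemma prod_minus_one_power:
 "finite A ==> (PROD i:A. (- 1 :: rpoly) ^ k i) = ((-1) ^ (SUM i:A. k i)) *\<^sub>R 1"
proof (induction A rule: finite_induct)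
 case (insert x A)
 have "(- 1 :: rpoly) ^ j = ((-1) ^ j) *\<^sub>R 1" for j :: nat by (induction j) auto
 with insert show ?case by (simp add: power_add mult.commute)
qed simp

lemma act_mon: assumes "bij p" "finite N"
 shows "act (p, N) (mon m) = sg N m *\<^sub>R mon (pm (inv p) m)"
proof -
 let ?K = "keys m"
 have "act (p, N) (mon m) = (PROD i:?K. ((if i:N then - 1 else 1) * indet (p i)) ^ coef m i)"
  by (simp add: act_def mpow_def)
 also have "... = (PROD i:?K. (if i:N then - 1 else 1) ^ coef m i) * (PROD i:?K. indet (p i) ^ coef m i)"
  by (simp only: power_mult_distrib prod.distrib)
 also have "(PROD i:?K. (if i:N then - 1 else 1 :: rpoly) ^ coef m i) = (PROD i:N. (- 1) ^ coef m i)"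
 proof -
  have "(PROD i:?K. (if i:N then - 1 else 1 :: rpoly) ^ coef m i)
   = (PROD i:?K Un N. (if i:N then - 1 else 1 :: rpoly) ^ coef m i)"
   using assms(2) by (intro prod.mono_neutral_left) (auto simp: in_keys_iff)
  also have "... = (PROD i:N. (if i:N then - 1 else 1 :: rpoly) ^ coef m i)"
   using assms(2) by (intro prod.mono_neutral_right) (auto simp: in_keys_iff)
  also have "... = (PROD i:N. (- 1) ^ coef m i)" by (intro prod.cong) auto
  finally show ?thesis .
 qed
 also have "... = sg N m *\<^sub>R 1" using assms(2) by (simp add: prod_minus_one_power sg_def)
 also have "(PROD i:?K. indet (p i) ^ coef m i) = mon (SUM i:?K. Poly_Mapping.single (p i) (coef m i))"
  by (simp add: prod_indet_power)
 also have "(SUM i:?K. Poly_Mapping.single (p i) (coef m i)) = pm (inv p) m"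
 proof (rule poly_mapping_eqI)
  fix j
  have "coef (SUM i:?K. Poly_Mapping.single (p i) (coef m i)) j
   = (SUM i:?K. if i = inv p j then coef m (inv p j) else 0)" unfolding lookup_sum using assms(1)
   by (intro sum.cong refl) (auto simp: lookup_single when_def bij_inv_eq_iff[symmetric])
  also have "... = coef m (inv p j)" by (simp add: sum.delta in_keys_iff)
  also have "... = coef (pm (inv p) m) j" using assms(1) by (simp add: coef_pm bij_imp_bij_inv bij_is_inj)
  finally show "coef (SUM i:?K. Poly_Mapping.single (p i) (coef m i)) j = coef (pm (inv p) m) j" .
 qed
 finally show ?thesis by simp
qed

lemma linear_act: "linear (act g)" by (simp add: act_def linear_psubst)

lemma linear_coef: "linear (%p. coef p m :: real)" by (rule linearI) (simp_all add: lookup_add)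

text \<open>Reading coefficients at the pulled-back exponent keeps inverse permutations out of later
  computations.\<close>

lemma coef_act: assumes "bij h" "finite N"
 shows "coef (act (h, N) p) m = sg N (pm h m) * coef p (pm h m)"
proof (rule linear_eq_on_mon[where p = p])
 show "linear (%p. coef (act (h, N) p) m)"
  using linear_compose[OF linear_act linear_coef] by (simp add: o_def)
 show "linear (%p. sg N (pm h m) * coef p (pm h m))"
  by (rule linearI) (simp_all add: lookup_add algebra_simps)
 fix k
 show "coef (act (h, N) (mon k)) m = sg N (pm h m) * coef (mon k) (pm h m)"
  using assms by (auto simp: act_mon lookup_single when_def pm_eq_iff)
qed

lemma act_add: "act g (p + q) = act g p + act g q" by (simp add: act_def psubst_add)

lemma act_scaleR: "act g (a *\<^sub>R p) = a *\<^sub>R act g p"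
 by (simp add: act_def psubst_scaleR)

lemma act_0 [simp]: "act g 0 = 0" by (simp add: act_def)

lemma act_mult: "act g (p * q) = act g p * act g q" by (simp add: act_def psubst_mult)

lemma act_sum: "act g (sum f A) = (SUM x:A. act g (f x))" by (simp add: act_def psubst_sum)

lemma refl_groupD: assumes "(p, N):refl_group c n"
 shows "p permutes {1..n}" "N <= {1..n}" "bij p" "finite N"
proof -
 show "p permutes {1..n}" "N <= {1..n}" using assms by (cases c; auto)+
 thus "bij p" "finite N" by (auto simp: permutes_bij intro: finite_subset)
qed

lemma permutation_in_refl_group: "p permutes {1..n} ==> (p, {}):refl_group c n" by (cases c) auto

lemma finite_refl_group [simp]: "finite (refl_group c n)" by (cases c) (auto intro: finite_permutations)

text \<open>Under \<open>h\<close> and then \<open>g\<close> the variable X_i meets the sign of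
  \<open>h\<close> at i and that of \<open>g\<close> at h(i); the two cancel if both occur, hence
  the symmetric difference.\<close>

definition gmul :: "signed_perm => signed_perm => signed_perm" where
 "gmul g h = (fst g o fst h, sym_diff (snd h) (fst h -` snd g))"

definition ginv :: "signed_perm => signed_perm" where
 "ginv g = (inv (fst g), fst g ` snd g)"

lemma gmul_in_refl_group: assumes "g:refl_group c n" "h:refl_group c n"
 shows "gmul g h:refl_group c n"
proof -
 have "fst h -` snd g <= {1..n}" if "c = TypeB"
  using assms that permutes_in_image[of "fst h" "{1..n}"] by fastforce
 thus ?thesis using assms by (cases c) (auto simp: gmul_def permutes_compose)
qed

lemma ginv_in_refl_group: assumes "g:refl_group c n" shows "ginv g:refl_group c n"
proof -
 have "fst g ` snd g <= {1..n}" if "c = TypeB"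
  using assms that permutes_in_image[of "fst g" "{1..n}"] by fastforce
 thus ?thesis using assms by (cases c) (auto simp: ginv_def permutes_inv)
qed

lemma sg_sym_diff: assumes "finite A" "finite B" shows "sg (sym_diff A B) m = sg A m * sg B m"
proof -
 have A: "(SUM i:A. coef m i) = (SUM i:A - B. coef m i) + (SUM i:A Int B. coef m i)"
  using assms by (metis sum.Int_Diff add.commute)
 have B: "(SUM i:B. coef m i) = (SUM i:B - A. coef m i) + (SUM i:A Int B. coef m i)"
  using assms by (metis sum.Int_Diff add.commute inf_commute)
 have "(SUM i:sym_diff A B. coef m i) = (SUM i:A - B. coef m i) + (SUM i:B - A. coef m i)"
  using assms by (intro sum.union_disjoint) auto
 thus ?thesis unfolding sg_def A B by (simp add: power_add flip: power_mult_distrib)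
qed

lemma sg_vimage: assumes "bij p" shows "sg (p -` N) (pm p m) = sg N m"
proof -
 have "(SUM i:p -` N. coef m (p i)) = (SUM j:p ` (p -` N). coef m j)"
  using assms by (subst sum.reindex) (auto simp: bij_def inj_on_def)
 also have "p ` (p -` N) = N" using assms by (simp add: bij_is_surj surj_image_vimage_eq)
 finally show ?thesis using assms by (simp add: sg_def coef_pm bij_is_inj)
qed

lemma act_gmul: assumes "g:refl_group c n" "h:refl_group c n"
 shows "act (gmul g h) p = act g (act h p)"
proof -
 obtain r N r' N' where [simp]: "g = (r, N)" "h = (r', N')"
  by (cases g, cases h)
 note g = refl_groupD[OF assms(1)[simplified]] and h = refl_groupD[OF assms(2)[simplified]]
 have fin: "finite (r' -` N)" using g(4) h(3) by (simp add: bij_is_inj finite_vimageI)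
 show ?thesis
 proof (rule poly_mapping_eqI)
  fix m
  have *: "sg (r' -` N) (pm (r o r') m) = sg N (pm r m)"
   using sg_vimage[OF h(3), of N "pm r m"] g h by (simp add: pm_pm bij_is_inj)
  show "coef (act (gmul g h) p) m = coef (act g (act h p)) m"
   using g h fin by (simp add: gmul_def coef_act bij_comp sg_sym_diff pm_pm bij_is_inj *)
 qed
qed

lemma act_id [simp]: "act (id, {}) p = p" by (rule poly_mapping_eqI) (simp add: coef_act)

lemma gmul_ginv: assumes "g:refl_group c n"
 shows "gmul g (ginv g) = (id, {})" "gmul (ginv g) g = (id, {})"
proof -
 obtain p N where [simp]: "g = (p, N)" by (cases g)
 note g = refl_groupD[OF assms[simplified]]
 have 1: "p o inv p = id" "inv p o p = id"
  using g(3) by (auto simp: bij_def surj_iff)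
 have 2: "inv p -` N = p ` N"
  using g(3) by (simp add: bij_vimage_eq_inv_image bij_imp_bij_inv inv_inv_eq)
 have 3: "p -` (p ` N) = N" using g(3) by (simp add: bij_is_inj inj_vimage_image_eq)
 show "gmul g (ginv g) = (id, {})" "gmul (ginv g) g = (id, {})"
  by (simp_all add: gmul_def ginv_def 1 2 3)
qed

lemma act_ginv: assumes "g:refl_group c n"
 shows "act g (act (ginv g) p) = p" "act (ginv g) (act g p) = p"
 using assms by (simp_all add: act_gmul[symmetric, OF _ ginv_in_refl_group]
   act_gmul[symmetric, OF ginv_in_refl_group] gmul_ginv)

lemma act_permutes_compose: assumes "h permutes {1..n}" "h' permutes {1..n}"
 shows "act (h, {}) (act (h', {}) p) = act (h o h', {}) p"
 using act_gmul[of "(h, {})" TypeA n "(h', {})"] assms by (simp add: gmul_def)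

lemma keys_pm: assumes "p permutes {1..n}"
 shows "keys (pm p m) <= {1..n} \<longleftrightarrow> keys m <= {1..n}"
proof -
 have "keys (pm p m) = p -` keys m"
  using assms by (simp add: keys_map_key permutes_inj)
 moreover have "p -` {1..n} = {1..n}" "p ` {1..n} = {1..n}" "p ` (p -` K) = K" for K
  using assms by (simp_all only: permutes_vimage permutes_image permutes_surj surj_image_vimage_eq)
 ultimately show ?thesis by (metis image_mono vimage_mono)
qed

lemma mdeg_pm: assumes "bij p" shows "mdeg (pm p m) = mdeg m"
proof -
 have "mdeg (pm p m) = (SUM i:p -` keys m. coef m (p i))"
  using assms by (simp add: mdeg_def keys_map_key bij_is_inj coef_pm)
 also have "... = (SUM j:p ` (p -` keys m). coef m j)"
  using assms by (subst sum.reindex) (auto simp: bij_def inj_on_def)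
 also have "p ` (p -` keys m) = keys m"
  using assms by (simp add: bij_is_surj surj_image_vimage_eq)
 finally show ?thesis by (simp add: mdeg_def)
qed

lemma act_in_poly_ring: assumes "g:refl_group c n" "p:poly_ring n" shows "act g p:poly_ring n"
proof -
 obtain h N where [simp]: "g = (h, N)" by (cases g)
 note g = refl_groupD[OF assms(1)[simplified]]
 show ?thesis using assms(2) keys_pm[OF g(1)] by (auto simp: poly_ring_iff coef_act g)
qed

lemma act_in_forms: assumes "g:refl_group c n" "p:forms n d" shows "act g p:forms n d"
proof -
 obtain h N where [simp]: "g = (h, N)" by (cases g)
 note g = refl_groupD[OF assms(1)[simplified]]
 show ?thesis using assms act_in_poly_ring[OF assms(1), of p] mdeg_pm[OF g(3)]
  by (auto simp: forms_iff coef_act g)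
qed

subsection \<open>The standard inner product\<close>

text \<open>Monomials are orthonormal. Signed permutations permute them up to sign and hence act by
  isometries.\<close>

definition ip :: "rpoly => rpoly => real" where
 "ip p q = (SUM m:keys p. coef p m * coef q m)"

lemma ip_superset: assumes "finite A" "keys p <= A"
 shows "ip p q = (SUM m:A. coef p m * coef q m)"
 unfolding ip_def using assms by (intro sum.mono_neutral_left) (auto simp: in_keys_iff)

lemma ip_commute: "ip p q = ip q p" using ip_superset[of "keys p Un keys q" p q]
  ip_superset[of "keys p Un keys q" q p] by (simp add: mult.commute)

lemma linear_ip_right: "linear (%q. ip p q)"
 by (rule linearI) (simp_all add: ip_def lookup_add sum.distrib sum_distrib_left algebra_simps)

lemma linear_ip_left: "linear (%p. ip p q)" using linear_ip_right[of q] by (simp add: ip_commute)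

lemma ip_self_eq_0_iff: "ip p p = 0 \<longleftrightarrow> p = 0"
proof
 assume "ip p p = 0"
 hence "ALL m:keys p. coef p m * coef p m = 0" by (simp add: ip_def sum_nonneg_eq_0_iff)
 thus "p = 0" by (intro poly_mapping_eqI) (auto simp: in_keys_iff)
qed (simp add: ip_def)

lemma ip_self_nonneg: "0 <= ip p p" by (simp add: ip_def sum_nonneg)

lemma ip_self_pos: "p ~= 0 ==> 0 < ip p p" using ip_self_nonneg[of p] ip_self_eq_0_iff[of p] by linarith

lemma ip_act_act: assumes "g:refl_group c n" shows "ip (act g p) (act g q) = ip p q"
proof -
 obtain h N where [simp]: "g = (h, N)" by (cases g)
 note g = refl_groupD[OF assms(1)[simplified]]
 let ?A = "pm h -` keys p"
 have bij: "bij (pm h)"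
 proof (rule bijI')
  show "pm h x = pm h y \<longleftrightarrow> x = y" for x y using pm_eq_iff[OF g(3)] by metis
  show "EX x. y = pm h x" for y using pm_eq_iff[OF g(3)] by metis
 qed
 have "ip (act g p) (act g q) = (SUM m:?A. coef (act g p) m * coef (act g q) m)"
  using bij by (intro ip_superset) (auto simp: finite_vimageI bij_is_inj in_keys_iff coef_act g)
 also have "... = (SUM m:?A. coef p (pm h m) * coef q (pm h m))"
 proof (rule sum.cong)
  fix m
  have "(sg N m' * a) * (sg N m' * b) = (sg N m' * sg N m') * (a * b)" for a b m' by (simp only: ac_simps)
  thus "coef (act g p) m * coef (act g q) m = coef p (pm h m) * coef q (pm h m)"
   by (simp add: coef_act g)
 qed simp
 also have "... = (SUM m:pm h ` ?A. coef p m * coef q m)"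
  using bij by (subst sum.reindex) (auto simp: bij_def inj_on_def)
 also have "pm h ` ?A = keys p" using bij by (simp add: bij_is_surj surj_image_vimage_eq)
 finally show ?thesis by (simp add: ip_def)
qed

lemma ip_act_left: assumes "g:refl_group c n"
 shows "ip (act g p) q = ip p (act (ginv g) q)"
 using ip_act_act[OF assms, of p "act (ginv g) q"] act_ginv[OF assms] by simp

section \<open>Group algebra elements paired with their adjoints\<close>

section \<open>The real group algebra as an algebra of operators\<close>

text \<open>The second operator is the adjoint of the first one, obtained by \<open>g \<mapsto> g\<^sup>-\<^sup>1\<close>.\<close>

inductive gop :: "cox_type => nat => (rpoly => rpoly) => (rpoly => rpoly) => bool" for c n where
 gop_zero: "gop c n (%p. 0) (%p. 0)"
| gop_step: "g:refl_group c n ==> gop c n A B ==>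
  gop c n (%p. a *\<^sub>R act g p + A p) (%p. a *\<^sub>R act (ginv g) p + B p)"

lemma gop_linear: assumes "gop c n A B" shows "linear A" "linear B"
proof -
 have *: "linear (%p. a *\<^sub>R act g p + C p)" if "linear C" for a g C
  using that by (auto simp: linear_iff act_add act_scaleR algebra_simps)
 have "linear A & linear B" using assms by (induction rule: gop.induct) (auto intro!: * linear_zero)
 thus "linear A" "linear B" by auto
qed

lemmas gop_simps =
 linear_add[OF gop_linear(1)] linear_scale[OF gop_linear(1)] linear_0[OF gop_linear(1)]
 linear_sum[OF gop_linear(1)] linear_diff[OF gop_linear(1)] linear_neg[OF gop_linear(1)]

lemma gop_scaleR_act: "g:refl_group c n ==>
  gop c n (%p. a *\<^sub>R act g p) (%p. a *\<^sub>R act (ginv g) p)"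
 using gop_step[OF _ gop_zero] by simp

lemma gop_act: "g:refl_group c n ==> gop c n (act g) (act (ginv g))"
 using gop_scaleR_act[of g c n 1] by simp

lemma gop_id: "gop c n (%p. p) (%p. p)"
proof -
 have "ginv (id, {}) = (id, {})" by (simp add: ginv_def)
 moreover have "act (id, {}) = (%p. p)" by (rule ext) simp
 ultimately show ?thesis using gop_act[OF permutation_in_refl_group[OF permutes_id], of c n] by simp
qed

lemma gop_add: assumes "gop c n A B" "gop c n A' B'" shows "gop c n (%p. A p + A' p) (%p. B p + B' p)"
 using assms by (induction rule: gop.induct) (auto simp: add.assoc intro: gop.intros)

lemma gop_scaleR: assumes "gop c n A B" shows "gop c n (%p. a *\<^sub>R A p) (%p. a *\<^sub>R B p)"
 using assms
proof (induction rule: gop.induct)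
 case (gop_step g A B b)
 thus ?case using gop.gop_step[of g c n _ _ "a * b"] by (simp add: scaleR_add_right)
qed (auto intro: gop_zero)

lemma gop_sum: assumes "finite I" "!!i. i:I ==> gop c n (A i) (B i)"
 shows "gop c n (%p. SUM i:I. A i p) (%p. SUM i:I. B i p)"
 using assms by (induction I rule: finite_induct) (auto intro: gop_zero gop_add)

lemma ginv_gmul: assumes "g:refl_group c n" "h:refl_group c n"
 shows "act (ginv (gmul g h)) p = act (ginv h) (act (ginv g) p)"
proof -
 note ss = assms gmul_in_refl_group[OF assms] ginv_in_refl_group
 have "p = act g (act h (act (ginv (gmul g h)) p))"
  using act_ginv(1)[OF ss(3)] ss by (simp add: act_gmul)
 hence "act (ginv h) (act (ginv g) p)
   = act (ginv h) (act (ginv g) (act g (act h (act (ginv (gmul g h)) p))))"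
  by simp
 also have "... = act (ginv (gmul g h)) p" by (simp only: act_ginv[OF ss(1)] act_ginv[OF ss(2)])
 finally show ?thesis by simp
qed

lemma gop_comp: assumes "gop c n A B" "gop c n A' B'" shows "gop c n (%p. A (A' p)) (%p. B' (B p))"
proof -
 have *: "gop c n (%p. a *\<^sub>R act g (A' p)) (%p. a *\<^sub>R B' (act (ginv g) p))"
  if "g:refl_group c n" for g a using assms(2)
 proof (induction rule: gop.induct)
  case (gop_step h A B b)
  have "gop c n (%p. (a * b) *\<^sub>R act (gmul g h) p + a *\<^sub>R act g (A p))
    (%p. (a * b) *\<^sub>R act (ginv (gmul g h)) p + a *\<^sub>R B (act (ginv g) p))"
   using that gop_step by (intro gop.gop_step gmul_in_refl_group)
  thus ?case using that gop_step by (simp add: act_gmul ginv_gmul act_add act_scaleR scaleR_add_right)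
 qed (simp add: gop_zero)
 show ?thesis using assms(1)
 proof (induction rule: gop.induct)
  case gop_zero
  thus ?case using linear_0[OF gop_linear(2)[OF assms(2)]] by (simp add: gop.gop_zero)
 next
  case (gop_step g A B a)
  thus ?case using gop_add[OF *[of g a] gop_step(3)] gop_linear(2)[OF assms(2)]
   by (simp add: linear_add linear_scale)
 qed
qed

lemma gop_adjoint: assumes "gop c n A B" shows "gop c n B A" using assms
proof (induction rule: gop.induct)
 case (gop_step g A B a)
 have "act (ginv (ginv g)) p = act g p" for p
  using act_ginv[OF gop_step(1)] act_ginv[OF ginv_in_refl_group[OF gop_step(1)]] by metis
 thus ?case using gop.gop_step[OF ginv_in_refl_group[OF gop_step(1)] gop_step(3), of a] by simp
qed (rule gop_zero)

lemma gop_ip: assumes "gop c n A B" shows "ip (A p) q = ip p (B q)" using assms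
 by (induction rule: gop.induct)
  (simp_all add: linear_add[OF linear_ip_left] linear_add[OF linear_ip_right]
   linear_scale[OF linear_ip_left] linear_scale[OF linear_ip_right]
   linear_0[OF linear_ip_left] linear_0[OF linear_ip_right] ip_act_left)

lemma gop_in_gmodule: assumes "gop c n A B" "gmodule (refl_group c n) V" "v:V" shows "A v:V"
 using assms by (induction rule: gop.induct)
  (auto simp: gmodule_def intro: subspace_0 subspace_add subspace_scale)

lemma gop_gmodule_iso:
 assumes "gop c n A B" "gmodule_iso (refl_group c n) V W f" "gmodule (refl_group c n) V" "v:V"
 shows "f (A v) = A (f v)" using assms
proof (induction rule: gop.induct)
 case gop_zero
 hence "f (0 *\<^sub>R v) = 0 *\<^sub>R f v" unfolding gmodule_iso_def by blast
 thus ?case by simp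
next
 case (gop_step g A B a)
 have "act g v:V" "a *\<^sub>R act g v:V" "A v:V"
  using gop_step gop_in_gmodule[OF gop_step(2) gop_step(5,6)] by (auto simp: gmodule_def subspace_scale)
 thus ?case using gop_step by (simp add: gmodule_iso_def)
qed

lemma gmodule_forms: "gmodule (refl_group c n) (forms n d)"
 by (auto simp: gmodule_def subspace_forms act_in_forms)

lemma gmodule_gop_range: "gmodule (refl_group c n) {x. EX A B. gop c n A B & x = A f}" (is "gmodule _ ?R")
proof -
 have R: "A f:?R" if "gop c n A B" for A B using that by (intro CollectI exI[of _ A] exI[of _ B]) simp
 have "subspace ?R" unfolding subspace_def
 proof (intro conjI ballI allI)
  show "0:?R" using R[OF gop_zero] .
 next
  fix x y assume "x:?R" "y:?R"
  thus "x + y:?R" using R[OF gop_add] by auto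
 next
  fix a x assume "x:?R"
  thus "a *\<^sub>R x:?R" using R[OF gop_scaleR] by auto
 qed
 moreover have "act g x:?R" if "g:refl_group c n" "x:?R" for g x
 proof -
  from that(2) obtain A B where "gop c n A B" "x = A f" by auto
  thus ?thesis using R[OF gop_comp[OF gop_act[OF that(1)]]] by auto
 qed
 ultimately show ?thesis by (simp add: gmodule_def)
qed

text \<open>Identifies orbit spans with cyclic modules over the group algebra, so that each element
  can be represented by an operator.\<close>

lemma orbit_span_iff:
 "x:orbit_span (refl_group c n) f \<longleftrightarrow> (EX A B. gop c n A B & x = A f)"
proof
 let ?R = "{x. EX A B. gop c n A B & x = A f}"
 have "(%g. act g f) ` refl_group c n <= ?R"
 proof (intro image_subsetI CollectI)
  fix g assume "g:refl_group c n"
  from gop_act[OF this] show "EX A B. gop c n A B & act g f = A f"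
   by (intro exI[of _ "act g"] exI[of _ "act (ginv g)"]) simp
 qed
 moreover have "subspace ?R" using gmodule_gop_range by (simp add: gmodule_def)
 ultimately have "orbit_span (refl_group c n) f <= ?R"
  unfolding orbit_span_def by (rule span_minimal)
 thus "x:orbit_span (refl_group c n) f ==> EX A B. gop c n A B & x = A f" by auto
next
 have "A f:orbit_span (refl_group c n) f" if "gop c n A B" for A B using that by (induction rule: gop.induct)
   (auto simp: orbit_span_def intro!: span_add span_scale span_zero intro: span_base)
 thus "EX A B. gop c n A B & x = A f ==> x:orbit_span (refl_group c n) f" by auto
qed

lemma orbit_spanI: "gop c n A B ==> A f:orbit_span (refl_group c n) f" by (auto simp: orbit_span_iff)

lemma orbit_spanE: assumes "x:orbit_span (refl_group c n) f"
 obtains A B where "gop c n A B" "x = A f" using assms by (auto simp: orbit_span_iff)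

lemma gmodule_orbit_span: "gmodule (refl_group c n) (orbit_span (refl_group c n) f)"
proof -
 have "orbit_span (refl_group c n) f = {x. EX A B. gop c n A B & x = A f}"
  unfolding set_eq_iff mem_Collect_eq orbit_span_iff by (intro allI refl)
 thus ?thesis by (simp only: gmodule_gop_range)
qed

lemma in_orbit_span: "f:orbit_span (refl_group c n) f" using orbit_spanI[OF gop_id] .

lemma orbit_span_subset: assumes "gmodule (refl_group c n) V" "f:V"
 shows "orbit_span (refl_group c n) f <= V" using assms gop_in_gmodule by (auto elim!: orbit_spanE)

section \<open>Averaging over the group\<close>

section \<open>The Reynolds operator\<close>

lemma linear_reynolds: "linear (reynolds G)" by (rule linearI)
  (simp_all add: reynolds_def act_add act_scaleR sum.distrib scaleR_add_right
   scaleR_sum_right scaleR_left_commute)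

lemma card_refl_group_pos: "0 < card (refl_group c n)"
 using permutation_in_refl_group[OF permutes_id] by (auto simp: card_gt_0_iff)

lemma reynolds_invariant_mult: assumes "g:invariants n (refl_group c n)"
 shows "reynolds (refl_group c n) (g * p) = g * reynolds (refl_group c n) p"
proof -
 have "(SUM s:refl_group c n. act s (g * p)) = g * (SUM s:refl_group c n. act s p)"
  using assms by (simp add: sum_distrib_left act_mult invariants_def)
 thus ?thesis by (simp add: reynolds_def)
qed

lemma reynolds_invariant: assumes "g:invariants n (refl_group c n)" shows "reynolds (refl_group c n) g = g"
proof -
 have "reynolds (refl_group c n) 1 = 1" using card_refl_group_pos[of c n]
  by (auto simp: reynolds_def act_def sum_constant_scaleR card_gt_0_iff simp del: sum_constant)
 thus ?thesis using reynolds_invariant_mult[OF assms, of 1] by simp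
qed

text \<open>Right multiplication by \<open>ginv h\<close> permutes the group, so a polynomial and
  its translate by \<open>ginv h\<close> have the same average.\<close>

lemma reynolds_act_left: assumes "h:refl_group c n"
 shows "reynolds (refl_group c n) (act h p * q) = reynolds (refl_group c n) (p * act (ginv h) q)"
proof -
 have "reynolds (refl_group c n) (act h p * q) = reynolds (refl_group c n) (act (ginv h) (act h p * q))"
 proof -
  have "(SUM g:refl_group c n. act g r) = (SUM g:refl_group c n. act g (act (ginv h) r))" for r
  proof -
   have "bij_betw (%g. gmul g (ginv h)) (refl_group c n) (refl_group c n)"
   proof (rule bij_betw_imageI)
    let ?w = "ginv h" and ?G = "refl_group c n"
    have "bij (fst ?w)" using refl_groupD(3) ginv_in_refl_group[OF assms] by (metis prod.collapse)
    hence surj: "surj (fst ?w)" by (rule bij_is_surj)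
    show inj: "inj_on (%g. gmul g ?w) ?G"
    proof (rule inj_onI)
     fix g g' assume "gmul g ?w = gmul g' ?w"
     hence 1: "fst g o fst ?w = fst g' o fst ?w"
      and 2: "sym_diff (snd ?w) (fst ?w -` snd g) = sym_diff (snd ?w) (fst ?w -` snd g')"
      by (auto simp: gmul_def)
     from 1 have "fst g = fst g'" using surj by (rule_tac ext) (metis comp_apply surjD)
     moreover have "fst ?w -` snd g = fst ?w -` snd g'"
      using 2 by (simp add: set_eq_iff) blast
     hence "snd g = snd g'" using surj by (metis surj_image_vimage_eq)
     ultimately show "g = g'" by (simp add: prod_eq_iff)
    qed
    show "(%g. gmul g ?w) ` ?G = ?G" using inj assms by (intro card_subset_eq)
      (auto simp: card_image gmul_in_refl_group ginv_in_refl_group)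
   qed
   hence "(SUM g:refl_group c n. act g r) = (SUM g:refl_group c n. act (gmul g (ginv h)) r)"
    by (rule sum.reindex_bij_betw[symmetric])
   thus ?thesis using ginv_in_refl_group[OF assms] by (simp add: act_gmul)
  qed
  thus ?thesis by (simp add: reynolds_def)
 qed
 thus ?thesis by (simp add: act_mult act_ginv[OF assms])
qed

text \<open>An operator has the same adjoint for the pairing by averaged products as for
  \<open>ip\<close>; this is what lets averages be computed through inner products.\<close>

lemma gop_reynolds: assumes "gop c n A B"
 shows "reynolds (refl_group c n) (A p * q) = reynolds (refl_group c n) (p * B q)" using assms
 by (induction rule: gop.induct)
  (simp_all add: distrib_left distrib_right linear_add[OF linear_reynolds] linear_scale[OF linear_reynolds]
   reynolds_act_left)

lemma gop_invariant_mult: assumes "gop c n A B" "g:invariants n (refl_group c n)" shows "A (g * p) = g * A p"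
 using assms by (induction rule: gop.induct) (simp_all add: invariants_def act_mult algebra_simps)

section \<open>Linear algebra of indexed families\<close>

section \<open>Linearly independent families\<close>

definition lin_indep_family :: "'i set => ('i => 'b::real_vector) => bool" where
 "lin_indep_family I x \<longleftrightarrow> (ALL a. (SUM i:I. a i *\<^sub>R x i) = 0 --> (ALL i:I. a i = 0))"

lemma lin_indep_familyD:
 "lin_indep_family I x ==> (SUM i:I. a i *\<^sub>R x i) = 0 ==> i:I ==> a i = 0"
 by (auto simp: lin_indep_family_def)

lemma lin_indep_family_inj: assumes "finite I" "lin_indep_family I x" shows "inj_on x I"
proof (rule inj_onI, rule ccontr)
 fix i j assume ij: "i:I" "j:I" "x i = x j" "i ~= j"
 let ?a = "%k. if k = i then 1 else if k = j then - 1 else 0 :: real"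
 have "(SUM k:I. ?a k *\<^sub>R x k) = (SUM k:{i, j}. ?a k *\<^sub>R x k)"
  using assms(1) ij by (intro sum.mono_neutral_right) auto
 also have "... = 0" using ij by simp
 finally have "?a i = 0" using lin_indep_familyD[OF assms(2), of ?a] ij(1) by blast
 thus False by simp
qed

lemma lin_indep_family_independent: assumes "finite I" "lin_indep_family I x" shows "independent (x ` I)"
proof -
 note inj = lin_indep_family_inj[OF assms]
 have "u v = 0" if "(SUM v:x ` I. u v *\<^sub>R v) = 0" "v:x ` I" for u v
 proof -
  have "(SUM i:I. u (x i) *\<^sub>R x i) = 0" using that(1) inj by (simp add: sum.reindex)
  thus ?thesis using lin_indep_familyD[OF assms(2), of "%i. u (x i)"] that(2) by auto
 qed
 thus ?thesis using assms(1) by (auto simp: dependent_finite)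
qed

lemma lin_indep_family_card_le:
 assumes "finite I" "finite I'" "lin_indep_family I x" "x ` I <= span (z ` I')"
 shows "card I <= card I'"
proof -
 have "card (x ` I) <= card (z ` I')"
  using independent_span_bound[OF _ lin_indep_family_independent[OF assms(1,3)] assms(4)] assms(2) by simp
 thus ?thesis
  using card_image[OF lin_indep_family_inj[OF assms(1,3)]] card_image_le[OF assms(2), of z] by simp
qed

lemma lin_indep_family_spans:
 assumes "finite I" "finite I'" "lin_indep_family I x" "x ` I <= span (z ` I')" "card I' <= card I"
 shows "span (x ` I) = span (z ` I')"
proof -
 have "z i:span (x ` I)" if "i:I'" for i
 proof (rule ccontr)
  assume z: "z i ~: span (x ` I)"
  hence "z i ~: x ` I" by (auto intro: span_base)
  hence "card (insert (z i) (x ` I)) = Suc (card I)"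
   using assms(1) by (simp add: card_image[OF lin_indep_family_inj[OF assms(1,3)]])
  moreover have "independent (insert (z i) (x ` I))"
   using lin_indep_family_independent[OF assms(1,3)] z by (simp add: independent_insertI)
  hence "card (insert (z i) (x ` I)) <= card (z ` I')"
   using independent_span_bound[of "z ` I'" "insert (z i) (x ` I)"] assms that by (auto simp: span_base)
  ultimately show False using assms(5) card_image_le[OF assms(2), of z] by simp
 qed
 thus ?thesis using assms(4) by (metis image_subsetI span_eq)
qed

lemma span_image_family: assumes "finite I"
 shows "y:span (x ` I) \<longleftrightarrow> (EX a. y = (SUM i:I. a i *\<^sub>R x i))"
proof
 assume "y:span (x ` I)"
 thus "EX a. y = (SUM i:I. a i *\<^sub>R x i)"
 proof (induction rule: span_induct_alt)
  case base
  thus ?case by (intro exI[of _ "%_. 0"]) simp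
 next
  case (step c v y)
  then obtain a i where *: "y = (SUM i:I. a i *\<^sub>R x i)" "i:I" "v = x i" by auto
  have "c *\<^sub>R v = (SUM j:I. (if j = i then c else 0) *\<^sub>R x j)"
   using * assms by (simp add: if_distrib[of "%c. c *\<^sub>R _"] cong: if_cong)
  hence "c *\<^sub>R v + y = (SUM j:I. ((if j = i then c else 0) + a j) *\<^sub>R x j)"
   using * by (simp add: scaleR_add_left sum.distrib)
  thus ?case by (intro exI[of _ "%j. (if j = i then c else 0) + a j"])
 qed
qed (auto intro: span_sum span_scale span_base)

lemma span_mult_family: fixes e :: "'i => rpoly"
 assumes "finite I" "subspace K" "f:span {a * e i | a i. a:K & i:I}"
 obtains p where "!!i. p i:K" "f = (SUM i:I. p i * e i)"
proof -
 have "EX p. (ALL i. p i:K) & f = (SUM i:I. p i * e i)" using assms(3)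
 proof (induction rule: span_induct_alt)
  case base
  thus ?case by (intro exI[of _ "%_. 0"]) (simp add: subspace_0[OF assms(2)])
 next
  case (step c x y)
  then obtain a i p where *: "x = a * e i" "a:K" "i:I" "ALL i. p i:K" "y = (SUM i:I. p i * e i)" by blast
  thus ?case using assms(1,2) by (intro exI[of _ "%k. (if k = i then c *\<^sub>R a else 0) + p k"])
    (simp add: subspace_add subspace_scale subspace_0 distrib_right sum.distrib if_distrib[of "%a. a * _"] cong: if_cong)
 qed
 thus ?thesis using that by blast
qed

lemma sum_Sigma_times: assumes "finite J" "!!j. j:J ==> finite (A j)" "!!j. j:J ==> finite (B j)"
 shows "(SUM k:(SIGMA j:J. A j \<times> B j). f k) = (SUM j:J. SUM a:A j. SUM b:B j. f (j, a, b))"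
 using sum.Sigma[of J "%j. A j \<times> B j" "%j z. f (j, z)"] assms
 by (simp add: sum.cartesian_product split_def)

lemma span_UN_sums: assumes "finite I" "!!i. i:I ==> subspace (U i)"
 shows "span (UN i:I. U i) = {SUM i:I. u i | u. ALL i:I. u i:U i}" (is "_ = ?R")
proof (intro equalityI subsetI)
 fix v assume "v:span (UN i:I. U i)"
 thus "v:?R"
 proof (induction rule: span_induct_alt)
  case base
  show ?case using assms(2) by (intro CollectI exI[of _ "%_. 0"]) (simp add: subspace_0)
 next
  case (step c x y)
  then obtain i u where "i:I" "x:U i" "y = (SUM i:I. u i)" "ALL i:I. u i:U i" by blast
  thus ?case using assms by (intro CollectI exI[of _ "%k. (if k = i then c *\<^sub>R x else 0) + u k"])
    (simp add: subspace_add subspace_scale subspace_0 sum.distrib)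
 qed
qed (auto intro!: span_sum intro: span_base)

lemma direct_sum_iff: "direct_sum V I U \<longleftrightarrow> finite I & (ALL i:I. subspace (U i)) & V = span (UN i:I. U i) &
  (ALL u. (ALL i:I. u i:U i) & (SUM i:I. u i) = 0 --> (ALL i:I. u i = 0))"
 using span_UN_sums[of I U] by (auto simp: direct_sum_def)

lemma gmodule_span_Union: assumes "!!U. U:\<U> ==> gmodule G U" shows "gmodule G (span (\<Union>\<U>))"
 unfolding gmodule_def
proof (intro conjI ballI subspace_span)
 fix g v assume "g:G" "v:span (\<Union>\<U>)"
 hence "act g v:span (act g ` \<Union>\<U>)" by (simp add: linear_span_image[OF linear_act])
 also have "... <= span (\<Union>\<U>)"
  using assms `g:G` by (intro span_mono) (auto simp: gmodule_def)
 finally show "act g v:span (\<Union>\<U>)" .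
qed

section \<open>Schur theory from self-adjoint primitive idempotents\<close>

section \<open>Systems of primitive idempotents\<close>

lemma gmodule_isoD: assumes "gmodule_iso G V W f"
 shows "bij_betw f V W" "!!u v. u:V ==> v:V ==> f (u + v) = f u + f v"
  "!!a v. v:V ==> f (a *\<^sub>R v) = a *\<^sub>R f v" "!!v. v:V ==> f v:W"
  "0:V ==> f 0 = 0" "!!v. v:V ==> 0:V ==> f v = 0 ==> v = 0"
  "!!v. v:W ==> EX u:V. v = f u"
proof -
 show *: "bij_betw f V W" "!!u v. u:V ==> v:V ==> f (u + v) = f u + f v"
  "!!a v. v:V ==> f (a *\<^sub>R v) = a *\<^sub>R f v" using assms by (auto simp: gmodule_iso_def)
 show "!!v. v:V ==> f v:W" "!!v. v:W ==> EX u:V. v = f u" using *(1) by (auto simp: bij_betw_def)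
 show z: "f 0 = 0" if "0:V" using *(3)[OF that, of 0] by simp
 show "v = 0" if "v:V" "0:V" "f v = 0" for v
  using inj_onD[of f V v 0] *(1) z[OF that(2)] that by (simp add: bij_betw_def)
qed

text \<open>One idempotent per isomorphism type. Self-adjointness is expressed by pairing
  \<open>E j\<close> with itself in \<open>gop\<close>; \<open>E_prim\<close> says that compressions
  to the image of \<open>E j\<close> are real scalars, and \<open>E_orth\<close> excludes maps
  between different types.\<close>

locale primitive_system = fixes c :: cox_type and n :: nat and J :: "'j set" and E :: "'j => rpoly => rpoly"
 assumes finite_J [simp]: "finite J" and E_gop: "j:J ==> gop c n (E j) (E j)"
  and E_idem: "j:J ==> E j (E j p) = E j p"
  and E_prim: "j:J ==> gop c n A B ==> EX k. ALL p. E j (A (E j p)) = k *\<^sub>R E j p"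
  and E_orth: "j:J ==> k:J ==> j ~= k ==> gop c n A B ==> E j (A (E k p)) = 0"
begin

abbreviation "GG == refl_group c n"
abbreviation "orb == orbit_span GG"

text \<open>The scalar is common to all vectors fixed by \<open>E j\<close>. This is how information
  passes from one such vector to another.\<close>

definition scal :: "'j => (rpoly => rpoly) => real" where
 "scal j A = (SOME k. ALL p. E j (A (E j p)) = k *\<^sub>R E j p)"

lemma scal: assumes "j:J" "gop c n A B" "E j f = f" shows "E j (A f) = scal j A *\<^sub>R f"
proof -
 have "ALL p. E j (A (E j p)) = scal j A *\<^sub>R E j p"
  unfolding scal_def by (rule someI_ex[OF E_prim[OF assms(1,2)]])
 from spec[OF this, of f] show ?thesis by (simp add: assms(3))
qed

lemma orth: assumes "j:J" "k:J" "j ~= k" "gop c n A B" "E k f = f" shows "E j (A f) = 0"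
 using E_orth[OF assms(1-4), of f] by (simp add: assms(5))

text \<open>Positivity of \<open>ip\<close>: for u = A f nonzero, \<open>ip u u\<close> equals the
  product of f with \<open>E j (B u)\<close>, which is therefore nonzero, and it is a multiple of f
  by primitivity.\<close>

lemma regain: assumes "j:J" "E j f = f" "u:orb f" "u ~= 0"
 obtains A B where "gop c n A B" "E j (A u) = f"
proof -
 obtain A B where A: "gop c n A B" "u = A f" using assms(3) by (rule orbit_spanE)
 note B = gop_adjoint[OF A(1)]
 have "ip u u = ip (E j f) (B (A f))" using gop_ip[OF A(1)] A(2) assms(2) by simp
 also have "... = ip f (E j (B (A f)))" by (rule gop_ip[OF E_gop[OF assms(1)]])
 finally have "ip f (E j (B u)) ~= 0" using assms(4) A(2) ip_self_eq_0_iff[of u] by simp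
 hence "E j (B u) ~= 0" using linear_0[OF linear_ip_right[of f]] by auto
 moreover have "E j (B u) = scal j (%p. B (A p)) *\<^sub>R f"
  unfolding A(2) by (rule scal[OF assms(1) gop_comp[OF B A(1)] assms(2)])
 ultimately obtain k where k: "E j (B u) = k *\<^sub>R f" "k ~= 0" by auto
 have "E j ((1 / k) *\<^sub>R B u) = f" using k by (simp add: gop_simps[OF E_gop[OF assms(1)]])
 thus ?thesis using that[OF gop_scaleR[OF B]] by blast
qed

lemma irreducible: assumes "j:J" "E j f = f" "f ~= 0" shows "irreducible_gmodule GG (orb f)"
 unfolding irreducible_gmodule_def
proof (intro conjI allI impI)
 show "gmodule GG (orb f)" by (rule gmodule_orbit_span)
 show "orb f ~= {0}" using in_orbit_span[of f c n] assms(3) by auto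
 fix U assume U: "gmodule GG U & U <= orb f"
 show "U = {0} | U = orb f"
 proof (cases "U <= {0}")
  case True
  thus ?thesis using U subspace_0 by (auto simp: gmodule_def)
 next
  case False
  then obtain u where u: "u:U" "u ~= 0" by auto
  obtain A B where A: "gop c n A B" "E j (A u) = f" using regain[OF assms(1,2)] u U by blast
  have "A u:U" using gop_in_gmodule[OF A(1)] U u by blast
  hence "f:U" using gop_in_gmodule[OF E_gop[OF assms(1)]] U A(2) by force
  thus ?thesis using orbit_span_subset U by blast
 qed
qed

text \<open>By \<open>regain\<close>, whether \<open>A\<close> kills a nonzero fixed vector is
  decided by scalars \<open>scal j\<close> of products A' A, and these do not depend on the
  vector.\<close>

lemma same_annihilator: assumes "j:J" "E j f = f" "f ~= 0" "E j g = g" "gop c n A B" "A f = 0" shows "A g = 0"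
proof (rule ccontr)
 assume Ag: "A g ~= 0"
 obtain A' B' where A': "gop c n A' B'" "E j (A' (A g)) = g"
  using regain[OF assms(1,4) orbit_spanI[OF assms(5)] Ag] .
 have "scal j (%p. A' (A p)) *\<^sub>R f = 0"
  using scal[OF assms(1) gop_comp[OF A'(1) assms(5)] assms(2)] assms(6)
  by (simp add: gop_simps[OF A'(1)] gop_simps[OF E_gop[OF assms(1)]])
 hence "scal j (%p. A' (A p)) = 0" using assms(3) by simp
 hence "g = 0" using scal[OF assms(1) gop_comp[OF A'(1) assms(5)] assms(4)] A'(2) by simp
 thus False using Ag by (simp add: gop_simps[OF assms(5)])
qed

text \<open>The map sends A f to A g; \<open>same_annihilator\<close> makes it well defined in one
  direction and injective in the other.\<close>

lemma orbit_span_iso: assumes "j:J" "E j f = f" "f ~= 0" "E j g = g" "g ~= 0"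
 obtains w where "gmodule_iso GG (orb f) (orb g) w" "w f = g"
proof -
 define w where "w u = (SOME A. EX B. gop c n A B & u = A f) g" for u
 have w: "w (A f) = A g" if A: "gop c n A B" for A B
 proof -
  define A' where "A' = (SOME A'. EX B. gop c n A' B & A f = A' f)"
  have "EX A'. EX B. gop c n A' B & A f = A' f" using A by (intro exI[of _ A] exI[of _ B]) simp
  hence "EX B. gop c n A' B & A f = A' f" unfolding A'_def by (rule someI_ex)
  then obtain B' where A': "gop c n A' B'" "A f = A' f" by blast
  have "gop c n (%p. A' p + (- 1) *\<^sub>R A p) (%p. B' p + (- 1) *\<^sub>R B p)"
   by (intro gop_add gop_scaleR A A')
  from same_annihilator[OF assms(1-4) this] A'(2) have "A' g = A g" by simp
  thus ?thesis by (simp add: w_def A'_def)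
 qed
 have "bij_betw w (orb f) (orb g)"
 proof (rule bij_betw_imageI)
  show "inj_on w (orb f)"
  proof (rule inj_onI)
   fix u v assume "u:orb f" "v:orb f" and eq: "w u = w v"
   then obtain A B A' B' where *: "gop c n A B" "u = A f" "gop c n A' B'" "v = A' f" by (elim orbit_spanE)
   have "gop c n (%p. A' p + (- 1) *\<^sub>R A p) (%p. B' p + (- 1) *\<^sub>R B p)"
    by (intro gop_add gop_scaleR *)
   from same_annihilator[OF assms(1,4,5,2) this] eq * w show "u = v" by auto
  qed
  show "w ` orb f = orb g"
  proof
   show "w ` orb f <= orb g"
    by (auto elim!: orbit_spanE simp: w orbit_spanI)
   show "orb g <= w ` orb f"
   proof
    fix y assume "y:orb g"
    then obtain A B where A: "gop c n A B" "y = A g" by (rule orbit_spanE)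
    show "y:w ` orb f"
     unfolding A(2) w[OF A(1), symmetric] by (intro imageI orbit_spanI[OF A(1)])
   qed
  qed
 qed
 moreover have "w (u + v) = w u + w v" if uv: "u:orb f" "v:orb f" for u v
 proof -
  obtain A B A' B' where *: "gop c n A B" "u = A f" "gop c n A' B'" "v = A' f" using uv by (elim orbit_spanE)
  show ?thesis using w[OF gop_add[OF *(1,3)]] w[OF *(1)] w[OF *(3)] *(2,4) by simp
 qed
 moreover have "w (a *\<^sub>R v) = a *\<^sub>R w v" if v: "v:orb f" for a v
 proof -
  obtain A B where *: "gop c n A B" "v = A f" using v by (elim orbit_spanE)
  show ?thesis using w[OF gop_scaleR[OF *(1)]] w[OF *(1)] *(2) by simp
 qed
 moreover have "w (act b v) = act b (w v)" if v: "b:GG" "v:orb f" for b v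
 proof -
  obtain A B where *: "gop c n A B" "v = A f" using v(2) by (elim orbit_spanE)
  show ?thesis using w[OF gop_comp[OF gop_act[OF v(1)] *(1)]] w[OF *(1)] *(2) by simp
 qed
 ultimately have "gmodule_iso GG (orb f) (orb g) w" by (simp add: gmodule_iso_def)
 moreover have "w f = g" using w[OF gop_id] by simp
 ultimately show ?thesis by (rule that)
qed

lemma isomorphic_orbit_spans: assumes "j:J" "E j f = f" "f ~= 0" "E j g = g" "g ~= 0"
 shows "isomorphic_gmodules GG (orb f) (orb g)"
 using orbit_span_iso[OF assms] by (auto simp: isomorphic_gmodules_def gmodule_orbit_span)

text \<open>A module isomorphic to the orbit span of \<open>y = E j y\<close> is itself the orbit span of such a vector.\<close>

lemma iso_generator: assumes "j:J" "E j y = y" "isomorphic_gmodules GG U (orb y)"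
 obtains u where "u:U" "E j u = u" "U = orb u" "y ~= 0 --> u ~= 0"
proof -
 obtain f where U: "gmodule GG U" and f: "gmodule_iso GG U (orb y) f"
  using assms(3) by (auto simp: isomorphic_gmodules_def)
 note iso = gmodule_isoD[OF f]
 have inj: "u = v" if "u:U" "v:U" "f u = f v" for u v
  using iso(1) that by (auto simp: bij_betw_def dest: inj_onD)
 obtain u where u: "u:U" "f u = y" using iso(7)[OF in_orbit_span] by auto
 have "E j u = u"
 proof (rule inj[OF gop_in_gmodule[OF E_gop[OF assms(1)] U u(1)] u(1)])
  show "f (E j u) = f u"
   by (simp only: gop_gmodule_iso[OF E_gop[OF assms(1)] f U u(1)] u(2) assms(2))
 qed
 moreover have "U = orb u"
 proof
  show "U <= orb u"
  proof
   fix w assume w: "w:U"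
   obtain A B where A: "gop c n A B" "f w = A y" using iso(4)[OF w] by (rule orbit_spanE)
   have "w = A u"
   proof (rule inj[OF w gop_in_gmodule[OF A(1) U u(1)]])
    show "f w = f (A u)" by (simp only: gop_gmodule_iso[OF A(1) f U u(1)] u(2) A(2))
   qed
   thus "w:orb u" using orbit_spanI[OF A(1)] by simp
  qed
  show "orb u <= U" using orbit_span_subset[OF U u(1)] .
 qed
 moreover have "y ~= 0 --> u ~= 0" using iso(5) u by auto
 ultimately show ?thesis using that[OF u(1)] by simp
qed

text \<open>An isomorphism would produce a generator of the first module fixed by
  \<open>E k\<close>, from which \<open>E j\<close> cannot recover f.\<close>

lemma not_isomorphic_orbit_spans: assumes "j:J" "k:J" "j ~= k" "E j f = f" "f ~= 0" "E k g = g"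
 shows "~ isomorphic_gmodules GG (orb f) (orb g)"
proof
 assume "isomorphic_gmodules GG (orb f) (orb g)"
 then obtain u where u: "E k u = u" "orb f = orb u" by (rule iso_generator[OF assms(2,6)])
 obtain A B where A: "gop c n A B" "f = A u"
  using in_orbit_span[of f c n] unfolding u(2) by (rule orbit_spanE)
 thus False using orth[OF assms(1-3) A(1) u(1)] assms(4,5) by simp
qed

text \<open>If the summand \<open>u j i\<close> were nonzero, some operator would carry it to
  \<open>x j i\<close>. Followed by \<open>E j\<close>, that operator kills all other types and
  sends the remaining summands of type j to multiples of the \<open>x j i'\<close>, so the relation
  becomes one among independent vectors.\<close>

lemma orbit_spans_direct: assumes "!!j. j:J ==> finite (I j)"
  and "!!j i. j:J ==> i:I j ==> E j (x j i) = x j i" and "!!j. j:J ==> lin_indep_family (I j) (x j)"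
  and "!!j i. j:J ==> i:I j ==> u j i:orb (x j i)"
  and "(SUM j:J. SUM i:I j. u j i) = 0" and j: "j:J" and i: "i:I j" shows "u j i = 0"
proof (rule ccontr)
 assume ui: "u j i ~= 0"
 obtain A B where A: "gop c n A B" "E j (A (u j i)) = x j i"
  using regain[OF j assms(2)[OF j i] assms(4)[OF j i] ui] .
 note EA = gop_comp[OF E_gop[OF j] A(1)]
 have "EX k. E j (A (u j i')) = k *\<^sub>R x j i'" if i': "i':I j" for i'
 proof -
  obtain A' B' where A': "gop c n A' B'" "u j i' = A' (x j i')" using assms(4)[OF j i'] by (rule orbit_spanE)
  show ?thesis using scal[OF j gop_comp[OF A(1) A'(1)] assms(2)[OF j i']] A'(2) by auto
 qed
 then obtain k where k: "!!i'. i':I j ==> E j (A (u j i')) = k i' *\<^sub>R x j i'" by metis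
 have 0: "E j (A (u j' i')) = 0" if i': "j':J" "i':I j'" "j' ~= j" for i' j'
 proof -
  obtain A' B' where A': "gop c n A' B'" "u j' i' = A' (x j' i')"
   using assms(4)[OF i'(1,2)] by (rule orbit_spanE)
  show ?thesis
   using orth[OF j i'(1) i'(3)[symmetric] gop_comp[OF A(1) A'(1)] assms(2)[OF i'(1,2)]] A'(2) by auto
 qed
 have "0 = E j (A (SUM j:J. SUM i:I j. u j i))" using assms(5) gop_simps(3)[OF EA] by simp
 also have "... = (SUM j':J. SUM i:I j'. E j (A (u j' i)))" by (simp add: gop_simps(4)[OF EA])
 also have "... = (SUM j':J. if j' = j then SUM i:I j. k i *\<^sub>R x j i else 0)"
  by (intro sum.cong refl) (auto simp: 0 k)
 also have "... = (SUM i:I j. k i *\<^sub>R x j i)" using j by simp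
 finally have "k i = 0" using lin_indep_familyD[OF assms(3)[OF j]] i by metis
 hence "x j i = 0" using k[OF i] A(2) by simp
 thus False using ui assms(4)[OF j i] by (auto elim!: orbit_spanE simp: gop_simps)
qed

text \<open>A vanishing test that involves only the scalars produced by \<open>E j\<close>; it is
  applied to relations with invariant coefficients.\<close>

lemma orbit_span_eq_0: assumes "j:J" "E j f = f" "u:orb f" "!!A B. gop c n A B ==> E j (A u) = 0"
 shows "u = 0"
proof (rule ccontr)
 assume u: "u ~= 0"
 obtain A B where "gop c n A B" "E j (A u) = f" by (rule regain[OF assms(1-3) u])
 hence "f = 0" using assms(4) by simp
 thus False using assms(3) u by (auto elim!: orbit_spanE simp: gop_simps)
qed

end

lemma gmodule_subspace: "gmodule G V ==> subspace V" by (simp add: gmodule_def)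

lemma direct_sum_reindex: assumes h: "bij_betw h I' I" and V: "direct_sum V I U"
 shows "direct_sum V I' (%i. U (h i))" unfolding direct_sum_iff
proof (intro conjI allI impI)
 note inj = bij_betw_imp_inj_on[OF h] and img = bij_betw_imp_surj_on[OF h]
 show "finite I'" using V bij_betw_finite[OF h] by (simp add: direct_sum_def)
 show "ALL i:I'. subspace (U (h i))" "V = span (UN i:I'. U (h i))"
  using V unfolding direct_sum_iff img[symmetric] by (simp_all add: image_image)
 have dir: "ALL u. (ALL i:I. u i:U i) & (SUM i:I. u i) = 0 --> (ALL i:I. u i = 0)"
  by (rule conjunct2[OF conjunct2[OF conjunct2[OF V[unfolded direct_sum_iff]]]])
 fix u assume u: "(ALL i:I'. u i:U (h i)) & (SUM i:I'. u i) = 0"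
 let ?w = "%i. u (the_inv_into I' h i)"
 have w: "?w (h i) = u i" if "i:I'" for i using that by (simp add: the_inv_into_f_f[OF inj])
 have "(SUM i:I. ?w i) = 0" using u sum.reindex_bij_betw[OF h, of ?w] w by simp
 moreover have "ALL i:h ` I'. ?w i:U i" using u w by simp
 ultimately have "ALL i:h ` I'. ?w i = 0" using dir[THEN spec, of ?w] unfolding img by blast
 thus "ALL i:I'. u i = 0" using w by simp
qed

context primitive_system
begin

text \<open>On the decomposition of a module into irreducibles, \<open>E j\<close> picks one line from each summand
 isomorphic to the orbit span of \<open>y = E j y\<close> and annihilates the other summands.\<close>

lemma E_irreducible: assumes "j:J" "E j y = y" "y ~= 0" "irreducible_gmodule GG U"
  "~ isomorphic_gmodules GG U (orb y)" "v:U" shows "E j v = 0"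
proof (rule ccontr)
 assume 0: "E j v ~= 0"
 have U: "gmodule GG U" using assms(4) unfolding irreducible_gmodule_def by (rule conjunct1)
 have Ev: "E j v:U" by (rule gop_in_gmodule[OF E_gop[OF assms(1)] U assms(6)])
 have "orb (E j v) = {0} | orb (E j v) = U"
 proof -
  have "ALL W. gmodule GG W & W <= U --> W = {0} | W = U"
   using assms(4) unfolding irreducible_gmodule_def by (elim conjE)
  thus ?thesis using gmodule_orbit_span[of c n "E j v"] orbit_span_subset[OF U Ev] by simp
 qed
 moreover have "orb (E j v) ~= {0}" using in_orbit_span[of "E j v" c n] 0 by (metis singletonD)
 ultimately have "orb (E j v) = U" by blast
 thus False using isomorphic_orbit_spans[OF assms(1) E_idem[OF assms(1)] 0 assms(2,3)] assms(5) by argo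
qed

text \<open>The common situation for H_{n,d} and for the model of the coinvariant algebra: a module
  generated by orbit spans of fixed vectors that are independent within each type. Adapted bases,
  isotypic components and multiplicities all follow from it.\<close>

context fixes V :: "rpoly set" and q :: "'j => nat" and x :: "'j => nat => rpoly" assumes gV: "gmodule GG V"
  and xE: "!!j i. j:J ==> i < q j ==> E j (x j i) = x j i" and xV: "!!j i. j:J ==> i < q j ==> x j i:V"
  and xind: "!!j. j:J ==> lin_indep_family {..<q j} (x j)"
  and xspan: "V <= span (UN j:J. UN i<q j. orb (x j i))"
begin

lemma x_nonzero: assumes "j:J" "i < q j" shows "x j i ~= 0"
proof
 assume "x j i = 0"
 hence "(SUM k<q j. (if k = i then 1 else 0) *\<^sub>R x j k) = 0" by (intro sum.neutral) auto
 from lin_indep_familyD[OF xind[OF assms(1)] this, of i] assms(2) show False by simp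
qed

lemma orbit_span_x: "j:J ==> i < q j ==> orb (x j i) <= V"
 by (rule orbit_span_subset[OF gV xV])

lemma direct_sum_Sigma: "direct_sum V (SIGMA j:J. {..<q j}) (%(j, i). orb (x j i))"
 unfolding direct_sum_iff
proof (intro conjI allI impI ballI)
 let ?U = "UN p:(SIGMA j:J. {..<q j}). case p of (j, i) => orb (x j i)"
 show "subspace (case p of (j, i) => orb (x j i))" for p
  using gmodule_subspace[OF gmodule_orbit_span] by (cases p) auto
 have "?U = (UN j:J. UN i<q j. orb (x j i))" by auto
 hence "V <= span ?U" using xspan by simp
 moreover have "span ?U <= V" using orbit_span_x by (intro span_minimal gmodule_subspace[OF gV]) auto
 ultimately show "V = span ?U" by (rule equalityI)
 fix u p assume u: "(ALL p:SIGMA j:J. {..<q j}. u p:(case p of (j, i) => orb (x j i))) &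
   (SUM p:(SIGMA j:J. {..<q j}). u p) = 0" and p: "p:(SIGMA j:J. {..<q j})"
 have "u (fst p, snd p) = 0" using u p by (intro orbit_spans_direct[of "%j. {..<q j}" x "%j i. u (j, i)"])
   (auto simp: xE xind sum.Sigma)
 thus "u p = 0" by simp
qed simp

lemma symmetry_adapted: "symmetry_adapted_basis GG V J q x" unfolding symmetry_adapted_basis_def
proof (intro conjI ballI allI impI)
 show "gmodule GG V" by (rule gV)
 show "direct_sum V (SIGMA j:J. {..<q j}) (%(j, i). orb (x j i))" by (rule direct_sum_Sigma)
next
 fix j i assume "j:J" "i < q j"
 thus "irreducible_gmodule GG (orb (x j i))" using irreducible[OF _ xE x_nonzero] by blast
next
 fix j i assume ji: "j:J" "i < q j"
 hence 0: "0 < q j" by simp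
 obtain f where "gmodule_iso GG (orb (x j 0)) (orb (x j i)) f" "f (x j 0) = x j i"
  by (rule orbit_span_iso[OF ji(1) xE[OF ji(1) 0] x_nonzero[OF ji(1) 0] xE[OF ji] x_nonzero[OF ji]])
 thus "EX f. gmodule_iso GG (orb (x j 0)) (orb (x j i)) f & f (x j 0) = x j i"
  by (intro exI[of _ f] conjI)
next
 fix j k i l assume "j:J" "k:J" "j ~= k" "i < q j" "l < q k"
 thus "~ isomorphic_gmodules GG (orb (x j i)) (orb (x k l))"
  by (intro not_isomorphic_orbit_spans[of j k]) (auto simp: xE x_nonzero)
qed

definition iso_sum :: "'j => rpoly set" where
 "iso_sum j = span (UN i<q j. orb (x j i))"

text \<open>Shows that the image of \<open>V\<close> under \<open>E j\<close> has dimension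
  \<open>q j\<close>, a number that does not depend on a decomposition of \<open>V\<close>.\<close>

lemma E_image: assumes j: "j:J" and v: "v:V" shows "E j v:span (x j ` {..<q j})"
proof -
 let ?B = "UN j:J. UN i<q j. orb (x j i)"
 have "E j ` ?B <= span (x j ` {..<q j})"
 proof (clarsimp elim!: orbit_spanE)
  fix k i A B assume k: "k:J" "i < q k" and A: "gop c n A B"
  show "E j (A (x k i)):span (x j ` {..<q j})" using scal[OF j A xE[OF j]] orth[OF j k(1) _ A xE[OF k]] k
   by (cases "j = k") (auto intro: span_scale span_base span_zero)
 qed
 hence "span (E j ` ?B) <= span (x j ` {..<q j})" by (rule span_minimal[OF _ subspace_span])
 thus ?thesis using xspan v by (auto simp: linear_span_image[OF gop_linear(1)[OF E_gop[OF j]]])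
qed

lemma isotypic_component_eq: assumes j: "j:J" and y: "E j y = y" "y ~= 0"
 shows "isotypic_component GG V (orb y) = iso_sum j"
proof
 have sup: "orb (x j i) <= iso_sum j" if "i < q j" for i
  using that unfolding iso_sum_def by (auto intro: span_base)
 have gm: "gmodule GG (iso_sum j)"
  unfolding iso_sum_def by (rule gmodule_span_Union) (auto intro: gmodule_orbit_span)
 show "isotypic_component GG V (orb y) <= iso_sum j" unfolding isotypic_component_def
 proof (intro span_minimal gmodule_subspace[OF gm] Union_least)
  fix U assume "U:{U. U <= V & isomorphic_gmodules GG U (orb y)}"
  hence U: "U <= V" "isomorphic_gmodules GG U (orb y)" by auto
  obtain u where u: "u:U" "E j u = u" "U = orb u" by (rule iso_generator[OF j y(1) U(2)])
  have "span (x j ` {..<q j}) <= iso_sum j"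
   using sup in_orbit_span by (intro span_minimal gmodule_subspace[OF gm]) blast
  hence "u:iso_sum j" using E_image[OF j, of u] u(1,2) U(1) by auto
  thus "U <= iso_sum j" unfolding u(3) by (rule orbit_span_subset[OF gm])
 qed
 show "iso_sum j <= isotypic_component GG V (orb y)"
  unfolding isotypic_component_def iso_sum_def
  using orbit_span_x[OF j] isomorphic_orbit_spans[OF j xE[OF j] x_nonzero[OF j] y] by (intro span_mono) auto
qed

lemma direct_sum_iso_sum: assumes "j:J" shows "direct_sum (iso_sum j) {..<q j} (%i. orb (x j i))"
 unfolding direct_sum_iff
proof (intro conjI allI impI ballI)
 fix u i assume u: "(ALL i:{..<q j}. u i:orb (x j i)) & (SUM i<q j. u i) = 0" and i: "i:{..<q j}"
 let ?u = "%k i. if k = j then u i else 0"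
 have "(SUM k:J. SUM i<q k. ?u k i) = (SUM k:J. if k = j then SUM i<q j. u i else 0)" by (intro sum.cong) auto
 hence "?u j i = 0" using assms i u subspace_0[OF gmodule_subspace[OF gmodule_orbit_span]]
  by (intro orbit_spans_direct[of "%j. {..<q j}" x ?u]) (auto simp: xE xind)
 thus "u i = 0" by simp
qed (simp_all add: iso_sum_def gmodule_subspace[OF gmodule_orbit_span])

lemma isotypic: assumes y: "!!j. j:J ==> E j (y j) = y j" "!!j. j:J ==> y j ~= 0"
 shows "isotypic_decomposition GG V J q (%j. orb (y j))" unfolding isotypic_decomposition_def
proof (intro conjI ballI impI)
 fix j assume j: "j:J"
 show "irreducible_gmodule GG (orb (y j))" by (rule irreducible[OF j y(1)[OF j] y(2)[OF j]])
 show "~ isomorphic_gmodules GG (orb (y j)) (orb (y k))" if "k:J" "j ~= k" for k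
  by (rule not_isomorphic_orbit_spans[OF j that y(1)[OF j] y(2)[OF j] y(1)[OF that(1)]])
 show "EX U. direct_sum (isotypic_component GG V (orb (y j))) {..<q j} U &
   (ALL i<q j. isomorphic_gmodules GG (U i) (orb (y j)))"
 proof (intro exI[of _ "%i. orb (x j i)"] conjI allI impI)
  show "direct_sum (isotypic_component GG V (orb (y j))) {..<q j} (%i. orb (x j i))"
   unfolding isotypic_component_eq[OF j y(1)[OF j] y(2)[OF j]] by (rule direct_sum_iso_sum[OF j])
  show "isomorphic_gmodules GG (orb (x j i)) (orb (y j))" if "i < q j" for i
   by (rule isomorphic_orbit_spans[OF j xE[OF j that] x_nonzero[OF j that] y(1)[OF j] y(2)[OF j]])
 qed
next
 have eq: "isotypic_component GG V (orb (y j)) = iso_sum j" if "j:J" for j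
  by (rule isotypic_component_eq[OF that y(1)[OF that] y(2)[OF that]])
 show "direct_sum V J (%j. isotypic_component GG V (orb (y j)))" unfolding direct_sum_iff
 proof (intro conjI allI impI)
  show "ALL j:J. subspace (isotypic_component GG V (orb (y j)))" by (simp add: eq iso_sum_def)
  have "span (UN j:J. iso_sum j) <= V"
   unfolding iso_sum_def using orbit_span_x by (intro span_minimal gmodule_subspace[OF gV] UN_least) auto
  moreover have "V <= span (UN j:J. iso_sum j)" using xspan unfolding iso_sum_def
   by (rule order.trans) (intro span_mono UN_mono order.refl span_superset)
  ultimately show "V = span (UN j:J. isotypic_component GG V (orb (y j)))" by (simp add: eq)
  fix u assume u: "(ALL j:J. u j:isotypic_component GG V (orb (y j))) & (SUM j:J. u j) = 0"
  hence "ALL j:J. EX w. u j = (SUM i<q j. w i) & (ALL i<q j. w i:orb (x j i))"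
   by (fastforce simp: eq iso_sum_def span_UN_sums[OF _ gmodule_subspace[OF gmodule_orbit_span]])
  then obtain w where w: "!!j. j:J ==> u j = (SUM i<q j. w j i)"
   "!!j i. j:J ==> i < q j ==> w j i:orb (x j i)" by (auto dest!: bchoice)
  hence "w j i = 0" if "j:J" "i < q j" for j i
   using that u by (intro orbit_spans_direct[of "%j. {..<q j}" x w]) (auto simp: xE xind)
  thus "ALL j:J. u j = 0" by (simp add: w(1))
 qed simp
qed

text \<open>Each summand of the given type contains one generator \<open>z i\<close> fixed by
  \<open>E j\<close>. The families \<open>z\<close> and \<open>x j\<close> are independent and lie
  in each other's span, so they have equally many members.\<close>

lemma card_isomorphic_summands: assumes j: "j:J" and y: "E j y = y" "y ~= 0"
  and U: "direct_sum V I U" "ALL i:I. irreducible_gmodule GG (U i)"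
 shows "card {i:I. isomorphic_gmodules GG (U i) (orb y)} = q j"
proof -
 let ?I = "{i:I. isomorphic_gmodules GG (U i) (orb y)}"
 have finI: "finite I" and VU: "V = span (UN i:I. U i)"
  and dirU: "!!u. (ALL i:I. u i:U i) & (SUM i:I. u i) = 0 --> (ALL i:I. u i = 0)"
  and subU: "!!i. i:I ==> subspace (U i)" using U(1) unfolding direct_sum_iff by blast+
 have ex: "EX z. z:U i & E j z = z & U i = orb z & z ~= 0" if "i:?I" for i
 proof -
  have Ui: "isomorphic_gmodules GG (U i) (orb y)" using that by simp
  obtain u where "u:U i" "E j u = u" "U i = orb u" "y ~= 0 --> u ~= 0"
   by (rule iso_generator[OF j y(1) Ui])
  thus ?thesis using y(2) by (intro exI[of _ u]) simp
 qed
 obtain z where z0: "ALL i:?I. z i:U i & E j (z i) = z i & U i = orb (z i) & z i ~= 0"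
  using bchoice[OF ballI[OF ex]] by (rule exE)
 have z: "z i:U i" "E j (z i) = z i" "U i = orb (z i)" "z i ~= 0" if "i:?I" for i
  by (insert bspec[OF z0 that], (elim conjE, assumption)+)
 have zind: "lin_indep_family ?I z" unfolding lin_indep_family_def
 proof (intro allI impI)
  fix a assume a: "(SUM i:?I. a i *\<^sub>R z i) = 0"
  let ?u = "%i. if i:?I then a i *\<^sub>R z i else 0"
  have "(SUM i:I. ?u i) = (SUM i:?I. a i *\<^sub>R z i)"
   using finI by (simp add: sum.inter_filter[symmetric] cong: if_cong)
  moreover have "ALL i:I. ?u i:U i" using z(1) subU by (auto intro: subspace_scale subspace_0)
  ultimately have "ALL i:I. ?u i = 0" using dirU[of ?u] a by simp
  thus "ALL i:?I. a i = 0" using z(4) by fastforce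
 qed
 have "z i:span (x j ` {..<q j})" if "i:?I" for i
  using E_image[OF j, of "z i"] z(1,2)[OF that] that unfolding VU by (auto intro: span_base)
 hence "card ?I <= card {..<q j}" using finI by (intro lin_indep_family_card_le[OF _ _ zind, of _ "x j"]) auto
 moreover have "E j ` (UN i:I. U i) <= span (z ` ?I)"
 proof clarify
  fix k v assume k: "k:I" and v: "v:U k"
  show "E j v:span (z ` ?I)"
  proof (cases "k:?I")
   case True
   then obtain A B where "gop c n A B" "v = A (z k)" using v z(3)[OF True] by (metis orbit_spanE)
   thus ?thesis using True scal[OF j _ z(2)[OF True]] by (auto intro: span_scale span_base)
  next
   case False
   thus ?thesis using E_irreducible[OF j y, of "U k" v] U(2) v k by (simp add: span_zero)
  qed
 qed
 hence "span (E j ` (UN i:I. U i)) <= span (z ` ?I)" by (rule span_minimal[OF _ subspace_span])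
 hence "x j ` {..<q j} <= span (z ` ?I)" using imageI[OF xV[OF j], of _ "E j"] xE[OF j]
  unfolding VU linear_span_image[OF gop_linear(1)[OF E_gop[OF j]]] by fastforce
 hence "card {..<q j} <= card ?I" using finI by (intro lin_indep_family_card_le[OF _ _ xind[OF j]]) auto
 ultimately show ?thesis by simp
qed

lemma multiplicity: assumes j: "j:J" and y: "E j y = y" "y ~= 0"
 shows "module_multiplicity GG V (orb y) = q j" unfolding module_multiplicity_def
proof (rule the_equality)
 let ?S = "SIGMA j:J. {..<q j}"
 \<comment> \<open>\<open>module_multiplicity\<close> speaks of index sets of natural numbers, so
   the pairs (j, i) have to be enumerated.\<close>
 obtain h where h: "bij_betw h {0..<card ?S} ?S" using ex_bij_betw_nat_finite[of ?S] by auto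
 let ?U = "%i. case h i of (j, i) => orb (x j i)"
 have A: "direct_sum V {0..<card ?S} ?U" by (rule direct_sum_reindex[OF h direct_sum_Sigma])
 have B: "ALL i:{0..<card ?S}. irreducible_gmodule GG (?U i)"
  using bij_betw_apply[OF h] irreducible[OF _ xE x_nonzero] by (fastforce split: prod.split)
 show "EX (I :: nat set) U. direct_sum V I U & (ALL i:I. irreducible_gmodule GG (U i)) &
   q j = card {i:I. isomorphic_gmodules GG (U i) (orb y)}"
  by (intro exI[of _ "{0..<card ?S}"] exI[of _ ?U] conjI A B card_isomorphic_summands[OF j y A B, symmetric])
qed (auto simp: card_isomorphic_summands[OF j y])

end

end

section \<open>Gram matrices and averages of squares\<close>

section \<open>Sums of squares and Gram matrices\<close>

lemma sums_of_squares_0: "0:sums_of_squares n"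
 unfolding sums_of_squares_def by (intro CollectI exI[of _ "[]"]) simp

lemma sums_of_squares_square: "h:poly_ring n ==> h ^ 2:sums_of_squares n"
 unfolding sums_of_squares_def by (intro CollectI exI[of _ "[h]"]) simp

lemma sums_of_squares_add: assumes "p:sums_of_squares n" "q:sums_of_squares n" shows "p + q:sums_of_squares n"
proof -
 obtain hs hs' where "p = sum_list (map (%h. h ^ 2) hs)" "q = sum_list (map (%h. h ^ 2) hs')"
  "set hs <= poly_ring n" "set hs' <= poly_ring n"
  using assms unfolding sums_of_squares_def by blast
 thus ?thesis unfolding sums_of_squares_def by (intro CollectI exI[of _ "hs @ hs'"]) simp
qed

lemma sums_of_squares_sum:
 "(!!i. i:I ==> f i:sums_of_squares n) ==> sum f I:sums_of_squares n"
 by (induction I rule: infinite_finite_induct) (auto intro: sums_of_squares_0 sums_of_squares_add)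

lemma reynolds_square_sos: assumes "p:poly_ring n" shows "reynolds (refl_group c n) (p * p):sums_of_squares n"
proof -
 let ?a = "1 / sqrt (card (refl_group c n))"
 have "?a ^ 2 = 1 / card (refl_group c n)" by (simp add: power_divide)
 hence "reynolds (refl_group c n) (p * p) = (SUM g:refl_group c n. (?a *\<^sub>R act g p) ^ 2)"
  by (simp add: reynolds_def act_mult power2_eq_square scaleR_sum_right)
 also have "...:sums_of_squares n" using assms by (intro sums_of_squares_sum sums_of_squares_square
    subspace_scale[OF subspace_poly_ring] act_in_poly_ring[of _ c])
 finally show ?thesis .
qed

lemma sum_list_sum_nth': "sum_list (map f xs) = (SUM i<length xs. f (xs ! i))"
 by (simp add: sum_list_sum_nth atLeast0LessThan)

lemma mat_trace_eq: "A:carrier_mat q q ==> mat_trace A = (SUM i<q. A $$ (i, i))"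
 unfolding mat_trace_def diag_mat_def by (auto simp: sum_list_sum_nth' intro!: sum.cong)

lemma mat_trace_reynolds: assumes "A:carrier_mat q q" shows "mat_trace (reynolds_matrix G q s * A) =
  (SUM v<q. SUM u<q. A $$ (u, v) * reynolds G (s v * s u))"
proof -
 have "mat_trace (reynolds_matrix G q s * A) = (SUM v<q. (reynolds_matrix G q s * A) $$ (v, v))"
  using assms by (intro mat_trace_eq) (auto simp: reynolds_matrix_def)
 also have "... = (SUM v<q. SUM u<q. reynolds G (s v * s u) * A $$ (u, v))"
  using assms by (intro sum.cong refl)
   (auto simp: reynolds_matrix_def scalar_prod_def atLeast0LessThan intro!: sum.cong)
 finally show ?thesis by (simp add: mult.commute)
qed

lemma gram_entry: assumes "L:carrier_mat k q" "u < q" "v < q"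
 shows "(transpose_mat L * L) $$ (u, v) = (SUM r<k. L $$ (r, u) * L $$ (r, v))"
 using assms by (auto simp: scalar_prod_def atLeast0LessThan intro!: sum.cong)

text \<open>The product of a matrix and its transpose, with rows indexed by an arbitrary set; this
  spares an enumeration of squares and monomials.\<close>

definition gram :: "nat => 'r set => ('r => nat => 'a::comm_semiring_0) => 'a mat" where
 "gram q R l = mat q q (%(u, v). SUM r:R. l r u * l r v)"

lemma mat_trace_gram:
 "mat_trace (reynolds_matrix G q s * gram q R l) =
  (SUM v<q. SUM u<q. (SUM r:R. l r v * l r u) * reynolds G (s v * s u))"
 by (simp add: mat_trace_reynolds gram_def mult.commute)

lemma gram_transpose_mult: assumes "finite R"
 obtains k L where "L:carrier_mat k q" "elements_mat L <= {l r u | r u. r:R & u < q}"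
  "gram q R l = transpose_mat L * L"
proof -
 obtain h where h: "bij_betw h {0..<card R} R" using ex_bij_betw_nat_finite[OF assms] by blast
 define L where "L = mat (card R) q (%(i, u). l (h i) u)"
 have L: "L:carrier_mat (card R) q" by (simp add: L_def)
 moreover have "elements_mat L <= {l r u | r u. r:R & u < q}"
  using bij_betw_apply[OF h] by (fastforce simp: L_def elements_mat_def)
 moreover have "gram q R l = transpose_mat L * L"
 proof (rule eq_matI)
  fix u v assume "u < dim_row (transpose_mat L * L)" "v < dim_col (transpose_mat L * L)"
  hence uv: "u < q" "v < q" using L by simp_all
  have "(SUM i<card R. L $$ (i, u) * L $$ (i, v)) = (SUM i:{0..<card R}. l (h i) u * l (h i) v)"
   unfolding atLeast0LessThan using uv by (intro sum.cong) (auto simp: L_def)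
  thus "gram q R l $$ (u, v) = (transpose_mat L * L) $$ (u, v)"
   using uv by (simp add: gram_def gram_entry[OF L] sum.reindex_bij_betw[OF h, of "%r. l r u * l r v"])
 qed (simp_all add: gram_def L_def)
 ultimately show ?thesis by (rule that)
qed

text \<open>Completing the square in the last variable reduces the number of variables.\<close>

lemma psd_form_sum_of_squares: fixes a :: "nat => nat => real"
 assumes "!!u v. u < q ==> v < q ==> a u v = a v u" and "!!x. 0 <= (SUM u<q. SUM v<q. a u v * x u * x v)"
 shows "EX (k::nat) l. ALL u<q. ALL v<q. a u v = (SUM r<k. l r u * l r v)" using assms
proof (induction q arbitrary: a)
 case (Suc q)
 have form: "(SUM u<Suc q. SUM v<Suc q. a u v * x u * x v) = (SUM u<q. SUM v<q. a u v * x u * x v)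
   + 2 * x q * (SUM u<q. a u q * x u) + a q q * x q * x q" for x :: "nat => real"
 proof -
  have "(SUM v<q. a q v * x q * x v) = x q * (SUM u<q. a u q * x u)"
   using Suc.prems(1)[of q] by (auto simp: sum_distrib_left intro!: sum.cong)
  moreover have "(SUM u<q. a u q * x u * x q) = x q * (SUM u<q. a u q * x u)"
   by (auto simp: sum_distrib_left intro!: sum.cong)
  ultimately show ?thesis by (simp add: sum.distrib algebra_simps)
 qed
 have nonneg: "0 <= (SUM u<q. SUM v<q. a u v * x u * x v) + 2 * t * (SUM u<q. a u q * x u) + a q q * t * t"
  for x :: "nat => real" and t
 proof -
  have "(SUM u<q. SUM v<q. a u v * (x(q := t)) u * (x(q := t)) v) = (SUM u<q. SUM v<q. a u v * x u * x v)"
   "(SUM u<q. a u q * (x(q := t)) u) = (SUM u<q. a u q * x u)" by (auto intro!: sum.cong)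
  thus ?thesis using Suc.prems(2)[of "x(q := t)"] unfolding form by simp
 qed
 have aqq: "0 <= a q q" using nonneg[of "%_. 0" 1] by simp
 \<comment> \<open>The row of the factor that splits off the last variable. If the last diagonal
   entry is 0, positivity makes the whole last column vanish, and \<open>m\<close> is 0.\<close>
 define m where "m u = (if a q q = 0 then 0 else a u q / sqrt (a q q))" for u
 define a' where "a' u v = a u v - m u * m v" for u v
 have m: "a u q = m u * m q" if "u < Suc q" for u
 proof (cases "a q q = 0")
  case True
  have "a u q = 0"
  proof (cases "u = q")
   case False
   hence u: "u < q" using that by simp
   have "(SUM v<q. SUM w<q. a v w * (if v = u then 1 else 0) * (if w = u then 1 else 0)) = a u u"
    using u by (simp add: if_distrib[of "%x. _ * x"] cong: if_cong)
   moreover have "(SUM v<q. a v q * (if v = u then 1 else 0)) = a u q"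
    using u by (simp add: if_distrib[of "%x. _ * x"] cong: if_cong)
   ultimately have *: "0 <= a u u + 2 * t * a u q" for t
    using nonneg[of "%v. if v = u then 1 else 0" t] True by simp
   show ?thesis
   proof (rule ccontr)
    assume "a u q ~= 0"
    \<comment> \<open>With this value of t the form takes the value -1.\<close>
    thus False using *[of "- (a u u + 1) / (2 * a u q)"] by (simp add: field_simps)
   qed
  qed (use True in simp)
  thus ?thesis by (simp add: m_def True)
 next
  case False
  thus ?thesis using aqq by (simp add: m_def field_simps)
 qed
 have "EX (k::nat) l. ALL u<q. ALL v<q. a' u v = (SUM r<k. l r u * l r v)"
 proof (rule Suc.IH)
  show "a' u v = a' v u" if "u < q" "v < q" for u v using Suc.prems(1)[of u v] that by (simp add: a'_def)
  fix x
  let ?b = "SUM u<q. m u * x u"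
  have 1: "(SUM u<q. a u q * x u) = m q * ?b"
   unfolding sum_distrib_left by (intro sum.cong refl) (use m in auto)
  have 2: "a q q = m q * m q" using m[of q] by simp
  have 3: "(SUM u<q. SUM v<q. a' u v * x u * x v) = (SUM u<q. SUM v<q. a u v * x u * x v) - ?b * ?b"
   by (simp add: a'_def left_diff_distrib right_diff_distrib sum_subtractf sum_product mult_ac)
  show "0 <= (SUM u<q. SUM v<q. a' u v * x u * x v)"
  proof (cases "a q q = 0")
   case True
   hence "?b = 0" by (simp add: m_def)
   thus ?thesis using nonneg[of x 0] 3 by simp
  next
   case False
   hence "m q ~= 0" using 2 by auto
   \<comment> \<open>This value of the last variable minimizes the form, and the minimum is the form
     with matrix \<open>a'\<close>.\<close>
   thus ?thesis using nonneg[of x "- ?b / m q"] unfolding 1 2 3 by (simp add: field_simps)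
  qed
 qed
 then obtain k :: nat and l where l: "!!u v. u < q ==> v < q ==> a' u v = (SUM r<k. l r u * l r v)" by blast
 let ?l = "%r u. if r = k then m u else if u = q then 0 else l r u"
 have "a u v = (SUM r<Suc k. ?l r u * ?l r v)" if "u < Suc q" "v < Suc q" for u v
 proof (cases "u = q | v = q")
  case True
  hence "(SUM r<k. ?l r u * ?l r v) = 0" by (intro sum.neutral) auto
  thus ?thesis using True m that Suc.prems(1)[of u v] by (auto simp: mult.commute)
 next
  case False
  hence "(SUM r<k. ?l r u * ?l r v) = a' u v" using l that by (auto intro!: sum.cong)
  thus ?thesis by (simp add: a'_def)
 qed
 thus ?case by (intro exI[of _ "Suc k"] exI[of _ ?l] allI impI)
qed auto

lemma psd_matrix_gram: assumes "psd_matrix q A"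
 obtains k :: nat and l where "!!u v. u < q ==> v < q ==> A $$ (u, v) = (SUM r<k. l r u * l r v)"
proof -
 have A: "A:carrier_mat q q" and sym: "transpose_mat A = A"
  and psd: "!!x. x:carrier_vec q ==> 0 <= x \<bullet> (A *\<^sub>v x)"
  using assms by (auto simp: psd_matrix_def)
 have "A $$ (u, v) = A $$ (v, u)" if "u < q" "v < q" for u v using A that by (subst sym[symmetric]) auto
 moreover have "0 <= (SUM u<q. SUM v<q. A $$ (u, v) * x u * x v)" for x
 proof -
  have "vec q x \<bullet> (A *\<^sub>v vec q x) = (SUM u<q. SUM v<q. A $$ (u, v) * x u * x v)"
   using A by (auto simp: scalar_prod_def atLeast0LessThan sum_distrib_left intro!: sum.cong)
  thus ?thesis using psd[of "vec q x"] by simp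
 qed
 ultimately obtain k :: nat and l where "ALL u<q. ALL v<q. A $$ (u, v) = (SUM r<k. l r u * l r v)"
  using psd_form_sum_of_squares[of q "%u v. A $$ (u, v)"] by blast
 thus ?thesis using that by blast
qed

lemma gram_psd: fixes L :: "real mat" assumes "L:carrier_mat k q" shows "psd_matrix q (transpose_mat L * L)"
proof -
 have "x \<bullet> (transpose_mat L * L *\<^sub>v x) = (L *\<^sub>v x) \<bullet> (L *\<^sub>v x)" if x: "x:carrier_vec q" for x
 proof -
  have Lx: "L *\<^sub>v x:carrier_vec k" and Lt: "transpose_mat L:carrier_mat q k" using assms x by auto
  have "x \<bullet> (transpose_mat L * L *\<^sub>v x) = x \<bullet> (transpose_mat L *\<^sub>v (L *\<^sub>v x))"
   by (simp only: assoc_mult_mat_vec[OF Lt assms x])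
  also have "... = (transpose_mat L *\<^sub>v (L *\<^sub>v x)) \<bullet> x"
   by (rule comm_scalar_prod[OF x mult_mat_vec_carrier[OF Lt Lx]])
  also have "... = (L *\<^sub>v x) \<bullet> (L *\<^sub>v x)"
   by (rule transpose_vec_mult_scalar[OF assms x Lx])
  finally show ?thesis .
 qed
 moreover have "0 <= y \<bullet> (y :: real vec)" for y by (simp add: scalar_prod_def sum_nonneg)
 ultimately show ?thesis using assms by (auto simp: psd_matrix_def transpose_mult)
qed

context primitive_system
begin

text \<open>Schur's lemma for averaged products: adjoints move both operators onto g, where
  \<open>E j\<close> yields a multiple of g for equal types and 0 otherwise.\<close>

lemma reynolds_pair: assumes "j:J" "k:J" "E j f = f" "E k g = g" "gop c n A A'" "gop c n B B'"
 shows "reynolds GG (A f * B g) = (if j = k then scal j (%p. A' (B p)) *\<^sub>R reynolds GG (f * g) else 0)"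
proof -
 note A'B = gop_comp[OF gop_adjoint[OF assms(5)] assms(6)]
 have "reynolds GG (A f * B g) = reynolds GG (E j f * A' (B g))"
  by (simp add: gop_reynolds[OF assms(5)] assms(3))
 also have "... = reynolds GG (f * E j (A' (B g)))" by (rule gop_reynolds[OF E_gop[OF assms(1)]])
 also have "... = (if j = k then scal j (%p. A' (B p)) *\<^sub>R reynolds GG (f * g) else 0)"
 proof (cases "j = k")
  case True
  hence "E j (A' (B g)) = scal j (%p. A' (B p)) *\<^sub>R g" using scal[OF assms(1) A'B] assms(4) by simp
  thus ?thesis using True by (simp add: linear_scale[OF linear_reynolds])
 next
  case False
  hence "E j (A' (B g)) = 0" using orth[OF assms(1,2) _ A'B assms(4)] by simp
  thus ?thesis using False by (simp add: linear_0[OF linear_reynolds])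
 qed
 finally show ?thesis .
qed

text \<open>The scalar is evaluated on an arbitrary reference vector y. As a normalized inner
  product of A y and B y it is an entry of a positive semidefinite Gram matrix.\<close>

lemma scal_pair: assumes "j:J" "E j y = y" "y ~= 0" "gop c n A A'" "gop c n B B'"
 shows "scal j (%p. A' (B p)) = ip (A y) (B y) / ip y y"
proof -
 note A'B = gop_comp[OF gop_adjoint[OF assms(4)] assms(5)]
 have "ip (A y) (B y) = ip (E j y) (A' (B y))" by (simp add: gop_ip[OF assms(4)] assms(2))
 also have "... = ip y (E j (A' (B y)))" by (rule gop_ip[OF E_gop[OF assms(1)]])
 also have "... = scal j (%p. A' (B p)) * ip y y"
  using scal[OF assms(1) A'B assms(2)] by (simp add: linear_scale[OF linear_ip_right])
 finally show ?thesis using ip_self_pos[OF assms(3)] by simp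
qed

text \<open>
 The pairing of two translates of \<open>f\<close> and \<open>g\<close> under the Reynolds operator is
 \<open>reynolds (f * g)\<close> times a real Gram matrix entry that does not depend on \<open>f\<close> and \<open>g\<close>; the
 latter is computed on the reference vector \<open>y j\<close> in the basis of monomials.
\<close>

lemma reynolds_square: fixes g :: "'j => nat => signed_perm => rpoly"
 assumes x: "!!j i. j:J ==> i < q j ==> E j (x j i) = x j i"
  and y: "!!j. j:J ==> E j (y j) = y j" "!!j. j:J ==> y j ~= 0"
  and M: "finite M" "!!j a. j:J ==> a:GG ==> keys (act a (y j)) <= M"
  and g: "!!j i a. g j i a:invariants n GG"
 defines "h == (SUM j:J. SUM i<q j. SUM a:GG. g j i a * act a (x j i))"
  and "L == (%j m i. SUM a:GG. (coef (act a (y j)) m / sqrt (ip (y j) (y j))) *\<^sub>R g j i a)"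
 shows "reynolds GG (h * h) =
  (SUM j:J. SUM i<q j. SUM l<q j. (SUM m:M. L j m i * L j m l) * reynolds GG (x j i * x j l))"
proof -
 define z where "z j i = (SUM a:GG. g j i a * act a (x j i))" for j i
 define b where "b j a m = coef (act a (y j)) m / sqrt (ip (y j) (y j))" for j a m
 have RT: "reynolds GG ((g j i a * u) * (g k l r * v)) = g j i a * g k l r * reynolds GG (u * v)" for j i a k l r u v
  using reynolds_invariant_mult[OF g, of j i a "g k l r * (u * v)"] reynolds_invariant_mult[OF g, of k l r "u * v"]
  by (simp add: ac_simps)
 have zz: "reynolds GG (z j i * z k l) =
   (if j = k then (SUM m:M. L j m i * L j m l) * reynolds GG (x j i * x j l) else 0)"
  if jk: "j:J" "k:J" and il: "i < q j" "l < q k" for j k i l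
 proof -
  let ?w = "reynolds GG (x j i * x j l)"
  have zz: "reynolds GG (z j i * z k l)
   = (SUM a:GG. SUM r:GG. g j i a * g k l r * reynolds GG (act a (x j i) * act r (x k l)))"
   unfolding z_def sum_product linear_sum[OF linear_reynolds] RT ..
  show ?thesis
  proof (cases "j = k")
   case False
   thus ?thesis
    unfolding zz using jk il by (auto intro!: sum.neutral simp: reynolds_pair[OF jk x x gop_act gop_act])
  next
   case True
   have "reynolds GG (act a (x j i) * act r (x j l)) = (SUM m:M. b j a m * b j r m) *\<^sub>R ?w"
    if a: "a:GG" "r:GG" for a r
   proof -
    have l: "l < q j" using il True by simp
    note gop = gop_act[OF a(1)] gop_act[OF a(2)]
    have "ip (act a (y j)) (act r (y j)) / ip (y j) (y j) = (SUM m:M. b j a m * b j r m)"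
     using ip_self_pos[OF y(2)[OF jk(1)]]
     by (simp add: ip_superset[OF M(1) M(2)[OF jk(1) a(1)]] b_def sum_divide_distrib flip: real_sqrt_mult)
    thus ?thesis using reynolds_pair[OF jk(1) jk(1) x[OF jk(1) il(1)] x[OF jk(1) l] gop]
      scal_pair[OF jk(1) y(1)[OF jk(1)] y(2)[OF jk(1)] gop] by simp
   qed
   hence "reynolds GG (z j i * z k l)
    = (SUM a:GG. SUM r:GG. SUM m:M. (b j a m *\<^sub>R g j i a) * (b j r m *\<^sub>R g j l r) * ?w)"
    unfolding zz using True by (intro sum.cong refl) (simp add: scaleR_sum_left sum_distrib_left mult.commute)
   also have "... = (SUM a:GG. SUM m:M. SUM r:GG. (b j a m *\<^sub>R g j i a) * (b j r m *\<^sub>R g j l r) * ?w)"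
    by (intro sum.cong refl sum.swap)
   also have "... = (SUM m:M. SUM a:GG. SUM r:GG. (b j a m *\<^sub>R g j i a) * (b j r m *\<^sub>R g j l r) * ?w)"
    by (rule sum.swap)
   also have "... = (SUM m:M. L j m i * L j m l) * ?w"
    unfolding L_def b_def[symmetric] sum_product by (simp only: sum_distrib_right)
   finally show ?thesis using True by simp
  qed
 qed
 have "reynolds GG (h * h) = (SUM j:J. SUM k:J. SUM i<q j. SUM l<q k. reynolds GG (z j i * z k l))"
  unfolding h_def z_def[symmetric] sum_product linear_sum[OF linear_reynolds] ..
 also have "... = (SUM j:J. SUM k:J.
   if j = k then SUM i<q j. SUM l<q j. (SUM m:M. L j m i * L j m l) * reynolds GG (x j i * x j l) else 0)"
  by (intro sum.cong refl) (auto simp: zz)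
 finally show ?thesis by simp
qed

text \<open>An invariant equals its average, so f is the sum of the averages of the squares, to each
  of which \<open>reynolds_square\<close> applies. The space \<open>K\<close> of admissible
  coefficients will be that of all invariants, or that of constants for forms.\<close>

lemma sum_of_squares_gram: assumes K: "subspace K" "K <= invariants n GG"
  and x: "!!j i. j:J ==> i < q j ==> E j (x j i) = x j i"
  and y: "!!j. j:J ==> E j (y j) = y j" "!!j. j:J ==> y j ~= 0"
  and f: "f:invariants n GG" "f = (SUM r<k. h r * h r)"
  and h: "!!r. r < (k::nat) ==> h r:span {a * act g (x j i) | a g j i. a:K & g:GG & j:J & i < q j}"
 obtains R :: "(nat \<times> (nat \<Rightarrow>\<^sub>0 nat)) set" and l where "finite R" "!!j w u. l j w u:K"
  "f = (SUM j:J. mat_trace (reynolds_matrix GG (q j) (x j) * gram (q j) R (l j)))"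
proof -
 let ?I = "SIGMA j:J. {..<q j} \<times> GG" and ?e = "%(j, i, g). act g (x j i)"
 let ?h = "%p. SUM j:J. SUM i<q j. SUM g:GG. p (j, i, g) * act g (x j i)"
 have "EX p. (ALL b. p b:K) & (r < k --> h r = ?h p)" for r
 proof (cases "r < k")
  case False
  thus ?thesis using subspace_0[OF K(1)] by (intro exI[of _ "%_. 0"]) simp
 next
  case True
  have fin: "finite ?I" by (intro finite_SigmaI finite_J finite_cartesian_product) simp_all
  have "h r:span {a * ?e b | a b. a:K & b:?I}"
   using h[OF True] by (rule rev_subsetD[OF _ span_mono]) force
  then obtain p where "!!b. p b:K" "h r = (SUM b:?I. p b * ?e b)"
   using span_mult_family[OF fin K(1)] by blast
  thus ?thesis by (intro exI[of _ p]) (simp add: sum_Sigma_times)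
 qed
 from choice[OF allI[OF this]]
 obtain P where P': "ALL r. (ALL b. P r b:K) & (r < k --> h r = ?h (P r))" by (rule exE)
 hence P: "P r b:K" "r < k ==> h r = ?h (P r)" for r b by blast+
 define M where "M = (UN j:J. UN g:GG. keys (act g (y j)))"
 define L where "L r j m i = (SUM g:GG. (coef (act g (y j)) m / sqrt (ip (y j) (y j))) *\<^sub>R P r (j, i, g))" for r j m i
 let ?L = "%r j v u. (SUM m:M. L r j m v * L r j m u) * reynolds GG (x j v * x j u)"
 have fin: "finite M" by (simp add: M_def)
 have sq: "reynolds GG (h r * h r) = (SUM j:J. SUM v<q j. SUM u<q j. ?L r j v u)"
  if "r < k" for r unfolding P(2)[OF that] L_def using K(2) P(1)
  by (intro reynolds_square[of q x y M "%j i g. P r (j, i, g)"] x y fin) (auto simp: M_def)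
 have "f = (SUM r<k. reynolds GG (h r * h r))"
  using reynolds_invariant[OF f(1)] unfolding f(2) linear_sum[OF linear_reynolds] ..
 also have "... = (SUM r<k. SUM j:J. SUM v<q j. SUM u<q j. ?L r j v u)" by (simp add: sq)
 also have "... = (SUM j:J. SUM r<k. SUM v<q j. SUM u<q j. ?L r j v u)" by (rule sum.swap)
 also have "... = (SUM j:J. SUM v<q j. SUM r<k. SUM u<q j. ?L r j v u)" by (intro sum.cong refl sum.swap)
 also have "... = (SUM j:J. SUM v<q j. SUM u<q j. SUM r<k. ?L r j v u)" by (intro sum.cong refl sum.swap)
 \<comment> \<open>A row of the Gram factor is indexed by a square together with a monomial
   occurring in translates of the reference vectors.\<close>
 also have "... = (SUM j:J. mat_trace (reynolds_matrix GG (q j) (x j) * gram (q j) ({..<k} \<times> M) (%w u. L (fst w) j (snd w) u)))"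
  unfolding mat_trace_gram by (simp only: sum_distrib_right[symmetric] sum.cartesian_product split_def)
 finally show ?thesis using fin P(1) K(1)
  by (intro that[of "{..<k} \<times> M" "%j w u. L (fst w) j (snd w) u"])
   (auto simp: L_def intro!: subspace_sum subspace_scale)
qed

end

section \<open>Combinatorics of row and column groups\<close>

section \<open>Row and column groups\<close>

text \<open>A labelled diagram assigns to each \<open>x:X\<close> its position (component, row, column).\<close>

type_synonym position = "nat \<times> nat \<times> nat"

abbreviation (input) "kk p x == fst (p x)"
abbreviation (input) "rr p x == fst (snd (p x))"
abbreviation (input) "cc p x == snd (snd (p x))"

text \<open>The closure condition makes the occupied cells of each component a Young
  diagram.\<close>

definition diagram :: "nat set => (nat => position) => bool" where
 "diagram X p \<longleftrightarrow> finite X & inj_on p X &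
   (ALL x:X. ALL r <= rr p x. ALL c <= cc p x. (kk p x, r, c):p ` X)"

definition colset :: "nat set => (nat => position) => nat => nat => nat set" where
 "colset X p k c = {x:X. kk p x = k & cc p x = c}"

text \<open>These are the partial sums of row lengths that are compared in the dominance
  order.\<close>

definition rowcount :: "nat set => (nat => position) => nat => nat => nat" where
 "rowcount X p k t = card {x:X. kk p x = k & rr p x < t}"

text \<open>A Young subgroup, given by the function whose fibres are preserved. Row groups, column
  groups and their parts in one component are instances.\<close>

definition Fgrp :: "nat set => (nat => 'b) => (nat => nat) set" where
 "Fgrp X u = {g. g permutes X & (ALL x:X. u (g x) = u x)}"

lemma Fgrp_permutes: "g:Fgrp X u ==> g permutes X" by (simp add: Fgrp_def)

lemma Fgrp_inv: assumes "g:Fgrp X u" shows "inv g:Fgrp X u"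
proof -
 have g: "g permutes X" "!!x. x:X ==> u (g x) = u x" using assms by (simp_all add: Fgrp_def)
 have "u (inv g x) = u x" if "x:X" for x
 proof -
  have "inv g x:X" using that by (simp only: permutes_in_image[OF permutes_inv[OF g(1)]])
  from g(2)[OF this] show ?thesis by (simp add: permutes_inverses[OF g(1)])
 qed
 thus ?thesis by (simp add: Fgrp_def permutes_inv[OF g(1)])
qed

lemma Fgrp_comp: "g:Fgrp X u ==> h:Fgrp X u ==> g o h:Fgrp X u"
 unfolding Fgrp_def by (auto simp: permutes_compose permutes_in_image)

lemma Fgrp_transpose: "x:X ==> y:X ==> u x = u y ==> transpose x y:Fgrp X u"
 by (auto simp: Fgrp_def permutes_swap_id transpose_def)

lemma Fgrp_id: "id:Fgrp X u" by (simp add: Fgrp_def permutes_id)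

lemma finite_Fgrp: "finite X ==> finite (Fgrp X u)"
 using finite_permutations[of X] by (auto simp: Fgrp_def intro: finite_subset[rotated])

definition Cgrp :: "nat set => (nat => position) => (nat => nat) set" where
 Cgrp_Fgrp: "Cgrp X p = Fgrp X (%x. (kk p x, cc p x))"

definition Rgrp :: "nat set => (nat => position) => (nat => nat) set" where
 Rgrp_Fgrp: "Rgrp X p = Fgrp X (%x. (kk p x, rr p x))"

lemma Cgrp_def: "Cgrp X p = {g. g permutes X & (ALL x:X. kk p (g x) = kk p x & cc p (g x) = cc p x)}"
 by (simp add: Cgrp_Fgrp Fgrp_def)

lemma Cgrp_permutes: "g:Cgrp X p ==> g permutes X"
 and Cgrp_inv: "g:Cgrp X p ==> inv g:Cgrp X p"
 and Cgrp_comp: "g:Cgrp X p ==> h:Cgrp X p ==> g o h:Cgrp X p"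
 and Cgrp_id: "id:Cgrp X p"
 and Cgrp_transpose: "x:X ==> y:X ==> kk p x = kk p y ==> cc p x = cc p y ==> transpose x y:Cgrp X p"
 and finite_Cgrp: "diagram X p ==> finite (Cgrp X p)"
 unfolding Cgrp_Fgrp
 by (simp_all add: Fgrp_permutes Fgrp_inv Fgrp_comp Fgrp_id Fgrp_transpose finite_Fgrp diagram_def)

lemma Rgrp_def: "Rgrp X p = {g. g permutes X & (ALL x:X. kk p (g x) = kk p x & rr p (g x) = rr p x)}"
 by (simp add: Rgrp_Fgrp Fgrp_def)

lemma Rgrp_permutes: "g:Rgrp X p ==> g permutes X"
 and Rgrp_inv: "g:Rgrp X p ==> inv g:Rgrp X p"
 and Rgrp_comp: "g:Rgrp X p ==> h:Rgrp X p ==> g o h:Rgrp X p"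
 and Rgrp_id: "id:Rgrp X p"
 and Rgrp_transpose: "x:X ==> y:X ==> kk p x = kk p y ==> rr p x = rr p y ==> transpose x y:Rgrp X p"
 and finite_Rgrp: "diagram X p ==> finite (Rgrp X p)"
 unfolding Rgrp_Fgrp
 by (simp_all add: Fgrp_permutes Fgrp_inv Fgrp_comp Fgrp_id Fgrp_transpose finite_Fgrp diagram_def)

lemma inj_on_lessThan_image: assumes "finite A" "inj_on f A" "!!x m. x:A ==> m <= f x ==> m:f ` A"
 shows "f ` A = {..<card A}"
proof -
 have "EX t. f ` A = {..<t}"
 proof (cases "A = {}")
  case False
  have "f ` A = {..<Suc (Max (f ` A))}"
  proof (intro equalityI subsetI)
   fix y assume "y:{..<Suc (Max (f ` A))}"
   moreover have "Max (f ` A):f ` A" using assms(1) False by (intro Max_in) auto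
   then obtain x where "Max (f ` A) = f x" "x:A" by (rule imageE)
   ultimately show "y:f ` A" using assms(3)[of x y] by simp
  qed (use assms(1) in \<open>auto simp: less_Suc_eq_le\<close>)
  thus ?thesis ..
 qed auto
 then obtain t where "f ` A = {..<t}" ..
 thus ?thesis using card_image[OF assms(2)] by simp
qed

context fixes X :: "nat set" and p :: "nat => position" assumes dia: "diagram X p"
begin

lemma finite_X: "finite X" using dia by (simp add: diagram_def)

lemma position_inj: "x:X ==> y:X ==> kk p x = kk p y ==> rr p x = rr p y ==> cc p x = cc p y ==> x = y"
 using dia unfolding diagram_def by (metis inj_onD prod_eqI)

lemma finite_colset: "finite (colset X p k g)" using finite_X by (simp add: colset_def)

lemma inj_on_row_colset: "inj_on (%x. rr p x) (colset X p k g)"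
 by (rule inj_onI) (auto simp: colset_def intro: position_inj)

lemma row_image_colset: "(%x. rr p x) ` colset X p k g = {..<card (colset X p k g)}"
proof (rule inj_on_lessThan_image[OF finite_colset inj_on_row_colset])
 fix x m assume x: "x:colset X p k g" "m <= rr p x"
 hence "(kk p x, m, cc p x):p ` X" using dia by (auto simp: diagram_def colset_def)
 then obtain y where "y:X" "p y = (kk p x, m, cc p x)" by auto
 thus "m:(%x. rr p x) ` colset X p k g"
  using x by (auto simp: colset_def intro!: image_eqI[of _ _ y])
qed

lemma card_by_columns:
 "card {x:X. kk p x = k & P x} = (SUM g:(%x. cc p x) ` X. card {x:colset X p k g. P x})"
proof -
 have "card {x:X. kk p x = k & P x} = (SUM x:{x:X. kk p x = k & P x}. 1)" by simp
 also have "... = (SUM g:(%x. cc p x) ` X. SUM x:{x:{x:X. kk p x = k & P x}. cc p x = g}. 1)"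
  using finite_X by (intro sum.group[symmetric]) auto
 also have "... = (SUM g:(%x. cc p x) ` X. card {x:colset X p k g. P x})"
  by (intro sum.cong refl) (simp add: colset_def, meson)
 finally show ?thesis .
qed

lemma card_colset_less: "card {x:colset X p k g. rr p x < t} = min t (card (colset X p k g))"
proof -
 have "card {x:colset X p k g. rr p x < t} = card ((%x. rr p x) ` {x:colset X p k g. rr p x < t})"
  by (intro card_image[symmetric] inj_on_subset[OF inj_on_row_colset]) auto
 also have "(%x. rr p x) ` {x:colset X p k g. rr p x < t} = {..<min t (card (colset X p k g))}"
 proof -
  have "(%x. rr p x) ` {x:colset X p k g. rr p x < t} = (%x. rr p x) ` colset X p k g Int {..<t}"
   by blast
  thus ?thesis unfolding row_image_colset by auto
 qed
 finally show ?thesis by simp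
qed

text \<open>Here \<open>h\<close> stands for the rows of the entries in another arrangement, with no
  two entries of one column of \<open>p\<close> in the same row.\<close>

context fixes h :: "nat => nat"
 assumes h: "!!x y. x:X ==> y:X ==> kk p x = kk p y ==> cc p x = cc p y ==> h x = h y ==> x = y"
begin

lemma inj_on_h: "inj_on h (colset X p k g)" by (rule inj_onI) (auto simp: colset_def intro: h)

lemma card_colset_h_less: "card {x:colset X p k g. h x < t} <= min t (card (colset X p k g))"
proof -
 have "card {x:colset X p k g. h x < t} = card (h ` {x:colset X p k g. h x < t})"
  by (intro card_image[symmetric] inj_on_subset[OF inj_on_h]) auto
 also have "... <= card {..<t}" by (intro card_mono) auto
 finally show ?thesis using finite_colset by (auto intro: card_mono)
qed

text \<open>A column of length l contains at most min(t, l) entries with value below t, and the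
  actual rows attain this bound in every column.\<close>

lemma rowcount_dominance: "card {x:X. kk p x = k & h x < t} <= rowcount X p k t"
 unfolding rowcount_def card_by_columns card_colset_less by (intro sum_mono card_colset_h_less)

text \<open>The vectors \<open>h\<close> with the row counts of \<open>p\<close> arise by permuting the columns of \<open>p\<close>.\<close>

lemma rowcount_eq_imp_column_perm:
 assumes eq: "!!k t. card {x:X. kk p x = k & h x < t} = rowcount X p k t"
 shows "EX g:Cgrp X p. ALL x:X. rr p (g x) = h x"
proof -
 have h_image: "h x < card (colset X p k b)" if x: "x:colset X p k b" for x k b
 proof -
  \<comment> \<open>For t equal to the column length, equality of the total counts forces equality
    in this column, so all its values lie below its length.\<close>
  let ?t = "card (colset X p k b)"
  have "card {x:colset X p k b. h x < ?t} = min ?t (card (colset X p k b))"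
  proof (rule antisym[OF card_colset_h_less], rule ccontr)
   assume "~ min ?t (card (colset X p k b)) <= card {x:colset X p k b. h x < ?t}"
   moreover have "b:(%x. cc p x) ` X"
   proof (rule image_eqI)
    show "x:X" "b = cc p x" using x by (simp_all add: colset_def)
   qed
   ultimately have "card {x:X. kk p x = k & h x < ?t} < rowcount X p k ?t"
    unfolding rowcount_def card_by_columns card_colset_less
    using finite_X by (intro sum_strict_mono_ex1 ballI card_colset_h_less bexI[of _ b])
     (simp_all only: finite_imageI not_le)
   thus False by (simp add: eq)
  qed
  hence "{x:colset X p k b. h x < ?t} = colset X p k b"
   using finite_colset by (intro card_subset_eq) auto
  thus ?thesis using x by blast
 qed
 define g where "g x = (if x:X then SOME y. y:colset X p (kk p x) (cc p x) & rr p y = h x else x)" for x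
 have g: "g x:colset X p (kk p x) (cc p x) & rr p (g x) = h x" if "x:X" for x
 proof -
  have "h x:(%x. rr p x) ` colset X p (kk p x) (cc p x)"
   unfolding row_image_colset using h_image[of x "kk p x" "cc p x"] that by (simp add: colset_def)
  hence "EX y. y:colset X p (kk p x) (cc p x) & rr p y = h x" by auto
  from someI_ex[OF this] show ?thesis by (simp only: g_def if_P[OF that])
 qed
 have inj: "inj_on g X"
 proof (rule inj_onI)
  fix x y assume xy: "x:X" "y:X" "g x = g y"
  have 1: "kk p (g z) = kk p z" "cc p (g z) = cc p z" "rr p (g z) = h z" if "z:X" for z
   using g[OF that] by (simp_all add: colset_def)
  show "x = y" by (rule h[OF xy(1,2)]) (simp_all only: 1[OF xy(1), symmetric] 1[OF xy(2), symmetric] xy(3))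
 qed
 have "g ` X <= X" using g by (auto simp: colset_def)
 hence "bij_betw g X X" using inj finite_X by (simp add: bij_betw_def endo_inj_surj)
 hence "g permutes X" by (rule bij_imp_permutes) (simp add: g_def)
 hence "g:Cgrp X p" using g by (simp add: Cgrp_def colset_def)
 thus ?thesis using g by blast
qed

end

end

declare One_nat_def [simp del]

section \<open>Column antisymmetrizers, row symmetrizers and the von Neumann lemma\<close>

section \<open>Young symmetrizers as operators\<close>

definition gsum :: "((nat => nat) => int) => (nat => nat) set => rpoly => rpoly" where
 "gsum e A f = (SUM g:A. real_of_int (e g) *\<^sub>R act (g, {}) f)"

lemma linear_gsum: "linear (gsum e A)"
 by (rule linearI) (simp_all add: gsum_def act_add act_scaleR scaleR_add_right sum.distrib scaleR_sum_right mult.commute)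

lemma gsum_linear_commute: assumes "linear w" "!!g. g:A ==> w (act (g, {}) f) = act (g, {}) (w f)"
 shows "w (gsum e A f) = gsum e A (w f)"
 by (simp add: gsum_def linear_sum[OF assms(1)] linear_scale[OF assms(1)] assms(2))

lemma permutes_permutation: "g permutes {1..n::nat} ==> permutation g"
 by (meson finite_atLeastAtMost permutation_permutes)

lemma real_sign_mult_self [simp]: "real_of_int (sign g) * real_of_int (sign g) = 1"
 by (simp add: sign_def)

context fixes e :: "(nat => nat) => int" and n :: nat assumes e: "e = sign | e = (%_. 1)"
begin

lemma character_comp: "g permutes {1..n} ==> h permutes {1..n} ==> e (g o h) = e g * e h"
 using e by (auto simp: sign_compose permutes_permutation[of _ n])

lemma character_inv: "g permutes {1..n} ==> e (inv g) = e g"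
 using e by (auto simp: sign_inverse permutes_permutation[of _ n])

lemma character_square: "e g * e g = 1" using e by (auto simp: sign_def)

lemma character_cancel: "real_of_int (e g) * real_of_int (e g) = 1" using e by auto

lemma gsum_product: assumes bij: "bij_betw (%(g, h). g o h) (A \<times> B) U"
  and A: "!!g. g:A ==> g permutes {1..n}" and B: "!!h. h:B ==> h permutes {1..n}"
 shows "gsum e U f = gsum e A (gsum e B f)"
proof -
 have "gsum e U f = (SUM (g, h):A \<times> B. real_of_int (e (g o h)) *\<^sub>R act (g o h, {}) f)"
  unfolding gsum_def by (subst sum.reindex_bij_betw[OF bij, symmetric]) (simp add: split_def)
 also have "... = (SUM (g, h):A \<times> B. (real_of_int (e g) * real_of_int (e h)) *\<^sub>R act (g, {}) (act (h, {}) f))"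
  using A B by (intro sum.cong refl) (auto simp: character_comp act_permutes_compose[of _ n])
 also have "... = gsum e A (gsum e B f)"
  unfolding gsum_def by (simp add: sum.cartesian_product[symmetric] act_sum act_scaleR scaleR_sum_right)
 finally show ?thesis .
qed

text \<open>Conjugation by \<open>u\<close> carries one Young subgroup onto the other and preserves
  the character.\<close>

lemma gsum_transport: assumes u: "u permutes {1..n}" and p: "!!x. x:{1..n} ==> p (u x) = p0 x"
 shows "gsum e (Fgrp {1..n} p) (act (u, {}) f) = act (u, {}) (gsum e (Fgrp {1..n} p0) f)"
proof -
 have conj: "u o g o inv u:Fgrp {1..n} p"
  if u: "u permutes {1..n}" and p: "!!x. x:{1..n} ==> p (u x) = p0 x" and g: "g:Fgrp {1..n} p0"
  for g u and p p0 :: "nat => 'b"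
 proof -
  note perm = permutes_inv[OF u] Fgrp_permutes[OF g]
  have "p ((u o g o inv u) x) = p x" if x: "x:{1..n}" for x
  proof -
   have 1: "inv u x:{1..n}" using x by (simp only: permutes_in_image[OF perm(1)])
   hence "g (inv u x):{1..n}" by (simp only: permutes_in_image[OF perm(2)])
   thus ?thesis using g 1 p[OF 1] by (simp add: p Fgrp_def permutes_inverses[OF u])
  qed
  thus ?thesis using permutes_compose[OF perm(1) permutes_compose[OF perm(2) u]] by (simp add: Fgrp_def)
 qed
 have p': "p0 (inv u x) = p x" if "x:{1..n}" for x
  using p[of "inv u x"] that permutes_in_image[OF permutes_inv[OF u], of x] by (simp add: permutes_inverses[OF u])
 have bij: "bij_betw (%g. u o g o inv u) (Fgrp {1..n} p0) (Fgrp {1..n} p)"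
  by (rule bij_betw_byWitness[of _ "%g. inv u o g o u"])
   (use conj[of u p p0, OF u p] conj[of "inv u" p0 p, OF permutes_inv[OF u] p'] permutes_inv_inv[OF u] in \<open>auto simp: fun_eq_iff permutes_inverses[OF u]\<close>)
 have "gsum e (Fgrp {1..n} p) (act (u, {}) f)
   = (SUM g:Fgrp {1..n} p0. real_of_int (e (u o g o inv u)) *\<^sub>R act (u o g o inv u, {}) (act (u, {}) f))"
  unfolding gsum_def by (rule sum.reindex_bij_betw[OF bij, symmetric])
 also have "... = act (u, {}) (gsum e (Fgrp {1..n} p0) f)" unfolding gsum_def act_sum act_scaleR
 proof (intro sum.cong refl)
  fix g assume "g:Fgrp {1..n} p0"
  note perm = u Fgrp_permutes[OF this] permutes_inv[OF u] and comp = permutes_compose[OF perm(2,1)]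
  have "u o g o inv u o u = u o g" by (simp add: fun_eq_iff permutes_inverses[OF u])
  hence "act (u o g o inv u, {}) (act (u, {}) f) = act (u, {}) (act (g, {}) f)"
   using act_permutes_compose[OF permutes_compose[OF perm(3) comp] u] act_permutes_compose[OF perm(1,2)] by simp
  moreover have "e (u o g o inv u) = e g * (e u * e u)"
   by (simp add: character_comp[OF comp perm(3)] character_comp[OF perm(1,2)] character_inv[OF u])
  ultimately show "real_of_int (e (u o g o inv u)) *\<^sub>R act (u o g o inv u, {}) (act (u, {}) f)
    = real_of_int (e g) *\<^sub>R act (u, {}) (act (g, {}) f)" by (simp only: character_square mult_1_right)
 qed
 finally show ?thesis .
qed

context fixes u :: "nat => 'b"
begin

lemma act_gsum: assumes g: "g:Fgrp {1..n} u"
 shows "act (g, {}) (gsum e (Fgrp {1..n} u) f) = real_of_int (e g) *\<^sub>R gsum e (Fgrp {1..n} u) f"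
  and gsum_act: "gsum e (Fgrp {1..n} u) (act (g, {}) f) = real_of_int (e g) *\<^sub>R gsum e (Fgrp {1..n} u) f"
proof -
 let ?F = "Fgrp {1..n} u"
 note perm = Fgrp_permutes[OF g]
 have bij: "bij_betw (%h. g o h) ?F ?F" "bij_betw (%h. h o g) ?F ?F"
  using Fgrp_comp[OF g] Fgrp_comp[OF _ g] Fgrp_comp[OF Fgrp_inv[OF g]] Fgrp_comp[OF _ Fgrp_inv[OF g]]
  by (intro bij_betw_byWitness[of _ "%h. inv g o h"] bij_betw_byWitness[of _ "%h. h o inv g"];
    auto simp: fun_eq_iff permutes_inverses[OF perm])+
 have "gsum e ?F f = (SUM h:?F. real_of_int (e (g o h)) *\<^sub>R act (g o h, {}) f)"
  unfolding gsum_def by (rule sum.reindex_bij_betw[OF bij(1), symmetric])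
 also have "... = real_of_int (e g) *\<^sub>R act (g, {}) (gsum e ?F f)"
  unfolding gsum_def act_sum scaleR_sum_right using Fgrp_permutes[of _ _ u] perm
  by (intro sum.cong refl) (simp add: act_scaleR act_permutes_compose[of _ n] character_comp)
 finally show "act (g, {}) (gsum e ?F f) = real_of_int (e g) *\<^sub>R gsum e ?F f"
  by (metis character_cancel scaleR_one scaleR_scaleR)
 have "gsum e ?F f = (SUM h:?F. real_of_int (e (h o g)) *\<^sub>R act (h o g, {}) f)"
  unfolding gsum_def by (rule sum.reindex_bij_betw[OF bij(2), symmetric])
 also have "... = real_of_int (e g) *\<^sub>R gsum e ?F (act (g, {}) f)"
  unfolding gsum_def act_sum scaleR_sum_right using Fgrp_permutes[of _ _ u] perm
  by (intro sum.cong refl) (simp add: act_permutes_compose[of _ n] character_comp mult.commute)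
 finally show "gsum e ?F (act (g, {}) f) = real_of_int (e g) *\<^sub>R gsum e ?F f"
  by (metis character_cancel scaleR_one scaleR_scaleR)
qed

text \<open>Inversion permutes the subgroup and preserves the character, so these operators are
  self-adjoint.\<close>

lemma gop_gsum: "gop c n (gsum e (Fgrp {1..n} u)) (gsum e (Fgrp {1..n} u))"
proof -
 let ?F = "Fgrp {1..n} u"
 have "gop c n (%f. SUM g:?F. real_of_int (e g) *\<^sub>R act (g, {}) f)
   (%f. SUM g:?F. real_of_int (e g) *\<^sub>R act (ginv (g, {})) f)"
  by (intro gop_sum gop_scaleR_act finite_Fgrp finite_atLeastAtMost permutation_in_refl_group Fgrp_permutes)
 moreover have "(SUM g:?F. real_of_int (e g) *\<^sub>R act (ginv (g, {})) f) = gsum e ?F f" for f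
 proof -
  have bij: "bij_betw inv ?F ?F" using Fgrp_inv Fgrp_permutes[of _ _ u]
   by (intro bij_betw_byWitness[of _ inv]) (auto simp: permutes_inv_inv[of _ "{1..n}"])
  have "gsum e ?F f = (SUM g:?F. real_of_int (e (inv g)) *\<^sub>R act (inv g, {}) f)"
   unfolding gsum_def by (rule sum.reindex_bij_betw[OF bij, symmetric])
  also have "... = (SUM g:?F. real_of_int (e g) *\<^sub>R act (ginv (g, {})) f)"
   using Fgrp_permutes[of _ _ u] by (intro sum.cong refl) (simp add: ginv_def character_inv)
  finally show ?thesis ..
 qed
 ultimately show ?thesis by (simp add: gsum_def[abs_def])
qed

lemma gsum_gsum:
 "gsum e (Fgrp {1..n} u) (gsum e (Fgrp {1..n} u) f) = real (card (Fgrp {1..n} u)) *\<^sub>R gsum e (Fgrp {1..n} u) f"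
proof -
 have "gsum e (Fgrp {1..n} u) (gsum e (Fgrp {1..n} u) f) = (SUM g:Fgrp {1..n} u. gsum e (Fgrp {1..n} u) f)"
  unfolding gsum_def[of e _ "gsum _ _ _"] by (intro sum.cong refl) (simp add: act_gsum character_cancel)
 thus ?thesis by (simp add: sum_constant_scaleR del: sum_constant)
qed

end

end

definition Cop :: "nat => (nat => position) => rpoly => rpoly" where
 Cop_gsum: "Cop n p = gsum sign (Cgrp {1..n} p)"

definition Rop :: "nat => (nat => position) => rpoly => rpoly" where
 Rop_gsum: "Rop n p = gsum (%_. 1) (Rgrp {1..n} p)"

abbreviation (input) "CR n p f == Cop n p (Rop n p f)"

lemma Cop_def: "Cop n p f = (SUM g:Cgrp {1..n} p. real_of_int (sign g) *\<^sub>R act (g, {}) f)"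
 by (simp add: Cop_gsum gsum_def)

lemma Rop_def: "Rop n p f = (SUM h:Rgrp {1..n} p. act (h, {}) f)" by (simp add: Rop_gsum gsum_def)

lemma gop_Cop: "gop c n (Cop n p) (Cop n p)" and gop_Rop: "gop c n (Rop n p) (Rop n p)"
 by (simp_all add: Cop_gsum Rop_gsum Cgrp_Fgrp Rgrp_Fgrp gop_gsum)

lemma act_Rop: "g:Rgrp {1..n} p ==> act (g, {}) (Rop n p f) = Rop n p f"
 and Cop_act: "h:Cgrp {1..n} p ==> Cop n p (act (h, {}) f) = real_of_int (sign h) *\<^sub>R Cop n p f"
 by (simp_all add: Cop_gsum Rop_gsum Cgrp_Fgrp Rgrp_Fgrp act_gsum gsum_act)

lemma Cop_Cop: "Cop n p (Cop n p f) = real (card (Cgrp {1..n} p)) *\<^sub>R Cop n p f"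
 and Rop_Rop: "Rop n p (Rop n p f) = real (card (Rgrp {1..n} p)) *\<^sub>R Rop n p f"
 by (simp_all add: Cop_gsum Rop_gsum Cgrp_Fgrp Rgrp_Fgrp gsum_gsum)

lemma card_Cgrp_pos: "0 < card (Cgrp {1..n} p)" and card_Rgrp_pos: "0 < card (Rgrp {1..n} p)"
 unfolding card_gt_0_iff Cgrp_Fgrp Rgrp_Fgrp using finite_Fgrp[of "{1..n}"] Fgrp_id by auto

lemmas Cop_simps = gop_simps[OF gop_Cop]
lemmas Rop_simps = gop_simps[OF gop_Rop]

text \<open>
 The von Neumann argument: a pair \<open>x, y\<close> in a common row of \<open>p'\<close> whose images under \<open>h\<close>
 lie in a common column of \<open>p\<close> makes the product vanish.
\<close>

lemma Cop_act_Rop_eq_0: assumes "diagram {1..n} p" "diagram {1..n} p'" and h: "h permutes {1..n}"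
  and xy: "x:{1..n}" "y:{1..n}" "x ~= y" and row: "kk p' x = kk p' y" "rr p' x = rr p' y"
  and col: "kk p (h x) = kk p (h y)" "cc p (h x) = cc p (h y)"
 shows "Cop n p (act (h, {}) (Rop n p' f)) = 0"
proof -
 have t: "transpose x y:Rgrp {1..n} p'" by (rule Rgrp_transpose[OF xy(1,2) row])
 have t': "transpose (h x) (h y):Cgrp {1..n} p"
  using h xy by (intro Cgrp_transpose col) (simp_all only: permutes_in_image)
 have comm: "h o transpose x y = transpose (h x) (h y) o h"
  using h by (intro ext) (auto simp: transpose_def permutes_inj inj_eq)
 have "Cop n p (act (h, {}) (Rop n p' f)) = Cop n p (act (h, {}) (act (transpose x y, {}) (Rop n p' f)))"
  by (simp only: act_Rop[OF t])
 also have "... = Cop n p (act (transpose (h x) (h y), {}) (act (h, {}) (Rop n p' f)))"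
  using Rgrp_permutes[OF t] Cgrp_permutes[OF t'] h
  by (simp only: act_permutes_compose comm)
 also have "... = - Cop n p (act (h, {}) (Rop n p' f))"
 proof -
  have "h x ~= h y" using h xy(3) by (simp add: permutes_inj inj_eq)
  thus ?thesis by (simp add: Cop_act[OF t'] sign_swap_id)
 qed
 finally show ?thesis by simp
qed

lemma card_rows_transport: assumes "h permutes {1..n}" "!!x. x:{1..n} ==> kk p (h x) = kk p' x"
 shows "card {x:{1..n}. kk p x = k & rr p' (inv h x) < t} = rowcount {1..n} p' k t"
proof -
 have "{x:{1..n}. kk p x = k & rr p' (inv h x) < t} = h ` {x:{1..n}. kk p' x = k & rr p' x < t}"
 proof (intro equalityI subsetI)
  fix x assume x: "x:{x:{1..n}. kk p x = k & rr p' (inv h x) < t}"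
  have "inv h x:{1..n}" "h (inv h x) = x"
   using x assms(1) permutes_in_image[OF permutes_inv[OF assms(1)]] by (auto simp: permutes_inverses)
  thus "x:h ` {x:{1..n}. kk p' x = k & rr p' x < t}"
   using x assms(2)[of "inv h x"] by (intro image_eqI[of _ _ "inv h x"]) auto
 next
  fix x assume "x:h ` {x:{1..n}. kk p' x = k & rr p' x < t}"
  then obtain y where "y:{1..n}" "kk p' y = k" "rr p' y < t" "x = h y" by auto
  thus "x:{x:{1..n}. kk p x = k & rr p' (inv h x) < t}"
   using assms permutes_in_image[OF assms(1), of y] by (simp add: permutes_inverses)
 qed
 thus ?thesis using card_image[OF inj_on_subset[OF permutes_inj_on[OF assms(1)] subset_UNIV]]
  by (simp add: rowcount_def)
qed

lemma no_bad_pair: assumes "diagram {1..n} p" "diagram {1..n} p'" "h permutes {1..n}"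
  and k: "!!x. x:{1..n} ==> kk p (h x) = kk p' x" and nz: "Cop n p (act (h, {}) (Rop n p' f)) ~= 0"
  and xy: "x:{1..n}" "y:{1..n}" "kk p x = kk p y" "cc p x = cc p y"
   "rr p' (inv h x) = rr p' (inv h y)" shows "x = y"
proof (rule ccontr)
 assume "x ~= y"
 let ?x = "inv h x" and ?y = "inv h y"
 have x: "?x:{1..n}" "h ?x = x" and y: "?y:{1..n}" "h ?y = y"
  using xy assms(3) permutes_in_image[OF permutes_inv[OF assms(3)]] by (simp_all only: permutes_inverses)
 have "?x ~= ?y" using `x ~= y` x(2) y(2) by metis
 thus False
  using Cop_act_Rop_eq_0[OF assms(1-3) x(1) y(1), of f] nz k[OF x(1)] k[OF y(1)] x(2) y(2) xy by simp
qed

text \<open>By \<open>no_bad_pair\<close>, the rows in \<open>p'\<close> of the preimages under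
  \<open>h\<close> are distinct along each column of \<open>p\<close>, so
  \<open>rowcount_dominance\<close> applies.\<close>

lemma Cop_act_Rop_dominance: assumes "diagram {1..n} p" "diagram {1..n} p'" "h permutes {1..n}"
  and k: "!!x. x:{1..n} ==> kk p (h x) = kk p' x" and nz: "Cop n p (act (h, {}) (Rop n p' f)) ~= 0"
 shows "rowcount {1..n} p' a t <= rowcount {1..n} p a t"
proof -
 have "card {x:{1..n}. kk p x = a & rr p' (inv h x) < t} <= rowcount {1..n} p a t"
  by (rule rowcount_dominance[OF assms(1)]) (rule no_bad_pair[OF assms])
 thus ?thesis using card_rows_transport[where p = p, OF assms(3) k] by simp
qed

text \<open>If the product does not vanish, the row vector transported by \<open>h\<close> has the
  row counts of \<open>p\<close>. Then some column permutation g makes g o h a row permutation, and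
  the scalar is the sign of g.\<close>

lemma Cop_act_Rop: assumes dia: "diagram {1..n} p" and h: "h permutes {1..n}"
  and k: "!!x. x:{1..n} ==> kk p (h x) = kk p x"
 shows "EX a. ALL f. Cop n p (act (h, {}) (Rop n p f)) = a *\<^sub>R CR n p f"
proof (cases "ALL f. Cop n p (act (h, {}) (Rop n p f)) = 0")
 case True
 thus ?thesis by (intro exI[of _ 0]) simp
next
 case False
 then obtain f where nz: "Cop n p (act (h, {}) (Rop n p f)) ~= 0" by auto
 have "EX g:Cgrp {1..n} p. ALL x:{1..n}. rr p (g x) = rr p (inv h x)"
 proof (rule rowcount_eq_imp_column_perm[OF dia])
  show "x = y" if "x:{1..n}" "y:{1..n}" "kk p x = kk p y" "cc p x = cc p y"
   "rr p (inv h x) = rr p (inv h y)" for x y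
   by (rule no_bad_pair[OF dia dia h _ nz that]) (rule k)
  show "card {x:{1..n}. kk p x = l & rr p (inv h x) < t} = rowcount {1..n} p l t" for l t
   by (rule card_rows_transport[OF h]) (rule k)
 qed
 then obtain g where g: "g:Cgrp {1..n} p" "!!x. x:{1..n} ==> rr p (g x) = rr p (inv h x)"
  by blast
 have "g o h:Rgrp {1..n} p" unfolding Rgrp_def
 proof (intro CollectI conjI ballI)
  show "(g o h) permutes {1..n}"
   by (rule permutes_compose[OF h Cgrp_permutes[OF g(1)]])
  fix x assume x: "x:{1..n}"
  hence "h x:{1..n}" using permutes_in_image[OF h] by blast
  thus "kk p ((g o h) x) = kk p x" "rr p ((g o h) x) = rr p x"
   using g k[OF x] h by (auto simp: Cgrp_def permutes_inverses)
 qed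
 note r = this
 have "Cop n p (act (h, {}) (Rop n p f)) = real_of_int (sign g) *\<^sub>R CR n p f" for f
 proof -
  have "CR n p f = Cop n p (act (g o h, {}) (Rop n p f))"
   by (simp only: act_Rop[OF r])
  also have "... = Cop n p (act (g, {}) (act (h, {}) (Rop n p f)))"
   by (simp only: act_permutes_compose[OF Cgrp_permutes[OF g(1)] h])
  also have "... = real_of_int (sign g) *\<^sub>R Cop n p (act (h, {}) (Rop n p f))"
   by (rule Cop_act[OF g(1)])
  finally have "real_of_int (sign g) *\<^sub>R CR n p f
    = real_of_int (sign g) *\<^sub>R (real_of_int (sign g) *\<^sub>R Cop n p (act (h, {}) (Rop n p f)))"
   by simp
  thus ?thesis by (simp del: scaleR_cancel_left)
 qed
 thus ?thesis by blast
qed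

section \<open>From Young symmetrizers to a primitive system\<close>

section \<open>Primitive idempotents from labelled diagrams\<close>

text \<open>Odd exponents exactly on the second component: the monomials on which the sign changes
  act by the character belonging to \<open>p\<close>. In type A there is no condition.\<close>

definition qpar :: "cox_type => nat => (nat => position) => (nat \<Rightarrow>\<^sub>0 nat) => bool" where
 "qpar c n p m \<longleftrightarrow> (c = TypeB --> (ALL x:{1..n}. odd (coef m x) \<longleftrightarrow> kk p x = 1))"

text \<open>In type \<open>B\<close>, the isotypic projection for the sign character of the second component.\<close>

definition Qop :: "cox_type => nat => (nat => position) => rpoly => rpoly" where
 "Qop c n p f = (SUM m:{m:keys f. qpar c n p m}. coef f m *\<^sub>R mon m)"

definition kvalid :: "cox_type => nat => (nat => position) => bool" where
 "kvalid c n p \<longleftrightarrow> (ALL x:{1..n}. kk p x <= (if c = TypeB then 1 else 0))"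

lemma coef_Qop: "coef (Qop c n p f) m = (if qpar c n p m then coef f m else 0)"
proof -
 have "coef (Qop c n p f) m
  = (SUM k:{m:keys f. qpar c n p m}. if k = m then coef f m else 0)"
  unfolding Qop_def lookup_sum by (intro sum.cong refl) (simp add: lookup_single when_def)
 thus ?thesis by (auto simp: sum.delta in_keys_iff)
qed

lemma Qop_idem [simp]: "Qop c n p (Qop c n p f) = Qop c n p f" by (rule poly_mapping_eqI) (simp add: coef_Qop)

text \<open>Orthogonality of characters of the group of sign changes: the sum over subsets is the
  expansion of a product of factors equal to 2 or 0.\<close>

lemma sum_sign_characters: fixes e :: "nat => nat"
 shows "(SUM N:Pow {1..n}. (PROD x:N. if P x then - 1 else 1) * (-1) ^ (SUM x:N. e x) :: real)
  = (if ALL x:{1..n}. odd (e x) \<longleftrightarrow> P x then 2 ^ n else 0)"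
proof -
 let ?e = "%x. (if P x then - 1 else 1) * (-1) ^ e x :: real"
 have "(SUM N:Pow {1..n}. (PROD x:N. if P x then - 1 else 1) * (-1) ^ (SUM x:N. e x) :: real)
   = (SUM N:Pow {1..n}. prod ?e N * prod (%_. 1) ({1..n} - N))" by (simp add: prod.distrib power_sum)
 also have "... = (PROD x:{1..n}. ?e x + 1)" by (rule prod_add[symmetric]) simp
 also have "... = (if ALL x:{1..n}. odd (e x) \<longleftrightarrow> P x then 2 ^ n else 0)"
 proof (cases "ALL x:{1..n}. odd (e x) \<longleftrightarrow> P x")
  case True
  hence "(PROD x:{1..n}. ?e x + 1) = (PROD x:{1..n}. 2)" by (intro prod.cong) auto
  thus ?thesis using True by simp
 next
  case False
  then obtain x where x: "x:{1..n}" "odd (e x) ~= P x" by blast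
  hence "?e x + 1 = 0" by auto
  hence "(PROD x:{1..n}. ?e x + 1) = 0" using x(1) by (intro prod_zero finite_atLeastAtMost bexI[of _ x])
  thus ?thesis by (simp only: False if_False)
 qed
 finally show ?thesis .
qed

text \<open>The projection is an average of sign changes weighted by a real character. Sign changes
  are involutions, hence it is self-adjoint.\<close>

lemma gop_Qop: "gop c n (Qop c n p) (Qop c n p)"
proof (cases c)
 case TypeA
 hence "Qop c n p = (%f. f)" by (intro ext poly_mapping_eqI) (simp add: coef_Qop qpar_def)
 thus ?thesis using gop_id by simp
next
 case TypeB
 let ?a = "%N. (PROD x:N. if kk p x = 1 then - 1 else 1) / 2 ^ n :: real"
 have "gop c n (%f. SUM N:Pow {1..n}. ?a N *\<^sub>R act (id, N) f)
   (%f. SUM N:Pow {1..n}. ?a N *\<^sub>R act (ginv (id, N)) f)"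
  by (intro gop_sum gop_scaleR_act) (auto simp: TypeB permutes_id)
 moreover have "(SUM N:Pow {1..n}. ?a N *\<^sub>R act (id, N) f) = Qop c n p f" for f
 proof (rule poly_mapping_eqI)
  fix m
  have "coef (SUM N:Pow {1..n}. ?a N *\<^sub>R act (id, N) f) m
    = (SUM N:Pow {1..n}. ((PROD x:N. if kk p x = 1 then - 1 else 1) * (-1) ^ (SUM x:N. coef m x))
      * (coef f m / 2 ^ n))" unfolding lookup_sum
  proof (rule sum.cong)
   fix N assume "N:Pow {1..n}"
   hence "finite N" by (auto intro: finite_subset)
   thus "coef (?a N *\<^sub>R act (id, N) f) m = ((PROD x:N. if kk p x = 1 then - 1 else 1)
     * (-1) ^ (SUM x:N. coef m x)) * (coef f m / 2 ^ n)" by (simp add: coef_act sg_def)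
  qed simp
  also have "... = (SUM N:Pow {1..n}. (PROD x:N. if kk p x = 1 then - 1 else 1) * (-1) ^ (SUM x:N. coef m x))
      * (coef f m / 2 ^ n)" by (rule sum_distrib_right[symmetric])
  also have "... = coef (Qop c n p f) m"
  proof -
   have "qpar c n p m \<longleftrightarrow> (ALL x:{1..n}. odd (coef m x) \<longleftrightarrow> kk p x = 1)"
    by (simp add: qpar_def TypeB)
   moreover have "(if A then 2 ^ n else 0) * (z / 2 ^ n) = (if A then z else 0)" for A and z :: real by simp
   ultimately show ?thesis unfolding sum_sign_characters coef_Qop by (simp only:)
  qed
  finally show "coef (SUM N:Pow {1..n}. ?a N *\<^sub>R act (id, N) f) m = coef (Qop c n p f) m" .
 qed
 moreover have "ginv (id, N) = (id, N)" for N by (simp add: ginv_def)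
 ultimately show ?thesis by (simp add: Qop_def[abs_def])
qed

lemma Qop_act: assumes h: "h permutes {1..n}" and k: "!!x. x:{1..n} ==> kk p (h x) = kk p' x"
 shows "Qop c n p (act (h, {}) f) = act (h, {}) (Qop c n p' f)"
proof (rule poly_mapping_eqI)
 fix m :: "nat \<Rightarrow>\<^sub>0 nat"
 have "(ALL x:{1..n}. odd (coef m x) \<longleftrightarrow> kk p x = 1) \<longleftrightarrow>
   (ALL x:h ` {1..n}. odd (coef m x) \<longleftrightarrow> kk p x = 1)"
  by (simp only: permutes_image[OF h])
 also have "... \<longleftrightarrow> (ALL x:{1..n}. odd (coef m (h x)) \<longleftrightarrow> kk p' x = 1)"
  using k by simp
 finally have "qpar c n p m \<longleftrightarrow> qpar c n p' (pm h m)"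
  using permutes_inj[OF h] by (simp add: qpar_def coef_pm)
 thus "coef (Qop c n p (act (h, {}) f)) m = coef (act (h, {}) (Qop c n p' f)) m"
  using permutes_bij[OF h] by (simp add: coef_Qop coef_act)
qed

text \<open>All monomials in the image of \<open>Qop\<close> have the same parities in type B, so
  the signs in \<open>N\<close> contribute one common factor.\<close>

lemma act_Qop: assumes "(h, N):refl_group c n"
 shows "EX a. ALL f. act (h, N) (Qop c n p f) = a *\<^sub>R act (h, {}) (Qop c n p f)"
proof (intro exI allI poly_mapping_eqI)
 fix f m
 note h = refl_groupD[OF assms]
 let ?a = "PROD x:N. if kk p x = 1 then - 1 else 1 :: real"
 have "sg N k = ?a" if "qpar c n p k" for k
 proof (cases c)
  case TypeA
  thus ?thesis using assms by simp
 next
  case TypeB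
  have "(-1) ^ coef k x = (if kk p x = 1 then - 1 else 1 :: real)" if "x:N" for x
  proof -
   have "odd (coef k x) \<longleftrightarrow> kk p x = 1"
    using \<open>qpar c n p k\<close> h(2) that TypeB by (auto simp: qpar_def)
   thus ?thesis by auto
  qed
  thus ?thesis unfolding sg_def power_sum by (intro prod.cong refl)
 qed
 thus "coef (act (h, N) (Qop c n p f)) m = coef (?a *\<^sub>R act (h, {}) (Qop c n p f)) m"
  using h by (simp add: coef_act coef_Qop)
qed

text \<open>A mismatch of components forces type B, by \<open>kvalid\<close>, and there the two
  projections demand different parities of the same exponent.\<close>

lemma Qop_act_Qop_eq_0: assumes "(h, N):refl_group c n" "kvalid c n p" "kvalid c n p'"
  and x: "x:{1..n}" "kk p (h x) ~= kk p' x" shows "Qop c n p (act (h, N) (Qop c n p' f)) = 0"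
proof (rule poly_mapping_eqI)
 fix m
 note h = refl_groupD[OF assms(1)]
 have hx: "h x:{1..n}" using x(1) by (simp only: permutes_in_image[OF h(1)])
 have bounds: "kk p (h x) <= (if c = TypeB then 1 else 0)" "kk p' x <= (if c = TypeB then 1 else 0)"
  using bspec[OF assms(2)[unfolded kvalid_def] hx] bspec[OF assms(3)[unfolded kvalid_def] x(1)] by auto
 hence c: "c = TypeB" using x(2) by (auto split: if_splits)
 have "~ (qpar c n p m & qpar c n p' (pm h m))"
 proof
  assume *: "qpar c n p m & qpar c n p' (pm h m)"
  have "odd (coef m (h x)) \<longleftrightarrow> kk p (h x) = 1"
   using * c hx unfolding qpar_def by blast
  moreover have "odd (coef (pm h m) x) \<longleftrightarrow> kk p' x = 1"
   using * c x(1) unfolding qpar_def by blast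
  ultimately have "kk p (h x) = 1 \<longleftrightarrow> kk p' x = 1"
   using h(3) by (simp add: coef_pm bij_is_inj)
  thus False using bounds c x(2) by (auto simp: le_Suc_eq One_nat_def)
 qed
 thus "coef (Qop c n p (act (h, N) (Qop c n p' f))) m = coef 0 m"
  using h by (auto simp: coef_act coef_Qop)
qed

lemma Qop_Cop: "Qop c n p (Cop n p f) = Cop n p (Qop c n p f)"
 and Qop_Rop: "Qop c n p (Rop n p f) = Rop n p (Qop c n p f)"
 unfolding Cop_gsum Rop_gsum
 by (intro gsum_linear_commute gop_linear(1)[OF gop_Qop] Qop_act; simp add: Cgrp_def Rgrp_def)+

text \<open>The outer antisymmetrizer occurs on both sides to make the product self-adjoint, which
  the plain product of column and row operators need not be.\<close>

definition Dop :: "cox_type => nat => (nat => position) => rpoly => rpoly" where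
 "Dop c n p f = CR n p (Cop n p (Qop c n p f))"

lemma gop_Dop: "gop c n (Dop c n p) (Dop c n p)"
proof -
 note C = gop_Cop[of c] and R = gop_Rop[of c]
 have "gop c n (%f. CR n p (Cop n p (Qop c n p f))) (%f. Qop c n p (CR n p (Cop n p f)))"
  by (rule gop_comp[OF C gop_comp[OF R gop_comp[OF C gop_Qop]], simplified])
 thus ?thesis by (simp add: Dop_def[abs_def] Qop_Cop Qop_Rop)
qed

lemma Qop_Dop: "Qop c n p (Dop c n p f) = Dop c n p f"
 by (simp add: Dop_def Qop_Cop Qop_Rop)

lemma Dop_act_Dop: assumes p: "diagram {1..n} p" "kvalid c n p" and p': "diagram {1..n} p'" "kvalid c n p'"
  and h: "(h, N):refl_group c n" and k: "!!x. x:{1..n} ==> kk p (h x) = kk p' x"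
 shows "EX a. ALL f. Dop c n p (act (h, N) (Dop c n p' f))
   = a *\<^sub>R CR n p (Cop n p (act (h, {}) (Dop c n p' f)))"
proof -
 obtain a where a: "!!f. act (h, N) (Qop c n p' f) = a *\<^sub>R act (h, {}) (Qop c n p' f)"
  using act_Qop[OF h] by blast
 have q: "Qop c n p (act (h, {}) g) = act (h, {}) (Qop c n p' g)" for g
  by (rule Qop_act[OF refl_groupD(1)[OF h]]) (rule k)
 have "Qop c n p (act (h, N) (Dop c n p' f)) = a *\<^sub>R act (h, {}) (Dop c n p' f)" for f
 proof -
  have "Qop c n p (act (h, N) (Dop c n p' f)) = Qop c n p (act (h, N) (Qop c n p' (Dop c n p' f)))"
   by (simp only: Qop_Dop)
  also have "... = a *\<^sub>R act (h, {}) (Qop c n p' (Qop c n p' (Dop c n p' f)))"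
   by (simp only: a gop_simps[OF gop_Qop] q)
  finally show ?thesis by (simp only: Qop_Dop)
 qed
 thus ?thesis by (intro exI[of _ a]) (simp add: Dop_def[of c n p] Cop_simps Rop_simps)
qed

text \<open>Expanding the inner antisymmetrizer over the column group reduces this to
  \<open>Cop_act_Rop\<close> for the permutations h o g.\<close>

lemma Cop_act_Cop_Rop: assumes p: "diagram {1..n} p" and h: "h permutes {1..n}"
  and k: "!!x. x:{1..n} ==> kk p (h x) = kk p x"
 shows "EX a. ALL f. Cop n p (act (h, {}) (CR n p f)) = a *\<^sub>R CR n p f"
proof -
 have ex: "EX a. ALL f. Cop n p (act (h o g, {}) (Rop n p f)) = a *\<^sub>R CR n p f"
  if g: "g:Cgrp {1..n} p" for g
 proof (rule Cop_act_Rop[OF p])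
  show "(h o g) permutes {1..n}"
   by (rule permutes_compose[OF Cgrp_permutes[OF g] h])
  fix x assume x: "x:{1..n}"
  hence "g x:{1..n}" by (simp only: permutes_in_image[OF Cgrp_permutes[OF g]])
  thus "kk p ((h o g) x) = kk p x" using g x k by (simp add: Cgrp_def)
 qed
 obtain a where a: "ALL g:Cgrp {1..n} p. ALL f. Cop n p (act (h o g, {}) (Rop n p f)) = a g *\<^sub>R CR n p f"
  using bchoice[OF ballI[OF ex]] by (rule exE)
 have "Cop n p (act (h, {}) (CR n p f))
   = (SUM g:Cgrp {1..n} p. real_of_int (sign g) * a g) *\<^sub>R CR n p f" for f
 proof -
  have "Cop n p (act (h, {}) (CR n p f))
    = (SUM g:Cgrp {1..n} p. real_of_int (sign g) *\<^sub>R Cop n p (act (h, {}) (act (g, {}) (Rop n p f))))"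
   unfolding Cop_def[of n p "Rop n p f"] by (simp add: act_sum act_scaleR Cop_simps)
  also have "... = (SUM g:Cgrp {1..n} p. real_of_int (sign g) *\<^sub>R a g *\<^sub>R CR n p f)"
  proof (rule sum.cong)
   fix g assume g: "g:Cgrp {1..n} p"
   hence "Cop n p (act (h o g, {}) (Rop n p f)) = a g *\<^sub>R CR n p f"
    using a by blast
   thus "real_of_int (sign g) *\<^sub>R Cop n p (act (h, {}) (act (g, {}) (Rop n p f)))
     = real_of_int (sign g) *\<^sub>R a g *\<^sub>R CR n p f"
    by (simp only: act_permutes_compose[OF h Cgrp_permutes[OF g]])
  qed simp
  finally show ?thesis by (simp add: scaleR_sum_left)
 qed
 thus ?thesis by blast
qed

lemma Cop_Rop_Cop_Rop: assumes p: "diagram {1..n} p"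
 shows "EX a. ALL f. CR n p (CR n p f) = a *\<^sub>R CR n p f"
proof -
 have ex: "EX a. ALL f. Cop n p (act (r, {}) (CR n p f)) = a *\<^sub>R CR n p f"
  if "r:Rgrp {1..n} p" for r using that by (intro Cop_act_Cop_Rop[OF p]) (auto simp: Rgrp_def)
 obtain a where a: "ALL r:Rgrp {1..n} p. ALL f. Cop n p (act (r, {}) (CR n p f)) = a r *\<^sub>R CR n p f"
  using bchoice[OF ballI[OF ex]] by (rule exE)
 have "CR n p (CR n p f) = (SUM r:Rgrp {1..n} p. a r) *\<^sub>R CR n p f" for f
  unfolding Rop_def[of n p "CR n p f"] using a by (simp add: Cop_simps scaleR_sum_left)
 thus ?thesis by blast
qed

text \<open>Primitivity on group elements: either the permutation respects the components and the
  products collapse to scalars, or the parity projections annihilate each other.\<close>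

lemma Dop_act_Dop_same: assumes p: "diagram {1..n} p" "kvalid c n p" and g: "g:refl_group c n"
 shows "EX a. ALL f. Dop c n p (act g (Dop c n p f)) = a *\<^sub>R Dop c n p f"
proof -
 obtain h N where g_eq: "g = (h, N)" by (cases g)
 note h = g[unfolded g_eq]
 show ?thesis
 proof (cases "ALL x:{1..n}. kk p (h x) = kk p x")
  case True
  hence k: "!!x. x:{1..n} ==> kk p (h x) = kk p x" by blast
  obtain a where a: "!!f. Dop c n p (act g (Dop c n p f))
    = a *\<^sub>R CR n p (Cop n p (act (h, {}) (Dop c n p f)))"
   using Dop_act_Dop[OF p p h k] g_eq by blast
  obtain b where b: "!!f. Cop n p (act (h, {}) (CR n p f)) = b *\<^sub>R CR n p f"
   using Cop_act_Cop_Rop[OF p(1) refl_groupD(1)[OF h] k] by blast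
  obtain d where d: "!!f. CR n p (CR n p f) = d *\<^sub>R CR n p f"
   using Cop_Rop_Cop_Rop[OF p(1)] by blast
  have "Dop c n p (act g (Dop c n p f)) = (a * b * d) *\<^sub>R Dop c n p f" for f
   unfolding a unfolding Dop_def b Cop_simps Rop_simps d by simp
  thus ?thesis by blast
 next
  case False
  then obtain x where x: "x:{1..n}" "kk p (h x) ~= kk p x" by blast
  have "Dop c n p (act g (Dop c n p f)) = 0" for f
  proof -
   have "Qop c n p (act g (Dop c n p f)) = Qop c n p (act (h, N) (Qop c n p (Dop c n p f)))"
    by (simp only: g_eq Qop_Dop)
   also have "... = 0" by (rule Qop_act_Qop_eq_0[OF h p(2) p(2) x])
   finally show ?thesis
    by (simp add: Dop_def[of c n p "act g _"] Cop_simps Rop_simps)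
  qed
  thus ?thesis by (intro exI[of _ 0]) simp
 qed
qed

lemma Dop_act_Dop_dominance:
 assumes p: "diagram {1..n} p" "kvalid c n p" and p': "diagram {1..n} p'" "kvalid c n p'"
  and s: "s:refl_group c n" and nz: "Dop c n p (act s (Dop c n p' f)) ~= 0"
 shows "rowcount {1..n} p' l t <= rowcount {1..n} p l t"
proof -
 obtain h N where s_eq: "s = (h, N)" by (cases s)
 note h = s[unfolded s_eq]
 have k: "kk p (h x) = kk p' x" if x: "x:{1..n}" for x
 proof (rule ccontr)
  assume *: "kk p (h x) ~= kk p' x"
  have "Qop c n p (act s (Dop c n p' f)) = Qop c n p (act (h, N) (Qop c n p' (Dop c n p' f)))"
   by (simp only: s_eq Qop_Dop)
  also have "... = 0" by (rule Qop_act_Qop_eq_0[OF h p(2) p'(2) x *])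
  finally show False
   using nz by (simp add: Dop_def[of c n p "act s _"] Cop_simps Rop_simps)
 qed
 obtain a where a: "!!f. Dop c n p (act s (Dop c n p' f))
   = a *\<^sub>R CR n p (Cop n p (act (h, {}) (Dop c n p' f)))"
  using Dop_act_Dop[OF p p' h k] s_eq by blast
 let ?g = "Cop n p' (Qop c n p' f)"
 have "Cop n p (act (h, {}) (CR n p' ?g)) ~= 0"
 proof
  assume "Cop n p (act (h, {}) (CR n p' ?g)) = 0"
  hence "Cop n p (act (h, {}) (Dop c n p' f)) = 0" by (simp add: Dop_def)
  thus False using nz by (simp add: a Cop_simps Rop_simps)
 qed
 moreover have "Cop n p (act (h, {}) (CR n p' ?g))
   = (SUM u:Cgrp {1..n} p'. real_of_int (sign u) *\<^sub>R Cop n p (act (h, {}) (act (u, {}) (Rop n p' ?g))))"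
  unfolding Cop_def[of n p' "Rop n p' ?g"] by (simp add: act_sum act_scaleR Cop_simps)
 ultimately obtain u where u: "u:Cgrp {1..n} p'"
  "Cop n p (act (h, {}) (act (u, {}) (Rop n p' ?g))) ~= 0"
  by (metis (no_types, lifting) scaleR_zero_right sum.neutral)
 note up = Cgrp_permutes[OF u(1)]
 show ?thesis
 proof (rule Cop_act_Rop_dominance[OF p(1) p'(1)])
  show "(h o u) permutes {1..n}"
   by (rule permutes_compose[OF up refl_groupD(1)[OF h]])
  show "Cop n p (act (h o u, {}) (Rop n p' ?g)) ~= 0"
   using u(2) unfolding act_permutes_compose[OF refl_groupD(1)[OF h] up] .
  fix x assume x: "x:{1..n}"
  hence "u x:{1..n}" by (simp only: permutes_in_image[OF up])
  thus "kk p ((h o u) x) = kk p' x" using k x u(1) by (simp add: Cgrp_def)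
 qed
qed

text \<open>The scalar d with CRCR = d CR is nonzero by positivity: otherwise R C R g0 would have
  norm 0, and then so would C R g0.\<close>

lemma Dop_Cop_Rop: assumes p: "diagram {1..n} p" and nz: "CR n p g0 ~= 0"
 obtains a where "a ~= 0" "!!g. Qop c n p g = g ==> Dop c n p (CR n p g) = a *\<^sub>R CR n p g"
proof -
 obtain d where d: "!!f. CR n p (CR n p f) = d *\<^sub>R CR n p f"
  using Cop_Rop_Cop_Rop[OF p] by blast
 let ?C = "real (card (Cgrp {1..n} p))" and ?R = "real (card (Rgrp {1..n} p))"
 have pos: "0 < ?C" "0 < ?R" using card_Cgrp_pos card_Rgrp_pos by simp_all
 have "d ~= 0"
 proof
  assume "d = 0"
  hence 0: "CR n p (CR n p g0) = 0" using d[of g0] by simp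
  let ?h = "Rop n p (CR n p g0)"
  note ipC = gop_ip[OF gop_Cop[of TypeA]] and ipR = gop_ip[OF gop_Rop[of TypeA]]
  have "ip ?h ?h = ip (CR n p g0) (Rop n p ?h)" by (rule ipR)
  also have "... = ?R * ip (CR n p g0) ?h"
   by (simp add: Rop_Rop linear_scale[OF linear_ip_right])
  also have "ip (CR n p g0) ?h = ip (Rop n p g0) (Cop n p ?h)" by (rule ipC)
  finally have "?h = 0" using 0 linear_0[OF linear_ip_right] ip_self_eq_0_iff by simp
  have "ip (CR n p g0) (CR n p g0) = ip (Rop n p g0) (Cop n p (CR n p g0))"
   by (rule ipC)
  also have "... = ?C * ip (Rop n p g0) (CR n p g0)"
   by (simp add: Cop_Cop linear_scale[OF linear_ip_right])
  also have "ip (Rop n p g0) (CR n p g0) = ip g0 ?h" by (rule ipR)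
  finally show False using `?h = 0` nz linear_0[OF linear_ip_right] ip_self_eq_0_iff by simp
 qed
 show ?thesis
 proof (rule that[of "?C * d"])
  show "?C * d ~= 0" using pos `d ~= 0` by simp
  fix g assume "Qop c n p g = g"
  thus "Dop c n p (CR n p g) = (?C * d) *\<^sub>R CR n p g"
   by (simp add: Dop_def Qop_Cop Qop_Rop Cop_Cop Rop_simps Cop_simps d)
 qed
qed

lemma gop_scalar_closed:
 assumes "linear E" "linear E'" "!!g. g:refl_group c n ==> EX k. ALL p. E (act g (E' p)) = k *\<^sub>R D p"
  and "gop c n A B" shows "EX k. ALL p. E (A (E' p)) = k *\<^sub>R (D p :: rpoly)" using assms(4)
proof (induction rule: gop.induct)
 case gop_zero
 thus ?case using linear_0[OF assms(1)] by (intro exI[of _ 0]) simp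
next
 case (gop_step g A B a)
 obtain k where k: "!!p. E (act g (E' p)) = k *\<^sub>R D p" using assms(3)[OF gop_step(1)] by blast
 obtain l where l: "!!p. E (A (E' p)) = l *\<^sub>R D p" using gop_step(3) by blast
 show ?case by (intro exI[of _ "a * k + l"])
   (simp add: linear_add[OF assms(1)] linear_scale[OF assms(1)] k l scaleR_add_left)
qed

text \<open>A nonzero product gives dominance in one direction, and its adjoint, which is then
  nonzero too, gives dominance in the other; so the row counts would agree.\<close>

lemma Dop_act_Dop_eq_0:
 assumes p: "diagram {1..n} p" "kvalid c n p" and p': "diagram {1..n} p'" "kvalid c n p'"
  and g: "g:refl_group c n" and ne: "rowcount {1..n} p k t ~= rowcount {1..n} p' k t"
 shows "Dop c n p (act g (Dop c n p' f)) = 0"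
proof (rule ccontr)
 let ?D = "Dop c n p" and ?D' = "Dop c n p'"
 assume nz: "?D (act g (?D' f)) ~= 0"
 define u where "u = ?D (act g (?D' f))"
 have "ip u u = ip (act g (?D' f)) (?D u)" unfolding u_def by (rule gop_ip[OF gop_Dop])
 also have "... = ip (?D' f) (act (ginv g) (?D u))" by (rule ip_act_left[OF g])
 also have "... = ip f (?D' (act (ginv g) (?D u)))" by (rule gop_ip[OF gop_Dop])
 finally have nz': "?D' (act (ginv g) (?D u)) ~= 0"
  using nz ip_self_eq_0_iff[of u] linear_0[OF linear_ip_right] unfolding u_def by auto
 have "rowcount {1..n} p' k t <= rowcount {1..n} p k t"
  by (rule Dop_act_Dop_dominance[OF p p' g nz])
 moreover have "rowcount {1..n} p k t <= rowcount {1..n} p' k t"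
  by (rule Dop_act_Dop_dominance[OF p' p ginv_in_refl_group[OF g] nz'])
 ultimately show False using ne by simp
qed

text \<open>Dividing \<open>Dop\<close> by the scalar of \<open>Dop_Cop_Rop\<close> makes it an
  idempotent that fixes the polynomials C R g with g of the right parities.\<close>

lemma primitive_system_of_diagrams: fixes J :: "'j set" and P :: "'j => nat => position" assumes "finite J"
  and dia: "!!j. j:J ==> diagram {1..n} (P j)" and kv: "!!j. j:J ==> kvalid c n (P j)"
  and nz: "!!j. j:J ==> CR n (P j) (g0 j) ~= 0"
  and g0: "!!j. j:J ==> Qop c n (P j) (g0 j) = g0 j" and ne: "!!j k. j:J ==> k:J ==> j ~= k ==>
   EX b t. rowcount {1..n} (P j) b t ~= rowcount {1..n} (P k) b t"
 obtains E where "primitive_system c n J E"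
  "!!j g. j:J ==> Qop c n (P j) g = g ==>
   E j (CR n (P j) g) = CR n (P j) g"
proof -
 have "EX a. a ~= 0 & (ALL g. Qop c n (P j) g = g -->
   Dop c n (P j) (CR n (P j) g) = a *\<^sub>R CR n (P j) g)" if j: "j:J" for j
 proof -
  obtain a where "a ~= 0" "!!g. Qop c n (P j) g = g ==>
    Dop c n (P j) (CR n (P j) g) = a *\<^sub>R CR n (P j) g"
   using Dop_Cop_Rop[OF dia[OF j] nz[OF j]] by blast
  thus ?thesis by (intro exI[of _ a]) simp
 qed
 note ex = this
 obtain a where a: "ALL j:J. a j ~= 0 & (ALL g. Qop c n (P j) g = g -->
   Dop c n (P j) (CR n (P j) g) = a j *\<^sub>R CR n (P j) g)"
  using bchoice[OF ballI[OF ex]] by (rule exE)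
 define E where "E j f = (1 / a j) *\<^sub>R Dop c n (P j) f" for j f
 have E_gop: "gop c n (E j) (E j)" if "j:J" for j
  using gop_scaleR[OF gop_Dop, of c n "1 / a j"] by (simp add: E_def[abs_def])
 have E_fix: "E j (CR n (P j) g) = CR n (P j) g"
  if j: "j:J" and g: "Qop c n (P j) g = g" for j g
 proof -
  have "a j ~= 0" "Dop c n (P j) (CR n (P j) g) = a j *\<^sub>R CR n (P j) g"
   using bspec[OF a j] g by simp_all
  thus ?thesis by (simp add: E_def)
 qed
 have "primitive_system c n J E"
 proof
  show "finite J" by (rule assms(1))
  show "gop c n (E j) (E j)" if "j:J" for j by (rule E_gop[OF that])
  show "E j (E j f) = E j f" if j: "j:J" for j f unfolding E_def
  proof -
   let ?g = "Cop n (P j) (Qop c n (P j) f)"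
   have Q: "Qop c n (P j) ?g = ?g" by (simp add: Qop_Cop)
   have "E j (CR n (P j) ?g) = CR n (P j) ?g" by (rule E_fix[OF j Q])
   hence "E j (Dop c n (P j) f) = Dop c n (P j) f" by (simp add: Dop_def[of c n "P j" f])
   thus "(1 / a j) *\<^sub>R Dop c n (P j) ((1 / a j) *\<^sub>R Dop c n (P j) f) = (1 / a j) *\<^sub>R Dop c n (P j) f"
    by (simp add: E_def gop_simps[OF gop_Dop])
  qed
  show "EX k. ALL f. E j (A (E j f)) = k *\<^sub>R E j f" if j: "j:J" and A: "gop c n A B" for j A B
  proof (rule gop_scalar_closed[OF gop_linear(1)[OF E_gop[OF j]] gop_linear(1)[OF E_gop[OF j]] _ A])
   fix s assume s: "s:refl_group c n"
   obtain k where "!!f. Dop c n (P j) (act s (Dop c n (P j) f)) = k *\<^sub>R Dop c n (P j) f"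
    using Dop_act_Dop_same[OF dia[OF j] kv[OF j] s] by blast
   thus "EX k. ALL f. E j (act s (E j f)) = k *\<^sub>R E j f"
    by (intro exI[of _ "k / a j"]) (simp add: E_def act_scaleR gop_simps[OF gop_Dop])
  qed
  show "E j (A (E k f)) = 0" if jk: "j:J" "k:J" "j ~= k" and A: "gop c n A B" for j k A B f
  proof -
   obtain b t where ne': "rowcount {1..n} (P j) b t ~= rowcount {1..n} (P k) b t"
    using ne[OF jk] by blast
   have "EX l. ALL f. E j (A (E k f)) = l *\<^sub>R (0 :: rpoly)"
   proof (rule gop_scalar_closed[OF gop_linear(1)[OF E_gop[OF jk(1)]] gop_linear(1)[OF E_gop[OF jk(2)]] _ A])
    fix s assume s: "s:refl_group c n"
    have "E j (act s (E k f)) = 0" for f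
     by (simp add: E_def act_scaleR gop_simps[OF gop_Dop]
       Dop_act_Dop_eq_0[OF dia[OF jk(1)] kv[OF jk(1)] dia[OF jk(2)] kv[OF jk(2)] s ne'])
    thus "EX l. ALL f. E j (act s (E k f)) = l *\<^sub>R (0 :: rpoly)" by simp
   qed
   thus ?thesis by simp
  qed
 qed
 thus ?thesis using that E_fix by blast
qed

section \<open>Extremality of the exponent attached to a standard labelling\<close>

section \<open>Leading exponents\<close>

lemma layer_cake: fixes w f :: "'a => nat" assumes "finite X" "!!x. x:X ==> f x <= M"
 shows "(SUM x:X. w x * f x) = (SUM j:{1..M}. SUM x:{x:X. j <= f x}. w x)"
proof -
 have "(SUM x:X. w x * f x) = (SUM x:X. SUM j:{1..M}. if j <= f x then w x else 0)"
 proof (intro sum.cong refl)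
  fix x assume x: "x:X"
  have "(SUM j:{1..M}. if j <= f x then w x else 0) = (SUM j:{j:{1..M}. j <= f x}. w x)"
   by (simp only: sum.inter_filter[OF finite_atLeastAtMost])
  also have "{j:{1..M}. j <= f x} = {1..f x}" using assms(2)[OF x] by auto
  finally show "w x * f x = (SUM j:{1..M}. if j <= f x then w x else 0)" by simp
 qed
 also have "... = (SUM j:{1..M}. SUM x:X. if j <= f x then w x else 0)" by (rule sum.swap)
 also have "... = (SUM j:{1..M}. SUM x:{x:X. j <= f x}. w x)" by (simp add: sum.inter_filter[OF assms(1)])
 finally show ?thesis .
qed

lemma sum_le_eq_imp_eq: fixes f g :: "'a => nat"
 assumes "finite A" "!!x. x:A ==> f x <= g x" "sum f A = sum g A" "x:A" shows "f x = g x"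
proof (rule ccontr)
 assume "f x ~= g x"
 hence "sum f A < sum g A"
  using assms(1,2,4) by (intro sum_strict_mono_ex1) (auto intro!: bexI[of _ x] simp: less_le)
 thus False using assms(3) by simp
qed

lemma sum_insert_minus: fixes w :: "'a => nat" assumes "finite U" "x:U" "y ~: U"
 shows "sum w (insert y (U - {x})) + w x = sum w U + w y" "card (insert y (U - {x})) = card U"
proof -
 have "sum w U = w x + sum w (U - {x})" by (rule sum.remove[OF assms(1,2)])
 moreover have "sum w (insert y (U - {x})) = w y + sum w (U - {x})" using assms by (intro sum.insert) auto
 ultimately show "sum w (insert y (U - {x})) + w x = sum w U + w y" by simp
 have "card U = Suc (card (U - {x}))" using assms by (metis card.remove)
 thus "card (insert y (U - {x})) = card U" using assms by simp
qed

text \<open>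
 \<open>s\<close> is the labelling of the cells by a standard tableau, \<open>i\<close> its index and \<open>co\<close> the position of the
 column of a cell in the reading order.
\<close>

locale standard_labelling = fixes n :: nat and p :: "nat => position" and co s i :: "nat => nat"
 assumes dia: "diagram {1..n} p" and s_bij: "bij_betw s {1..n} {1..n}"
  and index_mono: "!!x y. x:{1..n} ==> y:{1..n} ==> s x < s y ==> i x <= i y"
  and index_eq: "!!x y. x:{1..n} ==> y:{1..n} ==> s x < s y ==> i x = i y ==> co x < co y"
  and row_mono: "!!x y. x:{1..n} ==> y:{1..n} ==> kk p x = kk p y ==> rr p x = rr p y ==>
    x ~= y ==> co x < co y & s x < s y | co y < co x & s y < s x"
  and col_mono: "!!x y. x:{1..n} ==> y:{1..n} ==> kk p x = kk p y ==> cc p x = cc p y ==>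
    rr p x < rr p y ==> i x < i y"
  and co_col: "!!x y. x:{1..n} ==> y:{1..n} ==> kk p x = kk p y ==> cc p x = cc p y ==> co x = co y"
begin

abbreviation "X == {1..n}"

lemma s_inj: "x:X ==> y:X ==> x ~= y ==> s x < s y | s y < s x"
 using s_bij unfolding bij_betw_def by (metis inj_onD linorder_neqE_nat)

definition upper :: "nat set => bool" where
 "upper V \<longleftrightarrow> V <= X & (ALL x:V. ALL y:X - V. s y < s x)"

text \<open>Weaker than \<open>upper\<close>: only indices are compared, and ties between equal
  indices remain open.\<close>

definition cosorted :: "nat set => bool" where
 "cosorted U \<longleftrightarrow> U <= X & (ALL x:U. ALL y:X - U. i y <= i x)"

lemma upper_unique: assumes "upper V" "upper V'" "card V = card V'" shows "V = V'"
proof -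
 have fin: "finite V" "finite V'" using assms by (auto simp: upper_def intro: finite_subset)
 have "V <= V'"
 proof (rule ccontr)
  assume "~ V <= V'"
  then obtain x where x: "x:V" "x ~: V'" by blast
  have "~ V' <= V" using card_subset_eq[OF fin(1), of V'] assms(3) x by auto
  then obtain y where y: "y:V'" "y ~: V" by blast
  have "s y < s x" "s x < s y" using assms(1,2) x y unfolding upper_def by blast+
  thus False by simp
 qed
 thus ?thesis using card_subset_eq[OF fin(2)] assms(3) by blast
qed

text \<open>Elements of \<open>U\<close> outside \<open>V\<close> have smaller labels than elements
  of \<open>V\<close> outside \<open>U\<close>, hence no larger indices, and there are equally many
  of both.\<close>

lemma sum_index_le: assumes "upper V" "U <= X" "card U = card V" shows "sum i U <= sum i V"
proof -
 have fin: "finite U" "finite V" and V: "V <= X"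
  using assms by (auto simp: upper_def intro: finite_subset)
 have card: "card (U - V) = card (V - U)"
  using fin assms(3) card_Diff_subset_Int[of U V] card_Diff_subset_Int[of V U] by (simp add: Int_commute)
 have le: "i x <= i y" if "x:U - V" "y:V - U" for x y
 proof -
  have "s x < s y" using assms(1,2) that unfolding upper_def by blast
  thus ?thesis using index_mono that assms(2) V by blast
 qed
 have "sum i (U - V) <= sum i (V - U)"
 proof (cases "U - V = {}")
  case True
  hence "sum i (U - V) = 0" by (simp only: sum.empty)
  thus ?thesis by simp
 next
  case False
  let ?m = "Max (i ` (U - V))"
  have "sum i (U - V) <= of_nat (card (U - V)) * ?m" using fin by (intro sum_bounded_above) auto
  also have "... = of_nat (card (V - U)) * ?m" by (simp add: card)
  also have "... <= sum i (V - U)"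
  proof (rule sum_bounded_below)
   fix y assume "y:V - U"
   thus "?m <= i y" using fin False le by (subst Max_le_iff) auto
  qed
  finally show ?thesis .
 qed
 moreover have "sum i U = sum i (U Int V) + sum i (U - V)" "sum i V = sum i (V Int U) + sum i (V - U)"
  using sum.Int_Diff[OF fin(1), of i V] sum.Int_Diff[OF fin(2), of i U] by auto
 ultimately show ?thesis by (simp add: Int_commute)
qed

lemma sum_index_eq_imp_cosorted: assumes "upper V" "U <= X" "card U = card V" "sum i U = sum i V"
 shows "cosorted U" unfolding cosorted_def
proof (intro conjI ballI assms(2))
 fix x y assume xy: "x:U" "y:X - U"
 have fin: "finite U" using assms(2) by (auto intro: finite_subset)
 have y: "y ~: U" using xy by simp
 note U' = sum_insert_minus[OF fin xy(1) y]
 have "sum i (insert y (U - {x})) <= sum i V" using assms xy by (intro sum_index_le) (auto simp: U'(2))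
 thus "i y <= i x" using U'(1)[of i] assms(4) by simp
qed

lemma upper_cosorted: "upper V ==> cosorted V"
 unfolding upper_def cosorted_def using index_mono by (meson DiffD1 subsetD)

lemma co_row_less_iff: assumes "x:X" "y:X" "kk p x = kk p y" "rr p x = rr p y"
 shows "co x < co y \<longleftrightarrow> s x < s y" using row_mono[OF assms] by (cases "x = y") auto

text \<open>
 A set with the maximal sum of columns among the row rearrangements of cosorted sets of a given
 size is an upper set of \<open>s\<close>, since otherwise an exchange of two elements increases the sum.
\<close>

lemma sum_co_rearrangement:
 assumes V: "upper V" and U: "cosorted U" "card U = card V" and r: "r:Rgrp X p"
 shows "sum co (r ` U) <= sum co V & (sum co (r ` U) = sum co V --> r ` U = V)"
proof -
 define F where "F = {Y. EX U r. cosorted U & card U = card V & r:Rgrp X p & Y = r ` U}"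
 have FI: "r ` U:F" if "cosorted U" "card U = card V" "r:Rgrp X p" for U r
  unfolding F_def using that by blast
 have "F <= Pow X"
 proof
  fix Y assume "Y:F"
  then obtain U r where "U <= X" "r:Rgrp X p" "Y = r ` U"
   unfolding F_def cosorted_def by blast
  thus "Y:Pow X" using image_mono[of U X r] permutes_image[OF Rgrp_permutes] by blast
 qed
 hence finF: "finite F" by (rule finite_subset) simp
 have maximal: "Y = V" if Y: "Y:F" "!!Y'. Y':F ==> sum co Y' <= sum co Y" for Y
 proof -
  obtain U r where U: "cosorted U" "card U = card V" and r: "r:Rgrp X p" and Y_eq: "Y = r ` U"
   using Y(1) unfolding F_def by blast
  have rp: "r permutes X" by (rule Rgrp_permutes[OF r])
  have UX: "U <= X" using U(1) by (simp add: cosorted_def)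
  hence finU: "finite U" by (rule finite_subset) simp
  have YX: "Y <= X" using UX permutes_in_image[OF rp] by (auto simp: Y_eq)
  hence finY: "finite Y" by (rule finite_subset) simp
  have cardY: "card Y = card V"
   using U(2) card_image[OF inj_on_subset[OF permutes_inj_on[OF rp] subset_UNIV]] by (simp add: Y_eq)
  \<comment> \<open>Exchanging two elements of one row stays within \<open>F\<close>, so a maximal
    set occupies the rightmost places of each row.\<close>
  have a: "co y < co x"
   if xy: "x:Y" "y:X - Y" and row: "kk p x = kk p y" "rr p x = rr p y" for x y
  proof (rule ccontr)
   assume "~ co y < co x"
   moreover have "x:X" "y:X" "x ~= y" using xy YX by auto
   ultimately have less: "co x < co y" using row_mono[OF _ _ row] by blast
   have "transpose x y o r:Rgrp X p"
    using Rgrp_comp[OF Rgrp_transpose[OF `x:X` `y:X` row] r] .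
   hence "(transpose x y o r) ` U:F" by (rule FI[OF U])
   moreover have "(transpose x y o r) ` U = insert y (Y - {x})"
    unfolding image_comp[symmetric] Y_eq[symmetric] using xy by (auto simp: transpose_def image_iff)
   ultimately have "sum co (insert y (Y - {x})) <= sum co Y" using Y(2) by simp
   thus False using sum_insert_minus(1)[OF finY xy(1), of y co] xy(2) less by simp
  qed
  define row where "row x = {z:X. kk p z = kk p x & rr p z = rr p x}" for x
  have card_row: "card (Y Int row x) = card (U Int row x)" for x
  proof -
   have "Y Int row x = r ` (U Int row x)"
    using r UX permutes_in_image[OF rp] by (auto simp: Y_eq row_def Rgrp_def)
   thus ?thesis using card_image[OF inj_on_subset[OF permutes_inj_on[OF rp] subset_UNIV]] by simp
  qed
  have fin_row: "finite (row x)" for x by (simp add: row_def)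
  have row_co: "co x < co z \<longleftrightarrow> s x < s z" if "z:row x" "x:X" for x z
   using that by (intro co_row_less_iff) (auto simp: row_def)
  \<comment> \<open>If the index of x were smaller, counting the rows of x and y would give u in
    \<open>U\<close> and u' outside with i u <= i x < i y <= i u', against cosortedness of
    \<open>U\<close>.\<close>
  have b: "i y <= i x" if xy: "x:Y" "y:X - Y" for x y
  proof (rule ccontr)
   assume less: "~ i y <= i x"
   have x: "x:X" "x:row x" and y: "y:X" "y:row y" using xy YX by (auto simp: row_def)
   have "EX u:U Int row x. i u <= i x"
   proof (rule ccontr)
    assume "~ (EX u:U Int row x. i u <= i x)"
    hence *: "i x < i u" if "u:U Int row x" for u using that by (meson not_le)
    have "co x < co u" if u: "u:U Int row x" for u
    proof -
     have uX: "u:X" using u by (simp add: row_def)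
     have "~ s u < s x" using index_mono[OF uX x(1)] *[OF u] by auto
     moreover have "u ~= x" using *[OF u] by auto
     ultimately show ?thesis using row_co[of u x] s_inj[OF uX x(1)] u x by blast
    qed
    hence "U Int row x <= {z:row x. co x < co z}" by blast
    also have "... \<subset> {z:row x. co x <= co z}" using x by auto
    also have "... <= Y Int row x"
    proof
     fix z assume z: "z:{z:row x. co x <= co z}"
     thus "z:Y Int row x" using a[OF xy(1), of z] by (auto simp: row_def)
    qed
    finally have "U Int row x \<subset> Y Int row x" .
    hence "card (U Int row x) < card (Y Int row x)" using fin_row by (intro psubset_card_mono) auto
    thus False using card_row by simp
   qed
   then obtain u where u: "u:U" "i u <= i x" by blast
   have "EX u:row y - U. i y <= i u"
   proof (rule ccontr)
    assume "~ (EX u:row y - U. i y <= i u)"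
    hence *: "z:U" if "z:row y" "i y <= i z" for z using that by blast
    have "Y Int row y <= {z:row y. co y < co z}" using a[OF _ xy(2)] by (auto simp: row_def)
    also have "... \<subset> {z:row y. co y <= co z}" using y by auto
    also have "... <= U Int row y"
    proof
     fix z assume z: "z:{z:row y. co y <= co z}"
     hence zX: "z:X" by (simp add: row_def)
     have "i y <= i z"
     proof (cases "z = y")
      case False
      have "~ co z < co y" using z by simp
      hence "s y < s z" using row_mono[OF zX y(1) _ _ False] z by (auto simp: row_def)
      thus ?thesis using index_mono[OF y(1) zX] by blast
     qed simp
     thus "z:U Int row y" using * z by blast
    qed
    finally have "Y Int row y \<subset> U Int row y" .
    hence "card (Y Int row y) < card (U Int row y)" using fin_row by (intro psubset_card_mono) auto
    thus False using card_row by simp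
   qed
   then obtain u' where u': "u':X - U" "i y <= i u'" by (auto simp: row_def)
   have "i u' <= i u" using U(1) u(1) u'(1) unfolding cosorted_def by blast
   thus False using less u(2) u'(2) by simp
  qed
  have "upper Y" unfolding upper_def
  proof (intro conjI ballI YX)
   fix x y assume xy: "x:Y" "y:X - Y"
   hence x: "x:X" and y: "y:X" "y ~: Y" and ne: "x ~= y" using YX by auto
   show "s y < s x"
   proof (rule ccontr)
    assume "~ s y < s x"
    hence less: "s x < s y" using s_inj[OF x y(1) ne] by blast
    hence "i x = i y" using index_mono[OF x y(1)] b[OF xy] by simp
    hence co: "co x < co y" using index_eq[OF x y(1) less] by blast
    \<comment> \<open>When the indices tie, replacing x by y keeps the set cosorted and increases
      the sum of columns.\<close>
    have "cosorted (insert y (Y - {x}))" unfolding cosorted_def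
    proof (intro conjI ballI)
     show "insert y (Y - {x}) <= X" using YX y by blast
     fix x' y' assume x': "x':insert y (Y - {x})" and y': "y':X - insert y (Y - {x})"
     have "i x' = i x | x':Y" "i y' = i y | y':X - Y" using x' y' `i x = i y` by auto
     thus "i y' <= i x'"
      using b[of x' y'] b[of x y'] b[of x' y] xy `i x = i y` by (elim disjE) simp_all
    qed
    hence "id ` insert y (Y - {x}):F"
     using sum_insert_minus(2)[OF finY xy(1) y(2)] cardY by (intro FI Rgrp_id) auto
    hence "sum co (insert y (Y - {x})) <= sum co Y" using Y(2) by (simp only: image_id id_apply)
    thus False using sum_insert_minus(1)[OF finY xy(1) y(2), of co] co by simp
   qed
  qed
  thus ?thesis using upper_unique[OF _ V cardY] by blast
 qed
 have "F ~= {}" using FI[OF U r] by blast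
 have "Max (sum co ` F):sum co ` F" using finF `F ~= {}` by (intro Max_in) simp_all
 then obtain Y where Y: "Max (sum co ` F) = sum co Y" "Y:F" by (rule imageE)
 have Ymax: "sum co Y' <= sum co Y" if "Y':F" for Y'
  unfolding Y(1)[symmetric] using finF that by (intro Max_ge) simp_all
 have "Y = V" by (rule maximal[OF Y(2) Ymax])
 hence le: "sum co Y' <= sum co V" if "Y':F" for Y' using Ymax[OF that] by simp
 show ?thesis
 proof (intro conjI impI)
  show "sum co (r ` U) <= sum co V" by (rule le[OF FI[OF U r]])
  assume "sum co (r ` U) = sum co V"
  thus "r ` U = V" using le by (intro maximal[OF FI[OF U r]]) simp
 qed
qed

end

context standard_labelling
begin

lemma upper_level_set: assumes "!!x y. x:X ==> y:X ==> s x < s y ==> f x <= f y"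
 shows "upper {x:X. (j::nat) <= f x}" unfolding upper_def
proof (intro conjI ballI)
 fix x y assume xy: "x:{x:X. j <= f x}" "y:X - {x:X. j <= f x}"
 hence "~ f x <= f y" "x ~= y" by auto
 thus "s y < s x" using s_inj[of x y] assms[of x y] xy by auto
qed auto

text \<open>
 Among all row rearrangements of \<open>i + e\<close>, for \<open>e\<close> running through the rearrangements of \<open>g\<close>, the
 vector \<open>i + g\<close> has the largest sum of squares and then the largest sum weighted by the columns,
 and it is the only one attaining both.
\<close>

lemma leading_exponent: assumes a: "a permutes X" "!!x. x:X ==> g x = e (a x)"
  and g: "!!x y. x:X ==> y:X ==> s x < s y ==> g x <= g y"
  and r: "r:Rgrp X p" and b: "!!x. x:X ==> b (r x) = i x + e x"
 shows "(SUM x:X. b x * b x) <= (SUM x:X. (i x + g x) * (i x + g x))"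
  and "(SUM x:X. b x * b x) = (SUM x:X. (i x + g x) * (i x + g x)) ==>
   (SUM x:X. co x * b x) <= (SUM x:X. co x * (i x + g x))"
  and "(SUM x:X. b x * b x) = (SUM x:X. (i x + g x) * (i x + g x)) ==>
   (SUM x:X. co x * b x) = (SUM x:X. co x * (i x + g x)) ==> y:X ==> b y = i y + g y"
proof -
 have rp: "r permutes X" by (rule Rgrp_permutes[OF r])
 note r_sum = sum.reindex_bij_betw[OF permutes_imp_bij[OF rp]]
  and a_sum = sum.reindex_bij_betw[OF permutes_imp_bij[OF a(1)]]
 define M where "M = (SUM x:X. i x + e x + g x)"
 have M: "i x + e x + g x <= M" if "x:X" for x
  unfolding M_def using that by (intro member_le_sum) auto
 define U V I where "U j = {x:X. j <= e x}" and "V j = {x:X. j <= g x}"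
  and "I j = {x:X. j <= i x}" for j
 have V: "upper (V j)" for j unfolding V_def by (rule upper_level_set) (rule g)
 have I: "upper (I j)" for j unfolding I_def by (rule upper_level_set) (rule index_mono)
 have UX: "U j <= X" and IX: "I j <= X" for j by (auto simp: U_def I_def)
 have card: "card (U j) = card (V j)" for j
 proof -
  have "U j = a ` V j"
  proof (intro equalityI subsetI)
   fix x assume x: "x:U j"
   have "inv a x:X" using x permutes_in_image[OF permutes_inv[OF a(1)], of x] by (simp add: U_def)
   thus "x:a ` V j" using x a(2)[of "inv a x"] permutes_inverses(1)[OF a(1), of x]
    by (intro image_eqI[of _ _ "inv a x"]) (simp_all add: U_def V_def)
  next
   fix x assume "x:a ` V j"
   then obtain z where "x = a z" "z:X" "j <= g z" by (auto simp: V_def)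
   thus "x:U j" using a(2)[of z] permutes_in_image[OF a(1), of z] by (simp add: U_def)
  qed
  thus ?thesis using card_image[OF inj_on_subset[OF permutes_inj_on[OF a(1)] subset_UNIV]] by simp
 qed
 \<comment> \<open>Only the mixed term depends on how \<open>e\<close> is arranged. By the layer
   cake formula it is compared through the sums of \<open>i\<close> over level sets.\<close>
 have sq: "(SUM x:X. b x * b x) = (SUM x:X. i x * i x) + 2 * (SUM x:X. i x * e x) + (SUM x:X. g x * g x)"
 proof -
  have "(SUM x:X. b x * b x) = (SUM x:X. b (r x) * b (r x))" by (rule r_sum[symmetric])
  also have "... = (SUM x:X. i x * i x + 2 * (i x * e x) + e x * e x)"
   by (intro sum.cong refl) (simp add: b algebra_simps)
  also have "... = (SUM x:X. i x * i x) + 2 * (SUM x:X. i x * e x) + (SUM x:X. e x * e x)"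
   by (simp add: sum.distrib sum_distrib_left)
  also have "(SUM x:X. e x * e x) = (SUM x:X. e (a x) * e (a x))"
   by (rule a_sum[symmetric])
  also have "... = (SUM x:X. g x * g x)" by (intro sum.cong refl) (simp add: a(2))
  finally show ?thesis .
 qed
 have sq': "(SUM x:X. (i x + g x) * (i x + g x))
   = (SUM x:X. i x * i x) + 2 * (SUM x:X. i x * g x) + (SUM x:X. g x * g x)"
  unfolding sum_distrib_left sum.distrib[symmetric] by (intro sum.cong refl) (simp add: algebra_simps)
 have layer: "(SUM x:X. w x * e x) = (SUM j:{1..M}. sum w (U j))"
  "(SUM x:X. w x * g x) = (SUM j:{1..M}. sum w (V j))"
  "(SUM x:X. w x * i x) = (SUM j:{1..M}. sum w (I j))" for w
 proof -
  have "i x <= M" "e x <= M" "g x <= M" if "x:X" for x using M[OF that] by simp_all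
  note le = this
  show "(SUM x:X. w x * e x) = (SUM j:{1..M}. sum w (U j))"
   unfolding U_def by (rule layer_cake[OF finite_atLeastAtMost le(2)])
  show "(SUM x:X. w x * g x) = (SUM j:{1..M}. sum w (V j))"
   unfolding V_def by (rule layer_cake[OF finite_atLeastAtMost le(3)])
  show "(SUM x:X. w x * i x) = (SUM j:{1..M}. sum w (I j))"
   unfolding I_def by (rule layer_cake[OF finite_atLeastAtMost le(1)])
 qed
 have le: "sum i (U j) <= sum i (V j)" for j by (rule sum_index_le[OF V UX card])
 have le_sum: "(SUM x:X. i x * e x) <= (SUM x:X. i x * g x)"
  unfolding layer by (rule sum_mono) (rule le)
 thus "(SUM x:X. b x * b x) <= (SUM x:X. (i x + g x) * (i x + g x))" unfolding sq sq' by simp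
 assume eq1: "(SUM x:X. b x * b x) = (SUM x:X. (i x + g x) * (i x + g x))"
 hence "(SUM j:{1..M}. sum i (U j)) = (SUM j:{1..M}. sum i (V j))" unfolding sq sq' layer by simp
 hence "sum i (U j) = sum i (V j)" if "j:{1..M}" for j
  using that by (rule sum_le_eq_imp_eq[OF finite_atLeastAtMost le])
 hence cos: "cosorted (U j)" if "j:{1..M}" for j
  using that by (intro sum_index_eq_imp_cosorted[OF V UX card]) blast
 note rI = sum_co_rearrangement[OF I upper_cosorted[OF I] refl r]
  and rU = sum_co_rearrangement[OF V cos card r]
 \<comment> \<open>In the sum weighted by columns, \<open>i\<close> and \<open>e\<close> contribute
   separately, each through the images under \<open>r\<close> of its level sets.\<close>
 have co_sum: "(SUM x:X. co x * b x) = (SUM j:{1..M}. sum co (r ` I j)) + (SUM j:{1..M}. sum co (r ` U j))"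
 proof -
  have im: "sum (%x. co (r x)) A = sum co (r ` A)" for A
   using sum.reindex[OF inj_on_subset[OF permutes_inj_on[OF rp] subset_UNIV], of co A] by (simp add: o_def)
  have "(SUM x:X. co x * b x) = (SUM x:X. co (r x) * b (r x))" by (rule r_sum[symmetric])
  also have "... = (SUM x:X. co (r x) * i x) + (SUM x:X. co (r x) * e x)"
   unfolding sum.distrib[symmetric] by (intro sum.cong refl) (simp add: b algebra_simps)
  finally show ?thesis unfolding layer im .
 qed
 have co_sum': "(SUM x:X. co x * (i x + g x)) = (SUM j:{1..M}. sum co (I j)) + (SUM j:{1..M}. sum co (V j))"
  unfolding layer[symmetric] sum.distrib[symmetric] by (intro sum.cong refl) (simp add: algebra_simps)
 have leI: "(SUM j:{1..M}. sum co (r ` I j)) <= (SUM j:{1..M}. sum co (I j))"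
  using rI by (intro sum_mono) blast
 have leU: "(SUM j:{1..M}. sum co (r ` U j)) <= (SUM j:{1..M}. sum co (V j))"
  using rU by (intro sum_mono) blast
 show "(SUM x:X. co x * b x) <= (SUM x:X. co x * (i x + g x))"
  unfolding co_sum co_sum' using leI leU by simp
 assume eq2: "(SUM x:X. co x * b x) = (SUM x:X. co x * (i x + g x))" and y: "y:X"
 have eqI: "(SUM j:{1..M}. sum co (r ` I j)) = (SUM j:{1..M}. sum co (I j))"
  and eqU: "(SUM j:{1..M}. sum co (r ` U j)) = (SUM j:{1..M}. sum co (V j))"
  using eq2 leI leU unfolding co_sum co_sum' by linarith+
 have tI: "r ` I j = I j" if "j:{1..M}" for j
 proof -
  have "sum co (r ` I j) = sum co (I j)" using rI by (intro sum_le_eq_imp_eq[OF _ _ eqI that]) simp_all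
  thus ?thesis using rI by blast
 qed
 have tU: "r ` U j = V j" if "j:{1..M}" for j
 proof -
  have "sum co (r ` U j) = sum co (V j)" using rU by (intro sum_le_eq_imp_eq[OF _ _ eqU that]) simp_all
  thus ?thesis using rU[OF that] by blast
 qed
 define x where "x = inv r y"
 have x: "x:X" "r x = y" unfolding x_def using y permutes_in_image[OF permutes_inv[OF rp], of y]
  by (simp_all only: permutes_inverses[OF rp])
 have mem: "r x:r ` A \<longleftrightarrow> x:A" for A
  using permutes_inj[OF rp] by (rule inj_image_mem_iff)
 have level_eq: "u = v" if "u <= M" "v <= M" "!!j. j:{1..M} ==> j <= u \<longleftrightarrow> j <= v" for u v :: nat
  using that(1,2) that(3)[of u] that(3)[of v] by (cases "u = 0"; cases "v = 0") auto
 have "i x = i y"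
 proof (rule level_eq)
  show "i x <= M" "i y <= M" using M[OF x(1)] M[OF y] by simp_all
  fix j assume "j:{1..M}"
  from tI[OF this] show "j <= i x \<longleftrightarrow> j <= i y" using mem[of "I j"] x y by (simp add: I_def)
 qed
 moreover have "e x = g y"
 proof (rule level_eq)
  show "e x <= M" "g y <= M" using M[OF x(1)] M[OF y] by simp_all
  fix j assume j: "j:{1..M}"
  have "x:U j \<longleftrightarrow> y:V j" using mem[of "U j"] x(2) tU[OF j] by simp
  thus "j <= e x \<longleftrightarrow> j <= g y" using x(1) y by (simp add: U_def V_def)
 qed
 ultimately show "b y = i y + g y" using b[OF x(1)] x(2) by simp
qed

lemma sorting_permutation: fixes e :: "nat => nat"
 obtains r where "r permutes X" "!!x y. x:X ==> y:X ==> s x < s y ==> e (r x) <= e (r y)"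
proof -
 define xs where "xs = sort_key e [1..<n + 1]"
 have xs: "set xs = X" "length xs = n" "distinct xs" "sorted (map e xs)" by (auto simp: xs_def)
 \<comment> \<open>Labels start at 1 and list positions at 0.\<close>
 define r where "r x = (if x:X then xs ! (s x - 1) else x)" for x
 have sX: "s x - 1 < n" "1 <= s x" if "x:X" for x using bij_betw_apply[OF s_bij that] by auto
 have "bij_betw (%x. s x - 1) X {..<n}"
 proof (rule bij_betw_imageI)
  show "inj_on (%x. s x - 1) X"
  proof (rule inj_onI)
   fix x y assume xy: "x:X" "y:X" "s x - 1 = s y - 1"
   hence "s x = s y" using sX(2)[OF xy(1)] sX(2)[OF xy(2)] by linarith
   thus "x = y" using s_inj[OF xy(1,2)] by auto
  qed
  thus "(%x. s x - 1) ` X = {..<n}" using sX(1) by (intro card_subset_eq) (auto simp: card_image)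
 qed
 moreover have "bij_betw ((!) xs) {..<n} X" using bij_betw_nth[OF xs(3)] xs by auto
 ultimately have "bij_betw ((!) xs o (%x. s x - 1)) X X" by (rule bij_betw_trans)
 moreover have "r x = ((!) xs o (%x. s x - 1)) x" if "x:X" for x using that by (simp add: r_def)
 ultimately have "bij_betw r X X"
  using bij_betw_cong[of X r "(!) xs o (%x. s x - 1)" X] by blast
 moreover have "r x = x" if "x ~: X" for x using that by (simp only: r_def if_False)
 ultimately have "r permutes X" by (rule bij_imp_permutes)
 moreover have "e (r x) <= e (r y)" if "x:X" "y:X" "s x < s y" for x y
 proof -
  have "map e xs ! (s x - 1) <= map e xs ! (s y - 1)"
   using sX[OF that(1)] sX[OF that(2)] that(3) xs(2) by (intro sorted_nth_mono[OF xs(4)]) auto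
  thus ?thesis using sX[OF that(1)] sX[OF that(2)] that xs(2) by (simp add: r_def)
 qed
 ultimately show ?thesis by (rule that)
qed

text \<open>Since \<open>g\<close> grows weakly with the labels and equal indices force increasing
  columns, the labelling is recovered from i + g by breaking ties with the column order.\<close>

lemma label_order: assumes g: "!!x y. x:X ==> y:X ==> s x < s y ==> g x <= g y"
  and x: "x:X" and y: "y:X"
 shows "s x < s y \<longleftrightarrow> i x + g x < i y + g y | (i x + g x = i y + g y & co x < co y)"
proof -
 have 1: "i u + g u < i v + g v | (i u + g u = i v + g v & co u < co v)"
  if "u:X" "v:X" "s u < s v" for u v using index_mono[OF that] g[OF that] index_eq[OF that] by linarith
 have "s x < s y | s y < s x | x = y" using s_inj[OF x y] by blast
 thus ?thesis using 1[OF x y] 1[OF y x] by (elim disjE) auto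
qed

lemma label_eq_card: "x:X ==> s x = card {y:X. s y < s x} + 1"
proof -
 assume x: "x:X"
 have "s ` {y:X. s y < s x} = {1..<s x}"
 proof (intro equalityI subsetI)
  fix z assume z: "z:{1..<s x}"
  hence "z:s ` X" using bij_betw_apply[OF s_bij x] bij_betw_imp_surj_on[OF s_bij] by auto
  thus "z:s ` {y:X. s y < s x}" using z by auto
 next
  fix z assume "z:s ` {y:X. s y < s x}"
  thus "z:{1..<s x}" using bij_betw_apply[OF s_bij] by auto
 qed
 moreover have "card (s ` {y:X. s y < s x}) = card {y:X. s y < s x}"
  by (rule card_image[OF inj_on_subset[OF bij_betw_imp_inj_on[OF s_bij]]]) auto
 moreover have "1 <= s x" using bij_betw_apply[OF s_bij x] by simp
 ultimately show "s x = card {y:X. s y < s x} + 1" by simp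
qed

end

lemma standardization_unique: assumes "standard_labelling n p co s i" "standard_labelling n p co s' i'"
  and c: "!!x y. x:{1..n} ==> y:{1..n} ==> s x < s y ==> c x <= c y"
  and c': "!!x y. x:{1..n} ==> y:{1..n} ==> s' x < s' y ==> c' x <= c' y"
  and eq: "!!x. x:{1..n} ==> i x + c x = i' x + c' x" and x: "x:{1..n}" shows "s x = s' x"
proof -
 interpret S: standard_labelling n p co s i by fact
 interpret S': standard_labelling n p co s' i' by fact
 have "s y < s x \<longleftrightarrow> s' y < s' x" if y: "y:{1..n}" for y
  using S.label_order[OF c y x] S'.label_order[OF c' y x] eq[OF x] eq[OF y] by simp
 hence "{y:{1..n}. s y < s x} = {y:{1..n}. s' y < s' x}" by blast
 thus ?thesis using S.label_eq_card[OF x] S'.label_eq_card[OF x] by simp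
qed

text \<open>Within a column the rows are ranked by \<open>b\<close> and also by \<open>b'\<close>;
  hence \<open>g\<close> preserves ranks, and the rank is the row.\<close>

lemma column_strict_unique: assumes dia: "diagram X p" and g: "g:Cgrp X p"
  and b: "!!x. x:X ==> b (g x) = (b' x :: nat)"
  and inc: "!!x y. x:X ==> y:X ==> kk p x = kk p y ==> cc p x = cc p y ==> rr p x < rr p y ==> b x < b y"
   "!!x y. x:X ==> y:X ==> kk p x = kk p y ==> cc p x = cc p y ==> rr p x < rr p y ==> b' x < b' y"
 shows "g = id"
proof
 fix x
 show "g x = id x"
 proof (cases "x:X")
  case False
  moreover have "g permutes X" using g by (simp add: Cgrp_def)
  ultimately show ?thesis by (simp add: permutes_not_in)
 next
  case x: True
  have gp: "g permutes X" and pres: "!!x. x:X ==> kk p (g x) = kk p x & cc p (g x) = cc p x"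
   using g by (simp_all add: Cgrp_def)
  let ?K = "colset X p (kk p x) (cc p x)"
  have xK: "x:?K" using x by (simp add: colset_def)
  have KX: "y:X" "kk p y = kk p x" "cc p y = cc p x" if "y:?K" for y using that by (simp_all add: colset_def)
  have gK: "g y:?K" if "y:?K" for y
   using KX[OF that] pres[OF KX(1)[OF that]] permutes_in_image[OF gp, of y] by (simp add: colset_def)
  have row_iff: "rr p (g y) < rr p (g z) \<longleftrightarrow> rr p y < rr p z" if yz: "y:?K" "z:?K" for y z
  proof -
   note y = KX[OF yz(1)] and z = KX[OF yz(2)] and sy = KX[OF gK[OF yz(1)]] and sz = KX[OF gK[OF yz(2)]]
   have 1: "rr p u < rr p v | rr p v < rr p u | u = v" if "u:?K" "v:?K" for u v
    using position_inj[OF dia, of u v] KX[OF that(1)] KX[OF that(2)] by (cases "rr p u = rr p v") auto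
   have 2: "rr p u < rr p v \<longleftrightarrow> b u < b v" if uv: "u:?K" "v:?K" for u v
    using 1[OF uv] inc(1)[of u v] inc(1)[of v u] KX[OF uv(1)] KX[OF uv(2)] by auto
   have 3: "rr p u < rr p v \<longleftrightarrow> b' u < b' v" if uv: "u:?K" "v:?K" for u v
    using 1[OF uv] inc(2)[of u v] inc(2)[of v u] KX[OF uv(1)] KX[OF uv(2)] by auto
   show ?thesis using 2[OF gK[OF yz(1)] gK[OF yz(2)]] 3[OF yz] b[OF y(1)] b[OF z(1)] by simp
  qed
  have row_card: "card {y:?K. rr p y < rr p z} = rr p z" if "z:?K" for z
  proof -
   have "rr p z:(%x. rr p x) ` ?K" using that by (rule imageI)
   hence "rr p z < card ?K" unfolding row_image_colset[OF dia] by simp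
   thus ?thesis unfolding card_colset_less[OF dia] by simp
  qed
  have "{y:?K. rr p y < rr p (g x)} = g ` {y:?K. rr p y < rr p x}"
  proof (intro equalityI subsetI)
   fix y assume y: "y:{y:?K. rr p y < rr p (g x)}"
   have yK: "y:?K" using y by blast
   have "inv g y:X" using KX(1)[OF yK] by (simp only: permutes_in_image[OF permutes_inv[OF gp]])
   moreover have "kk p (inv g y) = kk p y & cc p (inv g y) = cc p y"
    using Cgrp_inv[OF g] KX(1)[OF yK] unfolding Cgrp_def by blast
   ultimately have inv: "inv g y:?K" using KX(2,3)[OF yK] by (simp add: colset_def)
   have "g (inv g y) = y" by (rule permutes_inverses(1)[OF gp])
   thus "y:g ` {y:?K. rr p y < rr p x}"
    using inv y row_iff[OF inv xK] by (intro image_eqI[of _ _ "inv g y"]) (simp_all only: mem_Collect_eq)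
  next
   fix y assume "y:g ` {y:?K. rr p y < rr p x}"
   then obtain z where "z:?K" "rr p z < rr p x" "y = g z" by auto
   thus "y:{y:?K. rr p y < rr p (g x)}" using gK row_iff[OF _ xK] by simp
  qed
  hence "card {y:?K. rr p y < rr p (g x)} = card {y:?K. rr p y < rr p x}"
   using card_image[OF inj_on_subset[OF permutes_inj_on[OF gp] subset_UNIV]] by simp
  hence "rr p (g x) = rr p x" by (simp only: row_card[OF gK[OF xK]] row_card[OF xK])
  thus ?thesis using position_inj[OF dia KX(1)[OF gK[OF xK]] x] pres[OF x] by simp
 qed
qed

section \<open>Independence over the invariants for a fixed shape\<close>

section \<open>Independence over the invariants\<close>

definition expo :: "nat => (nat => nat) => (nat \<Rightarrow>\<^sub>0 nat)" where
 "expo n a = (SUM x:{1..n}. Poly_Mapping.single x (a x))"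

lemma coef_expo: "coef (expo n a) x = (if x:{1..n} then a x else 0)" by (simp add: expo_def coef_sum_single)

lemma keys_expo: "keys (expo n a) <= {1..n}"
 by (auto simp: in_keys_iff coef_expo split: if_splits)

lemma expo_eq_iff: "expo n a = expo n b \<longleftrightarrow> (ALL x:{1..n}. a x = b x)"
 unfolding poly_mapping_eq_iff fun_eq_iff coef_expo by auto

lemma eq_expo: assumes "keys m <= {1..n}" shows "m = expo n (coef m)"
proof (rule poly_mapping_eqI)
 fix x
 show "coef m x = coef (expo n (coef m)) x" using assms by (auto simp: coef_expo in_keys_iff)
qed

lemma expo_add: "expo n a + expo n b = expo n (%x. a x + b x)"
 by (rule poly_mapping_eqI) (simp add: lookup_add coef_expo)

lemma pm_expo: assumes "g permutes {1..n}" shows "pm g (expo n a) = expo n (%x. a (g x))"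
 using permutes_in_image[OF assms]
 by (intro poly_mapping_eqI) (simp add: coef_pm permutes_inj[OF assms] coef_expo)

lemma mdeg_expo: "mdeg (expo n a) = (SUM x:{1..n}. a x)"
 by (subst mdeg_superset[OF _ keys_expo]) (auto simp: coef_expo)

lemma coef_mult_mon_add: "coef (g * mon q) (r + q) = coef g r"
proof (rule linear_eq_on_mon[where p = g])
 show "linear (%g. coef (g * mon q) (r + q))"
  using linear_compose[OF linear_mult_right_rpoly linear_coef] by (simp add: o_def)
 show "linear (%g. coef g r :: real)" by (rule linear_coef)
 show "coef (mon m * mon q) (r + q) = coef (mon m) r" for m by (simp add: mon_mult lookup_single when_def)
qed

lemma coef_mult_mon_nonzero: assumes "coef (g * mon q) k ~= 0"
 obtains r where "k = r + q" "coef g r ~= 0"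
proof -
 obtain r b where "k = r + b" "coef g r ~= 0" "coef (mon q) b ~= 0" using assms by (rule coef_mult_nonzero)
 thus ?thesis using that by (auto simp: lookup_single when_def split: if_splits)
qed

text \<open>The variables of the invariants are the \<open>X\<^sub>x\<^sup>m\<close> with \<open>m = mult_c c\<close>; in type \<open>B\<close>, the
 entries of the second component contribute one more factor \<open>X\<^sub>x\<close>.\<close>

definition mult_c :: "cox_type => nat" where
 "mult_c c = (if c = TypeB then 2 else 1)"

definition offs :: "cox_type => (nat => position) => nat => nat" where
 "offs c p x = (if c = TypeB & kk p x = 1 then 1 else 0)"

lemma mult_c_pos: "0 < mult_c c" by (simp add: mult_c_def)

text \<open>In type B a single sign change fixes the invariant, so odd exponents cannot
  occur.\<close>

lemma invariant_exponents: assumes g: "g:invariants n (refl_group c n)" and m: "coef g m ~= 0"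
 shows "m = expo n (%x. mult_c c * (coef m x div mult_c c))"
proof -
 have keys: "keys m <= {1..n}" using g m by (auto simp: invariants_def poly_ring_iff)
 have "mult_c c dvd coef m x" if x: "x:{1..n}" for x
 proof (cases c)
  case TypeB
  have "(id, {x}):refl_group c n" using x by (simp add: TypeB permutes_id)
  hence "act (id, {x}) g = g" using g by (simp add: invariants_def)
  hence "sg {x} m * coef g m = coef g m" using coef_act[of id "{x}" g m] by simp
  hence "sg {x} m = 1" using m by simp
  hence "even (coef m x)" by (cases "even (coef m x)") (simp_all add: sg_def)
  thus ?thesis by (simp add: mult_c_def TypeB)
 qed (simp add: mult_c_def)
 hence "expo n (coef m) = expo n (%x. mult_c c * (coef m x div mult_c c))" unfolding expo_eq_iff by simp
 thus ?thesis using eq_expo[OF keys] by simp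
qed

lemma invariant_coef_pm: assumes "g:invariants n (refl_group c n)" "s permutes {1..n}"
 shows "coef g (pm s m) = coef g m"
proof -
 have "act (s, {}) g = g"
  using assms permutation_in_refl_group[OF assms(2)] by (auto simp: invariants_def)
 thus ?thesis using coef_act[OF permutes_bij[OF assms(2)], of "{}" g m] by simp
qed

lemma coef_Cop_Rop: assumes "diagram {1..n} p" shows "coef (CR n p h) e
  = (SUM g:Cgrp {1..n} p. SUM u:Rgrp {1..n} p. real_of_int (sign g) * coef h (pm u (pm g e)))"
 unfolding Cop_def Rop_def lookup_sum act_sum
 using permutes_bij[OF Cgrp_permutes] permutes_bij[OF Rgrp_permutes]
 by (intro sum.cong refl) (simp add: lookup_sum coef_act sum_distrib_left)

text \<open>Among the vectors index plus sorted invariant exponent, take one with the largest sum of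
  squares and then the largest sum weighted by columns. At the corresponding exponent only its own
  labelling contributes, with the trivial column permutation and without cancellation, so the
  coefficient of the relation there is nonzero.\<close>

theorem leading_independence: fixes s i :: "'a => nat => nat" and g :: "'a => rpoly"
 assumes std: "!!S. S:I ==> standard_labelling n p co (s S) (i S)" and fin: "finite I"
  and label: "!!S S'. S:I ==> S':I ==> (!!x. x:{1..n} ==> s S x = s S' x) ==> S = S'"
  and g: "!!S. S:I ==> g S:invariants n (refl_group c n)"
  and rel: "(SUM S:I. g S * CR n p (mon (expo n (%x. mult_c c * i S x + offs c p x)))) = 0"
  and S: "S:I" shows "g S = 0"
proof (rule ccontr)
 assume gS: "g S ~= 0"
 let ?X = "{1..n}" and ?m = "mult_c c"
 interpret St: standard_labelling n p co "s S" "i S" by (rule std[OF S])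
 note dia = St.dia
 \<comment> \<open>With a monomial an invariant contains all its rearrangements; those sorted along
   the labels serve as representatives.\<close>
 define sorted_exp where "sorted_exp S m \<longleftrightarrow> (ALL x:?X. ALL y:?X. s S x < s S y --> coef m x <= coef m y)" for S and m :: "nat \<Rightarrow>\<^sub>0 nat"
 define Supp where "Supp = (SIGMA S:I. {m:keys (g S). sorted_exp S m})"
 define bb where "bb z x = i (fst z) x + coef (snd z) x div ?m" for z :: "'a \<times> (nat \<Rightarrow>\<^sub>0 nat)" and x
 define \<Phi>1 where "\<Phi>1 b = (SUM x:?X. b x * b x)" for b :: "nat => nat"
 define \<Phi>2 where "\<Phi>2 b = (SUM x:?X. co x * b x)" for b :: "nat => nat"
 have finS: "finite Supp" unfolding Supp_def using fin by (intro finite_SigmaI) auto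
 have sort: "EX \<pi>. \<pi> permutes ?X & (S', pm \<pi> m):Supp" if S': "S':I" and m: "coef (g S') m ~= 0" for S' m
 proof -
  interpret S': standard_labelling n p co "s S'" "i S'" by (rule std[OF S'])
  obtain \<pi> where \<pi>: "\<pi> permutes ?X"
   "!!x y. x:?X ==> y:?X ==> s S' x < s S' y ==> coef m (\<pi> x) <= coef m (\<pi> y)"
   by (rule S'.sorting_permutation[of "coef m"]) (rule that)
  have "coef (g S') (pm \<pi> m) ~= 0" using m invariant_coef_pm[OF g[OF S'] \<pi>(1), of m] by simp
  moreover have "sorted_exp S' (pm \<pi> m)" using \<pi> by (simp add: sorted_exp_def coef_pm permutes_inj)
  ultimately show ?thesis using S' by (intro exI[of _ \<pi>] conjI \<pi>(1)) (simp add: Supp_def in_keys_iff)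
 qed
 obtain m where "coef (g S) m ~= 0" using gS by (metis poly_mapping_eqI lookup_zero)
 hence "Supp ~= {}" using sort[OF S] by blast
 define M1 where "M1 = Max ((%z. \<Phi>1 (bb z)) ` Supp)"
 have "M1:(%z. \<Phi>1 (bb z)) ` Supp"
  unfolding M1_def using finS `Supp ~= {}` by (intro Max_in) simp_all
 hence ne: "{z:Supp. \<Phi>1 (bb z) = M1} ~= {}" by auto
 define M2 where "M2 = Max ((%z. \<Phi>2 (bb z)) ` {z:Supp. \<Phi>1 (bb z) = M1})"
 have "M2:(%z. \<Phi>2 (bb z)) ` {z:Supp. \<Phi>1 (bb z) = M1}"
  unfolding M2_def using finS ne by (intro Max_in) simp_all
 then obtain z0 where z0: "z0:Supp" "\<Phi>1 (bb z0) = M1" "\<Phi>2 (bb z0) = M2" by auto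
 have max1: "\<Phi>1 (bb z) <= M1" if "z:Supp" for z
  unfolding M1_def using finS that by (intro Max_ge) simp_all
 have max2: "\<Phi>2 (bb z) <= M2" if "z:Supp" "\<Phi>1 (bb z) = M1" for z
  unfolding M2_def using finS that by (intro Max_ge) simp_all
 obtain S0 m0 where z0_eq: "z0 = (S0, m0)" by (cases z0)
 have S0: "S0:I" and m0: "coef (g S0) m0 ~= 0" "sorted_exp S0 m0"
  using z0(1) by (simp_all add: Supp_def z0_eq in_keys_iff)
 define b where "b = bb z0"
 define a where "a S = expo n (%x. ?m * i S x + offs c p x)" for S
 \<comment> \<open>The exponent at which the relation is tested. It arises from the maximal pair
   \<open>z0\<close>, rescaled by \<open>mult_c c\<close> and shifted by the parities of the
   components.\<close>
 define e where "e = expo n (%x. ?m * b x + offs c p x)"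
 define h where "h S = g S * mon (a S)" for S
 interpret S0: standard_labelling n p co "s S0" "i S0" by (rule std[OF S0])
 have m0_expo: "m0 = expo n (%x. ?m * (coef m0 x div ?m))" by (rule invariant_exponents[OF g[OF S0] m0(1)])
 have e_split: "e = m0 + a S0"
  by (subst m0_expo) (simp add: e_def a_def expo_add b_def bb_def z0_eq algebra_simps)
 have b_strict: "b x < b y" if "x:?X" "y:?X" "kk p x = kk p y" "cc p x = cc p y" "rr p x < rr p y" for x y
 proof -
  have lt: "i S0 x < i S0 y" by (rule S0.col_mono[OF that])
  have "~ s S0 y < s S0 x" using S0.index_mono[OF that(2,1)] lt by auto
  moreover have "x ~= y" using lt by auto
  ultimately have "s S0 x < s S0 y" using S0.s_inj[OF that(1,2)] by blast
  hence "coef m0 x <= coef m0 y" using m0(2) that(1,2) unfolding sorted_exp_def by blast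
  thus ?thesis using lt div_le_mono[of "coef m0 x" "coef m0 y" ?m] by (simp add: b_def bb_def z0_eq)
 qed
 \<comment> \<open>Sorting the invariant exponent of any contribution gives an element of
   \<open>Supp\<close> at least as large as \<open>z0\<close>. Maximality turns both inequalities of
   \<open>leading_exponent\<close> into equalities, and then column strictness and the recovery of
   labels leave no choice.\<close>
 have key: "S' = S0 & \<sigma> = id & coef (h S') (pm \<tau> (pm \<sigma> e)) = coef (g S0) m0"
  if S': "S':I" and \<sigma>: "\<sigma>:Cgrp ?X p" and \<tau>: "\<tau>:Rgrp ?X p"
   and nz: "coef (h S') (pm \<tau> (pm \<sigma> e)) ~= 0" for S' \<sigma> \<tau>
 proof -
  interpret S': standard_labelling n p co "s S'" "i S'" by (rule std[OF S'])
  note \<sigma>p = Cgrp_permutes[OF \<sigma>] and \<tau>p = Rgrp_permutes[OF \<tau>]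
  have \<tau>X: "\<tau> x:?X" if "x:?X" for x using that by (simp only: permutes_in_image[OF \<tau>p])
  have offs: "offs c p (\<sigma> (\<tau> x)) = offs c p x" if "x:?X" for x
   using \<sigma> \<tau> \<tau>X[OF that] that by (simp add: Cgrp_def Rgrp_def offs_def)
  obtain r where r: "pm \<tau> (pm \<sigma> e) = r + a S'" "coef (g S') r ~= 0"
   using nz unfolding h_def by (rule coef_mult_mon_nonzero)
  define \<delta> where "\<delta> x = coef r x div ?m" for x
  have r_expo: "r = expo n (%x. ?m * \<delta> x)"
   unfolding \<delta>_def by (rule invariant_exponents[OF g[OF S'] r(2)])
  have "expo n (%x. ?m * b (\<sigma> (\<tau> x)) + offs c p (\<sigma> (\<tau> x))) = r + a S'"
   using r(1) by (simp add: e_def pm_expo[OF \<sigma>p] pm_expo[OF \<tau>p])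
  hence "expo n (%x. ?m * b (\<sigma> (\<tau> x)) + offs c p (\<sigma> (\<tau> x)))
    = expo n (%x. ?m * \<delta> x + (?m * i S' x + offs c p x))" by (simp only: r_expo a_def expo_add)
  hence ex: "ALL x:?X. ?m * b (\<sigma> (\<tau> x)) + offs c p (\<sigma> (\<tau> x)) = ?m * \<delta> x + (?m * i S' x + offs c p x)"
   by (simp only: expo_eq_iff)
  have "?m * b (\<sigma> (\<tau> x)) = ?m * (i S' x + \<delta> x)" if "x:?X" for x
   using offs[OF that] bspec[OF ex that] by (simp only: distrib_left)
  hence b\<sigma>: "b (\<sigma> (\<tau> x)) = i S' x + \<delta> x" if "x:?X" for x
   using that mult_c_pos[of c] by simp
  obtain \<pi> where \<pi>: "\<pi> permutes ?X" "(S', pm \<pi> r):Supp" using sort[OF S' r(2)] by blast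
  define \<gamma> where "\<gamma> x = \<delta> (\<pi> x)" for x
  have sorted: "sorted_exp S' (pm \<pi> r)" using \<pi>(2) by (simp add: Supp_def)
  have \<gamma>_mono: "\<gamma> x <= \<gamma> y" if "x:?X" "y:?X" "s S' x < s S' y" for x y
  proof -
   have "coef (pm \<pi> r) x <= coef (pm \<pi> r) y" using sorted that unfolding sorted_exp_def by blast
   thus ?thesis by (simp add: \<gamma>_def \<delta>_def coef_pm permutes_inj[OF \<pi>(1)] div_le_mono)
  qed
  have bb_eq: "bb (S', pm \<pi> r) = (%x. i S' x + \<gamma> x)"
   by (rule ext) (simp add: bb_def \<gamma>_def \<delta>_def coef_pm permutes_inj[OF \<pi>(1)])
  note lead = S'.leading_exponent[of \<pi> \<gamma> \<delta> \<tau> "%x. b (\<sigma> x)", OF \<pi>(1) \<gamma>_def _ \<tau> b\<sigma>]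
  have \<Phi>1\<sigma>: "(SUM x:?X. b (\<sigma> x) * b (\<sigma> x)) = M1"
   using sum.reindex_bij_betw[OF permutes_imp_bij[OF \<sigma>p], of "%x. b x * b x"] z0(2)
   by (simp add: \<Phi>1_def b_def)
  have \<Phi>2\<sigma>: "(SUM x:?X. co x * b (\<sigma> x)) = M2"
  proof -
   have "(SUM x:?X. co x * b (\<sigma> x)) = (SUM x:?X. co (\<sigma> x) * b (\<sigma> x))"
   proof (intro sum.cong refl)
    fix x assume x: "x:?X"
    hence "co (\<sigma> x) = co x"
     using \<sigma> permutes_in_image[OF \<sigma>p, of x] by (intro S0.co_col) (auto simp: Cgrp_def)
    thus "co x * b (\<sigma> x) = co (\<sigma> x) * b (\<sigma> x)" by simp
   qed
   also have "... = (SUM x:?X. co x * b x)" by (rule sum.reindex_bij_betw[OF permutes_imp_bij[OF \<sigma>p]])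
   finally show ?thesis using z0(3) by (simp add: \<Phi>2_def b_def)
  qed
  have eq1: "\<Phi>1 (bb (S', pm \<pi> r)) = M1"
   using max1[OF \<pi>(2)] lead(1)[OF \<gamma>_mono] unfolding \<Phi>1\<sigma> bb_eq by (simp add: \<Phi>1_def)
  hence eq1': "(SUM x:?X. b (\<sigma> x) * b (\<sigma> x)) = (SUM x:?X. (i S' x + \<gamma> x) * (i S' x + \<gamma> x))"
   unfolding \<Phi>1\<sigma> bb_eq by (simp add: \<Phi>1_def)
  have eq2': "(SUM x:?X. co x * b (\<sigma> x)) = (SUM x:?X. co x * (i S' x + \<gamma> x))"
   using max2[OF \<pi>(2) eq1] lead(2)[OF \<gamma>_mono _ eq1'] unfolding \<Phi>2\<sigma> bb_eq by (simp add: \<Phi>2_def)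
  have b\<sigma>': "b (\<sigma> x) = i S' x + \<gamma> x" if "x:?X" for x
   by (rule lead(3)[OF \<gamma>_mono _ eq1' eq2' that])
  have "\<sigma> = id"
  proof (rule column_strict_unique[OF dia \<sigma>, of b "%x. i S' x + \<gamma> x"])
   show "b (\<sigma> x) = i S' x + \<gamma> x" if "x:?X" for x by (rule b\<sigma>'[OF that])
   show "b x < b y" if "x:?X" "y:?X" "kk p x = kk p y" "cc p x = cc p y" "rr p x < rr p y" for x y
    by (rule b_strict[OF that])
   show "i S' x + \<gamma> x < i S' y + \<gamma> y"
    if "x:?X" "y:?X" "kk p x = kk p y" "cc p x = cc p y" "rr p x < rr p y" for x y
   proof -
    have lt: "i S' x < i S' y" by (rule S'.col_mono[OF that])
    have "~ s S' y < s S' x" using S'.index_mono[OF that(2,1)] lt by auto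
    moreover have "x ~= y" using lt by auto
    ultimately have "s S' x < s S' y" using S'.s_inj[OF that(1,2)] by blast
    thus ?thesis using lt \<gamma>_mono[OF that(1,2)] by simp
   qed
  qed
  hence b_eq: "i S0 x + coef m0 x div ?m = i S' x + \<gamma> x" if "x:?X" for x
   using b\<sigma>'[OF that] by (simp add: b_def bb_def z0_eq)
  have "s S' x = s S0 x" if x: "x:?X" for x
  proof (rule standardization_unique[OF std[OF S'] std[OF S0] \<gamma>_mono _ _ x])
   show "coef m0 u div ?m <= coef m0 v div ?m" if "u:?X" "v:?X" "s S0 u < s S0 v" for u v
    using m0(2) that unfolding sorted_exp_def by (intro div_le_mono) blast
   show "i S' u + \<gamma> u = i S0 u + coef m0 u div ?m" if "u:?X" for u using b_eq[OF that] by simp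
  qed
  hence SS: "S' = S0" by (rule label[OF S' S0])
  have "pm \<pi> r = m0"
  proof -
   have "pm \<pi> r = expo n (%x. ?m * \<gamma> x)"
    unfolding \<gamma>_def by (subst r_expo) (simp add: pm_expo[OF \<pi>(1)])
   also have "... = expo n (%x. ?m * (coef m0 x div ?m))" unfolding expo_eq_iff using b_eq SS by simp
   finally show ?thesis using m0_expo by simp
  qed
  hence "coef (g S') r = coef (g S0) m0" using invariant_coef_pm[OF g[OF S'] \<pi>(1), of r] SS by simp
  hence "coef (h S') (pm \<tau> (pm \<sigma> e)) = coef (g S0) m0" unfolding r(1) h_def coef_mult_mon_add .
  thus ?thesis using SS \<open>\<sigma> = id\<close> by blast
 qed
 \<comment> \<open>Invariants commute with both symmetrizers, so each coefficient can be moved next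
   to its monomial.\<close>
 have "0 = coef (SUM S:I. CR n p (h S)) e"
 proof -
  have "g S * CR n p (mon (a S)) = CR n p (h S)" if "S:I" for S
   unfolding h_def gop_invariant_mult[OF gop_Rop g[OF that]]
    gop_invariant_mult[OF gop_Cop g[OF that]] ..
  hence "(SUM S:I. CR n p (h S)) = 0" using rel by (simp add: a_def cong: sum.cong)
  thus ?thesis by simp
 qed
 also have "... = (SUM S:I. SUM \<sigma>:Cgrp ?X p. SUM \<tau>:Rgrp ?X p. real_of_int (sign \<sigma>) * coef (h S) (pm \<tau> (pm \<sigma> e)))"
  unfolding lookup_sum coef_Cop_Rop[OF dia] ..
 also have "... = (SUM S:I. if S = S0 then SUM \<sigma>:Cgrp ?X p. if \<sigma> = id then
   SUM \<tau>:Rgrp ?X p. coef (h S0) (pm \<tau> e) else 0 else 0)"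
 proof (intro sum.cong refl)
  fix S' assume S': "S':I"
  show "(SUM \<sigma>:Cgrp ?X p. SUM \<tau>:Rgrp ?X p. real_of_int (sign \<sigma>) * coef (h S') (pm \<tau> (pm \<sigma> e)))
   = (if S' = S0 then SUM \<sigma>:Cgrp ?X p. if \<sigma> = id then SUM \<tau>:Rgrp ?X p. coef (h S0) (pm \<tau> e) else 0 else 0)"
  proof (cases "S' = S0")
   case True
   have "(SUM \<tau>:Rgrp ?X p. real_of_int (sign \<sigma>) * coef (h S0) (pm \<tau> (pm \<sigma> e)))
     = (if \<sigma> = id then SUM \<tau>:Rgrp ?X p. coef (h S0) (pm \<tau> e) else 0)" if \<sigma>: "\<sigma>:Cgrp ?X p" for \<sigma>
   proof (cases "\<sigma> = id")
    case True
    thus ?thesis by (simp add: sign_id)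
   next
    case False
    hence "coef (h S0) (pm \<tau> (pm \<sigma> e)) = 0" if "\<tau>:Rgrp ?X p" for \<tau>
     using key[OF S0 \<sigma> that] by blast
    thus ?thesis using False by simp
   qed
   thus ?thesis using True by simp
  next
   case False
   hence "coef (h S') (pm \<tau> (pm \<sigma> e)) = 0" if "\<sigma>:Cgrp ?X p" "\<tau>:Rgrp ?X p" for \<sigma> \<tau>
    using key[OF S' that] by blast
   thus ?thesis using False by simp
  qed
 qed
 also have "... = (SUM \<tau>:Rgrp ?X p. coef (h S0) (pm \<tau> e))"
  using fin S0 finite_Cgrp[OF dia] Cgrp_id by simp
 also have "... = (SUM \<tau>:{\<tau>:Rgrp ?X p. coef (h S0) (pm \<tau> e) ~= 0}. coef (h S0) (pm \<tau> e))"
  using finite_Rgrp[OF dia] by (intro sum.mono_neutral_right) auto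
 also have "... = (SUM \<tau>:{\<tau>:Rgrp ?X p. coef (h S0) (pm \<tau> e) ~= 0}. coef (g S0) m0)"
 proof (rule sum.cong[OF refl])
  fix \<tau> assume "\<tau>:{\<tau>:Rgrp ?X p. coef (h S0) (pm \<tau> e) ~= 0}"
  thus "coef (h S0) (pm \<tau> e) = coef (g S0) m0" using key[OF S0 Cgrp_id, of \<tau>] by simp
 qed
 finally have "card {\<tau>:Rgrp ?X p. coef (h S0) (pm \<tau> e) ~= 0} = 0" using m0(1) by simp
 moreover have "id:{\<tau>:Rgrp ?X p. coef (h S0) (pm \<tau> e) ~= 0}"
  using m0(1) by (simp add: Rgrp_id h_def e_split coef_mult_mon_add)
 ultimately show False using finite_Rgrp[OF dia] by auto
qed

section \<open>Enumeration of pairs of standard and semistandard fillings\<close>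

section \<open>Counting semistandard fillings\<close>

text \<open>A (bi-)partition is represented by the lengths of its rows, indexed by component and row.\<close>

type_synonym rows = "nat \<times> nat => nat"

definition comps :: "cox_type => nat set" where
 "comps c = (if c = TypeB then {0, 1} else {0})"

definition part :: "cox_type => rows => bool" where
 "part c q \<longleftrightarrow> finite {x. q x ~= 0} & (ALL k r. q (k, Suc r) <= q (k, r)) & (ALL k r. k ~: comps c --> q (k, r) = 0)"

definition rsize :: "rows => nat" where
 "rsize q = (SUM x:{x. q x ~= 0}. q x)"

text \<open>The skew shape \<open>q / q'\<close> is a horizontal strip in the component \<open>k\<close>.\<close>

definition strip :: "nat => rows => rows => bool" where
 "strip a q' q \<longleftrightarrow> (ALL k r. k ~= a --> q' (k, r) = q (k, r)) &
   (ALL r. q' (a, r) <= q (a, r) & q (a, Suc r) <= q' (a, r))"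

definition inc :: "rows => nat \<times> nat => rows" where
 "inc q x = q(x := Suc (q x))"

definition dec :: "rows => nat \<times> nat => rows" where
 "dec q x = q(x := q x - 1)"

definition addable :: "cox_type => rows => (nat \<times> nat) set" where
 "addable c q = {x. part c (inc q x)}"

definition removable :: "cox_type => rows => (nat \<times> nat) set" where
 "removable c q = {x. q x ~= 0 & part c (dec q x)}"

definition strips :: "cox_type => nat => rows => rows set" where
 "strips c k q = {q'. part c q' & strip k q' q}"

lemma dec_inc [simp]: "dec (inc q x) x = q" by (simp add: dec_def inc_def)

lemma inc_dec: "q x ~= 0 ==> inc (dec q x) x = q" by (simp add: dec_def inc_def)

lemma rsize_superset: assumes "finite A" "{x. q x ~= 0} <= A" shows "rsize q = (SUM x:A. q x)"
 unfolding rsize_def using assms by (intro sum.mono_neutral_left) auto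

lemma rsize_inc: assumes "part c q" shows "rsize (inc q x) = Suc (rsize q)"
proof -
 let ?A = "insert x {x. q x ~= 0}"
 have fin: "finite ?A" using assms by (simp add: part_def)
 have "rsize (inc q x) = (SUM y:?A. inc q x y)"
  using fin by (intro rsize_superset) (auto simp: inc_def split: if_splits)
 also have "... = inc q x x + (SUM y:?A - {x}. inc q x y)" by (rule sum.remove[OF fin]) simp
 also have "(SUM y:?A - {x}. inc q x y) = (SUM y:?A - {x}. q y)" by (intro sum.cong) (auto simp: inc_def)
 also have "inc q x x + (SUM y:?A - {x}. q y) = Suc (SUM y:?A. q y)"
  using sum.remove[OF fin, of x q] by (simp add: inc_def)
 also have "(SUM y:?A. q y) = rsize q" using fin by (intro rsize_superset[symmetric]) auto
 finally show ?thesis .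
qed

lemma part_inc_finite: "part c q ==> finite {y. inc q x y ~= 0}"
 by (rule finite_subset[of _ "insert x {y. q y ~= 0}"]) (auto simp: part_def inc_def)

lemma part_dec_finite: "part c q ==> finite {y. dec q x y ~= 0}"
 by (rule finite_subset[of _ "{y. q y ~= 0}"]) (auto simp: part_def dec_def split: if_splits)

lemma finite_addable: assumes "part c q" shows "finite (addable c q)"
proof (rule finite_subset)
 show "addable c q <= comps c \<times> {0} Un (%(k, r). (k, Suc r)) ` {x. q x ~= 0}"
 proof
  fix x assume x: "x:addable c q"
  obtain k r where x_eq: "x = (k, r)" by (cases x)
  have p: "part c (inc q (k, r))" using x by (simp add: addable_def x_eq)
  have k: "k:comps c"
  proof (rule ccontr)
   assume "k ~: comps c"
   hence "inc q (k, r) (k, r) = 0" using p unfolding part_def by blast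
   thus False by (simp add: inc_def)
  qed
  show "x:comps c \<times> {0} Un (%(k, r). (k, Suc r)) ` {x. q x ~= 0}"
  proof (cases r)
   case 0
   thus ?thesis using k by (simp add: x_eq)
  next
   case (Suc r')
   have "inc q (k, r) (k, Suc r') <= inc q (k, r) (k, r')" using p unfolding part_def by blast
   hence "q (k, r') ~= 0" by (simp add: inc_def Suc)
   thus ?thesis by (auto simp: x_eq Suc intro!: image_eqI[of _ _ "(k, r')"])
  qed
 qed
 show "finite (comps c \<times> {0} Un (%(k, r). (k, Suc r)) ` {x. q x ~= 0})"
  using assms by (simp add: part_def comps_def)
qed

lemma finite_removable: assumes "part c q" shows "finite (removable c q)"
 by (rule finite_subset[of _ "{x. q x ~= 0}"]) (use assms in \<open>auto simp: removable_def part_def\<close>)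

lemma finite_below: assumes "part c q" shows "finite {q'. ALL x. q' x <= q x}"
proof (rule finite_subset)
 let ?A = "{x. q x ~= 0}"
 have fin: "finite ?A" using assms by (simp add: part_def)
 show "{q'. ALL x. q' x <= q x} <= {f. ALL x. (x:?A --> f x:{..Max (q ` ?A)}) & (x ~: ?A --> f x = 0)}"
 proof (intro subsetI CollectI allI conjI impI)
  fix f x assume f: "f:{q'. ALL x. q' x <= q x}"
  have le: "f x <= q x" using f by blast
  show "f x:{..Max (q ` ?A)}" if "x:?A" using order.trans[OF le Max_ge[of "q ` ?A" "q x"]] that fin by simp
  show "f x = 0" if "x ~: ?A" using le that by simp
 qed
 show "finite {f. ALL x. (x:?A --> f x:{..Max (q ` ?A)}) & (x ~: ?A --> f x = 0)}"
  by (rule finite_set_of_finite_funs[OF fin finite_atMost])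
qed

lemma strip_le: assumes "strip k q' q" shows "q' x <= q x"
 using assms by (cases x; cases "fst x = k") (auto simp: strip_def)

lemma finite_strips: assumes "part c q" shows "finite (strips c k q)"
 by (rule finite_subset[OF _ finite_below[OF assms]]) (auto simp: strips_def strip_le)

lemma strip_inc: assumes "strip a q' q"
 shows "strip a q' (inc q (k, r)) \<longleftrightarrow> k = a & (ALL r'. r = Suc r' --> q (a, r) < q' (a, r'))"
proof
 assume s: "strip a q' (inc q (k, r))"
 have "k = a"
 proof (rule ccontr)
  assume "k ~= a"
  hence "q' (k, r) = inc q (k, r) (k, r)" "q' (k, r) = q (k, r)" using s assms unfolding strip_def by blast+
  thus False by (simp add: inc_def)
 qed
 moreover have "q (a, r) < q' (a, r')" if "r = Suc r'" for r'
 proof -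
  have "inc q (k, r) (a, Suc r') <= q' (a, r')" using s unfolding strip_def by blast
  thus ?thesis using that `k = a` by (simp add: inc_def)
 qed
 ultimately show "k = a & (ALL r'. r = Suc r' --> q (a, r) < q' (a, r'))" by blast
next
 assume "k = a & (ALL r'. r = Suc r' --> q (a, r) < q' (a, r'))"
 thus "strip a q' (inc q (k, r))" using assms by (auto simp: strip_def inc_def Suc_le_eq le_Suc_eq)
qed

lemma strip_dec: assumes "strip l q' q" "q' (k, r) ~= 0"
 shows "strip l (dec q' (k, r)) q \<longleftrightarrow> k = l & q (l, Suc r) < q' (l, r)"
proof
 assume s: "strip l (dec q' (k, r)) q"
 have "k = l"
 proof (rule ccontr)
  assume "k ~= l"
  hence "dec q' (k, r) (k, r) = q (k, r)" "q' (k, r) = q (k, r)"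
   using s assms(1) unfolding strip_def by blast+
  thus False using assms(2) by (simp add: dec_def)
 qed
 moreover have "q (l, Suc r) <= dec q' (k, r) (l, r)" using s unfolding strip_def by blast
 ultimately show "k = l & q (l, Suc r) < q' (l, r)" using assms(2) by (simp add: dec_def)
next
 assume "k = l & q (l, Suc r) < q' (l, r)"
 thus "strip l (dec q' (k, r)) q"
  using assms by (auto simp: strip_def dec_def intro: diff_le_self[THEN order.trans])
qed

text \<open>Interlacing with a partition makes both rows of lengths partitions in the component \<open>l\<close>.\<close>

lemma part_strip_upper:
 assumes q': "part c q'" and s: "strip a q' q" and fin: "finite {x. q x ~= 0}" and a: "a:comps c"
 shows "part c q" unfolding part_def
proof (intro conjI allI impI fin)
 fix k r
 show "q (k, Suc r) <= q (k, r)"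
 proof (cases "k = a")
  case True
  have "q (a, Suc r) <= q' (a, r)" "q' (a, r) <= q (a, r)"
   using s unfolding strip_def by blast+
  thus ?thesis using True by simp
 next
  case False
  hence "q' (k, Suc r) = q (k, Suc r)" "q' (k, r) = q (k, r)" using s unfolding strip_def by blast+
  thus ?thesis using q' unfolding part_def by metis
 qed
 assume "k ~: comps c"
 moreover from this have "q' (k, r) = q (k, r)" using s a unfolding strip_def by metis
 ultimately show "q (k, r) = 0" using q' unfolding part_def by metis
qed

lemma part_strip_lower:
 assumes q: "part c q" and s: "strip l q' q" and fin: "finite {x. q' x ~= 0}" and l: "l:comps c"
 shows "part c q'" unfolding part_def
proof (intro conjI allI impI fin)
 fix k r
 show "q' (k, Suc r) <= q' (k, r)"
 proof (cases "k = l")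
  case True
  have "q' (l, Suc r) <= q (l, Suc r)" "q (l, Suc r) <= q' (l, r)"
   using s unfolding strip_def by blast+
  thus ?thesis using True by simp
 next
  case False
  hence "q' (k, Suc r) = q (k, Suc r)" "q' (k, r) = q (k, r)" using s unfolding strip_def by blast+
  thus ?thesis using q unfolding part_def by metis
 qed
 assume "k ~: comps c"
 moreover from this have "q' (k, r) = q (k, r)" using s l unfolding strip_def by metis
 ultimately show "q' (k, r) = 0" using q unfolding part_def by metis
qed

text \<open>
 The commutation relation between removing a cell and adding a horizontal strip. If \<open>q / q'\<close> is
 itself a strip, a cell can be added to row \<open>r + 1\<close> of \<open>q\<close> iff one can be removed from row \<open>r\<close> of
 \<open>q'\<close>, and row \<open>0\<close> of \<open>q\<close> is the extra possibility; otherwise the cell is forced.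
\<close>

lemma card_commutation: assumes q: "part c q" and q': "part c q'" and b: "b:comps c"
 shows "card {x:addable c q. strip b q' (inc q x)}
  = card {y:removable c q'. strip b (dec q' y) q} + (if strip b q' q then 1 else 0)"
proof (cases "strip b q' q")
 case True
 define R where "R = {r. q (b, Suc r) < q' (b, r)}"
 have finR: "finite R"
 proof -
  have "finite (snd ` {x. q' x ~= 0})" using q' by (simp add: part_def)
  thus ?thesis by (rule finite_subset[rotated]) (auto simp: R_def intro!: image_eqI[of _ snd "(b, _)"])
 qed
 have A: "{x:addable c q. strip b q' (inc q x)} = insert (b, 0) ((%r. (b, Suc r)) ` R)"
 proof (intro equalityI subsetI)
  fix x assume x: "x:{x:addable c q. strip b q' (inc q x)}"
  obtain k r where x_eq: "x = (k, r)" by (cases x)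
  have "k = b" "!!r'. r = Suc r' ==> q (b, r) < q' (b, r')"
   using x strip_inc[OF True, of k r] by (auto simp: x_eq)
  thus "x:insert (b, 0) ((%r. (b, Suc r)) ` R)" by (cases r) (auto simp: x_eq R_def)
 next
  fix x assume "x:insert (b, 0) ((%r. (b, Suc r)) ` R)"
  then obtain r where x_eq: "x = (b, r)" and r: "ALL r'. r = Suc r' --> q (b, r) < q' (b, r')"
   by (auto simp: R_def)
  have s: "strip b q' (inc q x)" using strip_inc[OF True, of b r] r by (simp add: x_eq)
  have "part c (inc q x)" by (rule part_strip_upper[OF q' s part_inc_finite[OF q] b])
  thus "x:{x:addable c q. strip b q' (inc q x)}" using s by (simp add: addable_def)
 qed
 have B: "{y:removable c q'. strip b (dec q' y) q} = (%r. (b, r)) ` R"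
 proof (intro equalityI subsetI)
  fix x assume x: "x:{y:removable c q'. strip b (dec q' y) q}"
  obtain k r where x_eq: "x = (k, r)" by (cases x)
  have "k = b" "q (b, Suc r) < q' (b, r)"
   using x strip_dec[OF True, of k r] by (auto simp: x_eq removable_def)
  thus "x:(%r. (b, r)) ` R" by (auto simp: x_eq R_def)
 next
  fix x assume "x:(%r. (b, r)) ` R"
  then obtain r where x_eq: "x = (b, r)" and r: "q (b, Suc r) < q' (b, r)"
   by (auto simp: R_def)
  have nz: "q' (b, r) ~= 0" using r by simp
  have s: "strip b (dec q' x) q" using strip_dec[OF True nz] r by (simp add: x_eq)
  have "part c (dec q' x)" by (rule part_strip_lower[OF q s part_dec_finite[OF q'] b])
  thus "x:{y:removable c q'. strip b (dec q' y) q}" using s nz by (simp add: removable_def x_eq)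
 qed
 have "card (insert (b, 0) ((%r. (b, Suc r)) ` R)) = Suc (card R)"
  using finR by (subst card_insert_disjoint) (auto simp: card_image inj_on_def)
 moreover have "card ((%r. (b, r)) ` R) = card R" by (rule card_image) (auto simp: inj_on_def)
 ultimately show ?thesis unfolding A B using True by simp
next
 case False
 have "{x:addable c q. strip b q' (inc q x)} = {y:removable c q'. strip b (dec q' y) q}"
 proof (intro equalityI subsetI)
  fix x assume "x:{x:addable c q. strip b q' (inc q x)}"
  hence s: "strip b q' (inc q x)" by simp
  obtain k r where x_eq: "x = (k, r)" by (cases x)
  have s1: "q' (l, a) = inc q x (l, a)" if "l ~= b" for l a using s that unfolding strip_def by blast
  have s2: "q' (b, a) <= inc q x (b, a)" "inc q x (b, Suc a) <= q' (b, a)" for a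
   using s unfolding strip_def by blast+
  have le: "q y <= inc q x y" for y by (simp add: inc_def)
  have q'x: "q' x = Suc (q x)"
  proof (cases "k = b")
   case False
   thus ?thesis using s1[of k r] by (simp add: x_eq inc_def)
  next
   case k: True
   show ?thesis
   proof (rule ccontr)
    assume ne: "q' x ~= Suc (q x)"
    have "strip b q' q" unfolding strip_def
    proof (intro conjI allI impI)
     show "q' (l, a) = q (l, a)" if "l ~= b" for l a
      using s1[OF that, of a] that k by (simp add: x_eq inc_def)
     show "q' (b, a) <= q (b, a)" for a
      using s2(1)[of a] ne k by (cases "a = r") (auto simp: x_eq inc_def)
     show "q (b, Suc a) <= q' (b, a)" for a using s2(2)[of a] le[of "(b, Suc a)"] by simp
    qed
    thus False using False by blast
   qed
  qed
  have s': "strip b (dec q' x) q" unfolding strip_def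
  proof (intro conjI allI impI)
   show "dec q' x (l, a) = q (l, a)" if "l ~= b" for l a
    using s1[OF that, of a] q'x by (auto simp: dec_def inc_def)
   show "dec q' x (b, a) <= q (b, a)" for a
    using s2(1)[of a] q'x by (auto simp: dec_def inc_def split: if_splits)
   show "q (b, Suc a) <= dec q' x (b, a)" for a
   proof (cases "x = (b, a)")
    case True
    thus ?thesis using q'x q by (simp add: dec_def part_def)
   next
    case False
    thus ?thesis using s2(2)[of a] le[of "(b, Suc a)"] by (simp add: dec_def)
   qed
  qed
  have "part c (dec q' x)" by (rule part_strip_lower[OF q s' part_dec_finite[OF q'] b])
  thus "x:{y:removable c q'. strip b (dec q' y) q}" using s' q'x by (simp add: removable_def)
 next
  fix x assume "x:{y:removable c q'. strip b (dec q' y) q}"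
  hence s: "strip b (dec q' x) q" and nz: "q' x ~= 0" by (simp_all add: removable_def)
  obtain k r where x_eq: "x = (k, r)" by (cases x)
  have s1: "dec q' x (l, a) = q (l, a)" if "l ~= b" for l a using s that unfolding strip_def by blast
  have s2: "dec q' x (b, a) <= q (b, a)" "q (b, Suc a) <= dec q' x (b, a)" for a
   using s unfolding strip_def by blast+
  have le: "dec q' x y <= q' y" for y by (simp add: dec_def)
  have q'x: "q' x = Suc (q x)"
  proof (cases "k = b")
   case False
   thus ?thesis using s1[of k r] nz by (simp add: x_eq dec_def)
  next
   case k: True
   show ?thesis
   proof (rule ccontr)
    assume ne: "q' x ~= Suc (q x)"
    have "strip b q' q" unfolding strip_def
    proof (intro conjI allI impI)
     show "q' (l, a) = q (l, a)" if "l ~= b" for l a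
      using s1[OF that, of a] that k by (simp add: x_eq dec_def)
     show "q' (b, a) <= q (b, a)" for a
      using s2(1)[of a] ne nz k by (cases "a = r") (auto simp: x_eq dec_def)
     show "q (b, Suc a) <= q' (b, a)" for a using s2(2)[of a] le[of "(b, a)"] by simp
    qed
    thus False using False by blast
   qed
  qed
  have s': "strip b q' (inc q x)" unfolding strip_def
  proof (intro conjI allI impI)
   show "q' (l, a) = inc q x (l, a)" if "l ~= b" for l a
    using s1[OF that, of a] q'x by (cases "x = (l, a)") (simp_all add: dec_def inc_def)
   show "q' (b, a) <= inc q x (b, a)" for a
    using s2(1)[of a] q'x by (cases "x = (b, a)") (simp_all add: dec_def inc_def)
   show "inc q x (b, Suc a) <= q' (b, a)" for a
   proof (cases "x = (b, Suc a)")
    case True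
    hence "inc q x (b, Suc a) = q' (b, Suc a)" using q'x by (simp add: inc_def)
    thus ?thesis using q' by (simp add: part_def)
   next
    case False
    thus ?thesis using s2(2)[of a] le[of "(b, a)"] by (simp add: inc_def)
   qed
  qed
  have "part c (inc q x)" by (rule part_strip_upper[OF q' s' part_inc_finite[OF q] b])
  thus "x:{x:addable c q. strip b q' (inc q x)}" using s' by (simp add: addable_def)
 qed
 thus ?thesis using False by simp
qed

declare split_paired_All [simp del] split_paired_Ex [simp del]

text \<open>In type B the parity of an entry tells its component: entries become exponents, which
  are odd on the second component. Type A has one component only.\<close>

definition kap :: "cox_type => nat => nat" where
 "kap c j = (if c = TypeB then j mod 2 else 0)"

lemma kap_comps: "kap c j:comps c" by (auto simp: kap_def comps_def)

definition Parts :: "cox_type => nat => rows set" where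
 "Parts c n = {q. part c q & rsize q = n}"

primrec fnum :: "cox_type => nat => rows => nat" where
 "fnum c 0 q = (if q = (%_. 0) then 1 else 0)"
| "fnum c (Suc n) q = (SUM x:removable c q. fnum c n (dec q x))"

primrec Knum :: "cox_type => nat => rows => int => nat" where
 "Knum c 0 q d = (if q = (%_. 0) & d = 0 then 1 else 0)"
| "Knum c (Suc J) q d = (SUM q':strips c (kap c J) q. Knum c J q' (d - int J * (int (rsize q) - int (rsize q'))))"

lemma part_zero: "part c (%_. 0)" by (simp add: part_def)

lemma rsize_zero: "rsize (%_. 0) = 0" by (simp add: rsize_def)

lemma rsize_eq_0: assumes "part c q" "rsize q = 0" shows "q = (%_. 0)"
proof (rule ext)
 fix x
 have "finite {x. q x ~= 0}" using assms(1) by (simp add: part_def)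
 thus "q x = 0" using assms(2) unfolding rsize_def by (cases "q x = 0") simp_all
qed

lemma addable_dec: assumes "part c q" "x:removable c q"
 shows "x:addable c (dec q x)" "part c (dec q x)" "inc (dec q x) x = q"
 using assms by (simp_all add: removable_def addable_def inc_dec)

lemma removable_inc: assumes "part c q" "x:addable c q" shows "x:removable c (inc q x)" "part c (inc q x)"
 using assms by (simp_all add: removable_def addable_def) (simp add: inc_def)

lemma rsize_dec: assumes "part c q" "x:removable c q" shows "rsize q = Suc (rsize (dec q x))"
 using rsize_inc[OF addable_dec(2)[OF assms], of x] addable_dec(3)[OF assms] by simp

text \<open>Moving the added cell past one strip costs one extra term, by
  \<open>card_commutation\<close>; past all strips this makes one term for each value j below
  \<open>J\<close>.\<close>

lemma sum_addable_Knum: assumes "part c q"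
 shows "(SUM x:addable c q. Knum c J (inc q x) d) = (SUM j<J. Knum c J q (d - int j))" using assms
proof (induction J arbitrary: q d)
 case 0
 have "inc q x ~= (%_. 0)" for x
  using fun_cong[of "inc q x" "%_. 0" x] unfolding inc_def by (metis fun_upd_same nat.distinct(2))
 thus ?case by simp
next
 case (Suc J)
 note q = \<open>part c q\<close>
 let ?k = "kap c J"
 define K where "K q' = Knum c J q' (d - int J * (int (rsize q) + 1 - int (rsize q')))" for q'
 \<comment> \<open>A finite set containing all intermediate shapes, so that the sums can be
   interchanged over a fixed domain.\<close>
 define Q where "Q = (UN x:addable c q. strips c ?k (inc q x)) Un strips c ?k q
  Un (UN q':strips c ?k q. inc q' ` addable c q')"
 have partS: "part c q'" if "q':strips c ?k q''" for q' q'' using that by (simp add: strips_def)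
 have finQ: "finite Q" unfolding Q_def
  using finite_addable[OF q] removable_inc(2)[OF q] finite_strips finite_strips[OF q] finite_addable partS
  by (intro finite_UnI finite_UN_I finite_imageI) auto
 have partQ: "part c q'" if "q':Q" for q' using that partS removable_inc(2) unfolding Q_def by auto
 have "(SUM x:addable c q. Knum c (Suc J) (inc q x) d)
   = (SUM x:addable c q. SUM q':strips c ?k (inc q x). K q')"
  by (simp add: rsize_inc[OF q] K_def algebra_simps)
 also have "... = (SUM x:addable c q. SUM q':Q. if strip ?k q' (inc q x) then K q' else 0)"
 proof (rule sum.cong[OF refl])
  fix x assume x: "x:addable c q"
  have "strips c ?k (inc q x) = {q':Q. strip ?k q' (inc q x)}"
   using x partQ unfolding strips_def Q_def by blast
  thus "(SUM q':strips c ?k (inc q x). K q') = (SUM q':Q. if strip ?k q' (inc q x) then K q' else 0)"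
   using finQ by (simp add: sum.inter_filter)
 qed
 also have "... = (SUM q':Q. card {x:addable c q. strip ?k q' (inc q x)} * K q')"
  by (subst sum.swap) (simp add: sum.inter_filter[symmetric] finite_addable[OF q])
 also have "... = (SUM q':Q. card {y:removable c q'. strip ?k (dec q' y) q} * K q' + (if strip ?k q' q then K q' else 0))"
  by (intro sum.cong refl) (simp add: card_commutation[OF q partQ kap_comps] add_mult_distrib)
 also have "... = (SUM q':Q. card {y:removable c q'. strip ?k (dec q' y) q} * K q') + (SUM q':strips c ?k q. K q')"
 proof -
  have "strips c ?k q = {q':Q. strip ?k q' q}" using partQ unfolding strips_def Q_def by blast
  thus ?thesis using finQ by (simp add: sum.distrib sum.inter_filter)
 qed
 also have "(SUM q':strips c ?k q. K q') = Knum c (Suc J) q (d - int J)"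
  by (simp add: K_def algebra_simps)
 also have "(SUM q':Q. card {y:removable c q'. strip ?k (dec q' y) q} * K q')
   = (SUM q':Q. SUM y:{y:removable c q'. strip ?k (dec q' y) q}. K q')" by simp
 also have "... = (SUM (q', y):(SIGMA q':Q. {y:removable c q'. strip ?k (dec q' y) q}). K q')"
  using finQ finite_removable[OF partQ] by (intro sum.Sigma) auto
 also have "... = (SUM (q', y):(SIGMA q':strips c ?k q. addable c q'). K (inc q' y))"
 proof (rule sum.reindex_bij_witness[of _ "%(q', y). (inc q' y, y)" "%(q', y). (dec q' y, y)"])
  fix z assume z: "z:(SIGMA q':Q. {y:removable c q'. strip ?k (dec q' y) q})"
  obtain q' y where z_eq: "z = (q', y)" by (cases z)
  have *: "q':Q" "y:removable c q'" "strip ?k (dec q' y) q" using z by (simp_all add: z_eq)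
  note ad = addable_dec[OF partQ[OF *(1)] *(2)]
  show "(%(q', y). (inc q' y, y)) ((%(q', y). (dec q' y, y)) z) = z" using ad by (simp add: z_eq)
  show "(%(q', y). (dec q' y, y)) z:(SIGMA q':strips c ?k q. addable c q')"
   using ad * by (simp add: z_eq strips_def)
  show "(case (%(q', y). (dec q' y, y)) z of (q', y) => K (inc q' y)) = (case z of (q', y) => K q')"
   using ad by (simp add: z_eq)
 next
  fix z assume z: "z:(SIGMA q':strips c ?k q. addable c q')"
  obtain q' y where z_eq: "z = (q', y)" by (cases z)
  have *: "q':strips c ?k q" "y:addable c q'" using z by (simp_all add: z_eq)
  show "(%(q', y). (dec q' y, y)) ((%(q', y). (inc q' y, y)) z) = z" by (simp add: z_eq)
  show "(%(q', y). (inc q' y, y)) z:(SIGMA q':Q. {y:removable c q'. strip ?k (dec q' y) q})"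
   using * removable_inc[OF partS[OF *(1)] *(2)] by (auto simp: z_eq strips_def Q_def)
 qed
 also have "... = (SUM q':strips c ?k q. SUM y:addable c q'. K (inc q' y))"
  using finite_strips[OF q] finite_addable[OF partS] by (intro sum.Sigma[symmetric]) auto
 also have "... = (SUM q':strips c ?k q. SUM j<J. Knum c J q' (d - int J * (int (rsize q) - int (rsize q')) - int j))"
 proof (rule sum.cong[OF refl])
  fix q' assume q': "q':strips c ?k q"
  have "(SUM y:addable c q'. K (inc q' y))
    = (SUM y:addable c q'. Knum c J (inc q' y) (d - int J * (int (rsize q) - int (rsize q'))))"
   by (simp add: K_def rsize_inc[OF partS[OF q']])
  also have "... = (SUM j<J. Knum c J q' (d - int J * (int (rsize q) - int (rsize q')) - int j))"
   by (rule Suc.IH[OF partS[OF q']])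
  finally show "(SUM y:addable c q'. K (inc q' y)) = ..." .
 qed
 also have "... = (SUM j<J. Knum c (Suc J) q (d - int j))" by (subst sum.swap) (simp add: algebra_simps)
 finally show ?case by simp
qed

text \<open>A nonempty row with the largest possible row number has nothing below it, so its last
  cell can be removed.\<close>

lemma removable_nonempty: assumes q: "part c q" and "rsize q ~= 0" shows "removable c q ~= {}"
proof -
 have fin: "finite {x. q x ~= 0}" using q by (simp add: part_def)
 have "{x. q x ~= 0} ~= {}" using assms(2) unfolding rsize_def by (metis sum.empty)
 then obtain x where x: "q x ~= 0" "!!y. q y ~= 0 ==> snd y <= snd x"
 proof -
  let ?m = "Max (snd ` {x. q x ~= 0})"
  have "?m:snd ` {x. q x ~= 0}" using fin `{x. q x ~= 0} ~= {}` by (intro Max_in) simp_all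
  then obtain x where "q x ~= 0" "?m = snd x" by blast
  moreover have "snd y <= ?m" if "q y ~= 0" for y using fin that by (intro Max_ge) simp_all
  ultimately show ?thesis using that by metis
 qed
 obtain k r where x_eq: "x = (k, r)" by (cases x)
 have 0: "q (k, Suc r) = 0" using x(2)[of "(k, Suc r)"] by (auto simp: x_eq)
 have "part c (dec q x)" unfolding part_def
 proof (intro conjI allI impI)
  show "finite {y. dec q x y ~= 0}" by (rule part_dec_finite[OF q])
  fix l a
  have 1: "q (l, Suc a) <= q (l, a)" using q unfolding part_def by blast
  show "dec q x (l, Suc a) <= dec q x (l, a)"
  proof (cases "(l, a) = (k, r)")
   case True
   thus ?thesis using 0 by (simp add: dec_def x_eq)
  next
   case False
   hence "dec q x (l, a) = q (l, a)" by (auto simp: dec_def x_eq)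
   thus ?thesis using 1 by (auto simp: dec_def x_eq)
  qed
  assume "l ~: comps c"
  hence "q (l, a) = 0" using q unfolding part_def by blast
  thus "dec q x (l, a) = 0" by (auto simp: dec_def)
 qed
 thus ?thesis using x(1) by (auto simp: removable_def)
qed

lemma Parts_0: "Parts c 0 = {%_. 0}" using rsize_eq_0 part_zero rsize_zero by (auto simp: Parts_def)

lemma Parts_Suc: "Parts c (Suc n) = (UN q:Parts c n. inc q ` addable c q)"
proof (intro equalityI subsetI)
 fix q assume "q:Parts c (Suc n)"
 hence q: "part c q" "rsize q = Suc n" by (simp_all add: Parts_def)
 obtain x where x: "x:removable c q" using removable_nonempty[OF q(1)] q(2) by auto
 have "dec q x:Parts c n" using addable_dec[OF q(1) x] rsize_dec[OF q(1) x] q(2) by (simp add: Parts_def)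
 moreover have "q:inc (dec q x) ` addable c (dec q x)"
  by (rule image_eqI[of _ _ x]) (simp_all add: addable_dec[OF q(1) x])
 ultimately show "q:(UN q:Parts c n. inc q ` addable c q)" by blast
next
 fix q assume "q:(UN q:Parts c n. inc q ` addable c q)"
 then obtain q' x where "q':Parts c n" "x:addable c q'" "q = inc q' x" by blast
 thus "q:Parts c (Suc n)" using removable_inc(2)[of c q' x] rsize_inc[of c q' x] by (simp add: Parts_def)
qed

lemma finite_Parts: "finite (Parts c n)"
proof (induction n)
 case (Suc n)
 thus ?case unfolding Parts_Suc by (intro finite_UN_I finite_imageI finite_addable) (simp_all add: Parts_def)
qed (simp add: Parts_0)

definition bounded_exponents :: "nat => nat => int => (nat => nat) set" where
 "bounded_exponents n J d = {f. (ALL x. (x:{1..n} --> f x:{..<J}) & (x ~: {1..n} --> f x = 0)) & int (SUM x:{1..n}. f x) = d}"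

lemma finite_bounded_exponents: "finite (bounded_exponents n J d)"
 by (rule finite_subset[OF _ finite_set_of_finite_funs[of "{1..n}" "{..<J}" 0]])
  (auto simp: bounded_exponents_def)

lemma card_bounded_exponents_Suc:
 "card (bounded_exponents (Suc n) J d) = (SUM j<J. card (bounded_exponents n J (d - int j)))"
proof -
 have "bij_betw (%(j, f). f(Suc n := j)) (SIGMA j:{..<J}. bounded_exponents n J (d - int j)) (bounded_exponents (Suc n) J d)"
 proof (rule bij_betw_byWitness[where f' = "%f. (f (Suc n), f(Suc n := 0))"])
  show "ALL z:(SIGMA j:{..<J}. bounded_exponents n J (d - int j)).
    (%f. (f (Suc n), f(Suc n := 0))) (case z of (j, f) => f(Suc n := j)) = z"
   by (auto simp: bounded_exponents_def fun_eq_iff)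
 qed (auto simp: bounded_exponents_def)
 hence "card (bounded_exponents (Suc n) J d) = card (SIGMA j:{..<J}. bounded_exponents n J (d - int j))"
  by (rule bij_betw_same_card[symmetric])
 thus ?thesis using finite_bounded_exponents by simp
qed

text \<open>The count behind the Robinson-Schensted-Knuth correspondence. Each induction step takes
  the largest cell out of the standard filling and trades it, by \<open>sum_addable_Knum\<close>,
  for the last exponent.\<close>

theorem sum_fnum_Knum:
 "(SUM q:Parts c n. fnum c n q * Knum c J q d) = card (bounded_exponents n J d)"
proof (induction n arbitrary: d)
 case 0
 have "strips c \<kappa> (%_. 0) = {%_. 0}" for \<kappa>
 proof (intro equalityI subsetI)
  fix q assume "q:strips c \<kappa> (%_. 0)"
  hence "q x <= 0" for x using strip_le[of \<kappa> q "%_. 0" x] by (simp add: strips_def)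
  thus "q:{%_. 0}" by (auto simp: fun_eq_iff)
 qed (simp add: strips_def part_zero strip_def)
 hence "Knum c J (%_. 0) d = (if d = 0 then 1 else 0)" for d by (induction J arbitrary: d) simp_all
 moreover have "bounded_exponents 0 J d = (if d = 0 then {%_. 0} else {})"
  by (auto simp: bounded_exponents_def)
 ultimately show ?case by (simp add: Parts_0)
next
 case (Suc n)
 have part: "part c q" if "q:Parts c n" for q n using that by (simp add: Parts_def)
 have "(SUM q:Parts c (Suc n). fnum c (Suc n) q * Knum c J q d)
   = (SUM q:Parts c (Suc n). SUM x:removable c q. fnum c n (dec q x) * Knum c J q d)"
  by (simp add: sum_distrib_right)
 also have "... = (SUM (q, x):(SIGMA q:Parts c (Suc n). removable c q). fnum c n (dec q x) * Knum c J q d)"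
  using finite_Parts finite_removable[OF part] by (intro sum.Sigma) auto
 also have "... = (SUM (q, x):(SIGMA q:Parts c n. addable c q). fnum c n q * Knum c J (inc q x) d)"
 proof (rule sum.reindex_bij_witness[of _ "%(q', y). (inc q' y, y)" "%(q', y). (dec q' y, y)"])
  fix z assume z: "z:(SIGMA q:Parts c (Suc n). removable c q)"
  obtain q y where z_eq: "z = (q, y)" by (cases z)
  have *: "q:Parts c (Suc n)" "y:removable c q" using z by (simp_all add: z_eq)
  note ad = addable_dec[OF part[OF *(1)] *(2)]
  show "(%(q', y). (inc q' y, y)) ((%(q', y). (dec q' y, y)) z) = z" using ad by (simp add: z_eq)
  show "(%(q', y). (dec q' y, y)) z:(SIGMA q:Parts c n. addable c q)"
   using ad * rsize_dec[OF part[OF *(1)] *(2)] by (simp add: z_eq Parts_def)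
  show "(case (%(q', y). (dec q' y, y)) z of (q, x) => fnum c n q * Knum c J (inc q x) d)
    = (case z of (q, x) => fnum c n (dec q x) * Knum c J q d)" using ad by (simp add: z_eq)
 next
  fix z assume z: "z:(SIGMA q:Parts c n. addable c q)"
  obtain q y where z_eq: "z = (q, y)" by (cases z)
  have *: "q:Parts c n" "y:addable c q" using z by (simp_all add: z_eq)
  show "(%(q', y). (dec q' y, y)) ((%(q', y). (inc q' y, y)) z) = z" by (simp add: z_eq)
  show "(%(q', y). (inc q' y, y)) z:(SIGMA q:Parts c (Suc n). removable c q)"
   using * removable_inc[OF part[OF *(1)] *(2)] rsize_inc[OF part[OF *(1)], of y]
   by (auto simp: z_eq Parts_def)
 qed
 also have "... = (SUM q:Parts c n. SUM x:addable c q. fnum c n q * Knum c J (inc q x) d)"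
  using finite_Parts finite_addable[OF part] by (intro sum.Sigma[symmetric]) auto
 also have "... = (SUM q:Parts c n. SUM j<J. fnum c n q * Knum c J q (d - int j))"
  by (intro sum.cong refl) (simp add: sum_addable_Knum[OF part] flip: sum_distrib_left)
 also have "... = (SUM j<J. card (bounded_exponents n J (d - int j)))" by (subst sum.swap) (simp add: Suc.IH)
 finally show ?case by (simp add: card_bounded_exponents_Suc)
qed

definition cells :: "rows => position set" where
 "cells q = {(k, r, a). a < q (k, r)}"

text \<open>Fillings are functions on cells, extended by \<open>0\<close>, which makes them finite in number.\<close>

definition standard_fillings :: "rows => (position => nat) set" where
 "standard_fillings q = {t. (ALL z. z ~: cells q --> t z = 0) & bij_betw t (cells q) {1..rsize q} &
   (ALL k r a a'. a < a' & a' < q (k, r) --> t (k, r, a) < t (k, r, a')) &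
   (ALL k r r' a. r < r' & a < q (k, r') --> t (k, r, a) < t (k, r', a))}"

definition semistandard_fillings :: "cox_type => nat => rows => int => (position => nat) set" where
 "semistandard_fillings c J q d = {f. (ALL z. z ~: cells q --> f z = 0) &
   (ALL z:cells q. f z < J & kap c (f z) = fst z) &
   (ALL k r a a'. a <= a' & a' < q (k, r) --> f (k, r, a) <= f (k, r, a')) &
   (ALL k r r' a. r < r' & a < q (k, r') --> f (k, r, a) < f (k, r', a)) &
   int (SUM z:cells q. f z) = d}"

lemma semistandard_fillingsD: assumes "f:semistandard_fillings c J q d"
 shows "z ~: cells q ==> f z = 0" "z:cells q ==> f z < J" "z:cells q ==> kap c (f z) = fst z"
  "a <= a' ==> a' < q (k, r) ==> f (k, r, a) <= f (k, r, a')"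
  "r < r' ==> a < q (k, r') ==> f (k, r, a) < f (k, r', a)"
  "int (SUM z:cells q. f z) = d" using assms unfolding semistandard_fillings_def by simp_all

lemma standard_fillingsD: assumes "t:standard_fillings q"
 shows "z ~: cells q ==> t z = 0" "bij_betw t (cells q) {1..rsize q}"
  "a < a' ==> a' < q (k, r) ==> t (k, r, a) < t (k, r, a')"
  "r < r' ==> a < q (k, r') ==> t (k, r, a) < t (k, r', a)"
 using assms unfolding standard_fillings_def by simp_all

lemma cells_Sigma: "cells q = (%(x, a). (fst x, snd x, a)) ` (SIGMA x:{x. q x ~= 0}. {..<q x})"
proof (intro equalityI subsetI)
 fix z assume "z:cells q"
 then obtain k r a where "z = (k, r, a)" "a < q (k, r)" by (auto simp: cells_def)
 thus "z:(%(x, a). (fst x, snd x, a)) ` (SIGMA x:{x. q x ~= 0}. {..<q x})"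
  by (intro image_eqI[of _ _ "((k, r), a)"]) auto
qed (auto simp: cells_def)

lemma finite_cells: assumes "part c q" shows "finite (cells q)"
 unfolding cells_Sigma using assms by (intro finite_imageI finite_SigmaI) (simp_all add: part_def)

lemma card_cells: assumes "part c q" shows "card (cells q) = rsize q"
proof -
 have "card (cells q) = card (SIGMA x:{x. q x ~= 0}. {..<q x})"
  unfolding cells_Sigma by (intro card_image) (auto simp: inj_on_def)
 thus ?thesis using assms by (simp add: part_def rsize_def)
qed

lemma part_antimono: assumes "part c q" "r <= r'" shows "q (k, r') <= q (k, r)"
 using assms(2) by (rule lift_Suc_antimono_le[of "%r. q (k, r)", rotated]) (use assms(1) in \<open>simp add: part_def\<close>)

lemma finite_standard_fillings: assumes "part c q" shows "finite (standard_fillings q)"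
 by (rule finite_subset[OF _ finite_set_of_finite_funs[OF finite_cells[OF assms], of "{1..rsize q}" 0]])
  (auto simp: standard_fillings_def dest: bij_betwE)

lemma finite_semistandard_fillings: assumes "part c q" shows "finite (semistandard_fillings c J q d)"
 by (rule finite_subset[OF _ finite_set_of_finite_funs[OF finite_cells[OF assms], of "{..<J}" 0]])
  (auto simp: semistandard_fillings_def)

lemma cells_dec: assumes "q (k, r) ~= 0"
 shows "cells q = insert (k, r, q (k, r) - 1) (cells (dec q (k, r)))" "(k, r, q (k, r) - 1) ~: cells (dec q (k, r))"
proof -
 show "cells q = insert (k, r, q (k, r) - 1) (cells (dec q (k, r)))"
 proof (rule Set.set_eqI)
  fix z
  show "z:cells q \<longleftrightarrow> z:insert (k, r, q (k, r) - 1) (cells (dec q (k, r)))"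
   using assms by (cases z; cases "fst z = k & fst (snd z) = r") (auto simp: cells_def dec_def)
 qed
 show "(k, r, q (k, r) - 1) ~: cells (dec q (k, r))" by (simp add: cells_def dec_def)
qed

lemma standard_filling_extend:
 assumes q: "part c q" and x: "(k, r):removable c q" and t: "t:standard_fillings (dec q (k, r))"
 shows "t((k, r, q (k, r) - 1) := rsize q):standard_fillings q"
proof -
 let ?q = "dec q (k, r)" and ?z = "(k, r, q (k, r) - 1)"
 let ?t = "t(?z := rsize q)"
 have nz: "q (k, r) ~= 0" using x by (simp add: removable_def)
 note ad = addable_dec[OF q x]
 have size: "rsize q = Suc (rsize ?q)" by (rule rsize_dec[OF q x])
 note cells = cells_dec[of q, OF nz]
 have t0: "t z = 0" if "z ~: cells ?q" for z using t that unfolding standard_fillings_def by blast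
 have bij: "bij_betw t (cells ?q) {1..rsize ?q}" using t unfolding standard_fillings_def by blast
 have lt: "t z < rsize q" if "z:cells ?q" for z using bij_betwE[OF bij] that size by force
 have rows: "t (l, s, a) < t (l, s, a')" if "a < a'" "a' < ?q (l, s)" for l s a a'
  using t that unfolding standard_fillings_def by blast
 have columns: "t (l, s, a) < t (l, s', a)" if "s < s'" "a < ?q (l, s')" for l s s' a
  using t that unfolding standard_fillings_def by blast
 show ?thesis unfolding standard_fillings_def
 proof (intro CollectI conjI allI impI)
  show "?t z = 0" if "z ~: cells q" for z using that t0 cells(1) by auto
  have "bij_betw ?t (insert ?z (cells ?q)) (insert (rsize q) {1..rsize ?q})"
  proof (rule bij_betw_combine[of _ "{?z}" "{rsize q}" "cells ?q" "{1..rsize ?q}", simplified])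
   show "bij_betw ?t (cells ?q) {1..rsize ?q}"
    using bij by (rule bij_betw_cong[THEN iffD1, rotated]) (use cells(2) in auto)
  qed (simp_all add: size bij_betw_def)
  thus "bij_betw ?t (cells q) {1..rsize q}" using cells(1) by (simp add: size atLeastAtMostSuc_conv)
  show "?t (l, s, a) < ?t (l, s, a')" if a: "a < a' & a' < q (l, s)" for l s a a'
  proof (cases "(l, s, a') = ?z")
   case True
   hence "(l, s, a):cells ?q" using a by (auto simp: cells_def dec_def)
   moreover from this have "(l, s, a) ~= ?z" using cells(2) by blast
   ultimately show ?thesis using True lt by simp
  next
   case False
   hence *: "a' < ?q (l, s)" using a by (auto simp: dec_def)
   hence "(l, s, a):cells ?q" using a by (auto simp: cells_def)
   hence "(l, s, a) ~= ?z" using cells(2) by blast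
   thus ?thesis using rows[OF conjunct1[OF a] *] False by (simp only: fun_upd_other not_False_eq_True)
  qed
  show "?t (l, s, a) < ?t (l, s', a)" if s: "s < s' & a < q (l, s')" for l s s' a
  proof -
   have a: "a < q (l, s)" using s part_antimono[OF q, of s s' l] by simp
   show ?thesis
   proof (cases "(l, s', a) = ?z")
    case True
    hence "(l, s, a) ~= ?z" using s by auto
    moreover from this have "(l, s, a):cells ?q" using a by (auto simp: cells_def dec_def)
    ultimately show ?thesis using True lt by simp
   next
    case False
    hence *: "a < ?q (l, s')" using s by (auto simp: dec_def)
    have "?q (l, s') <= ?q (l, s)" using part_antimono[OF ad(2), of s s' l] s by simp
    hence "(l, s, a):cells ?q" using * by (simp add: cells_def)
    hence "(l, s, a) ~= ?z" using cells(2) by blast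
    thus ?thesis using columns[OF conjunct1[OF s] *] False by (simp only: fun_upd_other not_False_eq_True)
   qed
  qed
 qed
qed

text \<open>Restoring the removed cell with the largest entry is injective. The inequality in this
  direction is what the later comparison of dimensions uses.\<close>

lemma fnum_le_card: assumes "part c q" "rsize q = n" shows "fnum c n q <= card (standard_fillings q)"
 using assms
proof (induction n arbitrary: q)
 case 0
 hence q0: "q = (%_. 0)" by (rule rsize_eq_0)
 have "(%_. 0):standard_fillings q"
  by (simp add: standard_fillings_def q0 cells_def rsize_zero bij_betw_def inj_on_def)
 hence "standard_fillings q ~= {}" by blast
 hence "card (standard_fillings q) ~= 0" using finite_standard_fillings[OF 0(1)] by simp
 hence "1 <= card (standard_fillings q)" by linarith
 thus ?case by (simp add: q0)
next
 case (Suc n)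
 note q = Suc.prems(1)
 define ext where "ext x t = t((fst x, snd x, q x - 1) := rsize q)" for x and t :: "position => nat"
 have inj: "inj_on (%(x, t). ext x t) (SIGMA x:removable c q. standard_fillings (dec q x))"
 proof (rule inj_onI)
  fix u v assume u: "u:(SIGMA x:removable c q. standard_fillings (dec q x))"
   and v: "v:(SIGMA x:removable c q. standard_fillings (dec q x))"
   and eq: "(case u of (x, t) => ext x t) = (case v of (x, t) => ext x t)"
  obtain x t where u_eq: "u = (x, t)" by (cases u)
  obtain y t' where v_eq: "v = (y, t')" by (cases v)
  have x: "x:removable c q" "t:standard_fillings (dec q x)"
   and y: "y:removable c q" "t':standard_fillings (dec q y)" using u v by (simp_all add: u_eq v_eq)
  have e: "ext x t = ext y t'" using eq by (simp add: u_eq v_eq)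
  let ?zx = "(fst x, snd x, q x - 1)" and ?zy = "(fst y, snd y, q y - 1)"
  have nz: "q x ~= 0" "q y ~= 0" using x(1) y(1) by (simp_all add: removable_def)
  have E: "ext x t:standard_fillings q"
   using standard_filling_extend[OF q, of "fst x" "snd x" t] x by (simp add: ext_def)
  hence injt: "inj_on (ext x t) (cells q)" unfolding standard_fillings_def bij_betw_def by blast
  have cx: "?zx:cells q" "?zy:cells q" using nz by (simp_all add: cells_def)
  have "ext x t ?zx = rsize q" "ext x t ?zy = rsize q" by (simp add: ext_def) (simp add: e, simp add: ext_def)
  hence "ext x t ?zx = ext x t ?zy" by (simp only:)
  hence "?zx = ?zy" by (rule inj_onD[OF injt _ cx])
  hence xy: "x = y" by (simp add: prod_eq_iff)
  have "t z = t' z" for z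
  proof (cases "z = ?zx")
   case True
   have "?zx ~: cells (dec q x)" using cells_dec(2)[of q "fst x" "snd x"] nz by simp
   hence "t ?zx = 0" "t' ?zx = 0"
    using standard_fillingsD(1)[OF x(2)] standard_fillingsD(1)[OF y(2)] xy by simp_all
   thus ?thesis using True by simp
  next
   case False
   thus ?thesis using fun_cong[OF e, of z] xy by (simp add: ext_def)
  qed
  thus "u = v" using xy by (auto simp: u_eq v_eq)
 qed
 have sub: "(%(x, t). ext x t) ` (SIGMA x:removable c q. standard_fillings (dec q x)) <= standard_fillings q"
  using standard_filling_extend[OF q] by (force simp: ext_def)
 have "fnum c (Suc n) q <= (SUM x:removable c q. card (standard_fillings (dec q x)))" unfolding fnum.simps
 proof (rule sum_mono)
  fix x assume x: "x:removable c q"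
  show "fnum c n (dec q x) <= card (standard_fillings (dec q x))"
   using Suc.IH[OF addable_dec(2)[OF q x]] rsize_dec[OF q x] Suc.prems(2) by simp
 qed
 also have "... = card (SIGMA x:removable c q. standard_fillings (dec q x))"
  using finite_removable[OF q] finite_standard_fillings[OF addable_dec(2)[OF q]] by simp
 also have "... <= card (standard_fillings q)"
  using inj sub by (rule card_inj_on_le) (rule finite_standard_fillings[OF q])
 finally show ?case .
qed

lemma semistandard_filling_extend: assumes q: "part c q" and q': "q':strips c (kap c J) q"
  and f: "f:semistandard_fillings c J q' (d - int J * (int (rsize q) - int (rsize q')))"
 shows "(%z. if z:cells q & z ~: cells q' then J else f z):semistandard_fillings c (Suc J) q d"
proof -
 let ?b = "kap c J" and ?f = "%z. if z:cells q & z ~: cells q' then J else f z"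
 have p': "part c q'" and s: "strip ?b q' q" using q' by (simp_all add: strips_def)
 have sub: "cells q' <= cells q"
  using strip_le[OF s] unfolding cells_def by (auto intro: less_le_trans)
 have sb: "k = ?b" if "(k, r, a):cells q" "(k, r, a) ~: cells q'" for k r a
 proof (rule ccontr)
  assume "k ~= ?b"
  hence "q' (k, r) = q (k, r)" using s unfolding strip_def by blast
  thus False using that by (simp add: cells_def)
 qed
 have f0: "f z = 0" if "z ~: cells q'" for z by (rule semistandard_fillingsD(1)[OF f that])
 have fJ: "f z < J" "kap c (f z) = fst z" if "z:cells q'" for z
  by (rule semistandard_fillingsD(2,3)[OF f that])+
 have rows: "f (l, r, a) <= f (l, r, a')" if "a <= a'" "a' < q' (l, r)" for l r a a'
  by (rule semistandard_fillingsD(4)[OF f that])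
 have columns: "f (l, r, a) < f (l, r', a)" if "r < r'" "a < q' (l, r')" for l r r' a
  by (rule semistandard_fillingsD(5)[OF f that])
 have total: "int (SUM z:cells q'. f z) = d - int J * (int (rsize q) - int (rsize q'))"
  by (rule semistandard_fillingsD(6)[OF f])
 have le: "f z <= J" for z by (cases "z:cells q'") (use fJ(1)[of z] f0[of z] in auto)
 show ?thesis unfolding semistandard_fillings_def
 proof (intro CollectI conjI allI impI ballI)
  show "?f z = 0" if "z ~: cells q" for z using that sub f0[of z] by auto
  fix z assume z: "z:cells q"
  show "?f z < Suc J" using le by (simp add: less_Suc_eq_le)
  obtain k r a where z_eq: "z = (k, r, a)" by (cases z)
  show "kap c (?f z) = fst z" using z sb[of k r a] fJ(2)[of z] by (simp add: z_eq)
 next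
  fix k r a a' assume a: "a <= a' & a' < q (k, r)"
  show "?f (k, r, a) <= ?f (k, r, a')"
  proof (cases "(k, r, a'):cells q'")
   case True
   hence *: "a' < q' (k, r)" by (simp add: cells_def)
   hence "(k, r, a):cells q'" using a by (simp add: cells_def)
   thus ?thesis using True rows[OF _ *] a by simp
  next
   case False
   hence "?f (k, r, a') = J" using a by (simp add: cells_def)
   thus ?thesis using le by simp
  qed
 next
  fix k r r' a assume r: "r < r' & a < q (k, r')"
  show "?f (k, r, a) < ?f (k, r', a)"
  proof (cases "(k, r', a):cells q'")
   case True
   hence *: "a < q' (k, r')" by (simp add: cells_def)
   hence "(k, r, a):cells q'" using part_antimono[OF p', of r r' k] r by (simp add: cells_def)
   thus ?thesis using True columns[OF _ *] r by simp
  next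
   case False
   have c: "(k, r', a):cells q" using r by (simp add: cells_def)
   have k: "k = ?b" by (rule sb[OF c False])
   have "q (k, r') <= q (k, Suc r)" using part_antimono[OF q, of "Suc r" r' k] r by simp
   also have "... <= q' (k, r)" using s k unfolding strip_def by blast
   finally have "(k, r, a):cells q'" using r by (simp add: cells_def)
   thus ?thesis using fJ(1) c False by simp
  qed
 next
  have fin: "finite (cells q)" "finite (cells q')" by (rule finite_cells[OF q], rule finite_cells[OF p'])
  have "(SUM z:cells q. ?f z) = (SUM z:cells q - cells q'. ?f z) + (SUM z:cells q'. ?f z)"
   by (rule sum.subset_diff[OF sub fin(1)])
  also have "... = (card (cells q - cells q')) * J + (SUM z:cells q'. f z)" by simp
  also have "card (cells q - cells q') = rsize q - rsize q'"
   using card_Diff_subset[OF fin(2) sub] by (simp add: card_cells[OF q] card_cells[OF p'])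
  finally have *: "(SUM z:cells q. ?f z) = (rsize q - rsize q') * J + (SUM z:cells q'. f z)" .
  have "rsize q' <= rsize q" using card_mono[OF fin(1) sub] by (simp add: card_cells[OF q] card_cells[OF p'])
  thus "int (SUM z:cells q. ?f z) = d"
   unfolding * using total by (simp add: of_nat_diff left_diff_distrib right_diff_distrib mult.commute)
 qed
qed

text \<open>Filling the strip with the value J is injective, as the smaller shape is recovered from
  the cells with entries below J.\<close>

lemma Knum_le_card: assumes "part c q" shows "Knum c J q d <= card (semistandard_fillings c J q d)"
 using assms
proof (induction J arbitrary: q d)
 case 0
 show ?case
 proof (cases "q = (%_. 0) & d = 0")
  case True
  hence "(%_. 0):semistandard_fillings c 0 q d" by (simp add: semistandard_fillings_def cells_def)
  hence "semistandard_fillings c 0 q d ~= {}" by blast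
  hence "card (semistandard_fillings c 0 q d) ~= 0" using finite_semistandard_fillings[OF 0] by simp
  hence "1 <= card (semistandard_fillings c 0 q d)" by linarith
  thus ?thesis using True by simp
 next
  case False
  thus ?thesis by (simp only: Knum.simps if_False le0)
 qed
next
 case (Suc J)
 note q = \<open>part c q\<close>
 let ?k = "kap c J"
 let ?d = "%q'. d - int J * (int (rsize q) - int (rsize q'))"
 let ?D = "SIGMA q':strips c ?k q. semistandard_fillings c J q' (?d q')"
 define ext where "ext q' f = (%z. if z:cells q & z ~: cells q' then J else f z)" for q' and f :: "position => nat"
 have part: "part c q'" if "q':strips c ?k q" for q' using that by (simp add: strips_def)
 have cells_eq: "cells q' = {z:cells q. ext q' f z < J}"
  if q': "q':strips c ?k q" and f: "f:semistandard_fillings c J q' (?d q')" for q' f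
 proof -
  have "cells q' <= cells q"
   using strip_le[of ?k q' q] q' unfolding cells_def strips_def by (auto intro: less_le_trans)
  moreover have "f z < J" if "z:cells q'" for z by (rule semistandard_fillingsD(2)[OF f that])
  ultimately show ?thesis by (auto simp: ext_def)
 qed
 have rows_eq: "q1 = q2" if "cells q1 = cells q2" for q1 q2
 proof (rule ext)
  fix x
  have "{a. (fst x, snd x, a):cells q1} = {a. (fst x, snd x, a):cells q2}" using that by simp
  hence "{..<q1 x} = {..<q2 x}" by (simp add: cells_def lessThan_def)
  thus "q1 x = q2 x" by simp
 qed
 have inj: "inj_on (%(q', f). ext q' f) ?D"
 proof (rule inj_onI)
  fix u v assume u: "u:?D" and v: "v:?D"
   and eq: "(case u of (x, t) => ext x t) = (case v of (x, t) => ext x t)"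
  obtain x t where u_eq: "u = (x, t)" by (cases u)
  obtain y t' where v_eq: "v = (y, t')" by (cases v)
  have x: "x:strips c ?k q" "t:semistandard_fillings c J x (?d x)"
   and y: "y:strips c ?k q" "t':semistandard_fillings c J y (?d y)"
   using u v by (simp_all add: u_eq v_eq)
  have e: "ext x t = ext y t'" using eq by (simp add: u_eq v_eq)
  have cxy: "cells x = cells y" using cells_eq[OF x] cells_eq[OF y] e by simp
  have "t z = t' z" for z
  proof (cases "z:cells x")
   case True
   thus ?thesis using fun_cong[OF e, of z] cxy by (simp add: ext_def)
  next
   case False
   thus ?thesis using semistandard_fillingsD(1)[OF x(2)] semistandard_fillingsD(1)[OF y(2)] cxy by simp
  qed
  thus "u = v" using rows_eq[OF cxy] by (auto simp: u_eq v_eq)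
 qed
 have sub: "(%(q', f). ext q' f) ` ?D <= semistandard_fillings c (Suc J) q d"
  using semistandard_filling_extend[OF q] by (auto simp: ext_def)
 have "Knum c (Suc J) q d <= (SUM q':strips c ?k q. card (semistandard_fillings c J q' (?d q')))"
  unfolding Knum.simps by (rule sum_mono) (rule Suc.IH[OF part])
 also have "... = card ?D" using finite_strips[OF q] finite_semistandard_fillings[OF part] by simp
 also have "... <= card (semistandard_fillings c (Suc J) q d)"
  using inj sub by (rule card_inj_on_le) (rule finite_semistandard_fillings[OF q])
 finally show ?case .
qed

section \<open>Reading order, index and standardization\<close>

section \<open>Standardization\<close>

text \<open>The index of a word with its order made abstract: \<open>L j k\<close> says that j
  stands to the left of k. Letters start at 1, so the value at 0 is a dummy.\<close>

fun descent_index :: "(nat => nat => bool) => nat => nat" where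
 "descent_index L 0 = 0"
| "descent_index L (Suc 0) = 0"
| "descent_index L (Suc (Suc k)) = descent_index L (Suc k) + (if L (Suc k) (Suc (Suc k)) then 0 else 1)"

lemma descent_index_Suc:
 "0 < k ==> descent_index L (Suc k) = descent_index L k + (if L k (Suc k) then 0 else 1)"
 by (cases k) simp_all

lemma descent_index_mono: assumes "0 < k" "k <= l" shows "descent_index L k <= descent_index L l"
 using assms(2) by (induction l rule: dec_induct) (use assms(1) in \<open>auto simp: descent_index_Suc\<close>)

lemma letter_index_eq_descent_index: "letter_index w k = descent_index (left_of w) k"
 by (induction k rule: letter_index.induct) auto

lemma descent_index_cong: assumes "!!j. 0 < j ==> Suc j <= n ==> L j (Suc j) = L' j (Suc j)" "k <= n"
 shows "descent_index L k = descent_index L' k" using assms(2)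
proof (induction k)
 case (Suc k)
 thus ?case using assms(1)[of k] by (cases k) (simp_all add: descent_index_Suc)
qed simp

text \<open>The number of columns to the left of the column of a cell, over both components.\<close>

definition colno :: "rows => position => nat" where
 "colno q z = snd (snd z) + (if fst z = 1 then q (0, 0) else 0)"

text \<open>Columns are read from left to right and each of them from bottom to top, which is why
  rows are compared in reverse.\<close>

definition reading_less :: "rows => position => position => bool" where
 "reading_less q y z \<longleftrightarrow> colno q y < colno q z | (colno q y = colno q z & fst (snd z) < fst (snd y))"

definition place :: "rows => (position => nat) => nat => position" where
 "place q t = inv_into (cells q) t"

definition filling_index :: "rows => (position => nat) => nat => nat" where
 "filling_index q t = descent_index (%j k. reading_less q (place q t j) (place q t k))"

lemma colno_eqD: assumes q: "part c q" and y: "y:cells q" and z: "z:cells q" and eq: "colno q y = colno q z"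
 shows "fst y = fst z" "snd (snd y) = snd (snd z)"
proof -
 have *: "fst u:{0, 1}" "fst u = 0 ==> snd (snd u) < q (0, 0)" if u: "u:cells q" for u
 proof -
  obtain k r a where u_eq: "u = (k, r, a)" by (cases u)
  have a: "a < q (k, r)" using u by (simp add: cells_def u_eq)
  have "k:comps c"
  proof (rule ccontr)
   assume "k ~: comps c"
   hence "q (k, r) = 0" using q unfolding part_def by blast
   thus False using a by simp
  qed
  thus "fst u:{0, 1}" by (auto simp: u_eq comps_def split: if_splits)
  show "snd (snd u) < q (0, 0)" if "fst u = 0" using a that part_antimono[OF q, of 0 r k] by (simp add: u_eq)
 qed
 show "fst y = fst z" "snd (snd y) = snd (snd z)"
  using *[OF y] *[OF z] eq by (auto simp: colno_def split: if_splits)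
qed

locale standard_filling = fixes c :: cox_type and n :: nat and q :: rows and t :: "position => nat"
 assumes q: "q:Parts c n" and t: "t:standard_fillings q"
begin

lemma part_q: "part c q" and rsize_q: "rsize q = n" using q by (simp_all add: Parts_def)

lemma t_bij: "bij_betw t (cells q) {1..n}" using standard_fillingsD(2)[OF t] by (simp only: rsize_q)

lemma place_bij: "bij_betw (place q t) {1..n} (cells q)"
 unfolding place_def by (rule bij_betw_inv_into[OF t_bij])

lemma place_in: "x:{1..n} ==> place q t x:cells q" using bij_betwE[OF place_bij] by blast

lemma t_place: "x:{1..n} ==> t (place q t x) = x"
 unfolding place_def using bij_betw_inv_into_right[OF t_bij] by blast

lemma place_t: "z:cells q ==> place q t (t z) = z"
 unfolding place_def using bij_betw_inv_into_left[OF t_bij] by blast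

lemma place_image: "place q t ` {1..n} = cells q" using place_bij by (simp add: bij_betw_def)

lemma t_row:
 assumes "y:cells q" "z:cells q" "fst y = fst z" "fst (snd y) = fst (snd z)" "snd (snd y) < snd (snd z)"
 shows "t y < t z"
proof -
 have "t (fst z, fst (snd z), snd (snd y)) < t (fst z, fst (snd z), snd (snd z))"
  by (rule standard_fillingsD(3)[OF t assms(5)]) (use assms(2) in \<open>auto simp: cells_def\<close>)
 moreover have "y = (fst z, fst (snd z), snd (snd y))" using assms(3,4) by (simp add: prod_eq_iff)
 ultimately show ?thesis by simp
qed

lemma t_column:
 assumes "y:cells q" "z:cells q" "fst y = fst z" "snd (snd y) = snd (snd z)" "fst (snd y) < fst (snd z)"
 shows "t y < t z"
proof -
 have "t (fst z, fst (snd y), snd (snd z)) < t (fst z, fst (snd z), snd (snd z))"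
  by (rule standard_fillingsD(4)[OF t assms(5)]) (use assms(2) in \<open>auto simp: cells_def\<close>)
 moreover have "y = (fst z, fst (snd y), snd (snd z))" using assms(3,4) by (simp add: prod_eq_iff)
 ultimately show ?thesis by simp
qed

lemma diagram_place: "diagram {1..n} (place q t)" unfolding diagram_def
proof (intro conjI ballI allI impI)
 show "inj_on (place q t) {1..n}" by (rule bij_betw_imp_inj_on[OF place_bij])
 fix x r a assume x: "x:{1..n}" and r: "r <= rr (place q t) x" and a: "a <= cc (place q t) x"
 have "cc (place q t) x < q (kk (place q t) x, rr (place q t) x)"
  using place_in[OF x] by (auto simp: cells_def)
 also have "... <= q (kk (place q t) x, r)" by (rule part_antimono[OF part_q r])
 finally show "(kk (place q t) x, r, a):place q t ` {1..n}"
  unfolding place_image using a by (simp add: cells_def)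
qed simp

lemma kvalid_place: "kvalid c n (place q t)" unfolding kvalid_def
proof
 fix x assume "x:{1..n}"
 hence "place q t x:cells q" by (rule place_in)
 then obtain k r a where eq: "place q t x = (k, r, a)" "a < q (k, r)" by (auto simp: cells_def)
 have "k:comps c"
 proof (rule ccontr)
  assume "k ~: comps c"
  hence "q (k, r) = 0" using part_q unfolding part_def by blast
  thus False using eq(2) by simp
 qed
 thus "kk (place q t) x <= (if c = TypeB then 1 else 0)" by (auto simp: comps_def eq(1) split: if_splits)
qed

lemma rowcount_place:
 "rowcount {1..n} (place q t) k r = (SUM j<r. q (k, j))"
proof -
 have "rowcount {1..n} (place q t) k r = card {z:cells q. fst z = k & fst (snd z) < r}"
  unfolding rowcount_def
 proof (rule bij_betw_same_card[of "place q t"])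
  show "bij_betw (place q t) {x:{1..n}. kk (place q t) x = k & rr (place q t) x < r}
    {z:cells q. fst z = k & fst (snd z) < r}"
   using place_bij unfolding bij_betw_def inj_on_def by blast
 qed
 also have "{z:cells q. fst z = k & fst (snd z) < r} = (%(j, a). (k, j, a)) ` (SIGMA j:{..<r}. {..<q (k, j)})"
  by (auto simp: cells_def image_iff)
 also have "card ... = (SUM j<r. q (k, j))" by (subst card_image) (auto simp: inj_on_def)
 finally show ?thesis .
qed

text \<open>As long as the index stays constant each letter lies to the right of its predecessor. It
  cannot share its column, since reading upwards meets larger entries first.\<close>

lemma index_eq_imp_colno_less: assumes "0 < j" "j < k" "k <= n" "filling_index q t j = filling_index q t k"
 shows "colno q (place q t j) < colno q (place q t k)" using assms(2-4)
proof (induction k rule: less_induct)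
 case (less k)
 then obtain l where k: "k = Suc l" "j <= l" by (cases k) auto
 have l0: "0 < l" using k assms(1) by simp
 have 1: "filling_index q t j <= filling_index q t l" "filling_index q t l <= filling_index q t k"
  unfolding filling_index_def using k assms(1) l0 by (auto intro: descent_index_mono)
 hence eq: "filling_index q t l = filling_index q t k" "filling_index q t j = filling_index q t l"
  using less.prems by auto
 have "reading_less q (place q t l) (place q t k)"
  using eq(1) by (simp add: filling_index_def k descent_index_Suc[OF l0] split: if_splits)
 moreover have "~ (colno q (place q t l) = colno q (place q t k) & rr (place q t) k < rr (place q t) l)"
 proof
  assume *: "colno q (place q t l) = colno q (place q t k) & rr (place q t) k < rr (place q t) l"
  have lk: "l:{1..n}" "k:{1..n}" using l0 k less.prems by auto
  have "t (place q t k) < t (place q t l)" using colno_eqD[OF part_q place_in[OF lk(1)] place_in[OF lk(2)]] *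
   by (intro t_column place_in lk) auto
  thus False using k unfolding t_place[OF lk(1)] t_place[OF lk(2)] by simp
 qed
 ultimately have "colno q (place q t l) < colno q (place q t k)" by (auto simp: reading_less_def)
 thus ?case using less.IH[of l] k less.prems eq(2) by (cases "j = l") auto
qed

end

text \<open>The filling \<open>t0\<close> merely names the cells by 1 to n; thus one set of
  variables serves all fillings \<open>S\<close> of the shape.\<close>

lemma standard_labelling_of_filling: assumes "standard_filling c n q t0" and "standard_filling c n q S"
 shows "standard_labelling n (place q t0) (%x. colno q (place q t0 x))
  (%x. S (place q t0 x)) (%x. filling_index q S (S (place q t0 x)))"
proof -
 interpret T: standard_filling c n q t0 by fact
 interpret S: standard_filling c n q S by fact
 let ?p = "place q t0"
 have Sp: "S (?p x):{1..n}" if "x:{1..n}" for x using bij_betwE[OF S.t_bij] T.place_in[OF that] by blast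
 have mono: "filling_index q S (S (?p x)) <= filling_index q S (S (?p y))"
  if "x:{1..n}" "y:{1..n}" "S (?p x) < S (?p y)" for x y
  unfolding filling_index_def using Sp[OF that(1)] that(3) by (intro descent_index_mono) auto
 have eq: "colno q (?p x) < colno q (?p y)"
  if "x:{1..n}" "y:{1..n}" "S (?p x) < S (?p y)"
   "filling_index q S (S (?p x)) = filling_index q S (S (?p y))" for x y
  using S.index_eq_imp_colno_less[OF _ that(3) _ that(4)] Sp[OF that(1)] Sp[OF that(2)]
  by (simp add: S.place_t[OF T.place_in[OF that(1)]] S.place_t[OF T.place_in[OF that(2)]])
 show ?thesis
 proof
  show "diagram {1..n} ?p" by (rule T.diagram_place)
  show "bij_betw (%x. S (?p x)) {1..n} {1..n}"
   using bij_betw_trans[OF T.place_bij S.t_bij] by (simp add: o_def)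
  fix x y assume x: "x:{1..n}" and y: "y:{1..n}"
  note cx = T.place_in[OF x] and cy = T.place_in[OF y]
  show "filling_index q S (S (?p x)) <= filling_index q S (S (?p y))" if "S (?p x) < S (?p y)"
   by (rule mono[OF x y that])
  show "colno q (?p x) < colno q (?p y)"
   if "S (?p x) < S (?p y)" "filling_index q S (S (?p x)) = filling_index q S (S (?p y))"
   by (rule eq[OF x y that])
  show "colno q (?p x) = colno q (?p y)" if "kk ?p x = kk ?p y" "cc ?p x = cc ?p y"
   using that by (simp add: colno_def)
  show "colno q (?p x) < colno q (?p y) & S (?p x) < S (?p y) | colno q (?p y) < colno q (?p x) & S (?p y) < S (?p x)"
   if k: "kk ?p x = kk ?p y" and r: "rr ?p x = rr ?p y" and ne: "x ~= y"
  proof -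
   have "?p x ~= ?p y" using ne T.t_place[OF x] T.t_place[OF y] by metis
   hence "cc ?p x < cc ?p y | cc ?p y < cc ?p x" using k r by (auto simp: prod_eq_iff)
   thus ?thesis
    using S.t_row[OF cx cy k r] S.t_row[OF cy cx k[symmetric] r[symmetric]] k by (auto simp: colno_def)
  qed
  show "filling_index q S (S (?p x)) < filling_index q S (S (?p y))"
   if k: "kk ?p x = kk ?p y" and a: "cc ?p x = cc ?p y" and r: "rr ?p x < rr ?p y"
  proof -
   have lt: "S (?p x) < S (?p y)" by (rule S.t_column[OF cx cy k a r])
   have "filling_index q S (S (?p x)) ~= filling_index q S (S (?p y))"
    using eq[OF x y lt] k a by (auto simp: colno_def)
   thus ?thesis using mono[OF x y lt] by simp
  qed
 qed
qed

definition cell_offset :: "cox_type => position => nat" where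
 "cell_offset c z = (if c = TypeB & fst z = 1 then 1 else 0)"

text \<open>Sorting the cells by value and then by column produces \<open>S\<close>. Its index grows
  no faster than the values along the labels, so the difference \<open>g\<close> is nonnegative and
  monotone. In type B the values are halved first, the remainder being the component.\<close>

lemma standardization: assumes q: "q:Parts c n" and f: "f:semistandard_fillings c J q d"
 obtains S g where "S:standard_fillings q"
  "!!x y. 0 < x ==> x <= y ==> y <= n ==> g x <= (g y :: nat)"
  "!!x. x ~: {1..n} ==> g x = 0"
  "!!z. z:cells q ==> f z = mult_c c * (filling_index q S (S z) + g (S z)) + cell_offset c z"
proof -
 have part: "part c q" and size: "rsize q = n" using q by (simp_all add: Parts_def)
 note fin = finite_cells[OF part]
 let ?m = "mult_c c"
 define b where "b z = f z div ?m" for z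
 have f_eq: "f z = ?m * b z + cell_offset c z" if z: "z:cells q" for z
 proof (cases c)
  case TypeB
  hence "f z mod 2 = fst z" using semistandard_fillingsD(3)[OF f z] by (simp add: kap_def)
  moreover from this have "fst z < 2" by linarith
  ultimately show ?thesis
   using mult_div_mod_eq[of 2 "f z"] by (auto simp: b_def mult_c_def cell_offset_def TypeB)
 qed (simp add: b_def mult_c_def cell_offset_def)
 have b_row: "b y <= b z"
  if "z:cells q" "fst y = fst z" "fst (snd y) = fst (snd z)" "snd (snd y) <= snd (snd z)" for y z
 proof -
  have "f (fst z, fst (snd z), snd (snd y)) <= f (fst z, fst (snd z), snd (snd z))"
   by (rule semistandard_fillingsD(4)[OF f that(4)]) (use that(1) in \<open>auto simp: cells_def\<close>)
  moreover have "y = (fst z, fst (snd z), snd (snd y))" using that(2,3) by (simp add: prod_eq_iff)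
  ultimately show ?thesis unfolding b_def by (simp add: div_le_mono)
 qed
 have b_column: "b y < b z"
  if "y:cells q" "z:cells q" "fst y = fst z" "snd (snd y) = snd (snd z)" "fst (snd y) < fst (snd z)" for y z
 proof -
  have "f (fst z, fst (snd y), snd (snd z)) < f (fst z, fst (snd z), snd (snd z))"
   by (rule semistandard_fillingsD(5)[OF f that(5)]) (use that(2) in \<open>auto simp: cells_def\<close>)
  moreover have "y = (fst z, fst (snd y), snd (snd z))" using that(3,4) by (simp add: prod_eq_iff)
  ultimately have "f y < f z" by simp
  moreover have "cell_offset c y = cell_offset c z" using that(3) by (simp add: cell_offset_def)
  ultimately show ?thesis using f_eq[OF that(1)] f_eq[OF that(2)] by simp
 qed
 define N where "N = Suc (Max (insert 0 (colno q ` cells q)))"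
 have coN: "colno q z < N" if "z:cells q" for z
  unfolding N_def less_Suc_eq_le using fin that by (intro Max_ge) auto
 \<comment> \<open>Encodes the lexicographic order by value and column in one number; all column
   numbers are below \<open>N\<close>.\<close>
 define key where "key z = b z * N + colno q z" for z
 have key_less: "b y < b z | b y = b z & colno q y < colno q z"
  if "y:cells q" "z:cells q" "key y < key z" for y z
 proof -
  have "key u div N = b u" "key u mod N = colno q u" if "u:cells q" for u
   using coN[OF that] by (simp_all add: key_def)
  moreover have "key y div N <= key z div N" using that(3) by (simp add: div_le_mono)
  ultimately have "b y <= b z" using that(1,2) by simp
  thus ?thesis using that(3) by (auto simp: key_def)
 qed
 have key_inj: "y = z" if "y:cells q" "z:cells q" "key y = key z" for y z
 proof -
  have "key u div N = b u" "key u mod N = colno q u" if "u:cells q" for u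
   using coN[OF that] by (simp_all add: key_def)
  hence "b y = b z" "colno q y = colno q z" using that by metis+
  note col = colno_eqD[OF part that(1,2) this(2)]
  hence "fst (snd y) = fst (snd z)"
   using b_column[OF that(1,2)] b_column[OF that(2,1)] `b y = b z` by (cases "fst (snd y)" "fst (snd z)" rule: linorder_cases) auto
  thus ?thesis using col by (simp add: prod_eq_iff)
 qed
 define S where "S z = (if z:cells q then card {y:cells q. key y <= key z} else 0)" for z
 have S_mono: "S y < S z" if "y:cells q" "z:cells q" "key y < key z" for y z
 proof -
  have "{u:cells q. key u <= key y} \<subset> {u:cells q. key u <= key z}" using that by force
  thus ?thesis using fin that by (simp add: S_def psubset_card_mono)
 qed
 have S_less: "key y < key z" if "y:cells q" "z:cells q" "S y < S z" for y z
  using S_mono[OF that(2,1)] that key_inj[OF that(1,2)] by (cases "key y" "key z" rule: linorder_cases) auto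
 have S_bij: "bij_betw S (cells q) {1..n}"
 proof -
  have inj: "inj_on S (cells q)"
  proof (rule inj_onI)
   fix y z assume yz: "y:cells q" "z:cells q" "S y = S z"
   thus "y = z"
    using S_mono[OF yz(1,2)] S_mono[OF yz(2,1)] key_inj[OF yz(1,2)] by (cases "key y" "key z" rule: linorder_cases) auto
  qed
  have "S ` cells q <= {1..n}"
  proof (rule image_subsetI)
   fix z assume z: "z:cells q"
   have "card {y:cells q. key y <= key z} <= card (cells q)" using fin by (intro card_mono) auto
   moreover have "{y:cells q. key y <= key z} ~= {}" using z by blast
   hence "card {y:cells q. key y <= key z} ~= 0" using fin by simp
   ultimately show "S z:{1..n}" using z card_cells[OF part] size by (simp add: S_def Suc_le_eq)
  qed
  moreover have "card (S ` cells q) = card {1..n}" using card_image[OF inj] card_cells[OF part] size by simp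
  ultimately have "S ` cells q = {1..n}" by (intro card_subset_eq) auto
  thus ?thesis using inj by (simp add: bij_betw_def)
 qed
 have S: "S:standard_fillings q" unfolding standard_fillings_def
 proof (intro CollectI conjI allI impI)
  show "S z = 0" if "z ~: cells q" for z using that by (simp add: S_def)
  show "bij_betw S (cells q) {1..rsize q}" using S_bij size by simp
  show "S (k, r, a) < S (k, r, a')" if "a < a' & a' < q (k, r)" for k r a a'
  proof (rule S_mono)
   show cells: "(k, r, a):cells q" "(k, r, a'):cells q" using that by (simp_all add: cells_def)
   have "b (k, r, a) * N <= b (k, r, a') * N" using b_row[OF cells(2), of "(k, r, a)"] that by simp
   moreover have "colno q (k, r, a) < colno q (k, r, a')" using that by (simp add: colno_def)
   ultimately show "key (k, r, a) < key (k, r, a')" unfolding key_def by linarith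
  qed
  show "S (k, r, a) < S (k, r', a)" if r: "r < r' & a < q (k, r')" for k r r' a
  proof (rule S_mono)
   show cells: "(k, r, a):cells q" "(k, r', a):cells q"
    using r part_antimono[OF part, of r r' k] by (simp_all add: cells_def)
   have "b (k, r, a) < b (k, r', a)" using b_column[OF cells] r by simp
   hence "b (k, r, a) * N < b (k, r', a) * N" using coN[OF cells(1)] by simp
   moreover have "colno q (k, r, a) = colno q (k, r', a)" by (simp add: colno_def)
   ultimately show "key (k, r, a) < key (k, r', a)" unfolding key_def by linarith
  qed
 qed
 interpret S: standard_filling c n q S by unfold_locales (rule q, rule S)
 define g where "g x = (if x:{1..n} then b (place q S x) - filling_index q S x else 0)" for x
 \<comment> \<open>The index grows by one only at a descent. Equal values would mean increasing
   columns and hence no descent, so the value grows there as well.\<close>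
 have step: "filling_index q S (Suc x) + b (place q S x) <= filling_index q S x + b (place q S (Suc x))"
  if x: "0 < x" "Suc x <= n" for x
 proof -
  have c: "place q S x:cells q" "place q S (Suc x):cells q" using x by (intro S.place_in; simp)+
  have "S (place q S x) < S (place q S (Suc x))" using x by (simp add: S.t_place)
  hence "key (place q S x) < key (place q S (Suc x))" by (rule S_less[OF c])
  then consider "b (place q S x) < b (place q S (Suc x))"
   | "b (place q S x) = b (place q S (Suc x))" "colno q (place q S x) < colno q (place q S (Suc x))"
   using key_less[OF c] by blast
  thus ?thesis by cases (simp_all add: filling_index_def descent_index_Suc[OF x(1)] reading_less_def)
 qed
 have diff: "filling_index q S y + b (place q S x) <= filling_index q S x + b (place q S y)"
  if x: "0 < x" "x <= y" "y <= n" for x y using x(2,3)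
 proof (induction y rule: dec_induct)
  case (step y)
  thus ?case using `0 < x` `!!x. 0 < x ==> Suc x <= n ==> _`[of y] by simp
 qed simp
 have idx: "filling_index q S x <= b (place q S x)" if "x:{1..n}" for x
  using diff[of 1 x] that by (simp add: filling_index_def One_nat_def)
 show ?thesis
 proof (rule that[OF S, of g])
  show "g x <= g y" if "0 < x" "x <= y" "y <= n" for x y
   using diff[OF that] idx[of x] idx[of y] that by (simp add: g_def)
  show "g x = 0" if "x ~: {1..n}" for x using that by (simp only: g_def if_False)
  show "f z = ?m * (filling_index q S (S z) + g (S z)) + cell_offset c z" if z: "z:cells q" for z
  proof -
   have Sz: "S z:{1..n}" using bij_betwE[OF S_bij] z by blast
   show ?thesis using f_eq[OF z] idx[OF Sz] Sz by (simp add: g_def S.place_t[OF z])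
  qed
 qed
qed

section \<open>Tools for the independence of different tableaux\<close>

section \<open>Independence of the polynomials of different tableaux\<close>

text \<open>At a maximizing column permutation the vector \<open>u\<close> remains increasing along
  columns, since a transposition would otherwise improve the sum; by
  \<open>column_strict_unique\<close> the identity is the only maximizer.\<close>

lemma column_rearrangement: fixes u v :: "nat => nat"
 assumes dia: "diagram X p" and g: "g:Cgrp X p" and ne: "g ~= id"
  and u: "!!x y. x:X ==> y:X ==> kk p x = kk p y ==> cc p x = cc p y ==> rr p x < rr p y ==> u x < u y"
  and v: "!!x y. x:X ==> y:X ==> kk p x = kk p y ==> cc p x = cc p y ==> rr p x < rr p y ==> v x < v y"
 shows "(SUM x:X. u (g x) * v x) < (SUM x:X. u x * v x)"
proof -
 define W where "W h = (SUM x:X. u (h x) * v x)" for h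
 note fin = finite_X[OF dia]
 define M where "M = Max (W ` Cgrp X p)"
 have le: "W h <= M" if "h:Cgrp X p" for h
  unfolding M_def using finite_Cgrp[OF dia] that by (intro Max_ge) auto
 have max_id: "h = id" if h: "h:Cgrp X p" and eq: "W h = M" for h
 proof (rule column_strict_unique[OF dia h, of u "%x. u (h x)"])
  have hp: "h permutes X" and pres: "!!x. x:X ==> kk p (h x) = kk p x & cc p (h x) = cc p x"
   using h by (simp_all add: Cgrp_def)
  have hX: "h x:X" if "x:X" for x using that by (simp add: permutes_in_image[OF hp])
  fix x y assume xy: "x:X" "y:X" "kk p x = kk p y" "cc p x = cc p y" "rr p x < rr p y"
  have "x ~= y" using xy(5) by auto
  show "u (h x) < u (h y)"
  proof (rule ccontr)
   assume "~ u (h x) < u (h y)"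
   moreover have "u (h x) ~= u (h y)"
   proof
    assume eq: "u (h x) = u (h y)"
    have "h x ~= h y" using permutes_inj[OF hp] `x ~= y` by (auto dest: injD)
    hence "rr p (h x) ~= rr p (h y)"
     using position_inj[OF dia hX[OF xy(1)] hX[OF xy(2)]] pres[OF xy(1)] pres[OF xy(2)] xy(3,4) by auto
    thus False using u[OF hX[OF xy(1)] hX[OF xy(2)]] u[OF hX[OF xy(2)] hX[OF xy(1)]] eq
      pres[OF xy(1)] pres[OF xy(2)] xy(3,4) by (cases "rr p (h x)" "rr p (h y)" rule: linorder_cases) auto
   qed
   ultimately have gt: "u (h y) < u (h x)" by simp
   define r where "r = h o transpose x y"
   have r: "r:Cgrp X p"
    unfolding r_def by (rule Cgrp_comp[OF h Cgrp_transpose[OF xy(1-4)]])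
   have split: "W m = (SUM z:X - {x, y}. u (m z) * v z) + (u (m x) * v x + u (m y) * v y)" for m
    unfolding W_def using sum.subset_diff[of "{x, y}" X "%z. u (m z) * v z"] fin xy(1,2) `x ~= y` by simp
   have "(SUM z:X - {x, y}. u (r z) * v z) = (SUM z:X - {x, y}. u (h z) * v z)"
    by (intro sum.cong refl) (simp add: r_def transpose_def)
   hence "W r = (SUM z:X - {x, y}. u (h z) * v z) + (u (h y) * v x + u (h x) * v y)"
    unfolding split by (simp add: r_def)
   moreover have "u (h x) * v x + u (h y) * v y < u (h y) * v x + u (h x) * v y"
   proof -
    obtain e where e: "u (h x) = u (h y) + e" "0 < e" using gt less_imp_add_positive by metis
    obtain e' where e': "v y = v x + e'" "0 < e'" using v[OF xy] less_imp_add_positive by metis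
    show ?thesis using e(2) e'(2) by (simp add: e(1) e'(1) algebra_simps)
   qed
   ultimately have "W h < W r" unfolding split[of h] by simp
   thus False using le[OF r] eq by simp
  qed
 qed (use u in auto)
 have "M:W ` Cgrp X p" unfolding M_def using finite_Cgrp[OF dia] Cgrp_id by (intro Max_in) auto
 then obtain h where "h:Cgrp X p" "W h = M" by auto
 hence "W id = M" using max_id by metis
 hence "W g < W id" using le[OF g] max_id[OF g] ne by fastforce
 thus ?thesis by (simp add: W_def)
qed

text \<open>Includes the squared variables of type B and the extra factor X_j for entries j of the
  second component.\<close>

definition cell_exponent :: "cox_type => rows => (position => nat) => position => nat" where
 "cell_exponent c q S z = mult_c c * filling_index q S (S z) + cell_offset c z"

lemma fst_cell: assumes q: "part c q" and z: "z:cells q" shows "fst z = cell_offset c z"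
proof -
 obtain k r a where z_eq: "z = (k, r, a)" by (cases z)
 have "k:comps c"
 proof (rule ccontr)
  assume "k ~: comps c"
  hence "q (k, r) = 0" using q unfolding part_def by blast
  thus False using z by (simp add: cells_def z_eq)
 qed
 thus ?thesis by (auto simp: z_eq cell_offset_def comps_def split: if_splits)
qed

text \<open>Exponents that are constant on rows, hence invariant under the row group.\<close>

definition row_exponent :: "cox_type => position => nat" where
 "row_exponent c z = mult_c c * fst (snd z) + cell_offset c z"

lemma row_exponent_eq_iff: assumes "part c q" "y:cells q" "z:cells q"
 shows "row_exponent c y = row_exponent c z \<longleftrightarrow> fst y = fst z & fst (snd y) = fst (snd z)"
proof (cases c)
 case TypeB
 have "row_exponent c u mod 2 = cell_offset c u" "row_exponent c u div 2 = fst (snd u)" for u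
  by (simp_all add: row_exponent_def mult_c_def TypeB cell_offset_def)
 thus ?thesis using fst_cell[OF assms(1)] assms(2,3) by (metis row_exponent_def)
qed (use fst_cell[OF assms(1)] assms(2,3) in \<open>auto simp: row_exponent_def mult_c_def cell_offset_def\<close>)

lemma row_exponent_less:
 "fst y = fst z ==> fst (snd y) < fst (snd z) ==> row_exponent c y < row_exponent c z"
 using mult_c_pos[of c] by (simp add: row_exponent_def cell_offset_def)

text \<open>Rows increase, so a standard filling is determined by the set of entries in each of its
  rows.\<close>

lemma standard_filling_eqI: assumes T: "standard_filling c n q T" and T': "standard_filling c n q T'"
  and row: "!!z. z:cells q ==> fst (place q T (T' z)) = fst z & fst (snd (place q T (T' z))) = fst (snd z)"
 shows "T = T'"
proof (rule ext)
 interpret T: standard_filling c n q T by fact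
 interpret T': standard_filling c n q T' by fact
 fix z
 show "T z = T' z"
 proof (cases "z:cells q")
  case False
  thus ?thesis using standard_fillingsD(1)[OF T.t] standard_fillingsD(1)[OF T'.t] by simp
 next
  case True
  obtain k r a where z_eq: "z = (k, r, a)" by (cases z)
  let ?L = "[0..<q (k, r)]"
  let ?f = "%a. T (k, r, a)" and ?f' = "%a. T' (k, r, a)"
  have a: "a < q (k, r)" using True by (simp add: z_eq cells_def)
  have strict: "sorted_wrt (<) (map ?f ?L)" "sorted_wrt (<) (map ?f' ?L)"
   using standard_fillingsD(3)[OF T.t] standard_fillingsD(3)[OF T'.t] by (auto simp: sorted_wrt_iff_nth_less)
  hence s: "sorted (map ?f ?L)" "distinct (map ?f ?L)" "sorted (map ?f' ?L)" "distinct (map ?f' ?L)"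
   using strict_sorted_iff by blast+
  have "set (map ?f' ?L) <= set (map ?f ?L)"
  proof
   fix y assume "y:set (map ?f' ?L)"
   then obtain b where b: "b < q (k, r)" "y = T' (k, r, b)" by auto
   have c: "(k, r, b):cells q" using b by (simp add: cells_def)
   have y: "y:{1..n}" using bij_betwE[OF T'.t_bij] c b(2) by blast
   obtain b' where b': "place q T y = (k, r, b')" using row[OF c] b(2) by (cases "place q T y") auto
   have "(k, r, b'):cells q" using T.place_in[OF y] b' by simp
   hence "b' < q (k, r)" by (simp add: cells_def)
   moreover have "y = T (k, r, b')" using T.t_place[OF y] b' by simp
   ultimately show "y:set (map ?f ?L)" by auto
  qed
  moreover have "card (set (map ?f' ?L)) = card (set (map ?f ?L))"
   using distinct_card[OF s(2)] distinct_card[OF s(4)] by simp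
  ultimately have "set (map ?f' ?L) = set (map ?f ?L)" by (intro card_subset_eq) auto
  hence "map ?f' ?L = map ?f ?L" by (intro sorted_distinct_set_unique s)
  hence "map ?f' ?L ! a = map ?f ?L ! a" by (simp only:)
  thus ?thesis using a by (simp add: z_eq)
 qed
qed

lemma fnum_pos: "part c q ==> rsize q = n ==> 0 < fnum c n q"
proof (induction n arbitrary: q)
 case 0
 thus ?case using rsize_eq_0 by simp
next
 case (Suc n)
 obtain x where x: "x:removable c q" using removable_nonempty[OF Suc.prems(1)] Suc.prems(2) by auto
 have "0 < fnum c n (dec q x)"
  using addable_dec[OF Suc.prems(1) x] rsize_dec[OF Suc.prems(1) x] Suc.prems(2) by (intro Suc.IH) auto
 thus ?case using x finite_removable[OF Suc.prems(1)] by (auto simp: sum_eq_0_iff intro!: gr0I)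
qed

lemma card_standard_fillings_pos: "q:Parts c n ==> 0 < card (standard_fillings q)"
 using fnum_pos[of c q n] fnum_le_card[of c q n] by (simp add: Parts_def)

section \<open>Specht polynomials attached to a shape\<close>

section \<open>The families of Specht polynomials\<close>

text \<open>The index set stays abstract here; the final instance takes pairs of lists as shapes and
  \<open>shape_rows\<close> as \<open>R\<close>.\<close>

locale specht_shapes = fixes c :: cox_type and n :: nat and J :: "'j set" and R :: "'j => rows"
 assumes R: "bij_betw R J (Parts c n)"
begin

abbreviation "SF j == standard_fillings (R j)"

definition base :: "'j => position => nat" where
 "base j = (SOME t. t:SF j)"

definition bp :: "'j => nat => position" where
 "bp j = place (R j) (base j)"

definition bx :: "'j => (position => nat) => nat \<Rightarrow>\<^sub>0 nat" where
 "bx j S = expo n (%x. cell_exponent c (R j) S (bp j x))"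

text \<open>Up to a nonzero factor, the higher Specht polynomial of \<open>S\<close> whose other
  tableau is \<open>base j\<close>.\<close>

definition sp :: "'j => (position => nat) => rpoly" where
 "sp j S = CR n (bp j) (mon (bx j S))"

text \<open>The same with arbitrary exponents of the right parity in place of the index of \<open>S\<close>\<close>

definition sv :: "'j => (position => nat) => rpoly" where
 "sv j u = CR n (bp j) (mon (expo n (%x. mult_c c * u (bp j x) + cell_offset c (bp j x))))"

lemma sp_sv: "sp j S = sv j (%z. filling_index (R j) S (S z))"
 by (simp add: sp_def sv_def bx_def cell_exponent_def)

text \<open>Relabels the base filling as \<open>T\<close>, so that \<open>tw j T\<close> turns the
  polynomials of the base tableau into those of \<open>T\<close>.\<close>

definition tperm :: "'j => (position => nat) => nat => nat" where
 "tperm j T x = (if x:{1..n} then T (bp j x) else x)"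

abbreviation "tw j T == act (tperm j T, {})"

lemma R_Parts: "j:J ==> R j:Parts c n" using R bij_betwE by blast

lemma part_R: "j:J ==> part c (R j)" using R_Parts by (simp add: Parts_def)

lemma finite_SF: "j:J ==> finite (SF j)" by (rule finite_standard_fillings[OF part_R])

lemma finite_J': "finite J" using R bij_betw_finite finite_Parts by metis

lemma SF_standard_filling: "j:J ==> S:SF j ==> standard_filling c n (R j) S" by unfold_locales (rule R_Parts)

lemma base_in: "j:J ==> base j:SF j"
proof -
 assume "j:J"
 hence "SF j ~= {}" using card_standard_fillings_pos[OF R_Parts] by force
 thus "base j:SF j" unfolding base_def by (metis ex_in_conv someI)
qed

lemma base_filling: "j:J ==> standard_filling c n (R j) (base j)" by (rule SF_standard_filling[OF _ base_in])

lemma diagram_bp: "j:J ==> diagram {1..n} (bp j)"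
 unfolding bp_def by (rule standard_filling.diagram_place[OF base_filling])

lemma bp_in: "j:J ==> x:{1..n} ==> bp j x:cells (R j)"
 unfolding bp_def by (rule standard_filling.place_in[OF base_filling])

lemma bp_image: "j:J ==> bp j ` {1..n} = cells (R j)"
 unfolding bp_def by (rule standard_filling.place_image[OF base_filling])

lemma bp_bij: "j:J ==> bij_betw (bp j) {1..n} (cells (R j))"
 unfolding bp_def by (rule standard_filling.place_bij[OF base_filling])

lemma sp_independent: assumes j: "j:J" and h: "!!S. S:SF j ==> h S:invariants n (refl_group c n)"
  and rel: "(SUM S:SF j. h S * sp j S) = 0" and S: "S:SF j" shows "h S = 0"
proof (rule leading_independence[of "SF j" n "bp j" "%x. colno (R j) (bp j x)" "%S x. S (bp j x)"
   "%S x. filling_index (R j) S (S (bp j x))", OF _ finite_SF[OF j] _ h _ S])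
 show "standard_labelling n (bp j) (%x. colno (R j) (bp j x)) (%x. S' (bp j x))
   (%x. filling_index (R j) S' (S' (bp j x)))" if "S':SF j" for S'
  unfolding bp_def by (rule standard_labelling_of_filling[OF base_filling[OF j] SF_standard_filling[OF j that]])
 show "S1 = S2" if S1: "S1:SF j" and S2: "S2:SF j"
  and eq: "!!x. x:{1..n} ==> S1 (bp j x) = S2 (bp j x)" for S1 S2
 proof (rule ext)
  fix z
  show "S1 z = S2 z"
  proof (cases "z:cells (R j)")
   case True
   then obtain x where "x:{1..n}" "z = bp j x" using bp_image[OF j] by blast
   thus ?thesis using eq by simp
  next
   case False
   thus ?thesis using standard_fillingsD(1)[OF S1] standard_fillingsD(1)[OF S2] by simp
  qed
 qed
 show "(SUM S:SF j. h S * CR n (bp j) (mon (expo n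
   (%x. mult_c c * filling_index (R j) S (S (bp j x)) + offs c (bp j) x)))) = 0"
  using rel by (simp add: sp_def bx_def cell_exponent_def cell_offset_def offs_def)
qed

lemma one_invariant: "1:invariants n (refl_group c n)" and zero_invariant: "0:invariants n (refl_group c n)"
 by (auto simp: invariants_def act_def psubst_def poly_ring_def)

lemma sp_nonzero: assumes j: "j:J" and S: "S:SF j" shows "sp j S ~= 0"
proof
 assume 0: "sp j S = 0"
 let ?h = "%S'. if S' = S then 1 else 0 :: rpoly"
 have "(SUM S':SF j. ?h S' * sp j S') = 0" using 0 by (intro sum.neutral) auto
 hence "?h S = 0"
 proof (rule sp_independent[OF j _ _ S, of ?h, rotated])
  show "?h S':invariants n (refl_group c n)" for S'
   using one_invariant zero_invariant by (cases "S' = S") simp_all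
 qed
 thus False by simp
qed

lemma Qop_sv: fixes u :: "position => nat" and j :: 'j
 defines "m == expo n (%x. mult_c c * u (bp j x) + cell_offset c (bp j x))"
 shows "Qop c n (bp j) (mon m) = mon m"
proof (rule poly_mapping_eqI)
 have "qpar c n (bp j) m" by (auto simp: qpar_def m_def coef_expo cell_offset_def mult_c_def)
 thus "coef (Qop c n (bp j) (mon m)) k = coef (mon m) k" for k by (auto simp: coef_Qop lookup_single when_def)
qed

lemma rowcount_differs: assumes jk: "j:J" "k:J" "j ~= k"
 shows "EX a r. rowcount {1..n} (bp j) a r ~= rowcount {1..n} (bp k) a r"
proof (rule ccontr)
 assume "\<nexists>a r. rowcount {1..n} (bp j) a r ~= rowcount {1..n} (bp k) a r"
 hence *: "(SUM i<r. R j (a, i)) = (SUM i<r. R k (a, i))" for a r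
  using standard_filling.rowcount_place[OF base_filling[OF jk(1)]]
   standard_filling.rowcount_place[OF base_filling[OF jk(2)]] by (simp add: bp_def)
 have "R j x = R k x" for x
  using *[where a = "fst x" and r = "Suc (snd x)"] *[where a = "fst x" and r = "snd x"] by simp
 hence "R j = R k" by (rule ext)
 thus False using jk R by (metis bij_betw_imp_inj_on inj_onD)
qed

lemma primitive_system_exists:
 obtains E where "primitive_system c n J E" "!!j u. j:J ==> E j (sv j u) = sv j u"
proof (rule primitive_system_of_diagrams[of J n bp c])
 fix E' assume E': "primitive_system c n J E'"
  "!!j g. j:J ==> Qop c n (bp j) g = g ==> E' j (CR n (bp j) g) = CR n (bp j) g"
 show thesis by (rule that[OF E'(1)]) (simp only: sv_def E'(2) Qop_sv)
next
 fix j assume j: "j:J"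
 show "diagram {1..n} (bp j)" by (rule diagram_bp[OF j])
 show "kvalid c n (bp j)" unfolding bp_def by (rule standard_filling.kvalid_place[OF base_filling[OF j]])
 show "CR n (bp j) (mon (expo n (%x. mult_c c * filling_index (R j) (base j) (base j (bp j x)) + cell_offset c (bp j x)))) ~= 0"
  using sp_nonzero[OF j base_in[OF j]] unfolding sp_sv sv_def .
qed (rule finite_J' Qop_sv rowcount_differs; assumption?)+

lemma tperm_permutes: assumes j: "j:J" and T: "T:SF j" shows "tperm j T permutes {1..n}"
proof (rule bij_imp_permutes)
 have "bij_betw (T o bp j) {1..n} {1..n}"
  using bij_betw_trans[OF bp_bij[OF j] standard_filling.t_bij[OF SF_standard_filling[OF j T]]] .
 thus "bij_betw (tperm j T) {1..n} {1..n}" by (rule bij_betw_cong[THEN iffD1, rotated]) (simp add: tperm_def)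
qed (simp only: tperm_def if_False)

lemma gop_tw: "j:J ==> T:SF j ==> gop c n (tw j T) (act (ginv (tperm j T, {})))"
 by (intro gop_act permutation_in_refl_group tperm_permutes)

text \<open>Exponents constant on rows make the coefficients computable. Among the tableaux in a
  relation take the one with the largest \<open>F\<close>; at the exponent recording its rows the
  rearrangement inequality excludes all others.\<close>

lemma tw_sv_independent: assumes j: "j:J"
 shows "lin_indep_family (SF j) (%T. tw j T (sv j (%z. fst (snd z))))"
proof -
 let ?X = "{1..n}" and ?p = "bp j" and ?v = "sv j (%z. fst (snd z))"
 note dia = diagram_bp[OF j]
 define e where "e = row_exponent c"
 have sv: "?v = CR n ?p (mon (expo n (%x. e (?p x))))"
  by (simp add: sv_def e_def row_exponent_def)
 have coef_tw: "coef (tw j T ?v) (expo n v)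
   = real (card (Rgrp ?X ?p)) * (SUM g:Cgrp ?X ?p. if ALL x:?X. v (tperm j T (g x)) = e (?p x) then real_of_int (sign g) else 0)"
  if T: "T:SF j" for T v
 proof -
  note r = tperm_permutes[OF j T]
  have "coef (tw j T ?v) (expo n v) = coef ?v (pm (tperm j T) (expo n v))"
   by (simp add: coef_act[OF permutes_bij[OF r]] sg_def)
  also have "... = coef ?v (expo n (%x. v (tperm j T x)))" by (simp only: pm_expo[OF r])
  also have "... = (SUM g:Cgrp ?X ?p. SUM u:Rgrp ?X ?p. real_of_int (sign g) *
    coef (mon (expo n (%x. e (?p x)))) (pm u (pm g (expo n (%x. v (tperm j T x))))))"
   unfolding sv by (rule coef_Cop_Rop[OF dia])
  also have "... = (SUM g:Cgrp ?X ?p. SUM u:Rgrp ?X ?p.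
    if ALL x:?X. v (tperm j T (g x)) = e (?p x) then real_of_int (sign g) else 0)"
  proof (intro sum.cong refl)
   fix g u assume g: "g:Cgrp ?X ?p" and u: "u:Rgrp ?X ?p"
   note gp = Cgrp_permutes[OF g] and up = Rgrp_permutes[OF u]
   have eu: "e (?p (u x)) = e (?p x)" if x: "x:?X" for x
   proof -
    have "u x:?X" using x by (simp only: permutes_in_image[OF up])
    thus ?thesis
     unfolding e_def using row_exponent_eq_iff[OF part_R[OF j] bp_in[OF j] bp_in[OF j x]] u x by (simp add: Rgrp_def)
   qed
   have "(ALL x:?X. v (tperm j T (g (u x))) = e (?p x)) \<longleftrightarrow> (ALL x:?X. v (tperm j T (g x)) = e (?p x))"
   proof -
    have "(ALL x:?X. v (tperm j T (g (u x))) = e (?p x)) \<longleftrightarrow> (ALL x:?X. v (tperm j T (g (u x))) = e (?p (u x)))"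
     using eu by simp
    also have "... \<longleftrightarrow> (ALL y:u ` ?X. v (tperm j T (g y)) = e (?p y))" by blast
    finally show ?thesis by (simp only: permutes_image[OF up])
   qed
   thus "real_of_int (sign g) * coef (mon (expo n (%x. e (?p x)))) (pm u (pm g (expo n (%x. v (tperm j T x)))))
    = (if ALL x:?X. v (tperm j T (g x)) = e (?p x) then real_of_int (sign g) else 0)"
    by (simp add: pm_expo[OF gp] pm_expo[OF up] lookup_single when_def expo_eq_iff eq_commute[of "e (bp j _)"])
  qed
  also have "... = real (card (Rgrp ?X ?p)) * (SUM g:Cgrp ?X ?p. if ALL x:?X. v (tperm j T (g x)) = e (?p x) then real_of_int (sign g) else 0)"
   by (simp add: sum_distrib_left)
  finally show ?thesis .
 qed
 define F where "F T = (SUM x:?X. tperm j T x * e (?p x))" for T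
 \<comment> \<open>The exponent that gives the variable y the value of the row in which
   \<open>T\<close> contains y.\<close>
 define v where "v T y = e (place (R j) T y)" for T y
 \<comment> \<open>The condition rewrites \<open>F T0\<close> as the sum for \<open>T\<close>
   rearranged by \<open>g\<close>, which is smaller than \<open>F T\<close> unless \<open>g\<close>
   is the identity; then \<open>T\<close> and \<open>T0\<close> have the same rows.\<close>
 have key: "g = id & T = T0"
  if T: "T:SF j" and T0: "T0:SF j" and le: "F T <= F T0" and g: "g:Cgrp ?X ?p"
   and cond: "ALL x:?X. v T0 (tperm j T (g x)) = e (?p x)" for T T0 g
 proof -
  interpret T: standard_filling c n "R j" T by (rule SF_standard_filling[OF j T])
  interpret T0: standard_filling c n "R j" T0 by (rule SF_standard_filling[OF j T0])
  note r = tperm_permutes[OF j T] and r0 = tperm_permutes[OF j T0] and gp = Cgrp_permutes[OF g]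
  have "F T0 = (SUM x:?X. tperm j T0 x * v T0 (tperm j T0 x))"
   unfolding F_def by (intro sum.cong refl) (simp add: v_def tperm_def T0.place_t bp_in[OF j])
  also have "... = (SUM y:?X. y * v T0 y)" by (rule sum.reindex_bij_betw[OF permutes_imp_bij[OF r0]])
  also have "... = (SUM x:?X. tperm j T (g x) * v T0 (tperm j T (g x)))"
   using sum.reindex_bij_betw[OF permutes_imp_bij[OF permutes_compose[OF gp r]], of "%y. y * v T0 y"] by simp
  also have "... = (SUM x:?X. tperm j T (g x) * e (?p x))" using cond by simp
  finally have F0: "F T0 = (SUM x:?X. tperm j T (g x) * e (?p x))" .
  have gid: "g = id"
  proof (rule ccontr)
   assume "g ~= id"
   hence "(SUM x:?X. tperm j T (g x) * e (?p x)) < F T" unfolding F_def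
   proof (rule column_rearrangement[OF dia g])
    fix x y assume xy: "x:?X" "y:?X" "kk ?p x = kk ?p y" "cc ?p x = cc ?p y" "rr ?p x < rr ?p y"
    show "tperm j T x < tperm j T y"
     using T.t_column[OF bp_in[OF j xy(1)] bp_in[OF j xy(2)] xy(3-5)] xy(1,2) by (simp add: tperm_def)
    show "e (?p x) < e (?p y)" unfolding e_def by (rule row_exponent_less[OF xy(3,5)])
   qed
   thus False using F0 le by simp
  qed
  have "T0 = T"
  proof (rule standard_filling_eqI[OF T0.standard_filling_axioms T.standard_filling_axioms])
   fix z assume z: "z:cells (R j)"
   then obtain x where x: "x:?X" "z = ?p x" using bp_image[OF j] by blast
   have Tz: "T z:?X" using bij_betwE[OF T.t_bij] z by blast
   have "v T0 (tperm j T x) = e z" using cond x gid by simp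
   hence "e (place (R j) T0 (T z)) = e z" using x by (simp add: v_def tperm_def)
   thus "fst (place (R j) T0 (T z)) = fst z & fst (snd (place (R j) T0 (T z))) = fst (snd z)"
    unfolding e_def using row_exponent_eq_iff[OF part_R[OF j] T0.place_in[OF Tz] z] by blast
  qed
  thus ?thesis using gid by simp
 qed
 show ?thesis unfolding lin_indep_family_def
 proof (intro allI impI, rule ccontr)
  fix a assume rel: "(SUM T:SF j. a T *\<^sub>R tw j T ?v) = 0" and "~ (ALL T:SF j. a T = 0)"
  hence ne: "{T:SF j. a T ~= 0} ~= {}" by blast
  have fin: "finite {T:SF j. a T ~= 0}" using finite_SF[OF j] by simp
  define M where "M = Max (F ` {T:SF j. a T ~= 0})"
  have "M:F ` {T:SF j. a T ~= 0}" unfolding M_def using fin ne by (intro Max_in) simp_all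
  then obtain T0 where T0: "T0:SF j" "a T0 ~= 0" "F T0 = M" by auto
  have max: "F T <= F T0" if "T:SF j" "a T ~= 0" for T
   unfolding T0(3) M_def using fin that by (intro Max_ge) simp_all
  interpret T0: standard_filling c n "R j" T0 by (rule SF_standard_filling[OF j T0(1)])
  have c0: "coef (tw j T ?v) (expo n (v T0)) = (if T = T0 then real (card (Rgrp ?X ?p)) else 0)"
   if T: "T:SF j" "a T ~= 0" for T
  proof -
   have "(ALL x:?X. v T0 (tperm j T (g x)) = e (?p x)) \<longleftrightarrow> g = id & T = T0" if g: "g:Cgrp ?X ?p" for g
   proof
    assume "ALL x:?X. v T0 (tperm j T (g x)) = e (?p x)"
    thus "g = id & T = T0" by (rule key[OF T(1) T0(1) max[OF T] g])
   next
    assume "g = id & T = T0"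
    thus "ALL x:?X. v T0 (tperm j T (g x)) = e (?p x)"
     using T0.place_t bp_in[OF j] by (simp add: v_def tperm_def)
   qed
   hence "(SUM g:Cgrp ?X ?p. if ALL x:?X. v T0 (tperm j T (g x)) = e (?p x) then real_of_int (sign g) else 0)
     = (SUM g:Cgrp ?X ?p. if g = id then (if T = T0 then 1 else 0) else 0)"
    by (intro sum.cong refl) (auto simp: sign_id)
   also have "... = (if T = T0 then 1 else 0)" using finite_Cgrp[OF dia] Cgrp_id by simp
   finally show ?thesis using coef_tw[OF T(1)] by simp
  qed
  have "0 = coef (SUM T:SF j. a T *\<^sub>R tw j T ?v) (expo n (v T0))" by (simp add: rel)
  also have "... = (SUM T:SF j. a T * coef (tw j T ?v) (expo n (v T0)))" by (simp add: lookup_sum coef_scaleR)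
  also have "... = (SUM T:SF j. if T = T0 then a T0 * real (card (Rgrp ?X ?p)) else 0)"
   using c0 by (intro sum.cong refl) (metis mult_eq_0_iff)
  also have "... = a T0 * real (card (Rgrp ?X ?p))" using finite_SF[OF j] T0(1) by simp
  finally show False using T0(2) card_Rgrp_pos[of n "bp j"] by simp
 qed
qed

end

section \<open>The polynomial ring as a free module over the invariants\<close>

section \<open>Spanning over the invariants\<close>

lemma subspace_invariants: "subspace (invariants n G)" unfolding invariants_def subspace_def
 using subspace_poly_ring[of n] unfolding subspace_def
 by (auto simp: act_add act_scaleR linear_0[OF linear_act])

text \<open>Up to a factor, the monomial symmetric function of a monotone \<open>g\<close> in the variables \<open>X\<^sub>x\<^sup>m\<close>, \<open>m = mult_c c\<close>.\<close>

definition msym :: "cox_type => nat => (nat => nat) => rpoly" where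
 "msym c n g = (SUM p:{p. p permutes {1..n}}. mon (expo n (%x. mult_c c * g (p x))))"

text \<open>Partitions with at most n parts in increasing order; the value 0 elsewhere makes each of
  them a single function.\<close>

definition monotone_exponents :: "nat => (nat => nat) set" where
 "monotone_exponents n = {g. (ALL x y. 0 < x & x <= y & y <= n --> g x <= g y) & (ALL x. x ~: {1..n} --> g x = 0)}"

lemma msym_forms: "msym c n g:forms n (mult_c c * (SUM x:{1..n}. g x))" unfolding msym_def
proof (intro subspace_sum[OF subspace_forms])
 fix p assume "p:{p. p permutes {1..n}}"
 hence p: "p permutes {1..n}" by simp
 have "(SUM x:{1..n}. mult_c c * g (p x)) = mult_c c * (SUM x:{1..n}. g x)"
  using sum.reindex_bij_betw[OF permutes_imp_bij[OF p], of g] by (simp add: sum_distrib_left[symmetric])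
 thus "mon (expo n (%x. mult_c c * g (p x))):forms n (mult_c c * (SUM x:{1..n}. g x))"
  by (simp add: mon_in_forms keys_expo mdeg_expo)
qed

lemma msym_invariant: "msym c n g:invariants n (refl_group c n)" unfolding invariants_def
proof (intro CollectI conjI ballI)
 show "msym c n g:poly_ring n" using msym_forms forms_subset_poly_ring by blast
 fix s assume s: "s:refl_group c n"
 obtain u N where s_eq: "s = (u, N)" by (cases s)
 note u = refl_groupD[OF s[unfolded s_eq]]
 have inv: "inv u permutes {1..n}" by (rule permutes_inv[OF u(1)])
 have sg1: "sg N (expo n (%x. mult_c c * g (p x))) = 1" for p
 proof (cases c)
  case TypeA
  hence "N = {}" using s s_eq by simp
  thus ?thesis by (simp add: sg_def)
 next
  case TypeB
  have "even (SUM i:N. coef (expo n (%x. mult_c c * g (p x))) i)"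
   by (intro dvd_sum) (simp add: coef_expo mult_c_def TypeB)
  thus ?thesis by (simp add: sg_def)
 qed
 have "act s (msym c n g) = (SUM p:{p. p permutes {1..n}}. mon (expo n (%x. mult_c c * g ((p o inv u) x))))"
  unfolding msym_def act_sum s_eq
  by (intro sum.cong refl) (simp add: act_mon[OF u(3,4)] sg1 pm_expo[OF inv])
 also have "... = msym c n g" unfolding msym_def by (rule sum_permutations_compose_right[OF inv, symmetric])
 finally show "act s (msym c n g) = msym c n g" .
qed

lemma monotone_rearrangement:
 assumes g: "g:monotone_exponents n" and g': "g':monotone_exponents n" and p: "p permutes {1..n}"
  and eq: "!!x. x:{1..n} ==> g' (p x) = g x" shows "g' = g"
proof (rule ext)
 fix x
 let ?L = "[1..<Suc n]"
 have s: "sorted (map h ?L)" if "h:monotone_exponents n" for h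
  using that unfolding monotone_exponents_def sorted_iff_nth_mono by (auto simp del: upt_Suc)
 have L: "mset ?L = mset_set {1..n}" by (metis atLeastLessThanSuc_atLeastAtMost mset_upt)
 have "mset (map g ?L) = image_mset g (mset_set {1..n})" by (simp only: mset_map L)
 also have "... = image_mset (%x. g' (p x)) (mset_set {1..n})" using eq by (intro image_mset_cong) simp
 also have "... = image_mset g' (image_mset p (mset_set {1..n}))" by (simp add: multiset.map_comp o_def)
 also have "image_mset p (mset_set {1..n}) = mset_set {1..n}"
  using image_mset_mset_set[of p "{1..n}"] permutes_inj_on[OF p] permutes_image[OF p] by simp
 also have "image_mset g' (mset_set {1..n}) = mset (map g' ?L)" by (simp only: mset_map L)
 finally have "map g' ?L = map g ?L" using s[OF g] s[OF g'] by (metis properties_for_sort)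
 hence "ALL x:set ?L. g' x = g x" by (simp only: map_eq_conv)
 thus "g' x = g x" using g g' by (cases "x:{1..n}") (auto simp: monotone_exponents_def simp del: upt_Suc)
qed

lemma coef_msym: assumes g: "g:monotone_exponents n" and g': "g':monotone_exponents n"
 shows "coef (msym c n g') (expo n (%x. mult_c c * g x)) ~= 0 \<longleftrightarrow> g' = g"
proof -
 let ?e = "%p. if expo n (%x. mult_c c * g' (p x)) = expo n (%x. mult_c c * g x) then 1 else 0 :: real"
 have coef: "coef (msym c n g') (expo n (%x. mult_c c * g x)) = (SUM p:{p. p permutes {1..n}}. ?e p)"
  unfolding msym_def lookup_sum by (intro sum.cong refl) (simp add: lookup_single when_def)
 have fin: "finite {p. p permutes {1..n}}" by (rule finite_permutations) simp
 show ?thesis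
 proof
  assume "g' = g"
  hence e1: "?e id = 1" by simp
  have "0 < (SUM p:{p. p permutes {1..n}}. ?e p)"
  proof (rule sum_pos2[OF fin, of id])
   show "id:{p. p permutes {1..n}}" by (simp add: permutes_id)
   show "0 < ?e id" unfolding e1 by simp
  qed simp
  thus "coef (msym c n g') (expo n (%x. mult_c c * g x)) ~= 0" unfolding coef by simp
 next
  assume "coef (msym c n g') (expo n (%x. mult_c c * g x)) ~= 0"
  then obtain p where "p:{p. p permutes {1..n}}" "?e p ~= 0"
   unfolding coef by (rule sum.not_neutral_contains_not_neutral)
  hence "p permutes {1..n}" "ALL x:{1..n}. mult_c c * g' (p x) = mult_c c * g x"
   by (simp_all add: expo_eq_iff split: if_splits)
  thus "g' = g" using mult_c_pos[of c] monotone_rearrangement[OF g g'] by auto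
 qed
qed

lemma msym_independent:
 assumes "finite \<G>" "\<G> <= monotone_exponents n" "(SUM g:\<G>. a g *\<^sub>R msym c n g) = 0" "g:\<G>"
 shows "a g = 0"
proof -
 let ?m = "expo n (%x. mult_c c * g x)"
 have "0 = coef (SUM g':\<G>. a g' *\<^sub>R msym c n g') ?m" using assms(3) by simp
 also have "... = (SUM g':\<G>. a g' * coef (msym c n g') ?m)" by (simp add: lookup_sum coef_scaleR)
 also have "... = (SUM g':\<G>. if g' = g then a g * coef (msym c n g) ?m else 0)"
  using coef_msym[of g n _ c] assms(2,4) by (intro sum.cong refl) auto
 also have "... = a g * coef (msym c n g) ?m" using assms(1,4) by simp
 finally show ?thesis using coef_msym[of g n g c] assms(2,4) by auto
qed

locale specht_system = specht_shapes c n J R + primitive_system c n J E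
 for c :: cox_type and n :: nat and J :: "'j set" and R :: "'j => rows" and E :: "'j => rpoly => rpoly" +
 assumes E_sv: "j:J ==> E j (sv j u) = sv j u"
begin

lemma E_sp: "j:J ==> E j (sp j S) = sp j S" by (simp add: sp_sv E_sv)

definition dg :: "'j => (position => nat) => nat" where
 "dg j S = (SUM z:cells (R j). cell_exponent c (R j) S z)"

text \<open>A relation is a group algebra element killing \<open>sp j S\<close>. By
  \<open>same_annihilator\<close> it also kills the vector with row numbers as exponents, where
  independence is known.\<close>

lemma tw_sp_independent: assumes j: "j:J" and S: "S:SF j"
 shows "lin_indep_family (SF j) (%T. tw j T (sp j S))" unfolding lin_indep_family_def
proof (intro allI impI)
 fix a assume rel: "(SUM T:SF j. a T *\<^sub>R tw j T (sp j S)) = 0"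
 have gop: "gop c n (%p. SUM T:SF j. a T *\<^sub>R tw j T p) (%p. SUM T:SF j. a T *\<^sub>R act (ginv (tperm j T, {})) p)"
  by (intro gop_sum finite_SF gop_scaleR gop_tw j)
 have "(SUM T:SF j. a T *\<^sub>R tw j T (sv j (%z. fst (snd z)))) = 0"
  by (rule same_annihilator[OF j E_sp[OF j] sp_nonzero[OF j S] E_sv[OF j] gop rel])
 thus "ALL T:SF j. a T = 0" using lin_indep_familyD[OF tw_sv_independent[OF j]] by blast
qed

definition SI :: "('j \<times> (position => nat) \<times> (position => nat)) set" where
 "SI = (SIGMA j:J. SF j \<times> SF j)"

definition tp :: "'j \<times> (position => nat) \<times> (position => nat) => rpoly" where
 "tp = (%(j, S, T). tw j T (sp j S))"

lemma finite_SI: "finite SI"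
 unfolding SI_def by (intro finite_SigmaI finite_J finite_cartesian_product finite_SF)

lemma sum_SI: "(SUM i:SI. f i) = (SUM j:J. SUM S:SF j. SUM T:SF j. f (j, S, T))"
 unfolding SI_def by (intro sum_Sigma_times finite_J finite_SF)

context fixes j A B assumes j: "j:J" and A: "gop c n A B"
begin

text \<open>Independent of \<open>S\<close>, because \<open>scal\<close> is common to all vectors
  fixed by \<open>E j\<close>; this separates the roles of \<open>S\<close> and
  \<open>T\<close>.\<close>

definition sc :: "(position => nat) => real" where
 "sc T = scal j (%p. A (tw j T p))"

lemma E_tw: "T:SF j ==> E j (A (tw j T (sp j S))) = sc T *\<^sub>R sp j S"
 unfolding sc_def by (rule scal[OF j gop_comp[OF A gop_tw[OF j]] E_sp[OF j]])

lemma E_sum_tw: "E j (A (SUM T:SF j. a T *\<^sub>R tw j T (sp j S))) = (SUM T:SF j. sc T * a T) *\<^sub>R sp j S"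
 by (simp add: gop_simps[OF gop_comp[OF E_gop[OF j] A]] E_tw scaleR_sum_left mult.commute)

lemma E_sum_SI: assumes g: "!!i. i:SI ==> g i:invariants n GG"
 shows "E j (A (SUM i:SI. g i * tp i)) = (SUM S:SF j. (SUM T:SF j. sc T *\<^sub>R g (j, S, T)) * sp j S)"
proof -
 note EA = gop_comp[OF E_gop[OF j] A]
 have *: "E j (A (tw k T (sp k S))) = 0" if "k:J" "T:SF k" "k ~= j" for k S T
  using orth[OF j that(1) _ gop_comp[OF A gop_tw[OF that(1,2)]] E_sp[OF that(1)]] that(3) by auto
 have "E j (A (SUM i:SI. g i * tp i)) = (SUM i:SI. g i * E j (A (tp i)))"
  unfolding gop_simps(4)[OF EA] by (intro sum.cong refl gop_invariant_mult[OF EA] g)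
 also have "... = (SUM k:J. if k = j then SUM S:SF j. SUM T:SF j. g (j, S, T) * (sc T *\<^sub>R sp j S) else 0)"
  unfolding sum_SI tp_def by (intro sum.cong refl) (auto simp: * E_tw)
 also have "... = (SUM S:SF j. (SUM T:SF j. sc T *\<^sub>R g (j, S, T)) * sp j S)"
  using j by (simp add: sum_distrib_right)
 finally show ?thesis .
qed

lemma E_sum_SI_coeff: assumes g: "!!i. i:SI ==> g i:invariants n GG" and S: "S:SF j"
  and eq: "E j (A (SUM i:SI. g i * tp i)) = a *\<^sub>R sp j S"
 shows "(SUM T:SF j. sc T *\<^sub>R g (j, S, T)) = a *\<^sub>R 1"
proof -
 let ?h = "%S'. (SUM T:SF j. sc T *\<^sub>R g (j, S', T)) - (if S' = S then a *\<^sub>R 1 else 0)"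
 note eq' = trans[OF E_sum_SI[OF g, symmetric] eq]
 have "?h S = 0"
 proof (rule sp_independent[OF j _ _ S, of ?h])
  show "?h S':invariants n GG" if "S':SF j" for S' using that j one_invariant zero_invariant
   by (auto intro!: subspace_diff[OF subspace_invariants] subspace_sum[OF subspace_invariants]
     subspace_scale[OF subspace_invariants] g simp: SI_def)
  show "(SUM S':SF j. ?h S' * sp j S') = 0" using eq' S finite_SF[OF j]
   by (simp add: left_diff_distrib sum_subtractf if_distrib[of "%x. x * _"] cong: if_cong)
 qed
 thus ?thesis by simp
qed

end

text \<open>
 Applying \<open>E j o A\<close> to a relation and comparing coefficients of a fixed monomial reduces
 the independence over the invariants of the whole family to that of the single vectors.
\<close>

lemma sp_free:
 assumes g: "!!i. i:SI ==> g i:invariants n GG" and rel: "(SUM i:SI. g i * tp i) = 0" and i: "i:SI"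
 shows "g i = 0"
proof (rule poly_mapping_eqI)
 fix m
 obtain j S T where i_eq: "i = (j, S, T)" by (cases i)
 have j: "j:J" and S: "S:SF j" and T: "T:SF j" using i by (auto simp: SI_def i_eq)
 have "(SUM T:SF j. coef (g (j, S, T)) m *\<^sub>R tw j T (sp j S)) = 0" (is "?y = 0")
 proof (rule orbit_span_eq_0[OF j E_sp[OF j]])
  show "?y:orb (sp j S)"
   by (intro subspace_sum subspace_scale gmodule_subspace[OF gmodule_orbit_span] orbit_spanI[OF gop_tw] j)
  fix A B assume A: "gop c n A B"
  have "(SUM T:SF j. sc j A T *\<^sub>R g (j, S, T)) = 0 *\<^sub>R 1"
   by (rule E_sum_SI_coeff[OF j A g S]) (simp_all add: rel gop_simps[OF A] gop_simps[OF E_gop[OF j]])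
  hence "coef (SUM T:SF j. sc j A T *\<^sub>R g (j, S, T)) m = 0" by simp
  thus "E j (A ?y) = 0" unfolding E_sum_tw[OF j A] by (simp add: lookup_sum)
 qed
 thus "coef (g i) m = coef 0 m"
  using lin_indep_familyD[OF tw_sp_independent[OF j S], of "%T. coef (g (j, S, T)) m"] T by (simp add: i_eq)
qed

lemma sp_forms: assumes "j:J" shows "sp j S:forms n (dg j S)"
proof -
 have "mon (bx j S):forms n (dg j S)"
  using sum.reindex_bij_betw[OF bp_bij[OF assms], of "cell_exponent c (R j) S"]
  by (simp add: mon_in_forms bx_def keys_expo mdeg_expo dg_def)
 thus ?thesis unfolding sp_def using diagram_bp[OF assms]
  by (intro gop_in_gmodule[OF gop_Cop gmodule_forms] gop_in_gmodule[OF gop_Rop gmodule_forms])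
qed

text \<open>The condition says that \<open>msym c n g\<close> times \<open>sp j S\<close> is a form
  of degree \<open>d\<close>.\<close>

definition Gam :: "nat => 'j => (position => nat) => (nat => nat) set" where
 "Gam d j S = {g:monotone_exponents n. mult_c c * (SUM x:{1..n}. g x) + dg j S = d}"

lemma finite_Gam: "finite (Gam d j S)"
proof (rule finite_subset)
 show "Gam d j S <= {g. ALL x. (x:{1..n} --> g x:{..d}) & (x ~: {1..n} --> g x = 0)}"
 proof
  fix g assume g: "g:Gam d j S"
  have "g x <= d" if "x:{1..n}" for x
  proof -
   have "g x <= (SUM x:{1..n}. g x)" using that by (intro member_le_sum) auto
   also have "... <= mult_c c * (SUM x:{1..n}. g x)" using mult_c_pos[of c] by simp
   finally show ?thesis using g by (simp add: Gam_def)
  qed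
  thus "g:{g. ALL x. (x:{1..n} --> g x:{..d}) & (x ~: {1..n} --> g x = 0)}"
   using g by (auto simp: Gam_def monotone_exponents_def)
 qed
qed (intro finite_set_of_finite_funs, auto)

text \<open>By \<open>standardization\<close> every semistandard filling comes from a pair of a
  standard filling and a monotone exponent.\<close>

lemma card_semistandard_le: assumes j: "j:J"
 shows "card (semistandard_fillings c K (R j) (int d)) <= (SUM S:SF j. card (Gam d j S))"
proof -
 define F where "F = (%(S, g) z. if z:cells (R j) then mult_c c * (filling_index (R j) S (S z) + g (S z)) + cell_offset c z else 0)"
 let ?G = "SIGMA S:SF j. Gam d j S"
 have fin: "finite ?G" by (intro finite_SigmaI finite_SF j finite_Gam)
 have "semistandard_fillings c K (R j) (int d) <= F ` ?G"
 proof
  fix f assume f: "f:semistandard_fillings c K (R j) (int d)"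
  obtain S g where S: "S:SF j" and g: "!!x y. 0 < x ==> x <= y ==> y <= n ==> g x <= (g y :: nat)" "!!x. x ~: {1..n} ==> g x = 0"
   and fg: "!!z. z:cells (R j) ==> f z = mult_c c * (filling_index (R j) S (S z) + g (S z)) + cell_offset c z"
   using standardization[OF R_Parts[OF j] f] by metis
  interpret S: standard_filling c n "R j" S by (rule SF_standard_filling[OF j S])
  have "d = (SUM z:cells (R j). f z)" using semistandard_fillingsD(6)[OF f] by linarith
  also have "... = (SUM z:cells (R j). mult_c c * g (S z) + cell_exponent c (R j) S z)"
   by (intro sum.cong refl) (simp add: fg cell_exponent_def algebra_simps)
  also have "... = mult_c c * (SUM z:cells (R j). g (S z)) + dg j S"
   by (simp add: sum.distrib sum_distrib_left dg_def)
  also have "(SUM z:cells (R j). g (S z)) = (SUM x:{1..n}. g x)" by (rule sum.reindex_bij_betw[OF S.t_bij])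
  finally have "(S, g):?G" using S g by (simp add: Gam_def monotone_exponents_def)
  moreover have "f = F (S, g)" using fg semistandard_fillingsD(1)[OF f] by (auto simp: F_def fun_eq_iff)
  ultimately show "f:F ` ?G" by blast
 qed
 hence "card (semistandard_fillings c K (R j) (int d)) <= card ?G" by (rule surj_card_le[OF fin])
 thus ?thesis using finite_SF[OF j] finite_Gam by simp
qed

text \<open>A dimension count. The products of \<open>msym\<close> and \<open>tp\<close> in degree
  \<open>d\<close> are independent by \<open>sp_free\<close> and \<open>msym_independent\<close>,
  and by the enumeration they are at least as many as the monomials of degree
  \<open>d\<close>.\<close>

lemma forms_spanned: "forms n d <= span {g * tp (j, S, T) | g j S T. (j, S, T):SI &
  g:invariants n GG & dg j S <= d & g:forms n (d - dg j S)}" (is "_ <= span ?B")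
proof -
 define G where "G = (%(j, S, T :: position => nat). Gam d j S)"
 define I where "I = (SIGMA k:SI. G k)"
 define y where "y = (%(k, g). msym c n g * tp k)"
 \<comment> \<open>In degree \<open>d\<close> all exponents are at most d, so the bound d + 1
   captures every monomial.\<close>
 let ?I' = "bounded_exponents n (Suc d) (int d)" and ?z = "%a. mon (expo n a)"
 have finG: "finite (G k)" for k by (simp add: G_def finite_Gam split: prod.split)
 have G_mono: "G k <= monotone_exponents n" for k
  by (auto simp: G_def Gam_def split: prod.split)
 have finI: "finite I" unfolding I_def by (intro finite_SigmaI finite_SI finG)
 have indep: "lin_indep_family I y" unfolding lin_indep_family_def
 proof (intro allI impI ballI)
  fix a i assume rel: "(SUM i:I. a i *\<^sub>R y i) = 0" and i: "i:I"
  obtain k g where i_eq: "i = (k, g)" by (cases i)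
  define H where "H k = (SUM g:G k. a (k, g) *\<^sub>R msym c n g)" for k
  have H: "H k:invariants n GG" for k
   unfolding H_def by (intro subspace_sum[OF subspace_invariants] subspace_scale[OF subspace_invariants] msym_invariant)
  have "(SUM k:SI. H k * tp k) = (SUM k:SI. SUM g:G k. a (k, g) *\<^sub>R y (k, g))"
   by (simp add: H_def y_def sum_distrib_right)
  also have "... = 0" using rel finite_SI finG by (simp add: I_def sum.Sigma split_def)
  finally have "(SUM g:G k. a (k, g) *\<^sub>R msym c n g) = 0"
   using sp_free[OF H, where i = k] i by (simp add: H_def I_def i_eq)
  thus "a i = 0"
   using i msym_independent[OF finG[of k] G_mono, of "%g. a (k, g)"] by (simp add: I_def i_eq)
 qed
 have forms_span: "forms n d <= span (?z ` ?I')"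
 proof
  fix p assume p: "p:forms n d"
  have "coef p m *\<^sub>R mon m:span (?z ` ?I')" if m: "m:keys p" for m
  proof (intro span_scale span_base image_eqI)
   have keys: "keys m <= {1..n}" and deg: "mdeg m = d"
    using p m by (auto simp: forms_def poly_ring_def)
   show m_eq: "mon m = mon (expo n (coef m))" using eq_expo[OF keys] by simp
   have sum: "(SUM x:{1..n}. coef m x) = d" using deg mdeg_expo[of n "coef m"] eq_expo[OF keys] by simp
   have "coef m x <= d" if "x:{1..n}" for x using member_le_sum[of x "{1..n}" "coef m"] that sum by simp
   thus "coef m:?I'" using sum keys by (auto simp: bounded_exponents_def in_keys_iff less_Suc_eq_le)
  qed
  hence "(SUM m:keys p. coef p m *\<^sub>R mon m):span (?z ` ?I')" by (rule span_sum)
  thus "p:span (?z ` ?I')" using poly_expand[of "keys p" p] by simp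
 qed
 have y: "y i:forms n d & (EX g j S T. y i = g * tp (j, S, T) & (j, S, T):SI &
  g:invariants n GG & dg j S <= d & g:forms n (d - dg j S))" if i: "i:I" for i
 proof -
  obtain j S T g where i_eq: "i = ((j, S, T), g)" by (metis prod.exhaust)
  have jST: "(j, S, T):SI" and g: "mult_c c * (SUM x:{1..n}. g x) + dg j S = d"
   using i by (auto simp: I_def i_eq G_def Gam_def)
  have "tp (j, S, T):forms n (dg j S)"
   using jST by (auto simp: tp_def SI_def intro!: gop_in_gmodule[OF gop_tw gmodule_forms sp_forms])
  from forms_mult[OF msym_forms this, of c g] have "y i:forms n d" by (simp add: y_def i_eq g)
  moreover have "msym c n g:forms n (d - dg j S)" using msym_forms[of c n g] g by (simp flip: g)
  ultimately show ?thesis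
   using jST g by (intro conjI exI[of _ "msym c n g"] exI[of _ j] exI[of _ S] exI[of _ T])
    (simp_all add: y_def i_eq msym_invariant)
 qed
 have "card ?I' = (SUM q:Parts c n. fnum c n q * Knum c (Suc d) q (int d))" by (rule sum_fnum_Knum[symmetric])
 also have "... = (SUM j:J. fnum c n (R j) * Knum c (Suc d) (R j) (int d))"
  by (rule sum.reindex_bij_betw[OF R, symmetric])
 also have "... <= (SUM j:J. (SUM S:SF j. card (Gam d j S)) * card (SF j))"
 proof (intro sum_mono, subst mult.commute, intro mult_le_mono)
  fix j assume j: "j:J"
  show "fnum c n (R j) <= card (SF j)" using R_Parts[OF j] by (intro fnum_le_card) (simp_all add: Parts_def)
  show "Knum c (Suc d) (R j) (int d) <= (SUM S:SF j. card (Gam d j S))"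
   using Knum_le_card[OF part_R[OF j]] card_semistandard_le[OF j] by (rule order.trans)
 qed
 also have "... = card I" using finite_SI finG by (simp add: I_def sum_SI G_def sum_distrib_left mult.commute)
 finally have "card ?I' <= card I" .
 hence "span (y ` I) = span (?z ` ?I')"
  using y forms_span by (intro lin_indep_family_spans[OF finI finite_bounded_exponents indep]) auto
 moreover have "y ` I <= ?B" using y by blast
 ultimately show ?thesis using forms_span span_mono[of "y ` I" ?B] by simp
qed

lemma poly_spanned: assumes f: "f:poly_ring n"
 obtains h where "!!i. h i:invariants n GG" "f = (SUM i:SI. h i * tp i)"
proof (rule span_mult_family[OF finite_SI subspace_invariants])
 have "hcomp d f:span {a * tp i | a i. a:invariants n GG & i:SI}" for d
  by (rule subsetD[OF order.trans[OF forms_spanned span_mono] hcomp_in_forms[OF f]]) blast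
 hence "(SUM d:mdeg ` keys f. hcomp d f):span {a * tp i | a i. a:invariants n GG & i:SI}"
  by (rule span_sum)
 thus "f:span {a * tp i | a i. a:invariants n GG & i:SI}"
  using sum_hcomp[of "mdeg ` keys f" f] by simp
qed (rule that)

text \<open>Gives the dimension of the irreducible module as the number of standard fillings. A
  translate is expanded over the free basis, and freeness shows that the constant terms of the
  coefficients belonging to \<open>S\<close> already reproduce it.\<close>

lemma orbit_span_sp: assumes j: "j:J" and S: "S:SF j"
 shows "orb (sp j S) = span ((%T. tw j T (sp j S)) ` SF j)"
proof
 note sub = gmodule_subspace[OF gmodule_orbit_span]
 show "span ((%T. tw j T (sp j S)) ` SF j) <= orb (sp j S)"
  by (intro span_minimal sub image_subsetI orbit_spanI[OF gop_tw[OF j]])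
 have "act r (sp j S):span ((%T. tw j T (sp j S)) ` SF j)" if r: "r:GG" for r
 proof -
  obtain h where h: "!!i. h i:invariants n GG" "act r (sp j S) = (SUM i:SI. h i * tp i)"
   by (rule poly_spanned[OF subsetD[OF forms_subset_poly_ring act_in_forms[OF r sp_forms[OF j]]]]) (rule that)
  \<comment> \<open>The candidate: constant terms of the coefficients with the same shape and the
    same \<open>S\<close>, all other terms being dropped.\<close>
  let ?w = "SUM T:SF j. coef (h (j, S, T)) 0 *\<^sub>R tw j T (sp j S)"
  have "act r (sp j S) - ?w = 0"
  proof (rule orbit_span_eq_0[OF j E_sp[OF j]])
   show "act r (sp j S) - ?w:orb (sp j S)"
    by (intro subspace_diff subspace_sum subspace_scale sub orbit_spanI[OF gop_tw] orbit_spanI[OF gop_act] j r)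
   fix A B assume A: "gop c n A B"
   define k where "k = scal j (%p. A (act r p))"
   have k: "E j (A (act r (sp j S))) = k *\<^sub>R sp j S"
    unfolding k_def by (rule scal[OF j gop_comp[OF A gop_act[OF r]] E_sp[OF j]])
   hence "(SUM T:SF j. sc j A T *\<^sub>R h (j, S, T)) = k *\<^sub>R 1"
    unfolding h(2) by (intro E_sum_SI_coeff[OF j A h(1) S])
   from arg_cong[OF this, of "%p. coef p 0"] have "(SUM T:SF j. sc j A T * coef (h (j, S, T)) 0) = k"
    by (simp add: lookup_sum lookup_one)
   thus "E j (A (act r (sp j S) - ?w)) = 0"
    by (simp add: gop_simps(5)[OF gop_comp[OF E_gop[OF j] A]] E_sum_tw[OF j A] k)
  qed
  hence "act r (sp j S) = ?w" by simp
  thus ?thesis by (simp only:) (intro span_sum span_scale span_base imageI)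
 qed
 thus "orb (sp j S) <= span ((%T. tw j T (sp j S)) ` SF j)"
  unfolding orbit_span_def by (intro span_minimal subspace_span) blast
qed

end

section \<open>Shapes and columns of tableaux given as lists\<close>

section \<open>Tableaux as lists of rows\<close>

definition column_height :: "nat list => nat => nat" where
 "column_height m a = length (takeWhile (%l. a < l) m)"

definition width :: "nat list => nat" where
 "width m = (if m = [] then 0 else m ! 0)"

lemma less_column_height: assumes "sorted_wrt (>=) m"
 shows "r < column_height m a \<longleftrightarrow> r < length m & a < m ! r"
proof
 assume r: "r < column_height m a"
 hence "r < length m" using length_takeWhile_le[of "%l. a < l" m] by (simp add: column_height_def)
 moreover have "m ! r:set (takeWhile (%l. a < l) m)"
  using r takeWhile_nth[of r "%l. a < l" m] nth_mem[of r "takeWhile (%l. a < l) m"] by (simp add: column_height_def)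
 ultimately show "r < length m & a < m ! r" by (auto dest: set_takeWhileD)
next
 assume r: "r < length m & a < m ! r"
 show "r < column_height m a"
 proof (rule ccontr)
  assume "~ r < column_height m a"
  hence le: "column_height m a <= r" by simp
  hence "~ a < m ! column_height m a"
   unfolding column_height_def using r by (intro nth_length_takeWhile) simp
  moreover have "m ! r <= m ! column_height m a"
   using assms r le by (cases "column_height m a = r") (auto simp: sorted_wrt_iff_nth_less)
  ultimately show False using r by simp
 qed
qed

lemma transpose_eq_columns: assumes "sorted_wrt (>=) (map length T)"
 shows "List.transpose T = map (%a. map (%r. T ! r ! a) [0..<column_height (map length T) a]) [0..<width (map length T)]"
proof -
 have sorted: "sorted (rev (map length T))" using assms by (simp add: sorted_wrt_rev)
 have len: "length (List.transpose T) = width (map length T)"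
  unfolding length_transpose_sorted[OF sorted] by (simp add: width_def)
 have height: "column_height (map length T) a = length (filter (%ys. a < length ys) T)" for a
  unfolding filter_equals_takeWhile_sorted_rev[OF sorted] column_height_def by (simp add: takeWhile_map o_def)
 show ?thesis
 proof (rule nth_equalityI)
  show "length (List.transpose T) = length (map (%a. map (%r. T ! r ! a) [0..<column_height (map length T) a]) [0..<width (map length T)])"
   by (simp add: len)
  fix a assume a: "a < length (List.transpose T)"
  have "List.transpose T ! a = map (%r. T ! r ! a) [0..<column_height (map length T) a]"
  proof (rule nth_equalityI)
   show "length (List.transpose T ! a) = length (map (%r. T ! r ! a) [0..<column_height (map length T) a])"
    by (simp add: nth_transpose[OF a] height)
   fix r assume "r < length (List.transpose T ! a)"
   hence "r < length (filter (%ys. a < length ys) T)" by (simp add: nth_transpose[OF a])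
   thus "List.transpose T ! a ! r = map (%r. T ! r ! a) [0..<column_height (map length T) a] ! r"
    by (simp add: nth_nth_transpose_sorted[OF sorted a] height)
  qed
  thus "List.transpose T ! a = map (%a. map (%r. T ! r ! a) [0..<column_height (map length T) a]) [0..<width (map length T)] ! a"
   using a by (simp add: len)
 qed
qed

lemma less_width: assumes "sorted_wrt (>=) m" "r < length m" "a < m ! r" shows "a < width m"
proof -
 have "m ! r <= m ! 0" using assms(1,2) by (cases "r = 0") (auto simp: sorted_wrt_iff_nth_less)
 thus ?thesis using assms(2,3) by (auto simp: width_def)
qed

lemma increasing_tableau_iff: assumes "sorted_wrt (>=) (map length T)"
 shows "increasing_tableau T \<longleftrightarrow>
  (ALL r a a'. r < length T & a < a' & a' < length (T ! r) --> T ! r ! a < T ! r ! a') &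
  (ALL r r' a. r < r' & r' < length T & a < length (T ! r') --> T ! r ! a < T ! r' ! a)"
proof -
 let ?h = "column_height (map length T)" and ?w = "width (map length T)"
 have rows: "(ALL r:set T. sorted_wrt (<) r) \<longleftrightarrow>
   (ALL r a a'. r < length T & a < a' & a' < length (T ! r) --> T ! r ! a < T ! r ! a')"
  by (simp only: all_set_conv_all_nth sorted_wrt_iff_nth_less) blast
 have "(ALL c:set (List.transpose T). sorted_wrt (<) c)
   \<longleftrightarrow> (ALL a<?w. ALL r r'. r < r' --> r' < ?h a --> T ! r ! a < T ! r' ! a)"
  unfolding transpose_eq_columns[OF assms] by (auto simp: sorted_wrt_iff_nth_less)
 also have "... \<longleftrightarrow> (ALL r r' a. r < r' & r' < length T & a < length (T ! r') --> T ! r ! a < T ! r' ! a)"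
  using less_width[OF assms] by (auto simp: less_column_height[OF assms])
 finally show ?thesis unfolding increasing_tableau_def rows by blast
qed

text \<open>The cells of one component in the order of the reading word.\<close>

definition column_cells :: "nat => nat list => position list" where
 "column_cells k m = concat (map (%a. map (%r. (k, r, a)) (rev [0..<column_height m a])) [0..<width m])"

lemma column_word_eq: assumes "sorted_wrt (>=) (map length T)"
 shows "concat (map rev (List.transpose T)) = map (%z. T ! fst (snd z) ! snd (snd z)) (column_cells k (map length T))"
 unfolding transpose_eq_columns[OF assms] column_cells_def by (simp add: map_concat o_def rev_map)

lemma set_column_cells: assumes "sorted_wrt (>=) m"
 shows "set (column_cells k m) = {(k', r, a). k' = k & r < length m & a < m ! r}"
proof (intro equalityI subsetI)
 fix z assume "z:{(k', r, a). k' = k & r < length m & a < m ! r}"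
 then obtain r a where z: "z = (k, r, a)" "r < length m" "a < m ! r" by auto
 show "z:set (column_cells k m)" unfolding column_cells_def set_concat set_map UN_simps z(1)
 proof (rule UN_I)
  show "a:set [0..<width m]" using less_width[OF assms z(2,3)] by simp
  show "(k, r, a):(%r. (k, r, a)) ` set (rev [0..<column_height m a])"
   by (rule imageI) (use z(2,3) in \<open>simp add: less_column_height[OF assms]\<close>)
 qed
qed (auto simp: column_cells_def less_column_height[OF assms])

lemma sorted_wrt_concat:
 assumes "!!xs. xs:set xss ==> sorted_wrt P xs" "sorted_wrt (%xs ys. ALL x:set xs. ALL y:set ys. P x y) xss"
 shows "sorted_wrt P (concat xss)" using assms by (induction xss) (auto simp: sorted_wrt_append)

lemma sorted_column_cells: "sorted_wrt (reading_less q) (column_cells k m)" unfolding column_cells_def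
proof (rule sorted_wrt_concat)
 show "sorted_wrt (reading_less q) xs"
  if "xs:set (map (%a. map (%r. (k, r, a)) (rev [0..<column_height m a])) [0..<width m])" for xs
 proof -
  obtain a where xs: "xs = map (%r. (k, r, a)) (rev [0..<column_height m a])"
  proof -
   show thesis if *: "!!a. xs = map (%r. (k, r, a)) (rev [0..<column_height m a]) ==> thesis"
    using `xs:_` unfolding set_map by (rule imageE) (rule *)
  qed
  show ?thesis unfolding xs sorted_wrt_map sorted_wrt_rev
   by (simp add: sorted_wrt_iff_nth_less reading_less_def colno_def)
 qed
 show "sorted_wrt (%xs ys. ALL x:set xs. ALL y:set ys. reading_less q x y)
   (map (%a. map (%r. (k, r, a)) (rev [0..<column_height m a])) [0..<width m])"
  by (auto simp: sorted_wrt_map sorted_wrt_iff_nth_less reading_less_def colno_def)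
qed

definition component :: "'a list \<times> 'a list => nat => 'a list" where
 "component T k = (if k = 0 then fst T else if k = 1 then snd T else [])"

definition shape_rows :: "shape => rows" where
 "shape_rows Z = (%(k, r). if r < length (component Z k) then component Z k ! r else 0)"

text \<open>The value 0 outside the diagram matches the convention of
  \<open>standard_fillings\<close>, so that \<open>entry\<close> becomes a bijection onto
  them.\<close>

definition entry :: "bitableau => position => nat" where
 "entry T = (%(k, r, a). if r < length (component T k) & a < length (component T k ! r) then component T k ! r ! a else 0)"

lemma shapes_partitions: assumes "Z:shapes c n"
 shows "is_partition (component Z k)" "sum_list (fst Z) + sum_list (snd Z) = n"
 using assms by (cases c; auto simp: component_def is_partition_def)+

lemma component_sorted: "Z:shapes c n ==> sorted_wrt (>=) (component Z k)"
 using shapes_partitions(1) by (auto simp: is_partition_def)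

lemma component_empty: "Z:shapes c n ==> k ~: comps c ==> component Z k = []"
 by (cases c) (auto simp: comps_def component_def)

lemma rsize_shape_rows: "rsize (shape_rows Z) = sum_list (fst Z) + sum_list (snd Z)"
proof -
 let ?A = "%k. Pair k ` {..<length (component Z k)}"
 have "rsize (shape_rows Z) = (SUM x:?A 0 Un ?A 1. shape_rows Z x)"
 proof (rule rsize_superset)
  show "{x. shape_rows Z x ~= 0} <= ?A 0 Un ?A 1"
   by (auto simp: shape_rows_def component_def split: if_splits)
 qed auto
 also have "... = (SUM x:?A 0. shape_rows Z x) + (SUM x:?A 1. shape_rows Z x)"
  by (rule sum.union_disjoint) auto
 also have "(SUM x:?A k. shape_rows Z x) = sum_list (component Z k)" for k
  by (subst sum.reindex) (auto simp: inj_on_def shape_rows_def sum_list_sum_nth atLeast0LessThan)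
 also have "(SUM x:?A 0. shape_rows Z x) = sum_list (component Z 0)"
  by (subst sum.reindex) (auto simp: inj_on_def shape_rows_def sum_list_sum_nth atLeast0LessThan)
 finally show ?thesis by (simp add: component_def)
qed

lemma shape_rows_Parts: assumes "Z:shapes c n" shows "shape_rows Z:Parts c n"
 unfolding Parts_def part_def
proof (intro CollectI conjI allI impI)
 show "finite {x. shape_rows Z x ~= 0}"
 proof (rule finite_subset)
  show "{x. shape_rows Z x ~= 0} <= {0, 1} \<times> {..<length (fst Z) + length (snd Z)}"
   by (auto simp: shape_rows_def component_def split: if_splits)
 qed simp
 show "shape_rows Z (k, Suc r) <= shape_rows Z (k, r)" for k r
  using component_sorted[OF assms, of k] by (auto simp: shape_rows_def sorted_wrt_iff_nth_less)
 show "shape_rows Z (k, r) = 0" if "k ~: comps c" for k r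
  using component_empty[OF assms that] by (simp add: shape_rows_def)
 show "rsize (shape_rows Z) = n" using rsize_shape_rows shapes_partitions(2)[OF assms] by simp
qed

lemma shape_rows_bij: "bij_betw shape_rows (shapes c n) (Parts c n)" unfolding bij_betw_def
proof (intro conjI equalityI)
 show "inj_on shape_rows (shapes c n)"
 proof (rule inj_onI)
  fix Z Z' assume Z: "Z:shapes c n" "Z':shapes c n" and eq: "shape_rows Z = shape_rows Z'"
  have nz: "r < length (component L k) \<longleftrightarrow> shape_rows L (k, r) ~= 0" if "L:shapes c n" for L k r
   using shapes_partitions(1)[OF that, of k] by (auto simp: shape_rows_def is_partition_def)
  have "component Z k = component Z' k" for k
  proof (rule nth_equalityI)
   have "r < length (component Z k) \<longleftrightarrow> r < length (component Z' k)" for r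
    using nz[OF Z(1), of r k] nz[OF Z(2), of r k] eq by simp
   thus len: "length (component Z k) = length (component Z' k)"
    by (metis linorder_neqE_nat order_less_irrefl)
   fix r assume "r < length (component Z k)"
   thus "component Z k ! r = component Z' k ! r"
    using fun_cong[OF eq, of "(k, r)"] len by (simp add: shape_rows_def)
  qed
  from this[of 0] this[of 1] show "Z = Z'" by (simp add: component_def prod_eq_iff)
 qed
 show "shape_rows ` shapes c n <= Parts c n" using shape_rows_Parts by blast
 show "Parts c n <= shape_rows ` shapes c n"
 proof
  fix q assume "q:Parts c n"
  hence q: "part c q" "rsize q = n" by (simp_all add: Parts_def)
  \<comment> \<open>The number of nonempty rows in component k, as row lengths weakly
    decrease.\<close>
  define L where "L k = (LEAST r. q (k, r) = 0)" for k
  have "EX r. q (k, r) = 0" for k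
  proof (rule ccontr)
   assume "\<nexists>r. q (k, r) = 0"
   hence "range (Pair k) <= {x. q x ~= 0}" by auto
   moreover have "infinite (range (Pair k :: nat => nat \<times> nat))" by (auto dest: finite_imageD simp: inj_on_def)
   ultimately show False using q(1) unfolding part_def by (metis finite_subset)
  qed
  hence L0: "q (k, L k) = 0" for k unfolding L_def by (rule LeastI_ex)
  have L: "r < L k \<longleftrightarrow> q (k, r) ~= 0" for k r
  proof
   show "q (k, r) ~= 0" if "r < L k" using not_less_Least that unfolding L_def by blast
   show "r < L k" if "q (k, r) ~= 0"
    using part_antimono[OF q(1), of "L k" r k] L0[of k] that by (cases "r < L k") auto
  qed
  define Z where "Z = (map (%r. q (0, r)) [0..<L 0], map (%r. q (1, r)) [0..<L 1])"
  have rows: "shape_rows Z = q"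
  proof (rule HOL.ext)
   fix x :: "nat \<times> nat"
   obtain k r where x_eq: "x = (k, r)" by (cases x)
   have "q (k, r) = 0" if "k ~= 0" "k ~= 1"
   proof -
    have "k ~: comps c" using that by (simp add: comps_def)
    thus ?thesis using q(1) unfolding part_def by blast
   qed
   moreover have "q (k, r) = 0" if "~ r < L k" using that L by blast
   ultimately show "shape_rows Z x = q x"
    by (auto simp: x_eq shape_rows_def component_def Z_def)
  qed
  have "is_partition (map (%r. q (k, r)) [0..<L k])" for k unfolding is_partition_def
  proof (intro conjI)
   show "sorted_wrt (>=) (map (%r. q (k, r)) [0..<L k])"
    using part_antimono[OF q(1), OF less_imp_le] by (simp add: sorted_wrt_iff_nth_less)
  qed (use L in auto)
  moreover have "sum_list (fst Z) + sum_list (snd Z) = n"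
   using rsize_shape_rows[of Z] q(2) by (simp add: rows)
  moreover have "L 1 = 0" if "c = TypeA"
  proof -
   have "q (1, 0) = 0" using q(1) that unfolding part_def comps_def by simp
   thus ?thesis using L[of 0 1] by simp
  qed
  ultimately have "Z:shapes c n" by (cases c) (auto simp: Z_def)
  thus "q:shape_rows ` shapes c n" using rows by blast
 qed
qed

section \<open>Bijection between standard tableaux and standard fillings\<close>

section \<open>Standard tableaux as standard fillings\<close>

lemma filling_lengths: assumes "filling Z T"
 shows "map length (component T k) = component Z k"
 using assms by (simp add: filling_def component_def)

lemma cells_shape_rows: assumes "filling Z T"
 shows "(k, r, a):cells (shape_rows Z) \<longleftrightarrow> r < length (component T k) & a < length (component T k ! r)"
 unfolding filling_lengths[OF assms, symmetric] cells_def shape_rows_def by (auto split: if_splits)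

lemma entry_nth: assumes "r < length (component T k)" "a < length (component T k ! r)"
 shows "entry T (k, r, a) = component T k ! r ! a" using assms by (simp add: entry_def)

lemma entry_image: assumes "filling Z T"
 shows "entry T ` cells (shape_rows Z) = set (concat (fst T) @ concat (snd T))"
proof (intro equalityI subsetI)
 fix x assume "x:entry T ` cells (shape_rows Z)"
 then obtain k r a where z: "(k, r, a):cells (shape_rows Z)" and x: "x = entry T (k, r, a)" by auto
 hence ra: "r < length (component T k)" "a < length (component T k ! r)"
  using cells_shape_rows[OF assms] by auto
 hence "x:set (component T k ! r)" "component T k ! r:set (component T k)" by (auto simp: x entry_nth)
 thus "x:set (concat (fst T) @ concat (snd T))" by (auto simp: component_def split: if_splits)
next
 fix x assume "x:set (concat (fst T) @ concat (snd T))"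
 then obtain k R where "R:set (component T k)" "x:set R"
  by (auto simp: component_def) (metis One_nat_def zero_neq_one)+
 then obtain r a where ra: "r < length (component T k)" "a < length (component T k ! r)" "x = component T k ! r ! a"
  by (metis in_set_conv_nth)
 show "x:entry T ` cells (shape_rows Z)"
  by (rule image_eqI[of _ _ "(k, r, a)"]) (use ra in \<open>simp_all add: entry_nth cells_shape_rows[OF assms]\<close>)
qed

lemma entry_standard: assumes Z: "Z:shapes c n" and T: "T:SYT Z"
 shows "entry T:standard_fillings (shape_rows Z)"
proof -
 have fill: "filling Z T" and inc: "increasing_tableau (component T 0)" "increasing_tableau (component T 1)"
  using T by (simp_all add: SYT_def component_def)
 have size: "rsize (shape_rows Z) = n" and part: "part c (shape_rows Z)"
  using shape_rows_Parts[OF Z] by (simp_all add: Parts_def)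
 have incr: "increasing_tableau (component T k)" for k
 proof -
  have "k = 0 | k = 1 | component T k = []" by (simp add: component_def)
  then consider "k = 0" | "k = 1" | "component T k = []" by blast
  thus ?thesis by cases (use inc in \<open>simp_all add: increasing_tableau_def\<close>)
 qed
 have sorted: "sorted_wrt (>=) (map length (component T k))" for k
  using component_sorted[OF Z] by (simp add: filling_lengths[OF fill])
 note inc_iff = increasing_tableau_iff[OF sorted, THEN iffD1, OF incr]
 show ?thesis unfolding standard_fillings_def
 proof (intro CollectI conjI allI impI)
  fix z assume "z ~: cells (shape_rows Z)"
  thus "entry T z = 0" using cells_shape_rows[OF fill] by (cases z) (auto simp: entry_def)
 next
  have img: "entry T ` cells (shape_rows Z) = {1..n}"
   unfolding entry_image[OF fill] using fill shapes_partitions(2)[OF Z] by (simp add: filling_def)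
  moreover have "inj_on (entry T) (cells (shape_rows Z))"
   by (rule eq_card_imp_inj_on) (simp_all only: img finite_cells[OF part] card_cells[OF part] size card_atLeastAtMost diff_Suc_1 Suc_diff_1)
  ultimately show "bij_betw (entry T) (cells (shape_rows Z)) {1..rsize (shape_rows Z)}"
   by (simp add: bij_betw_def size)
 next
  fix k r a a' assume a: "a < a' & a' < shape_rows Z (k, r)"
  hence "(k, r, a):cells (shape_rows Z)" "(k, r, a'):cells (shape_rows Z)" by (auto simp: cells_def)
  thus "entry T (k, r, a) < entry T (k, r, a')"
   using inc_iff[of k] a unfolding cells_shape_rows[OF fill] by (simp add: entry_nth)
 next
  fix k r r' a assume r: "r < r' & a < shape_rows Z (k, r')"
  hence "(k, r, a):cells (shape_rows Z)" "(k, r', a):cells (shape_rows Z)"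
   using part_antimono[OF part, of r r' k] by (auto simp: cells_def)
  thus "entry T (k, r, a) < entry T (k, r', a)"
   using inc_iff[of k] r unfolding cells_shape_rows[OF fill] by (simp add: entry_nth)
 qed
qed

lemma entry_bij: assumes Z: "Z:shapes c n"
 shows "bij_betw entry (SYT Z) (standard_fillings (shape_rows Z))" unfolding bij_betw_def
proof (intro conjI equalityI)
 show "inj_on entry (SYT Z)"
 proof (rule inj_onI)
  fix T T' assume T: "T:SYT Z" and T': "T':SYT Z" and eq: "entry T = entry T'"
  have fill: "filling Z T" "filling Z T'" using T T' by (simp_all add: SYT_def)
  have "component T k = component T' k" for k
  proof -
   have len: "map length (component T k) = map length (component T' k)"
    by (simp only: filling_lengths[OF fill(1)] filling_lengths[OF fill(2)])
   hence len': "length (component T k) = length (component T' k)" by (rule map_eq_imp_length_eq)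
   show ?thesis
   proof (rule nth_equalityI[OF len'])
    fix r assume r: "r < length (component T k)"
    have len'': "length (component T k ! r) = length (component T' k ! r)" using len r len' by (metis nth_map)
    show "component T k ! r = component T' k ! r"
    proof (rule nth_equalityI[OF len''])
     fix a assume "a < length (component T k ! r)"
     thus "component T k ! r ! a = component T' k ! r ! a"
      using fun_cong[OF eq, of "(k, r, a)"] r len' len'' by (simp add: entry_def)
    qed
   qed
  qed
  from this[of 0] this[of 1] show "T = T'" by (simp add: component_def prod_eq_iff)
 qed
 show "entry ` SYT Z <= standard_fillings (shape_rows Z)" using entry_standard[OF Z] by blast
 show "standard_fillings (shape_rows Z) <= entry ` SYT Z"
 proof
  fix t assume t: "t:standard_fillings (shape_rows Z)"
  interpret t: standard_filling c n "shape_rows Z" t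
   by unfold_locales (rule shape_rows_Parts[OF Z], rule t)
  define tab where "tab k = map (%r. map (%a. t (k, r, a)) [0..<component Z k ! r]) [0..<length (component Z k)]" for k
  define T where "T = (tab 0, tab 1)"
  have comp: "component T k = tab k" for k by (auto simp: component_def T_def tab_def)
  have lens: "map length (tab k) = component Z k" for k unfolding tab_def by (rule nth_equalityI) auto
  have tab_nth: "tab k ! r ! a = t (k, r, a)" "length (tab k ! r) = component Z k ! r"
   if "r < length (component Z k)" "a < component Z k ! r" for k r a
   using that by (simp_all add: tab_def)
  have len_tab: "length (tab k) = length (component Z k)" for k by (simp add: tab_def)
  have entry_T: "entry T = t"
  proof (rule ext)
   fix z :: position
   obtain k r a where z_eq: "z = (k, r, a)" by (cases z)
   show "entry T z = t z"
   proof (cases "z:cells (shape_rows Z)")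
    case True
    hence "r < length (component Z k)" "a < component Z k ! r"
     by (auto simp: z_eq cells_def shape_rows_def split: if_splits)
    thus ?thesis using tab_nth by (simp add: z_eq entry_def comp len_tab)
   next
    case False
    hence "~ (r < length (component Z k) & a < component Z k ! r)"
     by (auto simp: z_eq cells_def shape_rows_def)
    hence "entry T z = 0" by (auto simp: z_eq entry_def comp len_tab) (simp add: tab_def)
    thus ?thesis using False standard_fillingsD(1)[OF t] by simp
   qed
  qed
  let ?C = "concat (fst T) @ concat (snd T)"
  have len_C: "length ?C = n" using lens[of 0] lens[of 1] shapes_partitions(2)[OF Z]
   by (simp add: T_def length_concat component_def)
  have fill': "map length (fst T) = fst Z" "map length (snd T) = snd Z"
   using lens[of 0] lens[of 1] by (simp_all add: T_def component_def)
  have set_C: "set ?C = {1..n}"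
  proof -
   have "set ?C = t ` cells (shape_rows Z)"
   proof (intro equalityI subsetI)
    fix x assume "x:set ?C"
    then obtain k where "x:set (concat (tab k))" by (auto simp: T_def)
    then obtain r a where "r < length (component Z k)" "a < component Z k ! r" "x = t (k, r, a)"
     by (auto simp: tab_def)
    thus "x:t ` cells (shape_rows Z)"
     by (intro image_eqI[of _ _ "(k, r, a)"]) (simp_all add: cells_def shape_rows_def)
   next
    fix x assume "x:t ` cells (shape_rows Z)"
    then obtain k r a where z: "(k, r, a):cells (shape_rows Z)" "x = t (k, r, a)" by auto
    hence ra: "r < length (component Z k)" "a < component Z k ! r"
     by (auto simp: cells_def shape_rows_def split: if_splits)
    hence "x:set (concat (tab k))" using z(2) by (force simp: tab_def)
    moreover have "k = 0 | k = 1" using ra by (auto simp: component_def split: if_splits)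
    ultimately show "x:set ?C" by (auto simp: T_def)
   qed
   thus ?thesis using t.t_bij by (simp add: bij_betw_def)
  qed
  have "distinct ?C" by (rule card_distinct) (simp only: set_C len_C card_atLeastAtMost diff_Suc_1)
  hence fill: "filling Z T"
   using fill' set_C shapes_partitions(2)[OF Z] by (simp add: filling_def)
  have "increasing_tableau (tab k)" for k
  proof (subst increasing_tableau_iff)
   show "sorted_wrt (>=) (map length (tab k))" using component_sorted[OF Z] by (simp only: lens)
   show "(ALL r a a'. r < length (tab k) & a < a' & a' < length (tab k ! r) --> tab k ! r ! a < tab k ! r ! a') &
    (ALL r r' a. r < r' & r' < length (tab k) & a < length (tab k ! r') --> tab k ! r ! a < tab k ! r' ! a)"
   proof (intro conjI allI impI)
    fix r a a' assume r: "r < length (tab k) & a < a' & a' < length (tab k ! r)"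
    hence r': "r < length (component Z k)" by (simp add: len_tab)
    hence "a' < component Z k ! r" using r by (simp add: tab_def)
    thus "tab k ! r ! a < tab k ! r ! a'"
     using standard_fillingsD(3)[OF t, of a a' k r] r r' by (simp add: tab_nth(1) shape_rows_def)
   next
    fix r r' a assume r: "r < r' & r' < length (tab k) & a < length (tab k ! r')"
    hence r': "r' < length (component Z k)" by (simp add: len_tab)
    hence a: "a < component Z k ! r'" using r by (simp add: tab_def)
    moreover have "component Z k ! r' <= component Z k ! r"
     using component_sorted[OF Z, of k] r r' by (simp add: sorted_wrt_iff_nth_less)
    ultimately show "tab k ! r ! a < tab k ! r' ! a"
     using standard_fillingsD(4)[OF t, of r r' a k] r r' by (simp add: tab_nth(1) shape_rows_def)
   qed
  qed
  hence "T:SYT Z" using fill by (simp add: SYT_def T_def)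
  thus "t:entry ` SYT Z" using entry_T by blast
 qed
qed

section \<open>Higher Specht polynomials as translates of symmetrized monomials\<close>

section \<open>Higher Specht polynomials\<close>

definition reading_cells :: "shape => position list" where
 "reading_cells Z = column_cells 0 (fst Z) @ column_cells 1 (snd Z)"

lemma not_reading_less_self: "~ reading_less q z z" by (simp add: reading_less_def)

lemma not_reading_less_sym: "reading_less q y z ==> ~ reading_less q z y" by (auto simp: reading_less_def)

context fixes c :: cox_type and n :: nat and Z :: shape assumes Z: "Z:shapes c n"
begin

abbreviation (input) "qq == shape_rows Z"

lemma partition_sorted: "sorted_wrt (>=) (fst Z)" "sorted_wrt (>=) (snd Z)"
 using component_sorted[OF Z, of 0] component_sorted[OF Z, of 1] by (simp_all add: component_def)

lemma set_reading_cells: "set (reading_cells Z) = cells qq"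
proof (rule Set.set_eqI)
 fix z :: position
 obtain k r a where z_eq: "z = (k, r, a)" by (cases z)
 show "z:set (reading_cells Z) \<longleftrightarrow> z:cells qq"
  by (auto simp: z_eq reading_cells_def set_column_cells partition_sorted cells_def shape_rows_def component_def)
qed

lemma sorted_reading_cells: "sorted_wrt (reading_less qq) (reading_cells Z)"
 unfolding reading_cells_def sorted_wrt_append
proof (intro conjI ballI sorted_column_cells)
 fix y z assume "y:set (column_cells 0 (fst Z))" "z:set (column_cells 1 (snd Z))"
 then obtain r a r' a' where y: "y = (0, r, a)" "r < length (fst Z)" "a < fst Z ! r" and z: "z = (1, r', a')"
  by (auto simp: set_column_cells partition_sorted)
 have "a < width (fst Z)" by (rule less_width[OF partition_sorted(1) y(2,3)])
 also have "width (fst Z) = qq (0, 0)" by (simp add: width_def shape_rows_def component_def)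
 finally show "reading_less qq y z" by (simp add: reading_less_def y(1) z colno_def)
qed

lemma distinct_reading_cells: "distinct (reading_cells Z)"
proof -
 have "reading_cells Z ! i ~= reading_cells Z ! j" if "i < j" "j < length (reading_cells Z)" for i j
  using sorted_wrt_nth_less[OF sorted_reading_cells that] not_reading_less_self by metis
 thus ?thesis unfolding distinct_conv_nth by (metis linorder_neqE_nat)
qed

lemma word_eq: assumes "T:SYT Z" shows "word T = map (entry T) (reading_cells Z)"
proof -
 have fill: "filling Z T" using assms by (simp add: SYT_def)
 have lens: "map length (fst T) = fst Z" "map length (snd T) = snd Z"
  using fill by (simp_all add: filling_def)
 have len: "length (fst T) = length (fst Z)" "length (snd T) = length (snd Z)"
  using lens by (metis length_map)+
 have nth: "r < length (fst Z) ==> length (fst T ! r) = fst Z ! r"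
  "r < length (snd Z) ==> length (snd T ! r) = snd Z ! r" for r
  using lens by (metis length_map nth_map)+
 have 0: "concat (map rev (List.transpose (fst T))) = map (entry T) (column_cells 0 (fst Z))"
  using column_word_eq[of "fst T" 0] partition_sorted(1) nth len unfolding lens
  by (auto simp: entry_def component_def set_column_cells)
 have 1: "concat (map rev (List.transpose (snd T))) = map (entry T) (column_cells 1 (snd Z))"
  using column_word_eq[of "snd T" 1] partition_sorted(2) nth len unfolding lens
  by (auto simp: entry_def component_def set_column_cells)
 show ?thesis unfolding word_def 0 1 reading_cells_def by simp
qed

lemma standard_filling_entry: "T:SYT Z ==> standard_filling c n qq (entry T)"
 by unfold_locales (rule shape_rows_Parts[OF Z], rule entry_standard[OF Z])

text \<open>The word lists the entries of cells sorted by \<open>reading_less\<close>, so positions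
  in the word translate into the order of cells.\<close>

lemma left_of_word: assumes S: "S:SYT Z" and j: "j:{1..n}" and k: "k:{1..n}"
 shows "left_of (word S) j k \<longleftrightarrow> reading_less qq (place qq (entry S) j) (place qq (entry S) k)"
proof -
 interpret S: standard_filling c n qq "entry S" by (rule standard_filling_entry[OF S])
 let ?w = "reading_cells Z"
 have nth: "?w ! i:cells qq" if "i < length ?w" for i using nth_mem[OF that] by (simp only: set_reading_cells)
 show ?thesis
 proof
  assume "left_of (word S) j k"
  then obtain a b where ab: "a < b" "b < length ?w" "entry S (?w ! a) = j" "entry S (?w ! b) = k"
   unfolding left_of_def word_eq[OF S] by auto
  have "place qq (entry S) j = ?w ! a" "place qq (entry S) k = ?w ! b" using S.place_t[OF nth] ab by auto
  thus "reading_less qq (place qq (entry S) j) (place qq (entry S) k)"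
   using sorted_wrt_nth_less[OF sorted_reading_cells ab(1,2)] by simp
 next
  assume less: "reading_less qq (place qq (entry S) j) (place qq (entry S) k)"
  obtain a where a: "a < length ?w" "?w ! a = place qq (entry S) j"
   using S.place_in[OF j] set_reading_cells by (metis in_set_conv_nth)
  obtain b where b: "b < length ?w" "?w ! b = place qq (entry S) k"
   using S.place_in[OF k] set_reading_cells by (metis in_set_conv_nth)
  have "a < b"
  proof (rule ccontr)
   assume "~ a < b"
   then consider "a = b" | "b < a" by linarith
   thus False
   proof cases
    case 1
    thus False using less a b not_reading_less_self by metis
   next
    case 2
    thus False
     using sorted_wrt_nth_less[OF sorted_reading_cells 2 a(1)] less a b not_reading_less_sym by metis
   qed
  qed
  thus "left_of (word S) j k" unfolding left_of_def word_eq[OF S] using a b S.t_place[OF j] S.t_place[OF k]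
   by (intro exI[of _ a] exI[of _ b]) simp
 qed
qed

lemma letter_index_word: assumes S: "S:SYT Z" and k: "k <= n"
 shows "letter_index (word S) k = filling_index qq (entry S) k"
 unfolding letter_index_eq_descent_index filling_index_def
 by (rule descent_index_cong[OF left_of_word[OF S] k]) auto

lemma tableau_monomial_eq: assumes T: "T:SYT Z" and S: "S:SYT Z" shows "tableau_monomial T S
  = mon (expo n (%x. filling_index qq (entry S) (entry S (place qq (entry T) x))))"
proof -
 interpret T: standard_filling c n qq "entry T" by (rule standard_filling_entry[OF T])
 interpret S: standard_filling c n qq "entry S" by (rule standard_filling_entry[OF S])
 let ?w = "reading_cells Z" and ?I = "%z. filling_index qq (entry S) (entry S z)"
 have idx: "letter_index (word S) (entry S z) = ?I z" if "z:cells qq" for z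
  using bij_betwE[OF S.t_bij] that by (intro letter_index_word[OF S]) auto
 have nth: "?w ! i:cells qq" if "i < length ?w" for i using nth_mem[OF that] by (simp only: set_reading_cells)
 have "tableau_monomial T S = (PROD k<length ?w. indet (entry T (?w ! k)) ^ ?I (?w ! k))"
 proof -
  have len: "length (word T) = length ?w" "length (word S) = length ?w"
   by (simp_all add: word_eq[OF T] word_eq[OF S])
  have "word T ! k = entry T (?w ! k) & tableau_index S ! k = ?I (?w ! k)" if k: "k < length ?w" for k
  proof -
   have "word S ! k = entry S (?w ! k)" using k by (simp add: word_eq[OF S])
   hence "tableau_index S ! k = ?I (?w ! k)" using k len(2) idx[OF nth[OF k]] by (simp add: tableau_index_def)
   moreover have "word T ! k = entry T (?w ! k)" using k by (simp add: word_eq[OF T])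
   ultimately show ?thesis by simp
  qed
  thus ?thesis unfolding tableau_monomial_def len(1) by simp
 qed
 also have "... = (PROD z:cells qq. indet (entry T z) ^ ?I z)"
  using prod.reindex_bij_betw[OF bij_betw_nth[OF distinct_reading_cells refl set_reading_cells[symmetric]], of "%z. indet (entry T z) ^ ?I z"] .
 also have "... = (PROD x:{1..n}. indet (entry T (place qq (entry T) x)) ^ ?I (place qq (entry T) x))"
  by (rule prod.reindex_bij_betw[OF T.place_bij, symmetric])
 also have "... = (PROD x:{1..n}. indet x ^ ?I (place qq (entry T) x))"
  by (intro prod.cong refl) (simp add: T.t_place)
 also have "... = mon (expo n (%x. ?I (place qq (entry T) x)))" by (simp add: prod_indet_power expo_def)
 finally show ?thesis .
qed

end

lemma stabilizer_eq_Fgrp: assumes X: "X = set (concat T)"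
  and blocks: "!!b. b:set blocks ==> EX i. set b = {x:X. f x = i}"
  and cover: "!!x. x:X ==> EX b:set blocks. x:set b" shows "stabilizer T blocks = Fgrp X f"
proof (intro equalityI subsetI)
 fix g assume "g:stabilizer T blocks"
 hence g: "g permutes X" "!!b. b:set blocks ==> g ` set b = set b"
  by (simp_all add: stabilizer_def X)
 have "f (g x) = f x" if x: "x:X" for x
 proof -
  obtain b where b: "b:set blocks" "x:set b" using cover[OF x] by blast
  obtain i where i: "set b = {x:X. f x = i}" using blocks[OF b(1)] by blast
  have "g x:set b" using g(2)[OF b(1)] b(2) by blast
  thus ?thesis using b(2) i by simp
 qed
 thus "g:Fgrp X f" using g(1) by (simp add: Fgrp_def)
next
 fix g assume "g:Fgrp X f"
 hence g: "g permutes X" "!!x. x:X ==> f (g x) = f x" by (simp_all add: Fgrp_def)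
 have "g ` set b = set b" if b: "b:set blocks" for b
 proof -
  obtain i where i: "set b = {x:X. f x = i}" using blocks[OF b] by blast
  show ?thesis
  proof (intro equalityI subsetI)
   fix y assume "y:g ` set b"
   then obtain x where x: "x:X" "f x = i" "y = g x" using i by blast
   thus "y:set b" using g(2) permutes_in_image[OF g(1), of x] by (simp add: i)
  next
   fix y assume y: "y:set b"
   hence "y:g ` X" using i permutes_image[OF g(1)] by simp
   then obtain x where x: "x:X" "y = g x" by blast
   hence "x:set b" using y g(2)[OF x(1)] by (simp add: i)
   thus "y:g ` set b" using x(2) by blast
  qed
 qed
 thus "g:stabilizer T blocks" using g(1) by (simp add: stabilizer_def X)
qed

lemma permutes_disjoint_commute: assumes "g permutes A" "h permutes B" "A Int B = {}"
 shows "g o h = h o g"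
proof (rule ext)
 fix x
 consider "x:A" | "x:B" | "x ~: A" "x ~: B" by blast
 thus "(g o h) x = (h o g) x"
 proof cases
  case 1
  hence "g x:A" by (simp only: permutes_in_image[OF assms(1)])
  thus ?thesis using 1 assms(3) permutes_not_in[OF assms(2)] by (metis IntI comp_apply empty_iff)
 next
  case 2
  hence "h x:B" by (simp only: permutes_in_image[OF assms(2)])
  thus ?thesis using 2 assms(3) permutes_not_in[OF assms(1)] by (metis IntI comp_apply empty_iff)
 next
  case 3
  thus ?thesis using permutes_not_in[OF assms(1)] permutes_not_in[OF assms(2)] by (metis comp_apply)
 qed
qed

text \<open>A permutation preserving \<open>k\<close> maps each part to itself; its two restrictions
  give the inverse map.\<close>

lemma bij_betw_Fgrp_product: fixes f g :: "nat => nat"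
 assumes X: "X = A Un B" "A Int B = {}" and k: "!!x. x:A ==> k x = (0::nat)" "!!x. x:B ==> k x = 1"
 shows "bij_betw (%(s, h). s o h) (Fgrp A f \<times> Fgrp B f)
  {s. s permutes X & (ALL x:X. k (s x) = k x & f (s x) = f x)}"
proof (rule bij_betw_byWitness[where f' = "%s. (%x. if x:A then s x else x, %x. if x:B then s x else x)"])
 let ?G = "{s. s permutes X & (ALL x:X. k (s x) = k x & f (s x) = f x)}"
 have eval: "(s o h) x = (if x:A then s x else if x:B then h x else x)"
  if "s permutes A" "h permutes B" for s h x
 proof -
  have "h x:B" if "x:B" using that by (simp only: permutes_in_image[OF \<open>h permutes B\<close>])
  thus ?thesis using permutes_not_in[OF that(1)] permutes_not_in[OF that(2)] X(2) by (auto simp: disjoint_iff)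
 qed
 have parts: "(%x. if x:A then s x else x):Fgrp A f" "(%x. if x:B then s x else x):Fgrp B f"
  if s: "s:?G" for s
 proof -
  have *: "(%x. if x:C then s x else x):Fgrp C f"
   if C: "C <= X" "!!x. x:X ==> s x:C \<longleftrightarrow> x:C" for C
  proof -
   have p: "s permutes X" using s by simp
   have "bij_betw s C C"
   proof (rule bij_betw_imageI)
    show "inj_on s C" by (rule permutes_inj_on[OF p])
    show "s ` C = C"
    proof (intro equalityI subsetI)
     fix y assume "y:C"
     hence "y:s ` X" using C(1) permutes_image[OF p] by blast
     then obtain x where "x:X" "y = s x" by blast
     thus "y:s ` C" using C(2) `y:C` by blast
    qed (use C in blast)
   qed
   hence "bij_betw (%x. if x:C then s x else x) C C" by (rule bij_betw_cong[THEN iffD1, rotated]) simp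
   hence "(%x. if x:C then s x else x) permutes C" by (rule bij_imp_permutes) simp
   thus ?thesis using C(1) s by (auto simp: Fgrp_def)
  qed
  have "s x:A \<longleftrightarrow> x:A" "s x:B \<longleftrightarrow> x:B" if x: "x:X" for x
  proof -
   have "s x:X" "k (s x) = k x" using s x permutes_in_image[of s X x] by auto
   thus "s x:A \<longleftrightarrow> x:A" "s x:B \<longleftrightarrow> x:B"
    using x X k by (metis UnE One_nat_def zero_neq_one)+
  qed
  thus "(%x. if x:A then s x else x):Fgrp A f" "(%x. if x:B then s x else x):Fgrp B f"
   using *[of A] *[of B] X(1) by blast+
 qed
 show "ALL z:Fgrp A f \<times> Fgrp B f. (%s. (%x. if x:A then s x else x, %x. if x:B then s x else x))
   ((%(s, h). s o h) z) = z"
 proof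
  fix z assume z: "z:Fgrp A f \<times> Fgrp B f"
  obtain s h where z_eq: "z = (s, h)" by (cases z)
  have p: "s permutes A" "h permutes B" using z by (simp_all add: z_eq Fgrp_def)
  have "(%x. if x:A then (s o h) x else x) = s"
   unfolding eval[OF p] using permutes_not_in[OF p(1)] by fastforce
  moreover have "(%x. if x:B then (s o h) x else x) = h"
   unfolding eval[OF p] using permutes_not_in[OF p(2)] X(2) by fastforce
  ultimately show "(%s. (%x. if x:A then s x else x, %x. if x:B then s x else x))
   ((%(s, h). s o h) z) = z" by (simp only: z_eq prod.case)
 qed
 show "ALL s:?G. (%(s, h). s o h) (%x. if x:A then s x else x, %x. if x:B then s x else x) = s"
 proof
  fix s assume s: "s:?G"
  have p: "(%x. if x:A then s x else x) permutes A" "(%x. if x:B then s x else x) permutes B"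
   using parts[OF s] by (simp_all add: Fgrp_def)
  have "s x = x" if "x ~: X" for x using s permutes_not_in[of s X x] that by simp
  thus "(%(s, h). s o h) (%x. if x:A then s x else x, %x. if x:B then s x else x) = s"
   unfolding prod.case by (intro ext) (simp only: eval[OF p], use X(1) in auto)
 qed
 show "(%s. (%x. if x:A then s x else x, %x. if x:B then s x else x)) ` ?G <= Fgrp A f \<times> Fgrp B f"
  by (rule image_subsetI) (intro SigmaI parts)
 show "(%(s, h). s o h) ` (Fgrp A f \<times> Fgrp B f) <= ?G"
 proof (rule image_subsetI)
  fix z assume z: "z:Fgrp A f \<times> Fgrp B f"
  obtain s h where z_eq: "z = (s, h)" by (cases z)
  have p: "s permutes A" "h permutes B" using z by (simp_all add: z_eq Fgrp_def)
  have fix_f: "!!x. x:A ==> f (s x) = f x" "!!x. x:B ==> f (h x) = f x"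
   using z by (simp_all add: z_eq Fgrp_def)
  have mem: "s x:A" if "x:A" for x using that by (simp only: permutes_in_image[OF p(1)])
  have mem': "h x:B" if "x:B" for x using that by (simp only: permutes_in_image[OF p(2)])
  have perm: "(s o h) permutes X"
   using permutes_compose[OF permutes_subset[OF p(2)] permutes_subset[OF p(1)], of X] X(1) by blast
  have "k ((s o h) x) = k x & f ((s o h) x) = f x" if x: "x:X" for x
  proof (cases "x:A")
   case True
   thus ?thesis unfolding eval[OF p] using fix_f(1) mem k(1) by simp
  next
   case False
   hence "x:B" using x X(1) by blast
   thus ?thesis unfolding eval[OF p] using False fix_f(2) mem' k(2) by simp
  qed
  thus "(%(s, h). s o h) z:?G" using perm by (simp add: z_eq)
 qed
qed

lemma young_symmetrizer_eq:
 "young_symmetrizer T f = (real (card (SYT (map length T, []))) / fact (length (concat T))) *\<^sub>R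
   gsum sign (column_stabilizer T) (gsum (%_. 1) (row_stabilizer T) f)"
 unfolding young_symmetrizer_def gsum_def by (simp add: act_sum scaleR_sum_right)

lemma card_SYT_nonzero: assumes "Z:shapes c n" shows "card (SYT Z) ~= 0"
 using card_standard_fillings_pos[OF shape_rows_Parts[OF assms]] bij_betw_same_card[OF entry_bij[OF assms]] by simp

lemma Cop_transport: assumes "u permutes {1..n}" "!!x. x:{1..n} ==> p (u x) = p0 x"
 shows "Cop n p (act (u, {}) f) = act (u, {}) (Cop n p0 f)"
  and "Rop n p (act (u, {}) f) = act (u, {}) (Rop n p0 f)"
 unfolding Cop_gsum Rop_gsum Cgrp_Fgrp Rgrp_Fgrp by (rule gsum_transport; simp add: assms)+

lemma mpow_square: "mpow (%i. indet i ^ 2) m = mon (m + m)"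
proof -
 have "mpow (%i. indet i ^ 2) m = (PROD i:keys m. indet i ^ (2 * coef m i))"
  by (simp add: mpow_def power_mult)
 also have "... = mon (SUM i:keys m. Poly_Mapping.single i (2 * coef m i))"
  by (simp add: prod_indet_power)
 also have "(SUM i:keys m. Poly_Mapping.single i (2 * coef m i)) = m + m"
  by (rule poly_mapping_eqI) (auto simp: coef_sum_single lookup_add in_keys_iff)
 finally show ?thesis .
qed

lemma psubst_square_act: assumes "g permutes {1..n}"
 shows "psubst (%i. indet i ^ 2) (act (g, {}) f) = act (g, {}) (psubst (%i. indet i ^ 2) f)"
proof (rule linear_eq_on_mon[where p = f])
 show "linear (%f. psubst (%i. indet i ^ 2) (act (g, {}) f))"
  using linear_compose[OF linear_act linear_psubst] by (simp add: o_def)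
 show "linear (%f. act (g, {}) (psubst (%i. indet i ^ 2) f))"
  using linear_compose[OF linear_psubst linear_act] by (simp add: o_def)
 fix m
 have "pm (inv g) (m + m) = pm (inv g) m + pm (inv g) m"
  using permutes_inj[OF permutes_inv[OF assms]] by (intro poly_mapping_eqI) (simp add: coef_pm lookup_add)
 thus "psubst (%i. indet i ^ 2) (act (g, {}) (mon m)) = act (g, {}) (psubst (%i. indet i ^ 2) (mon m))"
  by (simp add: act_mon[OF permutes_bij[OF assms]] sg_def mpow_square)
qed

text \<open>Row and column permutations commute with squaring the variables and fix the monomial
  with exponent o', which is constant on components. So both symmetrizers pass through.\<close>

lemma psubst_square_Cop_Rop:
 assumes dia: "diagram {1..n} p" and o: "!!x y. x:{1..n} ==> y:{1..n} ==> kk p x = kk p y ==> o' x = o' y"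
 shows "psubst (%i. indet i ^ 2) (CR n p (mon (expo n u))) * mon (expo n o')
  = CR n p (mon (expo n (%x. 2 * u x + o' x)))"
proof -
 define w where "w f = psubst (%i. indet i ^ 2) f * mon (expo n o')" for f
 have lin: "w (f + g) = w f + w g" "w (a *\<^sub>R f) = a *\<^sub>R w f" for f g a
  by (simp_all add: w_def psubst_add psubst_scaleR distrib_right)
 have comm: "w (act (s, {}) f) = act (s, {}) (w f)"
  if s: "s permutes {1..n}" and k: "!!x. x:{1..n} ==> kk p (s x) = kk p x" for s f
 proof -
  have inv: "inv s permutes {1..n}" by (rule permutes_inv[OF s])
  have "o' (inv s x) = o' x" if x: "x:{1..n}" for x
  proof -
   have i: "inv s x:{1..n}" using x by (simp only: permutes_in_image[OF inv])
   thus ?thesis using k[OF i] by (intro o i x) (simp add: permutes_inverses(1)[OF s])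
  qed
  hence "expo n (%x. o' (inv s x)) = expo n o'" by (simp add: expo_eq_iff)
  hence "act (s, {}) (mon (expo n o')) = mon (expo n o')"
   by (simp add: act_mon[OF permutes_bij[OF s]] sg_def pm_expo[OF inv])
  thus ?thesis by (simp add: w_def psubst_square_act[OF s] act_mult)
 qed
 have "linear w" by (rule linearI) (simp_all add: lin)
 hence C: "w (Cop n p f) = Cop n p (w f)" and R: "w (Rop n p f) = Rop n p (w f)" for f
  unfolding Cop_gsum Rop_gsum by (auto intro!: gsum_linear_commute comm simp: Cgrp_def Rgrp_def)
 have "w (mon (expo n u)) = mon (expo n (%x. 2 * u x + o' x))"
  by (simp add: w_def mpow_square mon_mult expo_add mult_2)
 thus ?thesis using C R by (simp add: w_def)
qed

context fixes c :: cox_type and n :: nat and Z :: shape and T :: bitableau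
 assumes Z: "Z:shapes c n" and T: "T:SYT Z"
begin

abbreviation (input) "PT == place (shape_rows Z) (entry T)"
abbreviation (input) "XT k == {x:{1..n}. fst (PT x) = k}"

lemma filling_T: "filling Z T" using T by (simp add: SYT_def)

lemma place_entry: assumes "r < length (component T k)" "a < length (component T k ! r)"
 shows "component T k ! r ! a:{1..n}" "PT (component T k ! r ! a) = (k, r, a)"
proof -
 interpret T: standard_filling c n "shape_rows Z" "entry T" by (rule standard_filling_entry[OF Z T])
 have z: "(k, r, a):cells (shape_rows Z)" using assms by (simp add: cells_shape_rows[OF filling_T])
 show "component T k ! r ! a:{1..n}" using bij_betwE[OF T.t_bij] z entry_nth[OF assms] by metis
 show "PT (component T k ! r ! a) = (k, r, a)" using T.place_t[OF z] entry_nth[OF assms] by simp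
qed

lemma entry_place: assumes "x:{1..n}" "PT x = (k, r, a)"
 shows "r < length (component T k)" "a < length (component T k ! r)" "x = component T k ! r ! a"
proof -
 interpret T: standard_filling c n "shape_rows Z" "entry T" by (rule standard_filling_entry[OF Z T])
 have z: "(k, r, a):cells (shape_rows Z)" using T.place_in[OF assms(1)] assms(2) by simp
 thus ra: "r < length (component T k)" "a < length (component T k ! r)"
  by (simp_all add: cells_shape_rows[OF filling_T])
 show "x = component T k ! r ! a" using T.t_place[OF assms(1)] assms(2) entry_nth[OF ra] by simp
qed

lemma set_row: assumes "r < length (component T k)" shows "set (component T k ! r) = {x:XT k. rr PT x = r}"
proof (intro equalityI subsetI)
 fix x assume "x:set (component T k ! r)"
 then obtain a where "a < length (component T k ! r)" "x = component T k ! r ! a" by (metis in_set_conv_nth)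
 thus "x:{x:XT k. rr PT x = r}" using place_entry[OF assms] by simp
next
 fix x assume x: "x:{x:XT k. rr PT x = r}"
 obtain a where "PT x = (k, r, a)" using x by (cases "PT x") auto
 thus "x:set (component T k ! r)" using entry_place[of x k r a] x by simp
qed

lemma set_component: "set (concat (component T k)) = XT k"
proof (intro equalityI subsetI)
 fix x assume "x:set (concat (component T k))"
 then obtain b where "b:set (component T k)" "x:set b" by auto
 then obtain r where "r < length (component T k)" "x:set (component T k ! r)" by (metis in_set_conv_nth)
 thus "x:XT k" using set_row by blast
next
 fix x assume x: "x:XT k"
 obtain r a where "PT x = (k, r, a)" using x by (cases "PT x") auto
 hence "r < length (component T k)" "x:set (component T k ! r)" using entry_place[of x k r a] x by simp_all
 thus "x:set (concat (component T k))" by auto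
qed

lemma row_stabilizer_eq: "row_stabilizer (component T k) = Fgrp (XT k) (%x. rr PT x)"
proof (rule stabilizer_eq_Fgrp)
 show "XT k = set (concat (component T k))" by (rule set_component[symmetric])
 show "EX i. set b = {x:XT k. rr PT x = i}" if "b:set (component T k)" for b
 proof -
  obtain r where "r < length (component T k)" "b = component T k ! r" using `b:_` by (metis in_set_conv_nth)
  thus ?thesis using set_row by blast
 qed
 show "EX b:set (component T k). x:set b" if "x:XT k" for x
  using that unfolding set_component[symmetric] by auto
qed

lemma column_stabilizer_eq: "column_stabilizer (component T k) = Fgrp (XT k) (%x. cc PT x)"
proof (rule stabilizer_eq_Fgrp)
 have sorted: "sorted_wrt (>=) (map length (component T k))"
  using component_sorted[OF Z] by (simp add: filling_lengths[OF filling_T])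
 let ?h = "column_height (map length (component T k))" and ?w = "width (map length (component T k))"
 have height: "r < ?h a \<longleftrightarrow> r < length (component T k) & a < length (component T k ! r)" for r a
  using less_column_height[OF sorted, of r a] by auto
 show "XT k = set (concat (component T k))" by (rule set_component[symmetric])
 have set_col: "set (map (%r. component T k ! r ! a) [0..<?h a]) = {x:XT k. cc PT x = a}" for a
 proof (intro equalityI subsetI)
  fix x assume "x:set (map (%r. component T k ! r ! a) [0..<?h a])"
  then obtain r where "r < ?h a" "x = component T k ! r ! a" by auto
  thus "x:{x:XT k. cc PT x = a}" using place_entry[of r k a] height by simp
 next
  fix x assume x: "x:{x:XT k. cc PT x = a}"
  obtain r where "PT x = (k, r, a)" using x by (cases "PT x") auto
  hence "r < ?h a" "x = component T k ! r ! a" using entry_place[of x k r a] height x by simp_all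
  thus "x:set (map (%r. component T k ! r ! a) [0..<?h a])" by simp
 qed
 show "EX i. set b = {x:XT k. cc PT x = i}" if "b:set (List.transpose (component T k))" for b
 proof -
  obtain a where "b = map (%r. component T k ! r ! a) [0..<?h a]"
  proof -
   show thesis if *: "!!a. b = map (%r. component T k ! r ! a) [0..<?h a] ==> thesis"
    using `b:_` unfolding transpose_eq_columns[OF sorted] set_map by (rule imageE) (rule *)
  qed
  thus ?thesis using set_col[of a] by blast
 qed
 show "EX b:set (List.transpose (component T k)). x:set b" if x: "x:XT k" for x
 proof -
  obtain r a where z: "PT x = (k, r, a)" using x by (cases "PT x") auto
  note ra = entry_place[OF _ z]
  have "a < ?w" using less_width[OF sorted, of r a] ra x by simp
  hence "map (%r. component T k ! r ! a) [0..<?h a]:set (List.transpose (component T k))"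
   unfolding transpose_eq_columns[OF sorted] by simp
  moreover have "x:set (map (%r. component T k ! r ! a) [0..<?h a])" unfolding set_col using x z by simp
  ultimately show ?thesis by blast
 qed
qed

text \<open>Permutations of the two components commute, so the factors C_0 R_0 C_1 R_1 rearrange to
  C_0 C_1 R_0 R_1, and these are the column and row operators of the whole bitableau.\<close>

lemma young_symmetrizers:
 obtains a where "a ~= 0" "!!f. young_symmetrizer (fst T) (young_symmetrizer (snd T) f) = a *\<^sub>R CR n PT f"
proof -
 interpret T: standard_filling c n "shape_rows Z" "entry T" by (rule standard_filling_entry[OF Z T])
 define C where "C k = Fgrp (XT k) (%x. cc PT x)" for k
 define R where "R k = Fgrp (XT k) (%x. rr PT x)" for k
 define a where "a k = real (card (SYT (map length (component T k), []))) / fact (length (concat (component T k)))" for k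
 have young: "young_symmetrizer (component T k) f = a k *\<^sub>R gsum sign (C k) (gsum (%_. 1) (R k) f)" for k f
  unfolding young_symmetrizer_eq a_def C_def R_def row_stabilizer_eq column_stabilizer_eq ..
 have a_nz: "a k ~= 0" for k
 proof -
  have "(component Z k, []):shapes TypeA (sum_list (component Z k))"
   using shapes_partitions(1)[OF Z, of k] by simp
  hence "card (SYT (map length (component T k), [])) ~= 0"
   unfolding filling_lengths[OF filling_T] by (rule card_SYT_nonzero)
  thus ?thesis by (simp add: a_def)
 qed
 have perm: "g permutes {1..n}" if "g:C k | g:R k" for g k
  by (rule permutes_subset[of _ "XT k"]) (use that in \<open>auto simp: C_def R_def Fgrp_def\<close>)
 have X: "{1..n} = XT 0 Un XT 1"
 proof -
  have "kk PT x = 0 | kk PT x = 1" if "x:{1..n}" for x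
  proof -
   have "kk PT x <= (if c = TypeB then 1 else 0)" using T.kvalid_place that unfolding kvalid_def by blast
   hence "kk PT x <= 1" by (simp split: if_splits)
   thus ?thesis by linarith
  qed
  thus ?thesis by blast
 qed
 have Cprod: "gsum sign (Cgrp {1..n} PT) f = gsum sign (C 0) (gsum sign (C 1) f)" for f
 proof (rule gsum_product)
  show "bij_betw (%(g, u). g o u) (C 0 \<times> C 1) (Cgrp {1..n} PT)"
   unfolding C_def Cgrp_def by (rule bij_betw_Fgrp_product[OF X]) auto
 qed (use perm in auto)
 have Rprod: "gsum (%_. 1) (Rgrp {1..n} PT) f = gsum (%_. 1) (R 0) (gsum (%_. 1) (R 1) f)" for f
 proof (rule gsum_product)
  show "bij_betw (%(g, u). g o u) (R 0 \<times> R 1) (Rgrp {1..n} PT)"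
   unfolding R_def Rgrp_def by (rule bij_betw_Fgrp_product[OF X]) auto
 qed (use perm in auto)
 have comm: "gsum sign (C 1) (gsum (%_. 1) (R 0) f) = gsum (%_. 1) (R 0) (gsum sign (C 1) f)" for f
 proof (intro gsum_linear_commute linear_gsum linear_act sym[OF gsum_linear_commute[OF linear_act]])
  fix g u f assume gu: "u:R 0" "g:C 1"
  have "g o u = u o g" by (rule permutes_disjoint_commute[of _ "XT 1" _ "XT 0"])
    (use gu in \<open>auto simp: C_def R_def Fgrp_def\<close>)
  thus "act (u, {}) (act (g, {}) f) = act (g, {}) (act (u, {}) f)"
   using perm[of g 1] perm[of u 0] gu by (simp add: act_permutes_compose[of _ n])
 qed
 show ?thesis
 proof (rule that[of "a 0 * a 1"])
  show "a 0 * a 1 ~= 0" using a_nz by simp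
  fix f
  have "young_symmetrizer (fst T) (young_symmetrizer (snd T) f)
    = young_symmetrizer (component T 0) (young_symmetrizer (component T 1) f)" by (simp add: component_def)
  also have "... = (a 0 * a 1) *\<^sub>R gsum sign (C 0) (gsum (%_. 1) (R 0) (gsum sign (C 1) (gsum (%_. 1) (R 1) f)))"
   by (simp add: young linear_scale[OF linear_gsum])
  also have "... = (a 0 * a 1) *\<^sub>R CR n PT f"
   by (simp only: Cop_gsum Rop_gsum Cprod Rprod comm)
  finally show "young_symmetrizer (fst T) (young_symmetrizer (snd T) f) = (a 0 * a 1) *\<^sub>R CR n PT f" .
 qed
qed

lemma higher_specht_eq: assumes S: "S:SYT Z"
 obtains a where "a ~= 0"
  "higher_specht c T S = a *\<^sub>R CR n PT (mon (expo n (%x. cell_exponent c (shape_rows Z) (entry S) (PT x))))"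
proof -
 interpret T: standard_filling c n "shape_rows Z" "entry T" by (rule standard_filling_entry[OF Z T])
 define u where "u x = filling_index (shape_rows Z) (entry S) (entry S (PT x))" for x
 obtain a where a: "a ~= 0" "!!f. young_symmetrizer (fst T) (young_symmetrizer (snd T) f) = a *\<^sub>R CR n PT f"
  by (rule young_symmetrizers) (rule that)
 have specht_F: "specht_F T S = a *\<^sub>R CR n PT (mon (expo n u))"
  unfolding specht_F_def a(2) tableau_monomial_eq[OF Z T S] u_def ..
 show ?thesis
 proof (rule that[OF a(1)])
  show "higher_specht c T S = a *\<^sub>R CR n PT (mon (expo n (%x. cell_exponent c (shape_rows Z) (entry S) (PT x))))"
  proof (cases c)
   case TypeA
   have "(%x. cell_exponent c (shape_rows Z) (entry S) (PT x)) = u"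
    by (rule ext) (simp add: cell_exponent_def mult_c_def cell_offset_def u_def TypeA)
   thus ?thesis using specht_F by (simp add: TypeA)
  next
   case TypeB
   define o' where "o' x = cell_offset c (PT x)" for x
   have e: "(%x. cell_exponent c (shape_rows Z) (entry S) (PT x)) = (%x. 2 * u x + o' x)"
    by (rule ext) (simp add: cell_exponent_def mult_c_def u_def o'_def TypeB)
   have "(PROD j:set (concat (snd T)). indet j) = (PROD j:XT 1. indet j)"
    using set_component[of 1] by (simp add: component_def)
   also have "... = (PROD j:{1..n}. indet j ^ o' j)"
    by (rule prod.mono_neutral_cong_left) (auto simp: o'_def cell_offset_def TypeB)
   also have "... = mon (expo n o')" by (simp add: prod_indet_power expo_def)
   finally have M: "(PROD j:set (concat (snd T)). indet j) = mon (expo n o')" .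
   have "psubst (%i. indet i ^ 2) (CR n PT (mon (expo n u))) * mon (expo n o')
     = CR n PT (mon (expo n (%x. 2 * u x + o' x)))"
    by (rule psubst_square_Cop_Rop[OF T.diagram_place]) (simp add: o'_def cell_offset_def)
   thus ?thesis
    unfolding e unfolding TypeB higher_specht.simps specht_F M psubst_scaleR by (simp only: rpoly_scaleR_mult_left)
  qed
 qed
qed

end

lemma specht_shapes_shapes: "specht_shapes c n (shapes c n) shape_rows"
 by unfold_locales (rule shape_rows_bij)

text \<open>Connects the defined polynomials with the free basis. The nonzero factor collects the
  normalizations of the Young symmetrizers.\<close>

lemma higher_specht_sp:
 assumes Z: "Z:shapes c n" and T: "T:SYT Z" and S: "S:SYT Z"
 obtains a where "a ~= 0"
  "higher_specht c T S = a *\<^sub>R act (specht_shapes.tperm n shape_rows Z (entry T), {}) (specht_shapes.sp c n shape_rows Z (entry S))"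
proof -
 interpret specht_shapes c n "shapes c n" shape_rows by (rule specht_shapes_shapes)
 interpret T: standard_filling c n "shape_rows Z" "entry T" by (rule standard_filling_entry[OF Z T])
 let ?P = "place (shape_rows Z) (entry T)" and ?p = "tperm Z (entry T)"
 define e where "e = cell_exponent c (shape_rows Z) (entry S)"
 have p: "?p permutes {1..n}" by (rule tperm_permutes[OF Z entry_standard[OF Z T]])
 have inv: "inv ?p permutes {1..n}" by (rule permutes_inv[OF p])
 have P: "?P (?p x) = bp Z x" if "x:{1..n}" for x
  using T.place_t[OF bp_in[OF Z that]] that by (simp add: tperm_def)
 have "expo n (%x. e (bp Z (inv ?p x))) = expo n (%x. e (?P x))" unfolding expo_eq_iff
 proof
  fix x assume x: "x:{1..n}"
  have "inv ?p x:{1..n}" using x by (simp only: permutes_in_image[OF inv])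
  thus "e (bp Z (inv ?p x)) = e (?P x)" using P[of "inv ?p x"] by (simp add: permutes_inverses(1)[OF p])
 qed
 hence "act (?p, {}) (mon (bx Z (entry S))) = mon (expo n (%x. e (?P x)))"
  by (simp add: act_mon[OF permutes_bij[OF p]] sg_def bx_def e_def pm_expo[OF inv])
 hence "CR n ?P (mon (expo n (%x. e (?P x)))) = act (?p, {}) (sp Z (entry S))"
  using Cop_transport[of ?p n ?P "bp Z", OF p P] by (metis sp_def)
 moreover obtain a where "a ~= 0" "higher_specht c T S = a *\<^sub>R CR n ?P (mon (expo n (%x. e (?P x))))"
  unfolding e_def by (rule higher_specht_eq[OF Z T S])
 ultimately show ?thesis using that by simp
qed

section \<open>Sums of squares that are homogeneous\<close>

section \<open>Homogeneous sums of squares\<close>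

text \<open>In the linear order on exponents M + M arises from exponents bounded by M only as M plus
  M.\<close>

lemma coef_square_max: fixes p :: rpoly assumes "!!m. m:keys p ==> m <= M"
 shows "coef (p * p) (M + M) = coef p M ^ 2"
proof -
 define p' where "p' = p - coef p M *\<^sub>R mon M"
 have p: "p = coef p M *\<^sub>R mon M + p'" by (simp add: p'_def)
 have lt: "m < M" if "coef p' m ~= 0" for m
 proof -
  have "m ~= M" using that by (auto simp: p'_def lookup_minus lookup_single)
  hence "coef p m ~= 0" using that by (auto simp: p'_def lookup_minus lookup_single when_def)
  thus ?thesis using assms[of m] `m ~= M` by (auto simp: in_keys_iff)
 qed
 have 1: "coef (mon M * p') (M + M) = 0"
 proof (rule ccontr)
  assume "coef (mon M * p') (M + M) ~= 0"
  then obtain a b where "M + M = a + b" "coef (mon M) a ~= 0" "coef p' b ~= 0" by (rule coef_mult_nonzero)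
  hence "b = M" by (auto simp: lookup_single when_def split: if_splits)
  thus False using lt[of b] `coef p' b ~= 0` by simp
 qed
 have 2: "coef (p' * p') (M + M) = 0"
 proof (rule ccontr)
  assume "coef (p' * p') (M + M) ~= 0"
  then obtain a b where "M + M = a + b" "coef p' a ~= 0" "coef p' b ~= 0" by (rule coef_mult_nonzero)
  thus False using add_strict_mono[OF lt[of a] lt[of b]] by simp
 qed
 define q where "q = coef p M *\<^sub>R mon M"
 have qp: "coef (q * p') (M + M) = 0" using 1 by (simp add: q_def)
 have "coef (p * p) (M + M) = coef ((q + p') * (q + p')) (M + M)" using p by (simp add: q_def)
 also have "... = coef (q * q) (M + M) + coef (q * p') (M + M) + (coef (p' * q) (M + M) + coef (p' * p') (M + M))"
  by (simp only: distrib_left distrib_right lookup_add)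
 also have "... = coef (q * q) (M + M)" using qp 2 by (simp add: mult.commute[of p' q])
 also have "... = coef p M ^ 2" by (simp add: q_def mon_mult lookup_single power2_eq_square)
 finally show ?thesis .
qed

text \<open>At twice the largest exponent occurring, the coefficient is a sum of real squares, at
  least one of which would be positive.\<close>

lemma sum_squares_eq_0: fixes p :: "'i => rpoly" assumes "finite I" "(SUM i:I. p i * p i) = 0" "i:I"
 shows "p i = 0"
proof (rule ccontr)
 assume nz: "p i ~= 0"
 let ?K = "UN i:I. keys (p i)"
 define M where "M = Max ?K"
 have fin: "finite ?K" using assms(1) by simp
 have ne: "?K ~= {}" using nz assms(3) by auto
 have max: "m <= M" if "i:I" "m:keys (p i)" for i m
  unfolding M_def using fin that by (intro Max_ge) auto
 have "M:?K" unfolding M_def using fin ne by (rule Max_in)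
 then obtain j where j: "j:I" "coef (p j) M ~= 0" by (auto simp: in_keys_iff)
 have "0 = coef (SUM i:I. p i * p i) (M + M)" by (simp add: assms(2))
 also have "... = (SUM i:I. coef (p i) M ^ 2)"
  unfolding lookup_sum by (intro sum.cong refl coef_square_max max)
 finally have "(SUM i:I. coef (p i) M ^ 2) = 0" by simp
 hence "coef (p j) M ^ 2 = 0" using sum_nonneg_eq_0_iff[OF assms(1), of "%i. coef (p i) M ^ 2"] j(1) by simp
 thus False using j(2) by simp
qed

lemma hcomp_square: assumes "h:poly_ring n" "!!e'. e' < e ==> hcomp e' h = 0"
 shows "hcomp (2 * e) (h * h) = hcomp e h * hcomp e h"
proof -
 define D where "D = insert e (mdeg ` keys h)"
 have D: "finite D" "e:D" by (simp_all add: D_def)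
 have h: "h = (SUM d:D. hcomp d h)" by (rule sum_hcomp) (auto simp: D_def)
 have form: "hcomp d h * hcomp d' h:forms n (d + d')" for d d' by (intro forms_mult hcomp_in_forms assms(1))
 have "hcomp (2 * e) (h * h) = (SUM d:D. SUM d':D. hcomp (2 * e) (hcomp d h * hcomp d' h))"
  by (subst (1 2) h) (simp add: sum_product linear_sum[OF linear_hcomp])
 also have "... = (SUM d:D. SUM d':D. if d = e & d' = e then hcomp e h * hcomp e h else 0)"
 proof (intro sum.cong refl)
  fix d d'
  consider "d = e" "d' = e" | "d < e | d' < e" | "2 * e ~= d + d'" by linarith
  thus "hcomp (2 * e) (hcomp d h * hcomp d' h) = (if d = e & d' = e then hcomp e h * hcomp e h else 0)"
   by cases (use hcomp_forms[OF form[of d d'], of "2 * e"] assms(2) linear_0[OF linear_hcomp] in auto)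
 qed
 also have "... = (SUM d:D. if d = e then hcomp e h * hcomp e h else 0)" using D by (intro sum.cong refl) auto
 also have "... = hcomp e h * hcomp e h" using D by simp
 finally show ?thesis .
qed

text \<open>In degrees below 2d the lowest components would have squares summing to 0, so by
  induction they vanish; what remains in degree 2d comes from the components of degree d
  alone.\<close>

lemma homogeneous_sos: fixes h :: "'i => rpoly"
 assumes fin: "finite I" and h: "!!i. i:I ==> h i:poly_ring n" and f: "(SUM i:I. h i * h i):forms n (2 * d)"
 shows "(SUM i:I. h i * h i) = (SUM i:I. hcomp d (h i) * hcomp d (h i))"
proof -
 have low: "ALL i:I. hcomp e (h i) = 0" if "e < d" for e using that
 proof (induction e rule: less_induct)
  case (less e)
  have "hcomp (2 * e) (SUM i:I. h i * h i) = 0" using hcomp_forms[OF f, of "2 * e"] less.prems by simp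
  moreover have "hcomp (2 * e) (h i * h i) = hcomp e (h i) * hcomp e (h i)" if "i:I" for i
   by (rule hcomp_square[OF h[OF that] bspec[OF less.IH that]]) (use less.prems in simp_all)
  ultimately have "(SUM i:I. hcomp e (h i) * hcomp e (h i)) = 0" by (simp add: linear_sum[OF linear_hcomp])
  thus ?case by (intro ballI) (rule sum_squares_eq_0[OF fin, of "%i. hcomp e (h i)"])
 qed
 have "(SUM i:I. h i * h i) = hcomp (2 * d) (SUM i:I. h i * h i)" using hcomp_forms[OF f, of "2 * d"] by simp
 also have "... = (SUM i:I. hcomp (2 * d) (h i * h i))" by (rule linear_sum[OF linear_hcomp])
 also have "... = (SUM i:I. hcomp d (h i) * hcomp d (h i))"
 proof (rule sum.cong[OF refl])
  show "hcomp (2 * d) (h i * h i) = hcomp d (h i) * hcomp d (h i)" if "i:I" for i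
   by (rule hcomp_square[OF h[OF that] bspec[OF low that]])
 qed
 finally show ?thesis .
qed

section \<open>Graded structure of the ring generated by the fundamental invariants\<close>

section \<open>Monomials in fundamental invariants\<close>

locale fundamental = fixes c :: cox_type and n :: nat and \<psi> :: "nat => rpoly"
 assumes fund: "fundamental_invariants n (refl_group c n) \<psi>"
begin

lemma generated: "generated_ring n \<psi> = invariants n (refl_group c n)"
 using fund by (simp add: fundamental_invariants_def)

lemma algebraic_independence: "p:poly_ring n ==> psubst \<psi> p = 0 ==> p = 0"
 using fund by (simp add: fundamental_invariants_def)

definition de :: "nat => nat" where
 "de i = (SOME d. \<psi> i:forms n d)"

lemma psi_forms: "i:{1..n} ==> \<psi> i:forms n (de i)"
 using fund unfolding fundamental_invariants_def de_def by (metis someI_ex)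

lemma psi_invariant: assumes i: "i:{1..n}" shows "\<psi> i:invariants n (refl_group c n)"
proof -
 have "psubst \<psi> (mon (Poly_Mapping.single i 1)) = \<psi> i" by (simp add: mpow_def)
 moreover have "mon (Poly_Mapping.single i 1):poly_ring n" using i by (simp add: mon_in_poly_ring)
 ultimately show ?thesis using generated unfolding generated_ring_def by (metis imageI)
qed

text \<open>A constant \<open>\<psi> i\<close> would satisfy the relation X_i minus that constant,
  against algebraic independence.\<close>

lemma de_pos: assumes i: "i:{1..n}" shows "0 < de i"
proof (rule ccontr)
 assume "~ 0 < de i"
 hence "\<psi> i:forms n 0" using psi_forms[OF i] by simp
 hence c0: "coef (\<psi> i) m = 0" if "m ~= 0" for m
  using that by (auto simp: forms_iff mdeg_def poly_mapping_eq_iff fun_eq_iff in_keys_iff sum_eq_0_iff)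
 let ?p = "mon (Poly_Mapping.single i 1) - coef (\<psi> i) 0 *\<^sub>R mon 0"
 have psi: "\<psi> i = coef (\<psi> i) 0 *\<^sub>R 1"
 proof (rule poly_mapping_eqI)
  fix m
  show "coef (\<psi> i) m = coef (coef (\<psi> i) 0 *\<^sub>R 1) m"
   using c0[of m] by (cases "m = 0") (simp_all add: lookup_one)
 qed
 have "psubst \<psi> ?p = psubst \<psi> (mon (Poly_Mapping.single i 1)) - coef (\<psi> i) 0 *\<^sub>R psubst \<psi> (mon 0)"
  by (simp only: linear_diff[OF linear_psubst] psubst_scaleR)
 also have "... = \<psi> i - coef (\<psi> i) 0 *\<^sub>R 1" by (simp add: mpow_def)
 also have "... = 0" using psi by simp
 finally have 0: "psubst \<psi> ?p = 0" .
 have "?p:poly_ring n"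
  using i by (intro subspace_diff[OF subspace_poly_ring] subspace_scale[OF subspace_poly_ring]) (simp_all only: mon_in_poly_ring, auto)
 hence "?p = 0" using 0 by (rule algebraic_independence)
 hence "coef ?p (Poly_Mapping.single i 1) = 0" by simp
 moreover have "Poly_Mapping.single i (1::nat) ~= 0" by (metis lookup_single_eq lookup_zero zero_neq_one)
 ultimately show False by (simp add: lookup_minus lookup_single lookup_one)
qed

definition wdeg :: "(nat \<Rightarrow>\<^sub>0 nat) => nat" where
 "wdeg m = (SUM i:{1..n}. coef m i * de i)"

definition Wexp :: "nat => (nat \<Rightarrow>\<^sub>0 nat) set" where
 "Wexp e = {m. keys m <= {1..n} & wdeg m = e}"

lemma mpow_psi: "keys m <= {1..n} ==> mpow \<psi> m = (PROD i = 1..n. \<psi> i ^ coef m i)"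
 by (rule mpow_superset) simp_all

lemma mpow_psi_forms: assumes "keys m <= {1..n}" shows "mpow \<psi> m:forms n (wdeg m)"
 unfolding mpow_psi[OF assms] wdeg_def by (intro forms_prod forms_power psi_forms) simp_all

lemma mpow_psi_invariant: assumes "keys m <= {1..n}"
 shows "mpow \<psi> m:invariants n (refl_group c n)"
 using generated assms unfolding generated_ring_def by (metis imageI mon_in_poly_ring psubst_mon)

lemma finite_Wexp: "finite (Wexp e)"
proof (rule finite_subset)
 show "Wexp e <= expo n ` {f. ALL x. (x:{1..n} --> f x:{..e}) & (x ~: {1..n} --> f x = 0)}"
 proof
  fix m assume m: "m:Wexp e"
  have "coef m i <= e" if i: "i:{1..n}" for i
  proof -
   have "coef m i <= coef m i * de i" using de_pos[OF i] by simp
   also have "... <= wdeg m" unfolding wdeg_def using i by (intro member_le_sum) auto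
   finally show ?thesis using m by (simp add: Wexp_def)
  qed
  moreover have "coef m i = 0" if "i ~: {1..n}" for i
   using m that unfolding Wexp_def by (metis (no_types, lifting) in_keys_iff mem_Collect_eq subsetD)
  moreover have "m = expo n (coef m)" using m by (intro eq_expo) (simp add: Wexp_def)
  ultimately show "m:expo n ` {f. ALL x. (x:{1..n} --> f x:{..e}) & (x ~: {1..n} --> f x = 0)}"
   by (intro image_eqI[of _ _ "coef m"]) auto
 qed
 show "finite (expo n ` {f. ALL x. (x:{1..n} --> f x:{..e}) & (x ~: {1..n} --> f x = 0)})"
  by (intro finite_imageI finite_set_of_finite_funs) simp_all
qed

lemma mpow_psi_independent: assumes "finite A" "!!m. m:A ==> keys m <= {1..n}"
  and "(SUM m:A. a m *\<^sub>R mpow \<psi> m) = 0" "m:A" shows "a m = 0"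
proof -
 let ?p = "SUM m:A. a m *\<^sub>R mon m"
 have "psubst \<psi> ?p = 0" using assms(3) by (simp add: psubst_sum psubst_scaleR)
 moreover have "?p:poly_ring n"
  using assms(2) by (intro subspace_sum[OF subspace_poly_ring] subspace_scale[OF subspace_poly_ring]) (simp add: mon_in_poly_ring)
 ultimately have "?p = 0" by (rule algebraic_independence[rotated])
 hence "0 = coef ?p m" by simp
 also have "... = (SUM k:A. if k = m then a m else 0)"
  unfolding lookup_sum by (intro sum.cong refl) (simp add: lookup_single when_def)
 finally show ?thesis using assms(1,4) by simp
qed

lemma invariant_expand: assumes "h:invariants n (refl_group c n)"
 obtains p where "p:poly_ring n" "h = (SUM m:keys p. coef p m *\<^sub>R mpow \<psi> m)"
proof -
 obtain p where p: "p:poly_ring n" "h = psubst \<psi> p"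
  using assms generated unfolding generated_ring_def by blast
 thus ?thesis using that by (simp add: psubst_def mpow_def)
qed

lemma invariant_form_expand: assumes h: "h:invariants n (refl_group c n)" and e: "h:forms n e"
 obtains a where "h = (SUM m:Wexp e. a m *\<^sub>R mpow \<psi> m)"
proof -
 obtain p where p: "p:poly_ring n" "h = (SUM m:keys p. coef p m *\<^sub>R mpow \<psi> m)"
  by (rule invariant_expand[OF h])
 have keys: "keys m <= {1..n}" if "m:keys p" for m
  using p(1) that by (simp add: poly_ring_def)
 have "h = hcomp e h" using hcomp_forms[OF e, of e] by simp
 also have "... = (SUM m:keys p. coef p m *\<^sub>R hcomp e (mpow \<psi> m))"
  by (subst p(2)) (simp add: linear_sum[OF linear_hcomp] linear_scale[OF linear_hcomp])
 also have "... = (SUM m:keys p. if m:Wexp e then coef p m *\<^sub>R mpow \<psi> m else 0)"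
  by (intro sum.cong refl) (simp add: hcomp_forms[OF mpow_psi_forms[OF keys]] Wexp_def keys)
 also have "... = (SUM m:keys p Int Wexp e. coef p m *\<^sub>R mpow \<psi> m)"
  by (simp add: sum.inter_restrict)
 also have "... = (SUM m:Wexp e. coef p m *\<^sub>R mpow \<psi> m)"
  using finite_Wexp by (intro sum.mono_neutral_left) (auto simp: in_keys_iff)
 finally show ?thesis by (rule that)
qed

lemma coinvariant_ideal_alt:
 "f:coinvariant_ideal n \<psi> \<longleftrightarrow> (EX a. (ALL i:{1..n}. a i:poly_ring n) & f = (SUM i = 1..n. a i * \<psi> i))"
 unfolding coinvariant_ideal_def by blast

lemma subspace_coinvariant_ideal: "subspace (coinvariant_ideal n \<psi>)" unfolding subspace_def
proof (intro conjI ballI allI)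
 show "0:coinvariant_ideal n \<psi>"
  unfolding coinvariant_ideal_alt by (intro exI[of _ "%_. 0"]) (simp add: subspace_0[OF subspace_poly_ring])
 fix f g assume "f:coinvariant_ideal n \<psi>" "g:coinvariant_ideal n \<psi>"
 then obtain a b where "ALL i:{1..n}. a i:poly_ring n" "f = (SUM i = 1..n. a i * \<psi> i)"
  "ALL i:{1..n}. b i:poly_ring n" "g = (SUM i = 1..n. b i * \<psi> i)"
  unfolding coinvariant_ideal_alt by blast
 thus "f + g:coinvariant_ideal n \<psi>" unfolding coinvariant_ideal_alt
  by (intro exI[of _ "%i. a i + b i"]) (simp add: subspace_add[OF subspace_poly_ring] distrib_right sum.distrib)
next
 fix r :: real and f assume "f:coinvariant_ideal n \<psi>"
 then obtain a where "ALL i:{1..n}. a i:poly_ring n" "f = (SUM i = 1..n. a i * \<psi> i)"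
  unfolding coinvariant_ideal_alt by blast
 thus "r *\<^sub>R f:coinvariant_ideal n \<psi>" unfolding coinvariant_ideal_alt
  by (intro exI[of _ "%i. r *\<^sub>R a i"]) (simp add: subspace_scale[OF subspace_poly_ring] scaleR_sum_right)
qed

lemma coinvariant_ideal_mult: assumes "f:coinvariant_ideal n \<psi>" "g:poly_ring n"
 shows "f * g:coinvariant_ideal n \<psi>"
proof -
 obtain a where "ALL i:{1..n}. a i:poly_ring n" "f = (SUM i = 1..n. a i * \<psi> i)"
  using assms(1) unfolding coinvariant_ideal_alt by blast
 thus ?thesis unfolding coinvariant_ideal_alt using assms(2)
  by (intro exI[of _ "%i. g * a i"]) (simp add: poly_ring_mult sum_distrib_left mult.commute[of _ g] mult.assoc)
qed

lemma mpow_psi_in_ideal: assumes "keys m <= {1..n}" "m ~= 0"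
 shows "mpow \<psi> m:coinvariant_ideal n \<psi>"
proof -
 obtain i where i: "i:keys m" using assms(2) by (metis keys_eq_empty ex_in_conv)
 have i': "i:{1..n}" using i assms(1) by blast
 define m' where "m' = m - Poly_Mapping.single i 1"
 have m: "m = m' + Poly_Mapping.single i 1"
  using i by (intro poly_mapping_eqI) (auto simp: m'_def lookup_add lookup_minus lookup_single when_def in_keys_iff)
 have keys': "keys m' <= {1..n}"
  using assms(1) by (auto simp: m'_def in_keys_iff lookup_minus)
 have "mpow \<psi> m = mpow \<psi> m' * \<psi> i" by (subst m) (simp add: mpow_add, simp add: mpow_def)
 also have "... = (SUM k = 1..n. (if k = i then mpow \<psi> m' else 0) * \<psi> k)"
  using i' by (simp add: if_distrib[of "%a. a * _"] cong: if_cong)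
 finally show ?thesis unfolding coinvariant_ideal_alt using mpow_psi_invariant[OF keys']
  by (intro exI[of _ "%k. if k = i then mpow \<psi> m' else 0"])
   (auto simp: invariants_def subspace_0[OF subspace_poly_ring])
qed

text \<open>An invariant is congruent to its constant term modulo the coinvariant ideal.\<close>

lemma invariant_mod_ideal: assumes "h:invariants n (refl_group c n)"
 obtains b where "h - b *\<^sub>R 1:coinvariant_ideal n \<psi>"
proof -
 obtain p where p: "p:poly_ring n" "h = (SUM m:keys p. coef p m *\<^sub>R mpow \<psi> m)"
  by (rule invariant_expand[OF assms])
 have "h = (SUM m:insert 0 (keys p). coef p m *\<^sub>R mpow \<psi> m)"
  unfolding p(2) by (intro sum.mono_neutral_left) (auto simp: in_keys_iff)
 also have "... = coef p 0 *\<^sub>R mpow \<psi> 0 + (SUM m:insert 0 (keys p) - {0}. coef p m *\<^sub>R mpow \<psi> m)"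
  by (rule sum.remove) simp_all
 finally have "h - coef p 0 *\<^sub>R 1 = (SUM m:insert 0 (keys p) - {0}. coef p m *\<^sub>R mpow \<psi> m)"
  by (simp only: mpow_0 add_diff_cancel_left')
 also have "...:coinvariant_ideal n \<psi>"
  using p(1) by (intro subspace_sum[OF subspace_coinvariant_ideal] subspace_scale[OF subspace_coinvariant_ideal] mpow_psi_in_ideal)
   (auto simp: poly_ring_def)
 finally show ?thesis by (rule that)
qed

lemma coef_0_mult_psi: assumes "i:{1..n}" shows "coef (g * \<psi> i) 0 = 0"
proof (rule ccontr)
 assume "coef (g * \<psi> i) 0 ~= 0"
 then obtain a b where "0 = a + b" "coef g a ~= 0" "coef (\<psi> i) b ~= 0" by (rule coef_mult_nonzero)
 have "coef a x + coef b x = 0" for x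
  using arg_cong[OF `0 = a + b`, of "%m. coef m x"] by (simp add: lookup_add)
 hence "b = 0" by (intro poly_mapping_eqI) simp
 hence "coef (\<psi> i) 0 ~= 0" using \<open>coef (\<psi> i) b ~= 0\<close> by simp
 hence "mdeg 0 = de i" using psi_forms[OF assms] unfolding forms_iff by blast
 thus False using de_pos[OF assms] by (simp add: mdeg_def)
qed

end

section \<open>Adapted bases of the spaces of forms\<close>

section \<open>Bases adapted to the symmetry\<close>

definition enum :: "'a set => nat => 'a" where
 "enum A = (SOME f. bij_betw f {..<card A} A)"

lemma enum_bij: assumes "finite A" shows "bij_betw (enum A) {..<card A} A"
 unfolding enum_def by (rule someI_ex[OF ex_bij_betw_nat_finite[OF assms, unfolded atLeast0LessThan]])

lemma enum_in: "finite A ==> i < card A ==> enum A i:A" using bij_betwE[OF enum_bij] by blast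

lemma enumE: assumes "finite A" "x:A"
 obtains i where "i < card A" "enum A i = x"
proof -
 have "x:enum A ` {..<card A}" using assms bij_betw_imp_surj_on[OF enum_bij[OF assms(1)]] by simp
 thus ?thesis using that by auto
qed

lemma lin_indep_family_enum: assumes A: "finite A" and indep: "lin_indep_family A x"
 shows "lin_indep_family {..<card A} (%i. x (enum A i))" unfolding lin_indep_family_def
proof (intro allI impI ballI)
 fix a i assume rel: "(SUM i<card A. a i *\<^sub>R x (enum A i)) = 0" and i: "i:{..<card A}"
 note bij = enum_bij[OF A]
 let ?a = "%k. a (inv_into {..<card A} (enum A) k)"
 have g: "?a (enum A i) = a i" if "i < card A" for i using bij_betw_inv_into_left[OF bij] that by simp
 have "(SUM k:A. ?a k *\<^sub>R x k) = 0"
  using rel g sum.reindex_bij_betw[OF bij, of "%k. ?a k *\<^sub>R x k"] by simp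
 thus "a i = 0" using lin_indep_familyD[OF indep, of ?a "enum A i"] enum_in[OF A] i g by simp
qed

lemma const_eq_scaleR: "const a = a *\<^sub>R 1" using const_mult[of a 1] by simp

lemma const_invariant: "const a:invariants n G" unfolding const_eq_scaleR
 by (intro subspace_scale[OF subspace_invariants]) (auto simp: invariants_def act_def psubst_def)

lemma const_sum: "const (sum f A) = (SUM x:A. const (f x))" by (simp add: const_eq_scaleR scaleR_sum_left)

lemma const_times: "const (a * b) = const a * const b" by (simp add: const_eq_scaleR)

lemma gram_sos: assumes "finite R" "!!r u. l r u:generated_ring n \<psi>"
 shows "sos_matrix n \<psi> q (gram q R l)"
proof -
 obtain k L where "L:carrier_mat k q" "elements_mat L <= {l r u | r u. r:R & u < q}"
  "gram q R l = transpose_mat L * L" by (rule gram_transpose_mult[OF assms(1)])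
 thus ?thesis using assms(2) unfolding sos_matrix_def by blast
qed

lemma gram_psd_matrix: "finite R ==> psd_matrix q (gram q R (l :: 'r => nat => real))"
 by (rule gram_transpose_mult[of R q l]) (simp_all add: gram_psd)

lemma map_const_gram: "map_mat const (gram q R l) = gram q R (%r u. const (l r u))"
 by (rule eq_matI) (simp_all add: gram_def const_sum const_times)

text \<open>The trace is the sum over r of the averages of the squares of the combinations of
  \<open>s\<close> with coefficients from row r, as invariants pass through the average.\<close>

lemma trace_gram_sos: assumes s: "!!u. u < q ==> s u:poly_ring n"
  and l: "!!r u. r < k ==> u < q ==> l r u:invariants n (refl_group c n)"
 shows "mat_trace (reynolds_matrix (refl_group c n) q s * gram q {..<k::nat} l):sums_of_squares n"
proof -
 let ?R = "reynolds (refl_group c n)" and ?p = "%r. SUM v<q. l r v * s v"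
 have "?R (?p r * ?p r) = (SUM v<q. SUM u<q. l r v * l r u * ?R (s v * s u))" if r: "r < k" for r
  unfolding sum_product linear_sum[OF linear_reynolds]
 proof (intro sum.cong refl)
  fix v u assume "v:{..<q}" "u:{..<q}"
  hence "?R (l r v * (l r u * (s v * s u))) = l r v * (l r u * ?R (s v * s u))"
   using l[OF r] by (simp add: reynolds_invariant_mult)
  thus "?R (l r v * s v * (l r u * s u)) = l r v * l r u * ?R (s v * s u)" by (simp add: mult_ac)
 qed
 hence "(SUM r<k. ?R (?p r * ?p r)) = (SUM r<k. SUM v<q. SUM u<q. l r v * l r u * ?R (s v * s u))" by simp
 also have "... = (SUM v<q. SUM r<k. SUM u<q. l r v * l r u * ?R (s v * s u))" by (rule sum.swap)
 also have "... = (SUM v<q. SUM u<q. SUM r<k. l r v * l r u * ?R (s v * s u))" by (intro sum.cong refl sum.swap)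
 finally have "mat_trace (reynolds_matrix (refl_group c n) q s * gram q {..<k} l) = (SUM r<k. ?R (?p r * ?p r))"
  by (simp add: mat_trace_gram sum_distrib_right)
 also have "...:sums_of_squares n"
  using l s by (intro sums_of_squares_sum reynolds_square_sos subspace_sum[OF subspace_poly_ring] poly_ring_mult)
   (auto simp: invariants_def)
 finally show ?thesis .
qed

lemma sums_of_squaresE: assumes "f:sums_of_squares n"
 obtains k h where "!!r. r < (k::nat) ==> h r:poly_ring n" "f = (SUM r<k. h r * h r)"
proof -
 obtain hs where "f = sum_list (map (%h. h ^ 2) hs)" "set hs <= poly_ring n"
  using assms unfolding sums_of_squares_def by blast
 thus ?thesis by (intro that[of "length hs" "%r. hs ! r"]) (auto simp: sum_list_sum_nth' power2_eq_square)
qed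

lemma orbit_span_scaleR: "a ~= 0 ==> orbit_span (refl_group c n) (a *\<^sub>R f) = orbit_span (refl_group c n) f"
proof -
 have sub: "orbit_span (refl_group c n) (b *\<^sub>R g) <= orbit_span (refl_group c n) g" for b g
  by (intro orbit_span_subset gmodule_orbit_span subspace_scale[OF gmodule_subspace[OF gmodule_orbit_span]] in_orbit_span)
 show "a ~= 0 ==> ?thesis" using sub[of a f] sub[of "1 / a" "a *\<^sub>R f"] by auto
qed

locale specht_setting = specht_system c n "shapes c n" shape_rows E + fundamental c n \<psi>
 for c n E \<psi>
begin

abbreviation "Sh == shapes c n"

definition tab :: "shape => (position => nat) => bitableau" where
 "tab j = inv_into (SYT j) entry"

text \<open>The first tableau is always the base tableau: then all \<open>hs j S\<close> are fixed
  by \<open>E j\<close>, which yields the isomorphisms matching generators.\<close>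

definition hs :: "shape => (position => nat) => rpoly" where
 "hs j S = higher_specht c (tab j (base j)) (tab j S)"

lemma tab_SYT: "j:Sh ==> S:SF j ==> tab j S:SYT j"
 unfolding tab_def using bij_betwE[OF bij_betw_inv_into[OF entry_bij]] by blast

lemma entry_tab: "j:Sh ==> S:SF j ==> entry (tab j S) = S"
 unfolding tab_def using bij_betw_inv_into_right[OF entry_bij] by blast

lemma tperm_base: "j:Sh ==> tperm j (base j) = id"
proof (rule ext)
 fix x assume j: "j:Sh"
 show "tperm j (base j) x = id x" using standard_filling.t_place[OF base_filling[OF j], of x]
  by (cases "x:{1..n}") (simp_all only: tperm_def bp_def if_True if_False id_apply)
qed

definition al :: "shape => (position => nat) => real" where
 "al j S = (SOME a. a ~= 0 & hs j S = a *\<^sub>R sp j S)"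

lemma al: assumes "j:Sh" "S:SF j" shows "al j S ~= 0" "hs j S = al j S *\<^sub>R sp j S"
proof -
 obtain a where a: "a ~= 0" "higher_specht c (tab j (base j)) (tab j S)
   = a *\<^sub>R act (tperm j (entry (tab j (base j))), {}) (sp j (entry (tab j S)))"
  by (rule higher_specht_sp[OF assms(1) tab_SYT[OF assms(1) base_in[OF assms(1)]] tab_SYT[OF assms]])
 hence "EX a. a ~= 0 & hs j S = a *\<^sub>R sp j S"
  using entry_tab[OF assms] entry_tab[OF assms(1) base_in[OF assms(1)]] tperm_base[OF assms(1)]
  by (intro exI[of _ a]) (simp add: hs_def)
 from someI_ex[OF this] show "al j S ~= 0" "hs j S = al j S *\<^sub>R sp j S" unfolding al_def by blast+
qed

lemma E_hs: "j:Sh ==> S:SF j ==> E j (hs j S) = hs j S" by (simp add: al gop_simps[OF E_gop] E_sp)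

lemma hs_nonzero: "j:Sh ==> S:SF j ==> hs j S ~= 0" by (simp add: al sp_nonzero)

lemma hs_forms: "j:Sh ==> S:SF j ==> hs j S:forms n (dg j S)"
 by (simp add: al(2) subspace_scale[OF subspace_forms] sp_forms)

lemma hs_higher_specht: "j:Sh ==> S:SF j ==> hs j S:higher_specht_polys c j"
 unfolding higher_specht_polys_def hs_def using tab_SYT base_in by blast

lemma orbit_span_hs:
 "j:Sh ==> S:SF j ==> orb (hs j S) = span ((%T. tw j T (sp j S)) ` SF j)"
 by (simp add: al orbit_span_scaleR orbit_span_sp)

lemma tp_hs: assumes "(j, S, T):SI" shows "tp (j, S, T) = (1 / al j S) *\<^sub>R tw j T (hs j S)"
 using assms al[of j S] by (auto simp: tp_def SI_def act_scaleR)

text \<open>The same choice as in \<open>specht_module\<close>, whose span is thereby the orbit span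
  of \<open>ref j\<close>.\<close>

definition refS :: "shape => (position => nat)" where
 "refS j = entry (SOME S. S:SYT j)"

definition ref :: "shape => rpoly" where
 "ref j = hs j (refS j)"

lemma some_SYT: "j:Sh ==> (SOME S. S:SYT j):SYT j" using tab_SYT base_in by (metis someI)

lemma refS_in: "j:Sh ==> refS j:SF j" unfolding refS_def by (rule entry_standard[OF _ some_SYT])

lemma specht_module_eq: assumes j: "j:Sh" shows "specht_module c j = orb (ref j)"
proof -
 define S where "S = (SOME S. S:SYT j)"
 let ?v = "%T. tw j T (sp j (refS j))" and ?A = "{higher_specht c T S | T. T:SYT j}"
 have ex: "EX a. a ~= 0 & higher_specht c T S = a *\<^sub>R ?v (entry T)" if T: "T:SYT j" for T
  using higher_specht_sp[OF j T some_SYT[OF j]] unfolding refS_def S_def by blast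
 have "?A <= span (?v ` SF j)"
 proof clarify
  fix T assume T: "T:SYT j"
  obtain a where "higher_specht c T S = a *\<^sub>R ?v (entry T)" using ex[OF T] by blast
  thus "higher_specht c T S:span (?v ` SF j)"
   by (simp only:) (intro span_scale span_base imageI entry_standard[OF j T])
 qed
 moreover have "?v ` SF j <= span ?A"
 proof clarify
  fix t assume t: "t:SF j"
  obtain a where a: "a ~= 0" "higher_specht c (tab j t) S = a *\<^sub>R ?v t"
   using ex[OF tab_SYT[OF j t]] entry_tab[OF j t] by auto
  hence "?v t = (1 / a) *\<^sub>R higher_specht c (tab j t) S" by simp
  moreover have "higher_specht c (tab j t) S:?A" using tab_SYT[OF j t] by blast
  ultimately show "?v t:span ?A" by (simp only: span_scale span_base)
 qed
 ultimately have "span ?A = span (?v ` SF j)" by (simp only: span_eq)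
 thus ?thesis unfolding specht_module_def Let_def S_def[symmetric] ref_def orbit_span_hs[OF j refS_in[OF j]] .
qed

lemma specht_dim_eq: assumes j: "j:Sh" shows "specht_dim c j = card (SF j)"
proof -
 note ind = tw_sp_independent[OF j refS_in[OF j]]
 show ?thesis using dim_span_eq_card_independent[OF lin_indep_family_independent[OF finite_SF[OF j] ind]]
   card_image[OF lin_indep_family_inj[OF finite_SF[OF j] ind]]
  by (simp add: specht_dim_def specht_module_eq[OF j] ref_def orbit_span_hs[OF j refS_in[OF j]])
qed

lemma E_ref: "j:Sh ==> E j (ref j) = ref j" and ref_nonzero: "j:Sh ==> ref j ~= 0"
 by (simp_all add: ref_def E_hs hs_nonzero refS_in)

definition Mset :: "nat => shape => (position => nat) => (nat \<Rightarrow>\<^sub>0 nat) set" where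
 "Mset d j S = {m. keys m <= {1..n} & wdeg m + dg j S = d}"

text \<open>Pairs of a standard filling and a monomial in the fundamental invariants with total
  degree \<open>d\<close>; they index the copies of one irreducible type in H_{n,d}.\<close>

definition Kset :: "nat => shape => ((position => nat) \<times> (nat \<Rightarrow>\<^sub>0 nat)) set" where
 "Kset d j = (SIGMA S:SF j. Mset d j S)"

definition xk :: "shape => (position => nat) \<times> (nat \<Rightarrow>\<^sub>0 nat) => rpoly" where
 "xk j = (%(S, m). mpow \<psi> m * hs j S)"

definition xx :: "nat => shape => nat => rpoly" where
 "xx d j i = xk j (enum (Kset d j) i)"

lemma finite_Mset: "finite (Mset d j S)"
 by (rule finite_subset[OF _ finite_Wexp[of "d - dg j S"]]) (auto simp: Mset_def Wexp_def)

lemma finite_Kset: "j:Sh ==> finite (Kset d j)"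
 unfolding Kset_def by (intro finite_SigmaI finite_SF finite_Mset)

lemma Mset_keys: "m:Mset d j S ==> keys m <= {1..n}" by (simp add: Mset_def)

lemma xk_props: assumes j: "j:Sh" and k: "k:Kset d j"
 shows "E j (xk j k) = xk j k" "xk j k:forms n d" "xk j k ~= 0"
proof -
 obtain S m where k_eq: "k = (S, m)" by (cases k)
 have S: "S:SF j" and m: "keys m <= {1..n}" "wdeg m + dg j S = d"
  using k by (simp_all add: Kset_def Mset_def k_eq)
 show "E j (xk j k) = xk j k"
  using gop_invariant_mult[OF E_gop[OF j] mpow_psi_invariant[OF m(1)]]
  by (simp add: xk_def k_eq E_hs[OF j S])
 show "xk j k:forms n d" using forms_mult[OF mpow_psi_forms[OF m(1)] hs_forms[OF j S]] m(2)
  by (simp add: xk_def k_eq)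
 have "mpow \<psi> m ~= 0" using mpow_psi_independent[of "{m}" "%_. 1" m] m(1) by auto
 thus "xk j k ~= 0" using hs_nonzero[OF j S] by (simp add: xk_def k_eq)
qed

lemma hs_independent: assumes j: "j:Sh" and h: "!!S. h S:invariants n GG"
  and rel: "(SUM S:SF j. h S * hs j S) = 0" and S: "S:SF j" shows "h S = 0"
proof -
 have "al j S *\<^sub>R h S = 0" by (rule sp_independent[OF j _ _ S, of "%S. al j S *\<^sub>R h S"])
   (use rel in \<open>simp_all add: al(2)[OF j] subspace_scale[OF subspace_invariants h]\<close>)
 thus ?thesis using al(1)[OF j S] by simp
qed

text \<open>Collecting the terms with the same \<open>S\<close> gives invariant coefficients. These
  vanish by \<open>hs_independent\<close>, and then algebraic independence of the psi_i
  applies.\<close>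

lemma xk_independent: assumes j: "j:Sh" shows "lin_indep_family (Kset d j) (xk j)"
 unfolding lin_indep_family_def
proof (intro allI impI ballI)
 fix a k assume rel: "(SUM k:Kset d j. a k *\<^sub>R xk j k) = 0" and k: "k:Kset d j"
 obtain S m where k_eq: "k = (S, m)" by (cases k)
 define h where "h S = (SUM m:Mset d j S. a (S, m) *\<^sub>R mpow \<psi> m)" for S
 have "(SUM S:SF j. h S * hs j S) = (SUM S:SF j. SUM m:Mset d j S. a (S, m) *\<^sub>R xk j (S, m))"
  by (simp add: h_def sum_distrib_right xk_def)
 also have "... = 0" using rel finite_SF[OF j] finite_Mset by (simp add: Kset_def sum.Sigma split_def)
 finally have "h S = 0" using k by (intro hs_independent[OF j, of h])
   (auto simp: h_def k_eq Kset_def intro!: subspace_sum[OF subspace_invariants] subspace_scale[OF subspace_invariants]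
    mpow_psi_invariant Mset_keys)
 thus "a k = 0" using mpow_psi_independent[OF finite_Mset Mset_keys, where a = "%m. a (S, m)"] k
  by (simp add: h_def k_eq Kset_def)
qed

context fixes d :: nat and q :: "shape => nat" assumes q: "!!j. j:Sh ==> q j = card (Kset d j)"
begin

lemma xx_E: "j:Sh ==> i < q j ==> E j (xx d j i) = xx d j i"
 and xx_forms: "j:Sh ==> i < q j ==> xx d j i:forms n d" and xx_nonzero: "j:Sh ==> i < q j ==> xx d j i ~= 0"
 unfolding xx_def using xk_props[OF _ enum_in[OF finite_Kset]] q by simp_all

lemma xx_independent: "j:Sh ==> lin_indep_family {..<q j} (xx d j)"
 unfolding xx_def[abs_def] by (simp only: q) (intro lin_indep_family_enum finite_Kset xk_independent)

text \<open>An invariant form is a combination of monomials in the psi_i of the same weighted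
  degree, so \<open>forms_spanned\<close> can be rewritten in terms of the
  \<open>xx d j i\<close>.\<close>

lemma xx_span: "forms n d <= span (UN j:Sh. UN i<q j. orb (xx d j i))" (is "_ <= span ?U")
proof (rule order.trans[OF forms_spanned span_minimal[OF _ subspace_span]], clarify)
 fix g j S T assume jST: "(j, S, T):SI" and g: "g:invariants n GG" "dg j S <= d" "g:forms n (d - dg j S)"
 have j: "j:Sh" and S: "S:SF j" and T: "T:SF j" using jST by (simp_all add: SI_def)
 obtain a where a: "g = (SUM m:Wexp (d - dg j S). a m *\<^sub>R mpow \<psi> m)"
  by (rule invariant_form_expand[OF g(1,3)])
 have "mpow \<psi> m * tw j T (hs j S):span ?U" if m: "m:Wexp (d - dg j S)" for m
 proof -
  have k: "(S, m):Kset d j" and keys: "keys m <= {1..n}"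
   using S m g(2) by (simp_all add: Kset_def Mset_def Wexp_def)
  obtain i where "i < q j" "enum (Kset d j) i = (S, m)"
   using enumE[OF finite_Kset[OF j] k] q[OF j] by metis
  moreover have "mpow \<psi> m * tw j T (hs j S) = tw j T (xk j (S, m))"
   using gop_invariant_mult[OF gop_tw[OF j T] mpow_psi_invariant[OF keys]] by (simp add: xk_def)
  ultimately show ?thesis using j orbit_spanI[OF gop_tw[OF j T], of "xx d j i"]
   by (intro span_base UN_I[of j] UN_I[of i]) (simp_all add: xx_def)
 qed
 thus "g * tp (j, S, T):span ?U"
  unfolding a tp_hs[OF jST] by (simp add: sum_distrib_right span_sum span_scale)
qed

lemmas xx_context = gmodule_forms xx_E xx_forms xx_independent xx_span

lemma forms_symmetry_adapted: "symmetry_adapted_basis GG (forms n d) Sh q (xx d)"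
 by (rule symmetry_adapted[OF xx_context])

lemma forms_isotypic: "isotypic_decomposition GG (forms n d) Sh q (%j. orb (ref j))"
 by (rule isotypic[OF xx_context E_ref ref_nonzero])

lemma forms_multiplicity: "j:Sh ==> module_multiplicity GG (forms n d) (orb (ref j)) = q j"
 by (rule multiplicity[OF xx_context _ E_ref ref_nonzero])

end

lemma specht_mult_eq: "j:Sh ==> specht_mult c n d j = card (Kset d j)" unfolding specht_mult_def
 by (simp add: specht_module_eq forms_multiplicity[of "%j. card (Kset d j)" d])

lemma isotypic_forms: "isotypic_decomposition GG (forms n d) Sh (specht_mult c n d) (specht_module c)"
proof -
 have "direct_sum (forms n d) Sh (%j. isotypic_component GG (forms n d) (specht_module c j)) \<longleftrightarrow>
   direct_sum (forms n d) Sh (%j. isotypic_component GG (forms n d) (orb (ref j)))"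
  unfolding direct_sum_def by (simp add: specht_module_eq cong: conj_cong)
 thus ?thesis using forms_isotypic[OF specht_mult_eq, of d]
  unfolding isotypic_decomposition_def by (simp add: specht_module_eq)
qed

lemma xx_isotypic: assumes j: "j:Sh" and i: "i < specht_mult c n d j"
 shows "xx d j i:isotypic_component GG (forms n d) (specht_module c j)" unfolding isotypic_component_def
proof (intro span_base UnionI)
 show "orb (xx d j i):{U. U <= forms n d & isomorphic_gmodules GG U (specht_module c j)}"
  using orbit_span_subset[OF gmodule_forms xx_forms[OF specht_mult_eq j i]]
   isomorphic_orbit_spans[OF j xx_E[OF specht_mult_eq j i] xx_nonzero[OF specht_mult_eq j i] E_ref[OF j] ref_nonzero[OF j]]
  by (simp add: specht_module_eq[OF j])
 show "xx d j i:orb (xx d j i)" by (rule in_orbit_span)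
qed

lemma xx_product: assumes j: "j:Sh" and i: "i < specht_mult c n d j"
 shows "EX F:higher_specht_polys c j. EX \<alpha>. xx d j i = F * (PROD i = 1..n. \<psi> i ^ \<alpha> i)"
proof -
 obtain S m where k: "enum (Kset d j) i = (S, m)" by (cases "enum (Kset d j) i")
 have "(S, m):Kset d j"
  using enum_in[OF finite_Kset[OF j], of i d] i by (simp add: specht_mult_eq[OF j] k)
 hence S: "S:SF j" and m: "m:Mset d j S" by (simp_all add: Kset_def)
 have "xx d j i = hs j S * (PROD i = 1..n. \<psi> i ^ coef m i)"
  by (simp add: xx_def k xk_def mpow_psi[OF Mset_keys[OF m]] mult.commute)
 thus ?thesis using hs_higher_specht[OF j S] by blast
qed

section \<open>Specht polynomials as a basis of the coinvariant algebra\<close>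

section \<open>The coinvariant algebra\<close>

definition xc :: "shape => nat => rpoly" where
 "xc j i = hs j (enum (SF j) i)"

text \<open>Real coefficients only. This space turns out to be a graded complement of the
  coinvariant ideal in the polynomial ring.\<close>

definition cospan :: "rpoly set" where
 "cospan = span (UN j:Sh. UN i<specht_dim c j. orb (xc j i))"

lemma enum_SF: "j:Sh ==> i < specht_dim c j ==> enum (SF j) i:SF j"
 using enum_in[OF finite_SF] by (simp add: specht_dim_eq)

lemma gmodule_cospan: "gmodule GG cospan"
proof -
 have "gmodule GG (span (\<Union>(UN j:Sh. (%i. orb (xc j i)) ` {..<specht_dim c j})))"
  by (rule gmodule_span_Union) (auto intro: gmodule_orbit_span)
 moreover have "\<Union>(UN j:Sh. (%i. orb (xc j i)) ` {..<specht_dim c j}) = (UN j:Sh. UN i<specht_dim c j. orb (xc j i))"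
  by auto
 ultimately show ?thesis by (simp add: cospan_def)
qed

lemma subspace_cospan: "subspace cospan" by (rule gmodule_subspace[OF gmodule_cospan])

lemma xc_props: assumes j: "j:Sh" and i: "i < specht_dim c j"
 shows "E j (xc j i) = xc j i" "orb (xc j i) <= cospan" "xc j i:cospan"
  "xc j i:higher_specht_polys c j" "xc j i:forms n (dg j (enum (SF j) i))" "xc j i:poly_ring n"
proof -
 note S = enum_SF[OF assms]
 show "E j (xc j i) = xc j i" "xc j i:higher_specht_polys c j" "xc j i:forms n (dg j (enum (SF j) i))"
  unfolding xc_def by (rule E_hs[OF j S], rule hs_higher_specht[OF j S], rule hs_forms[OF j S])
 thus "xc j i:poly_ring n" using forms_subset_poly_ring by blast
 show "orb (xc j i) <= cospan" unfolding cospan_def using assms by (auto intro: span_base)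
 thus "xc j i:cospan" using in_orbit_span by blast
qed

lemma xc_independent: assumes j: "j:Sh" shows "lin_indep_family {..<specht_dim c j} (xc j)"
 unfolding xc_def[abs_def] specht_dim_eq[OF j]
proof (rule lin_indep_family_enum[OF finite_SF[OF j]], unfold lin_indep_family_def, intro allI impI ballI)
 fix a S assume rel: "(SUM S:SF j. a S *\<^sub>R hs j S) = 0" and S: "S:SF j"
 have "const (a S) = 0"
  by (rule hs_independent[OF j const_invariant _ S]) (use rel in \<open>simp add: const_mult\<close>)
 thus "a S = 0" unfolding const_def by (metis lookup_single_eq lookup_zero)
qed

lemma graded_cospan: "graded_gmodule n GG cospan" unfolding graded_gmodule_def
proof (intro conjI gmodule_cospan equalityI)
 have xc: "orb (xc j i) <= cospan Int forms n (dg j (enum (SF j) i))"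
  if "j:Sh" "i < specht_dim c j" for j i
  using xc_props(2)[OF that] orbit_span_subset[OF gmodule_forms xc_props(5)[OF that]] by blast
 thus "cospan <= poly_ring n"
  using forms_subset_poly_ring unfolding cospan_def by (intro span_minimal subspace_poly_ring UN_least) blast
 show "span (UN d. cospan Int forms n d) <= cospan" by (intro span_minimal subspace_cospan) blast
 have "(UN j:Sh. UN i<specht_dim c j. orb (xc j i)) <= (UN d. cospan Int forms n d)"
  using xc by blast
 thus "cospan <= span (UN d. cospan Int forms n d)" by (subst cospan_def) (rule span_mono)
qed

lemma poly_ring_xc: "poly_ring n \<subseteq>
  span {a * act g (xc j i) | a g j i. a:invariants n GG & g:GG & j:Sh & i < specht_dim c j}" (is "_ <= span ?B")
proof
 fix f assume "f:poly_ring n"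
 then obtain h where h: "!!i. h i:invariants n GG" "f = (SUM i:SI. h i * tp i)"
  by (rule poly_spanned) (rule that)
 have "h k * tp k:span ?B" if k: "k:SI" for k
 proof -
  obtain j S T where k_eq: "k = (j, S, T)" by (cases k)
  have j: "j:Sh" and S: "S:SF j" and T: "T:SF j" using k by (simp_all add: SI_def k_eq)
  obtain i where "i < specht_dim c j" "hs j S = xc j i"
   using enumE[OF finite_SF[OF j] S] specht_dim_eq[OF j] xc_def by metis
  moreover have "(tperm j T, {}):GG" by (rule permutation_in_refl_group[OF tperm_permutes[OF j T]])
  ultimately have "h k * tw j T (hs j S):?B"
   using h(1) j by (intro CollectI exI[of _ "h k"] exI[of _ "(tperm j T, {})"] exI[of _ j] exI[of _ i]) simp
  thus ?thesis using tp_hs[of j S T] k by (simp add: k_eq span_scale span_base)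
 qed
 thus "f:span ?B" unfolding h(2) by (rule span_sum)
qed

text \<open>A polynomial is a combination of translates of the \<open>xc j i\<close> with invariant
  coefficients, and modulo the ideal each coefficient may be replaced by a constant.\<close>

lemma poly_ring_decomposition: assumes f: "f:poly_ring n"
 shows "EX w:cospan. f - w:coinvariant_ideal n \<psi>" using subsetD[OF poly_ring_xc f]
proof (induction rule: span_induct_alt)
 case base
 show ?case
  using subspace_0[OF subspace_cospan] subspace_0[OF subspace_coinvariant_ideal] by (intro bexI[of _ 0]) simp_all
next
 case (step k x y)
 then obtain w a g j i where w: "w:cospan" "y - w:coinvariant_ideal n \<psi>"
  and x: "x = a * act g (xc j i)" "a:invariants n GG" "g:GG" "j:Sh" "i < specht_dim c j" by blast
 obtain b where b: "a - b *\<^sub>R 1:coinvariant_ideal n \<psi>" by (rule invariant_mod_ideal[OF x(2)])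
 let ?x = "act g (xc j i)"
 have "?x:cospan" using gmodule_cospan xc_props(3)[OF x(4,5)] x(3) unfolding gmodule_def by blast
 hence "(k * b) *\<^sub>R ?x + w:cospan"
  by (intro subspace_add[OF subspace_cospan] subspace_scale[OF subspace_cospan] w(1))
 moreover have "?x:poly_ring n" using act_in_poly_ring[OF x(3) xc_props(6)[OF x(4,5)]] .
 hence "k *\<^sub>R ((a - b *\<^sub>R 1) * ?x) + (y - w):coinvariant_ideal n \<psi>"
  by (intro subspace_add[OF subspace_coinvariant_ideal] subspace_scale[OF subspace_coinvariant_ideal]
   coinvariant_ideal_mult[OF b] w(2))
 hence "k *\<^sub>R x + y - ((k * b) *\<^sub>R ?x + w):coinvariant_ideal n \<psi>"
  by (simp add: x(1) left_diff_distrib scaleR_diff_right algebra_simps)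
 ultimately show ?case by blast
qed

text \<open>Such a \<open>w\<close> has real coefficients over the free basis, but as an element of
  the ideal also coefficients that are combinations of the psi_k. By freeness they agree, and the
  latter have no constant term.\<close>

lemma cospan_ideal: assumes w: "w:cospan" and i: "w:coinvariant_ideal n \<psi>" shows "w = 0"
proof -
 have "orb (xc j i) <= span (tp ` SI)" if ji: "j:Sh" "i < specht_dim c j" for j i
  unfolding xc_def orbit_span_hs[OF ji(1) enum_SF[OF ji]]
  using enum_SF[OF ji] ji(1) by (intro span_mono) (force simp: tp_def SI_def)
 hence "cospan <= span (tp ` SI)"
  unfolding cospan_def by (intro span_minimal subspace_span UN_least) auto
 then obtain b where b: "w = (SUM i:SI. b i *\<^sub>R tp i)" using w span_image_family[OF finite_SI] by blast
 obtain a where a: "ALL i:{1..n}. a i:poly_ring n" "w = (SUM i = 1..n. a i * \<psi> i)"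
  using i unfolding coinvariant_ideal_alt by blast
 have "EX h. (ALL i. h i:invariants n GG) & a k = (SUM i:SI. h i * tp i)" if "k:{1..n}" for k
  using poly_spanned[OF bspec[OF a(1) that]] by blast
 from bchoice[OF ballI[OF this]]
 obtain H where H: "ALL k:{1..n}. (ALL i. H k i:invariants n GG) & a k = (SUM i:SI. H k i * tp i)" by (rule exE)
 define g where "g i = (SUM k = 1..n. H k i * \<psi> k)" for i
 have g_inv: "g i:invariants n GG" for i unfolding g_def
 proof (intro subspace_sum[OF subspace_invariants])
  fix k assume k: "k:{1..n}"
  thus "H k i * \<psi> k:invariants n GG"
   using psi_invariant[OF k] H by (simp add: invariants_def poly_ring_mult act_mult)
 qed
 have "w = (SUM k = 1..n. SUM i:SI. H k i * \<psi> k * tp i)"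
  unfolding a(2) using H by (intro sum.cong refl) (simp add: sum_distrib_right mult.assoc mult.commute[of "tp _"])
 also have "... = (SUM i:SI. g i * tp i)" by (subst sum.swap) (simp add: g_def sum_distrib_right)
 finally have rel: "(SUM i:SI. (g i - const (b i)) * tp i) = 0"
  using b by (simp add: left_diff_distrib sum_subtractf const_mult)
 have "b i = 0" if "i:SI" for i
 proof -
  have "g i - const (b i) = 0"
   by (rule sp_free[OF _ rel that]) (intro subspace_diff[OF subspace_invariants] const_invariant g_inv)
  hence "b i = coef (g i) 0" by (metis const_def eq_iff_diff_eq_0 lookup_single_eq)
  thus ?thesis by (simp add: g_def lookup_sum coef_0_mult_psi)
 qed
 thus ?thesis by (simp add: b)
qed

lemma residue_class_eq_iff: "residue_class n \<psi> p = residue_class n \<psi> p' \<longleftrightarrow> p - p':coinvariant_ideal n \<psi>"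
proof
 note I = subspace_coinvariant_ideal
 assume "residue_class n \<psi> p = residue_class n \<psi> p'"
 moreover have "p + 0:residue_class n \<psi> p" unfolding residue_class_def using subspace_0[OF I] by blast
 ultimately obtain h where "p = p' + h" "h:coinvariant_ideal n \<psi>" unfolding residue_class_def by auto
 thus "p - p':coinvariant_ideal n \<psi>" by simp
next
 note I = subspace_coinvariant_ideal
 assume d: "p - p':coinvariant_ideal n \<psi>"
 show "residue_class n \<psi> p = residue_class n \<psi> p'" unfolding residue_class_def
 proof (intro equalityI subsetI)
  fix x assume "x:{p + h | h. h:coinvariant_ideal n \<psi>}"
  then obtain h where h: "x = p + h" "h:coinvariant_ideal n \<psi>" by blast
  have "x = p' + (p - p' + h)" by (simp add: h(1))
  thus "x:{p' + h | h. h:coinvariant_ideal n \<psi>}" using subspace_add[OF I d h(2)] by blast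
 next
  fix x assume "x:{p' + h | h. h:coinvariant_ideal n \<psi>}"
  then obtain h where h: "x = p' + h" "h:coinvariant_ideal n \<psi>" by blast
  have "x = p + (h - (p - p'))" by (simp add: h(1))
  thus "x:{p + h | h. h:coinvariant_ideal n \<psi>}" using subspace_diff[OF I h(2) d] by blast
 qed
qed

lemma cospan_residue: "bij_betw (residue_class n \<psi>) cospan (coinvariant_algebra n \<psi>)"
proof (rule bij_betw_imageI)
 show "inj_on (residue_class n \<psi>) cospan"
 proof (rule inj_onI)
  fix w w' assume w: "w:cospan" "w':cospan" "residue_class n \<psi> w = residue_class n \<psi> w'"
  have "w - w' = 0"
   using w by (intro cospan_ideal subspace_diff[OF subspace_cospan]) (simp_all add: residue_class_eq_iff)
  thus "w = w'" by simp
 qed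
 show "residue_class n \<psi> ` cospan = coinvariant_algebra n \<psi>" unfolding coinvariant_algebra_def
 proof
  show "residue_class n \<psi> ` cospan <= residue_class n \<psi> ` poly_ring n"
   using graded_cospan unfolding graded_gmodule_def by blast
  show "residue_class n \<psi> ` poly_ring n <= residue_class n \<psi> ` cospan"
   using poly_ring_decomposition residue_class_eq_iff by blast
 qed
qed

lemma coinvariant_basis: "coinvariant_adapted_basis n GG \<psi> Sh (specht_dim c) xc"
 unfolding coinvariant_adapted_basis_def
proof (intro exI[of _ cospan] conjI graded_cospan cospan_residue)
 show "symmetry_adapted_basis GG cospan Sh (specht_dim c) xc"
  by (rule symmetry_adapted[OF gmodule_cospan xc_props(1) xc_props(3) xc_independent]) (simp_all add: cospan_def)
qed

section \<open>The two descriptions of invariant sums of squares\<close>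

section \<open>Invariant sums of squares\<close>

lemma sos_trace: assumes s: "!!i. i < q ==> s i:poly_ring n" and A: "sos_matrix n \<psi> q A"
 shows "mat_trace (reynolds_matrix GG q s * A):sums_of_squares n"
proof -
 obtain k L where L: "L:carrier_mat k q" "elements_mat L <= generated_ring n \<psi>" "A = transpose_mat L * L"
  using A unfolding sos_matrix_def by blast
 have "A = gram q {..<k} (%r u. L $$ (r, u))"
  using L(1) by (intro eq_matI) (simp_all add: L(3) gram_def gram_entry[OF L(1)] del: index_mult_mat(1))
 thus ?thesis using subsetD[OF L(2) elements_matI[OF L(1) _ _ refl]]
  by (auto simp: generated[symmetric] intro!: trace_gram_sos s)
qed

lemma psd_trace: assumes s: "!!i. i < q ==> s i:poly_ring n" and A: "psd_matrix q A"
 shows "mat_trace (reynolds_matrix GG q s * map_mat const A):sums_of_squares n"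
proof -
 obtain k :: nat and l where l: "!!u v. u < q ==> v < q ==> A $$ (u, v) = (SUM r<k. l r u * l r v)"
  by (rule psd_matrix_gram[OF A]) (rule that)
 have "A = gram q {..<k} l" using A l by (intro eq_matI) (auto simp: gram_def psd_matrix_def)
 thus ?thesis by (simp add: map_const_gram trace_gram_sos s const_invariant)
qed

text \<open>\<open>sum_of_squares_gram\<close> with all invariants as coefficients; the translates
  of the \<open>xc j i\<close> span every polynomial over them.\<close>

lemma invariant_sos: assumes g: "g:sums_of_squares n" "g:invariants n GG"
 shows "EX A. (ALL j:Sh. sos_matrix n \<psi> (specht_dim c j) (A j)) &
  g = (SUM j:Sh. mat_trace (reynolds_matrix GG (specht_dim c j) (xc j) * A j))"
proof -
 obtain k h where h: "!!r. r < (k::nat) ==> h r:poly_ring n" and g_eq: "g = (SUM r<k. h r * h r)"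
  by (rule sums_of_squaresE[OF g(1)]) (rule that)
 obtain R :: "(nat \<times> (nat \<Rightarrow>\<^sub>0 nat)) set" and l where "finite R" "!!j w u. l j w u:invariants n GG"
  "g = (SUM j:Sh. mat_trace (reynolds_matrix GG (specht_dim c j) (xc j) * gram (specht_dim c j) R (l j)))"
  by (rule sum_of_squares_gram[OF subspace_invariants order.refl xc_props(1) E_ref ref_nonzero g(2) g_eq
   subsetD[OF poly_ring_xc h]]) (assumption | rule that)+
 thus ?thesis by (intro exI[of _ "%j. gram (specht_dim c j) R (l j)"]) (simp add: gram_sos generated)
qed

text \<open>After passing to the components of degree d, the real span of the translates of the
  \<open>xx d j i\<close> suffices, so the Gram factors have constant entries.\<close>

lemma form_sos: assumes f: "f:sums_of_squares n" "f:forms n (2 * d)" "f:invariants n GG"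
 shows "EX A. (ALL j:Sh. psd_matrix (specht_mult c n d j) (A j)) &
  f = (SUM j:Sh. mat_trace (reynolds_matrix GG (specht_mult c n d j) (xx d j) * map_mat const (A j)))"
proof -
 let ?q = "specht_mult c n d"
 obtain k h where h: "!!r. r < (k::nat) ==> h r:poly_ring n" and f_eq: "f = (SUM r<k. h r * h r)"
  by (rule sums_of_squaresE[OF f(1)]) (rule that)
 have f_eq': "f = (SUM r<k. hcomp d (h r) * hcomp d (h r))"
  using homogeneous_sos[of "{..<k}" h n d] h f(2) by (simp add: f_eq)
 \<comment> \<open>The constants serve as the coefficient space \<open>K\<close> of
   \<open>sum_of_squares_gram\<close>.\<close>
 have "range const = span {1}" by (simp add: span_singleton const_eq_scaleR)
 hence K: "subspace (range const)" by simp
 have K': "range const <= invariants n GG" by (intro image_subsetI const_invariant)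
 have "orb (xx d j i) <= span {a * act g (xx d j i) | a g j i. a:range const & g:GG & j:Sh & i < ?q j}"
  if "j:Sh" "i < ?q j" for j i
  unfolding orbit_span_def using that by (intro span_mono) (force simp: const_eq_scaleR intro!: exI[of _ "1 :: rpoly"] image_eqI[of _ _ 1])
 hence "span (UN j:Sh. UN i<?q j. orb (xx d j i))
   <= span {a * act g (xx d j i) | a g j i. a:range const & g:GG & j:Sh & i < ?q j}"
  by (intro span_minimal subspace_span UN_least) auto
 note sub = order.trans[OF xx_span[OF specht_mult_eq] this]
 obtain R :: "(nat \<times> (nat \<Rightarrow>\<^sub>0 nat)) set" and l where R: "finite R" "!!j w u. l j w u:range const"
  "f = (SUM j:Sh. mat_trace (reynolds_matrix GG (?q j) (xx d j) * gram (?q j) R (l j)))"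
  by (rule sum_of_squares_gram[OF K K' xx_E[OF specht_mult_eq] E_ref ref_nonzero f(3) f_eq'
   subsetD[OF sub hcomp_in_forms[OF h]]]) (assumption | rule that)+
 have "l j w u = const (coef (l j w u) 0)" for j w u
  using R(2)[of j w u] by (auto simp: const_def)
 hence "gram (?q j) R (l j) = map_mat const (gram (?q j) R (%w u. coef (l j w u) 0))" for j
  unfolding map_const_gram by simp
 thus ?thesis
  using R(1,3) by (intro exI[of _ "%j. gram (?q j) R (%w u. coef (l j w u) 0)"]) (simp add: gram_psd_matrix)
qed

end

theorem theorem3p10: fixes c :: cox_type and n :: nat and \<psi> :: "nat => rpoly" assumes "1 <= n"
  and "fundamental_invariants n (refl_group c n) \<psi>"
 shows "(ALL d. isotypic_decomposition (refl_group c n) (forms n d)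
       (shapes c n) (specht_mult c n d) (specht_module c))
  & (EX s :: shape => nat => rpoly.
     coinvariant_adapted_basis n (refl_group c n) \<psi> (shapes c n) (specht_dim c) s
    & (ALL \<Lambda>:shapes c n. ALL v < specht_dim c \<Lambda>. s \<Lambda> v:higher_specht_polys c \<Lambda>)
    & sums_of_squares n Int invariants n (refl_group c n) =
      {g:generated_ring n \<psi>. EX A :: shape => rpoly mat.
        (ALL \<Lambda>:shapes c n. sos_matrix n \<psi> (specht_dim c \<Lambda>) (A \<Lambda>)) &
        g = (SUM \<Lambda>:shapes c n. mat_trace
           (reynolds_matrix (refl_group c n) (specht_dim c \<Lambda>) (s \<Lambda>) * A \<Lambda>))})
  & (ALL d. EX s :: shape => nat => rpoly.
     symmetry_adapted_basis (refl_group c n) (forms n d) (shapes c n) (specht_mult c n d) s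
    & (ALL \<Lambda>:shapes c n. ALL v < specht_mult c n d \<Lambda>.
       s \<Lambda> v:isotypic_component (refl_group c n) (forms n d) (specht_module c \<Lambda>) &
       (EX F:higher_specht_polys c \<Lambda>. EX \<alpha> :: nat => nat.
         s \<Lambda> v = F * (PROD i = 1..n. \<psi> i ^ \<alpha> i)))
    & (ALL f:forms n (2 * d) Int invariants n (refl_group c n).
       f:sums_of_squares n \<longleftrightarrow>
       (EX A :: shape => real mat.
         (ALL \<Lambda>:shapes c n. psd_matrix (specht_mult c n d \<Lambda>) (A \<Lambda>)) &
         f = (SUM \<Lambda>:shapes c n. mat_trace
            (reynolds_matrix (refl_group c n) (specht_mult c n d \<Lambda>) (s \<Lambda>)
             * map_mat const (A \<Lambda>))))))"
proof -
 interpret S: specht_shapes c n "shapes c n" shape_rows by (rule specht_shapes_shapes)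
 obtain E where "primitive_system c n (shapes c n) E" "!!j u. j:shapes c n ==> E j (S.sv j u) = S.sv j u"
  by (rule S.primitive_system_exists) (rule that)
 then interpret specht_setting c n E \<psi> using S.specht_shapes_axioms assms(2)
  by (intro specht_setting.intro specht_system.intro specht_system_axioms.intro fundamental.intro)
 have xx: "xx d j i:poly_ring n" if "j:Sh" "i < specht_mult c n d j" for d j i
  using xx_forms[of "specht_mult c n d" d, OF specht_mult_eq that] forms_subset_poly_ring by blast
 have part2: "sums_of_squares n Int invariants n GG =
   {g:generated_ring n \<psi>. EX A. (ALL j:Sh. sos_matrix n \<psi> (specht_dim c j) (A j)) &
    g = (SUM j:Sh. mat_trace (reynolds_matrix GG (specht_dim c j) (xc j) * A j))}"
  (is "_ = ?R")
 proof (intro equalityI subsetI)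
  fix g assume "g:sums_of_squares n Int invariants n GG"
  thus "g:?R" using invariant_sos[of g] by (simp add: generated)
 next
  fix g assume "g:?R"
  then obtain A where g: "g:invariants n GG" "ALL j:Sh. sos_matrix n \<psi> (specht_dim c j) (A j)"
   "g = (SUM j:Sh. mat_trace (reynolds_matrix GG (specht_dim c j) (xc j) * A j))" unfolding generated by blast
  hence "g:sums_of_squares n" by (simp only: g(3)) (intro sums_of_squares_sum sos_trace xc_props(6), simp_all)
  thus "g:sums_of_squares n Int invariants n GG" using g(1) by blast
 qed
 have part3: "f:sums_of_squares n \<longleftrightarrow> (EX A. (ALL j:Sh. psd_matrix (specht_mult c n d j) (A j)) &
   f = (SUM j:Sh. mat_trace (reynolds_matrix GG (specht_mult c n d j) (xx d j) * map_mat const (A j))))"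
  if "f:forms n (2 * d) Int invariants n GG" for f d
 proof
  show "f:sums_of_squares n" if "EX A. (ALL j:Sh. psd_matrix (specht_mult c n d j) (A j)) &
   f = (SUM j:Sh. mat_trace (reynolds_matrix GG (specht_mult c n d j) (xx d j) * map_mat const (A j)))"
   using that by (elim exE conjE) (simp only:, intro sums_of_squares_sum psd_trace xx, simp_all)
 qed (use that form_sos in blast)
 show ?thesis by (intro conjI allI isotypic_forms, rule exI[of _ xc],
   intro conjI coinvariant_basis part2 ballI allI impI xc_props(4), assumption+, rule exI[of _ "xx d" for d],
   intro conjI ballI allI impI; (rule forms_symmetry_adapted[OF specht_mult_eq] xx_isotypic xx_product part3; assumption))
qed

end
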